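(* Let $d\in\mathbb N$ be fixed and let $n\ge d$ be an integer. Let $\mathcal T_n$ be the Toeplitz algebra on the generalized Bergman space $\mathcal H_n$ on the unit ball of $\mathbb C^d$, let $(e_j)_{j\ge1}$ be an enumeration of the monomial orthonormal basis of $\mathcal H_n$, and let $\sigma:C(S^{2d-1})\to\mathcal T_n$ be a fixed positive linear splitting of the symbol map $\pi:\mathcal T_n\to C(S^{2d-1})$ (see context). Then $\mathcal T_n$ has the compact quantum metric space structure $(Lip(\mathcal T_n),L_n)$, where $$Lip(\mathcal T_n)=Lip(\mathscr K(\mathcal H_n))\oplus\{\sigma(f):f\text{ a real valued Lipschitz function on }S^{2d-1}\}$$ and $$L_n(\sigma(f)+K)=\tilde L_n(K)+L(f)$$ for all $K\in Lip(\mathscr K(\mathcal H_n))$ and all real valued Lipschitz functions $f$ on $S^{2d-1}$, $L(f)$ being the Lipschitz seminorm of $f$.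
   Context: **Compact quantum metric spaces.** An order-unit space $A$ is a real partially ordered vector space with an Archimedean order unit $e_A$, normed by $\|a\|=\inf\{r\ge 0:-re_A\le a\le re_A\}$. Its state space $\mathcal S(A)$ is the set of bounded real linear functionals $\mu$ on $A$ with $\mu(e_A)=1=\|\mu\|$. A seminorm $L$ on $A$ taking finite values is a Lip-norm if $L(e_A)=0$ and the topology on $\mathcal S(A)$ induced by the metric $\rho_L(\mu,\nu)=\sup\{|\mu(a)-\nu(a)|:L(a)\le 1\}$ coincides with the weak$^*$ topology. A compact quantum metric space is a pair $(A,L)$ of an order-unit space and a Lip-norm on it. **Toeplitz algebras.** $B^{2d}$ and $\bar B^{2d}$ are the open and closed unit balls of $\mathbb C^d$, and $S^{2d-1}$ is the unit sphere. For an integer $n\ge d$, $dV_n=c_n(1-|z|^2)^{n-d}\,dV$ with $dV$ Lebesgue measure and $c_n=\frac{n!}{(n-d)!\,\pi^d}$, a probability measure on $B^{2d}$. $\mathcal H_n$ is the Hilbert space of analytic $f:B^{2d}\to\mathbb C$ with $\int|f|^2dV_n<\infty$ and inner product $\langle f|g\rangle_{\mathcal H_n}=\int f\bar g\,dV_n$. An orthonormal basis of $\mathcal H_n$ is given by the monomials $e_{k,n}=\left(\frac{(|k|+n)!}{k!\,n!}\right)^{1/2}z^k$, $k\in\mathbb Z_{\ge0}^d$ (multi-index notation). For $\phi\in C(\bar B^{2d})$, $T_{\phi,n}f=P_n(\phi f)$ where $P_n:L^2(B^{2d},dV_n)\to\mathcal H_n$ is the orthogonal projection. $\mathcal T_n$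 is the $C^*$-algebra of operators on $\mathcal H_n$ generated by all $T_{\phi,n}$, $\phi\in C(\bar B^{2d})$, and $\mathscr K(\mathcal H_n)$ is the algebra of compact operators. One has $\mathcal T_n=\{T_{\phi,n}+K:\phi\in C(\bar B^{2d}),K\in\mathscr K(\mathcal H_n)\}$, and $\pi(T_{\phi,n}+K)=\phi|_{S^{2d-1}}$ defines a surjective $*$-homomorphism $\pi:\mathcal T_n\to C(S^{2d-1})$ with kernel $\mathscr K(\mathcal H_n)$. **Splitting.** A positive linear splitting is a positive linear map $\sigma:C(S^{2d-1})\to\mathcal T_n$ with $\pi\circ\sigma=\mathrm{id}$; for example $f\mapsto T_{\tilde f,n}$, with $\tilde f$ the unique solution of the Dirichlet problem on the ball with boundary values $f$. **Lipschitz compact operators.** $Lip(\mathscr K(\mathcal H_n))$ is the set of self-adjoint $T\in\mathscr K(\mathcal H_n)$ with $\langle Te_i|e_j\rangle_{\mathcal H_n}\in\mathbb R$ for all $i,j\ge1$ and $\tilde L_n(T):=\sup_{i,j\ge1}(i+j)^{n+2}|\langle Te_i|e_j\rangle_{\mathcal H_n}|<\infty$. **Lipschitz seminorm.** $L(f)$ is the Lipschitz constant of $f$ with respect to the metric of $S^{2d-1}$.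
   Formalization: The splitting σ is additionally assumed unital, σ(1)=I, with I the order unit; this is necessary, since L_n(I)=0 forces I=σ(1), and it fails e.g. for σ(f)=(1-p)T_{f~}(1-p) with p the projection onto e_1. *)

theory Defs
  imports
    "HOL-Analysis.Analysis"
    "HOL-Library.Function_Algebras"
begin

text \<open>
  Pointwise real vector space structure on function types, completing the pointwise operations of
  \<^theory>\<open>HOL-Library.Function_Algebras\<close>. Iterating it makes operators on function spaces
  elements of a real vector space.
\<close>

instantiation "fun" :: (type, real_vector) real_vector
begin

definition scaleR_fun :: "real \<Rightarrow> ('a \<Rightarrow> 'b) \<Rightarrow> 'a \<Rightarrow> 'b"
  where "scaleR_fun r f = (\<lambda>x. r *\<^sub>R f x)"

instance
  by standard (auto simp: scaleR_fun_def fun_eq_iff scaleR_add_right scaleR_add_left)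

end


section \<open>Compact quantum metric spaces\<close>

text \<open>
  An order-unit space is a real subspace \<open>A\<close> of an ambient real vector space with an order
  relation \<open>le\<close> (only its restriction to \<open>A\<close> matters) and an Archimedean order unit \<open>e\<close>.
\<close>

definition order_unit_space ::
    "'v::real_vector set \<Rightarrow> ('v \<Rightarrow> 'v \<Rightarrow> bool) \<Rightarrow> 'v \<Rightarrow> bool" where
  "order_unit_space A le e \<longleftrightarrow>
     subspace A \<and>
     (\<forall>a\<in>A. le a a) \<and>
     (\<forall>a\<in>A. \<forall>b\<in>A. le a b \<longrightarrow> le b a \<longrightarrow> a = b) \<and>
     (\<forall>a\<in>A. \<forall>b\<in>A. \<forall>c\<in>A. le a b \<longrightarrow> le b c \<longrightarrow> le a c) \<and>
     (\<forall>a\<in>A. \<forall>b\<in>A. \<forall>c\<in>A. le a b \<longrightarrow> le (a + c) (b + c)) \<and>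
     (\<forall>a\<in>A. \<forall>b\<in>A. \<forall>r\<ge>0. le a b \<longrightarrow> le (r *\<^sub>R a) (r *\<^sub>R b)) \<and>
     e \<in> A \<and>
     (\<forall>a\<in>A. \<exists>r. le a (r *\<^sub>R e)) \<and>
     (\<forall>a\<in>A. (\<forall>r>0. le a (r *\<^sub>R e)) \<longrightarrow> le a 0)"

definition order_unit_norm ::
    "('v::real_vector \<Rightarrow> 'v \<Rightarrow> bool) \<Rightarrow> 'v \<Rightarrow> 'v \<Rightarrow> real" where
  "order_unit_norm le e a = Inf {r. 0 \<le> r \<and> le (- r *\<^sub>R e) a \<and> le a (r *\<^sub>R e)}"

text \<open>
  States are functions on \<open>A\<close>, represented extensionally (\<open>undefined\<close> outside \<open>A\<close>), so that
  they are points of the product space over the index set \<open>A\<close>.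
\<close>

definition states ::
    "'v::real_vector set \<Rightarrow> ('v \<Rightarrow> 'v \<Rightarrow> bool) \<Rightarrow> 'v \<Rightarrow> ('v \<Rightarrow> real) set" where
  "states A le e =
     {\<mu> \<in> extensional A.
        (\<forall>a\<in>A. \<forall>b\<in>A. \<mu> (a + b) = \<mu> a + \<mu> b) \<and>
        (\<forall>a\<in>A. \<forall>r. \<mu> (r *\<^sub>R a) = r * \<mu> a) \<and>
        (\<exists>C. \<forall>a\<in>A. \<bar>\<mu> a\<bar> \<le> C * order_unit_norm le e a) \<and>
        \<mu> e = 1 \<and>
        (SUP a\<in>{a\<in>A. order_unit_norm le e a \<le> 1}. \<bar>\<mu> a\<bar>) = 1}"

definition weak_star_topology ::
    "'v::real_vector set \<Rightarrow> ('v \<Rightarrow> 'v \<Rightarrow> bool) \<Rightarrow> 'v \<Rightarrow> ('v \<Rightarrow> real) topology" where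
  "weak_star_topology A le e =
     subtopology (product_topology (\<lambda>_. euclideanreal) A) (states A le e)"

definition state_distance ::
    "'v::real_vector set \<Rightarrow> ('v \<Rightarrow> real) \<Rightarrow> ('v \<Rightarrow> real) \<Rightarrow> ('v \<Rightarrow> real) \<Rightarrow> ennreal" where
  "state_distance A L \<mu> \<nu> = (SUP a\<in>{a\<in>A. L a \<le> 1}. ennreal \<bar>\<mu> a - \<nu> a\<bar>)"

text \<open>
  That \<open>\<rho>\<^sub>L\<close> is a metric includes its finiteness, which has to be demanded before passing
  from \<^typ>\<open>ennreal\<close> to \<^typ>\<open>real\<close>.
\<close>

definition lip_norm ::
    "'v::real_vector set \<Rightarrow> ('v \<Rightarrow> 'v \<Rightarrow> bool) \<Rightarrow> 'v \<Rightarrow> ('v \<Rightarrow> real) \<Rightarrow> bool" where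
  "lip_norm A le e L \<longleftrightarrow>
     (\<forall>a\<in>A. 0 \<le> L a) \<and>
     (\<forall>a\<in>A. \<forall>b\<in>A. L (a + b) \<le> L a + L b) \<and>
     (\<forall>a\<in>A. \<forall>r. L (r *\<^sub>R a) = \<bar>r\<bar> * L a) \<and>
     L e = 0 \<and>
     (\<forall>\<mu>\<in>states A le e. \<forall>\<nu>\<in>states A le e. state_distance A L \<mu> \<nu> < \<infinity>) \<and>
     Metric_space (states A le e) (\<lambda>\<mu> \<nu>. enn2real (state_distance A L \<mu> \<nu>)) \<and>
     Metric_space.mtopology (states A le e) (\<lambda>\<mu> \<nu>. enn2real (state_distance A L \<mu> \<nu>))
       = weak_star_topology A le e"

definition compact_quantum_metric_space ::
    "'v::real_vector set \<Rightarrow> ('v \<Rightarrow> 'v \<Rightarrow> bool) \<Rightarrow> 'v \<Rightarrow> ('v \<Rightarrow> real) \<Rightarrow> bool" where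
  "compact_quantum_metric_space A le e L \<longleftrightarrow> order_unit_space A le e \<and> lip_norm A le e L"

definition internal_direct_sum :: "'v::real_vector set \<Rightarrow> 'v set \<Rightarrow> 'v set \<Rightarrow> bool" where
  "internal_direct_sum A U V \<longleftrightarrow>
     subspace U \<and> subspace V \<and> U \<inter> V = {0} \<and> A = {u + v |u v. u \<in> U \<and> v \<in> V}"


section \<open>Generalized Bergman spaces on the unit ball of \<open>\<complex>\<^sup>d\<close>\<close>

type_synonym 'd cfun = "complex ^ 'd \<Rightarrow> complex"
type_synonym 'd operator = "'d cfun \<Rightarrow> 'd cfun"

definition ball_measure :: "nat \<Rightarrow> (complex ^ 'd::finite) measure" where
  "ball_measure n =
     density lborel (\<lambda>z. ennreal (indicator (ball 0 1) z *
       (fact n / (fact (n - CARD('d)) * pi ^ CARD('d)) * (1 - (norm z)\<^sup>2) ^ (n - CARD('d)))))"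

text \<open>Analyticity in several variables: Frechet differentiability with complex linear derivative.\<close>

definition analytic_on_ball :: "('d::finite) cfun \<Rightarrow> bool" where
  "analytic_on_ball f \<longleftrightarrow>
     (\<forall>z\<in>ball 0 1. \<exists>f'. (f has_derivative f') (at z) \<and> (\<forall>c v. f' (c *s v) = c * f' v))"

text \<open>Functions on the open ball are represented by their extension by zero.\<close>

definition bergman :: "nat \<Rightarrow> ('d::finite) cfun set" where
  "bergman n =
     {f. analytic_on_ball f \<and> (\<forall>z. z \<notin> ball 0 1 \<longrightarrow> f z = 0) \<and>
         integrable (ball_measure n) (\<lambda>z. (cmod (f z))\<^sup>2)}"

definition bergman_inner :: "nat \<Rightarrow> ('d::finite) cfun \<Rightarrow> 'd cfun \<Rightarrow> complex" where
  "bergman_inner n f g = (LINT z|ball_measure n. f z * cnj (g z))"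

definition bergman_norm :: "nat \<Rightarrow> ('d::finite) cfun \<Rightarrow> real" where
  "bergman_norm n f = sqrt (LINT z|ball_measure n. (cmod (f z))\<^sup>2)"

definition monomial_basis :: "nat \<Rightarrow> ('d::finite \<Rightarrow> nat) \<Rightarrow> 'd cfun" where
  "monomial_basis n k =
     (\<lambda>z. if z \<in> ball 0 1
          then complex_of_real (sqrt (fact ((\<Sum>i\<in>UNIV. k i) + n) / ((\<Prod>i\<in>UNIV. fact (k i)) * fact n)))
               * (\<Prod>i\<in>UNIV. (z $ i) ^ k i)
          else 0)"


section \<open>Operators on \<open>\<H>\<^sub>n\<close>\<close>

text \<open>
  An operator on \<open>\<H>\<^sub>n\<close> is represented by its extension by zero to all functions. The pointwise
  vector space operations and the composition of such operators are again of this form.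
\<close>

definition bounded_operators :: "nat \<Rightarrow> ('d::finite) operator set" where
  "bounded_operators n =
     {T. (\<forall>f\<in>bergman n. T f \<in> bergman n) \<and> (\<forall>f. f \<notin> bergman n \<longrightarrow> T f = 0) \<and>
         (\<forall>f\<in>bergman n. \<forall>g\<in>bergman n. T (f + g) = T f + T g) \<and>
         (\<forall>f\<in>bergman n. \<forall>c. T (\<lambda>z. c * f z) = (\<lambda>z. c * T f z)) \<and>
         (\<exists>C. \<forall>f\<in>bergman n. bergman_norm n (T f) \<le> C * bergman_norm n f)}"

definition operator_norm :: "nat \<Rightarrow> ('d::finite) operator \<Rightarrow> real" where
  "operator_norm n T = (SUP f\<in>{f\<in>bergman n. bergman_norm n f \<le> 1}. bergman_norm n (T f))"

definition id_operator :: "nat \<Rightarrow> ('d::finite) operator" where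
  "id_operator n = (\<lambda>f. if f \<in> bergman n then f else 0)"

definition is_adjoint :: "nat \<Rightarrow> ('d::finite) operator \<Rightarrow> 'd operator \<Rightarrow> bool" where
  "is_adjoint n T S \<longleftrightarrow>
     (\<forall>f\<in>bergman n. \<forall>g\<in>bergman n. bergman_inner n (T f) g = bergman_inner n f (S g))"

definition self_adjoint :: "nat \<Rightarrow> ('d::finite) operator \<Rightarrow> bool" where
  "self_adjoint n T \<longleftrightarrow> is_adjoint n T T"

definition positive_operator :: "nat \<Rightarrow> ('d::finite) operator \<Rightarrow> bool" where
  "positive_operator n T \<longleftrightarrow>
     (\<forall>f\<in>bergman n. bergman_inner n (T f) f \<in> \<real> \<and> 0 \<le> Re (bergman_inner n (T f) f))"

definition operator_le :: "nat \<Rightarrow> ('d::finite) operator \<Rightarrow> 'd operator \<Rightarrow> bool" where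
  "operator_le n S T \<longleftrightarrow> positive_operator n (T - S)"

definition compact_operators :: "nat \<Rightarrow> ('d::finite) operator set" where
  "compact_operators n =
     {T\<in>bounded_operators n.
        \<forall>x :: nat \<Rightarrow> 'd cfun. (\<forall>m. x m \<in> bergman n \<and> bergman_norm n (x m) \<le> 1) \<longrightarrow>
          (\<exists>g\<in>bergman n. \<exists>r. strict_mono r \<and>
             (\<lambda>m. bergman_norm n (T (x (r m)) - g)) \<longlonglongrightarrow> 0)}"

definition cstar_subalgebra :: "nat \<Rightarrow> ('d::finite) operator set \<Rightarrow> bool" where
  "cstar_subalgebra n \<A> \<longleftrightarrow>
     \<A> \<subseteq> bounded_operators n \<and> 0 \<in> \<A> \<and>
     (\<forall>S\<in>\<A>. \<forall>T\<in>\<A>. S + T \<in> \<A>) \<and>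
     (\<forall>T\<in>\<A>. \<forall>c. (\<lambda>f z. c * T f z) \<in> \<A>) \<and>
     (\<forall>S\<in>\<A>. \<forall>T\<in>\<A>. S \<circ> T \<in> \<A>) \<and>
     (\<forall>T\<in>\<A>. \<forall>S\<in>bounded_operators n. is_adjoint n T S \<longrightarrow> S \<in> \<A>) \<and>
     (\<forall>X. \<forall>T\<in>bounded_operators n.
        (\<forall>m::nat. X m \<in> \<A>) \<longrightarrow> (\<lambda>m. operator_norm n (X m - T)) \<longlonglongrightarrow> 0 \<longrightarrow> T \<in> \<A>)"


section \<open>Toeplitz operators and the symbol map\<close>

text \<open>The orthogonal projection of \<open>L\<^sup>2\<close> onto \<open>\<H>\<^sub>n\<close>; only its values on \<open>L\<^sup>2\<close> functions matter.\<close>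

definition bergman_projection :: "nat \<Rightarrow> ('d::finite) cfun \<Rightarrow> 'd cfun" where
  "bergman_projection n g =
     (THE h. h \<in> bergman n \<and> (\<forall>u\<in>bergman n. bergman_inner n (g - h) u = 0))"

definition toeplitz :: "nat \<Rightarrow> ('d::finite) cfun \<Rightarrow> 'd operator" where
  "toeplitz n \<phi> = (\<lambda>f. if f \<in> bergman n then bergman_projection n (\<lambda>z. \<phi> z * f z) else 0)"

definition toeplitz_algebra :: "nat \<Rightarrow> ('d::finite) operator set" where
  "toeplitz_algebra n =
     cstar_subalgebra n hull {toeplitz n \<phi> |\<phi>. continuous_on (cball 0 1) \<phi>}"

text \<open>Functions on the sphere are represented by their extension by zero.\<close>

definition C_sphere :: "('d::finite) cfun set" where
  "C_sphere = {f. continuous_on (sphere 0 1) f \<and> (\<forall>z. z \<notin> sphere 0 1 \<longrightarrow> f z = 0)}"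

text \<open>
  The graph of the symbol map \<open>\<pi>\<close>: \<open>has_symbol n T f\<close> says \<open>\<pi> T = f\<close>, where \<open>\<pi>\<close> sends
  \<open>T\<^sub>\<phi> + K\<close> to the restriction of \<open>\<phi>\<close> to the sphere.
\<close>

definition has_symbol :: "nat \<Rightarrow> ('d::finite) operator \<Rightarrow> 'd cfun \<Rightarrow> bool" where
  "has_symbol n T f \<longleftrightarrow>
     T \<in> toeplitz_algebra n \<and> f \<in> C_sphere \<and>
     (\<exists>\<phi>. \<exists>K\<in>compact_operators n.
        continuous_on (cball 0 1) \<phi> \<and> T = toeplitz n \<phi> + K \<and> (\<forall>z\<in>sphere 0 1. f z = \<phi> z))"

definition positive_linear_splitting :: "nat \<Rightarrow> (('d::finite) cfun \<Rightarrow> 'd operator) \<Rightarrow> bool" where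
  "positive_linear_splitting n \<sigma> \<longleftrightarrow>
     (\<forall>f\<in>C_sphere. \<sigma> f \<in> toeplitz_algebra n) \<and>
     (\<forall>f\<in>C_sphere. \<forall>g\<in>C_sphere. \<sigma> (f + g) = \<sigma> f + \<sigma> g) \<and>
     (\<forall>f\<in>C_sphere. \<forall>c. \<sigma> (\<lambda>z. c * f z) = (\<lambda>h z. c * \<sigma> f h z)) \<and>
     (\<forall>f\<in>C_sphere. (\<forall>z\<in>sphere 0 1. f z \<in> \<real> \<and> 0 \<le> Re (f z)) \<longrightarrow> positive_operator n (\<sigma> f)) \<and>
     (\<forall>f\<in>C_sphere. has_symbol n (\<sigma> f) f)"


section \<open>Lipschitz functions and Lipschitz operators\<close>

text \<open>Great-circle distance; the inner product is the real part of the Hermitian one.\<close>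

definition geodesic_dist :: "complex ^ 'd::finite \<Rightarrow> complex ^ 'd \<Rightarrow> real" where
  "geodesic_dist z w = arccos (z \<bullet> w)"

definition real_lipschitz ::
    "(complex ^ 'd \<Rightarrow> complex ^ 'd \<Rightarrow> real) \<Rightarrow> ('d::finite) cfun set" where
  "real_lipschitz \<delta> =
     {f\<in>C_sphere. (\<forall>z\<in>sphere 0 1. f z \<in> \<real>) \<and>
        (\<exists>C\<ge>0. \<forall>z\<in>sphere 0 1. \<forall>w\<in>sphere 0 1. cmod (f z - f w) \<le> C * \<delta> z w)}"

definition lipschitz_constant ::
    "(complex ^ 'd \<Rightarrow> complex ^ 'd \<Rightarrow> real) \<Rightarrow> ('d::finite) cfun \<Rightarrow> real" where
  "lipschitz_constant \<delta> f =
     Inf {C. 0 \<le> C \<and> (\<forall>z\<in>sphere 0 1. \<forall>w\<in>sphere 0 1. cmod (f z - f w) \<le> C * \<delta> z w)}"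

text \<open>
  In the following, \<open>\<kappa>\<close> enumerates the multi-indices by \<open>1, 2, \<dots>\<close>, and \<open>e\<^sub>j\<close> is the
  basis vector \<open>monomial_basis n (\<kappa> j)\<close>.
\<close>

definition matrix_entry ::
    "nat \<Rightarrow> (nat \<Rightarrow> 'd \<Rightarrow> nat) \<Rightarrow> ('d::finite) operator \<Rightarrow> nat \<Rightarrow> nat \<Rightarrow> complex" where
  "matrix_entry n \<kappa> T i j =
     bergman_inner n (T (monomial_basis n (\<kappa> i))) (monomial_basis n (\<kappa> j))"

definition lip_compact :: "nat \<Rightarrow> (nat \<Rightarrow> 'd \<Rightarrow> nat) \<Rightarrow> ('d::finite) operator set" where
  "lip_compact n \<kappa> =
     {T\<in>compact_operators n. self_adjoint n T \<and>
        (\<forall>i\<ge>1. \<forall>j\<ge>1. matrix_entry n \<kappa> T i j \<in> \<real>) \<and>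
        bdd_above ((\<lambda>(i, j). real (i + j) ^ (n + 2) * cmod (matrix_entry n \<kappa> T i j)) ` ({1..} \<times> {1..}))}"

definition lip_compact_norm ::
    "nat \<Rightarrow> (nat \<Rightarrow> 'd \<Rightarrow> nat) \<Rightarrow> ('d::finite) operator \<Rightarrow> real" where
  "lip_compact_norm n \<kappa> T =
     (SUP (i, j)\<in>{1..} \<times> {1..}. real (i + j) ^ (n + 2) * cmod (matrix_entry n \<kappa> T i j))"

definition lip_toeplitz ::
    "nat \<Rightarrow> (nat \<Rightarrow> 'd \<Rightarrow> nat) \<Rightarrow> (complex ^ 'd \<Rightarrow> complex ^ 'd \<Rightarrow> real)
      \<Rightarrow> (('d::finite) cfun \<Rightarrow> 'd operator) \<Rightarrow> 'd operator set" where
  "lip_toeplitz n \<kappa> \<delta> \<sigma> = {K + \<sigma> f |K f. K \<in> lip_compact n \<kappa> \<and> f \<in> real_lipschitz \<delta>}"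

end

theory Submission
  imports Defs "HOL-Probability.Distributions" "HOL-Complex_Analysis.Complex_Analysis"
begin

text \<open>
  The monomials are orthonormal by a layer-cake reduction to Gaussian integrals and by rotation
  invariance, and complete because averaging over roots of unity isolates Taylor components; so an
  operator is determined by its matrix. A compact operator whose entries are
  \<open>O((i + j)\<^sup>-\<^sup>n\<^sup>-\<^sup>2)\<close> is a norm limit of combinations of rank-one operators, and these lie in the
  Toeplitz algebra, because the normalized operators with symbol \<open>(1 - \<bar>z\<bar>\<^sup>2)\<^sup>m\<close> converge to the
  projection onto the constants. The powers of the peak function \<open>(1 + \<langle>z, \<zeta>\<rangle>) / 2\<close> concentrate
  at \<open>\<zeta>\<close> and tend weakly to \<open>0\<close>, so a compact Toeplitz operator has a symbol vanishing on the sphere;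
  hence the sum of \<open>Lip(K)\<close> and the range of \<open>\<sigma>\<close> is direct. Finally \<open>{L \<le> 1}\<close> is totally bounded
  modulo scalars: far-out matrix entries are uniformly small, and a Lipschitz function is determined
  up to \<open>\<epsilon>\<close> by its values on a finite net of the sphere. Total boundedness makes weak-* convergence of
  states uniform on \<open>{L \<le> 1}\<close>.
\<close>

section \<open>Moments of Lebesgue measure on the ball\<close>

text \<open>Unitality of \<open>\<sigma>\<close> puts the order unit into the space as the image of
  the constant 1, where L vanishes. Together with positivity it turns |f| \<le> B into -B id \<le>
  \<sigma>(f) \<le> B id, the norm control of \<open>\<sigma>\<close> on which the estimates rest.
  The weight exponent n + 2 is at least 3, the least integer s for which the sum of (i + j)^(-s)
  over all pairs converges; hence the crude bound of an operator by the sum of the moduli of its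
  entries is good enough on Lip(K). Self-adjoint operators are compared through their quadratic
  forms, which determine them because the scalars are complex. The Toeplitz algebra is an
  intersection of C*-subalgebras, so membership is established in each of them separately. Analysis
  in several variables is reduced to one-variable slices and finite averages over roots of unity, so
  that neither multiple power series nor integrals over tori occur. Of the metric on the sphere
  three facts enter: it is nonnegative, bounded, and small wherever the chordal distance is
  small.\<close>

lemma lborel_vec:
  "distr (Pi\<^sub>M UNIV (\<lambda>_. lborel)) borel vec_lambda = (lborel :: ('a::euclidean_space ^ 'd::finite) measure)"
proof (rule lborel_eqI[symmetric])
  interpret product_sigma_finite "\<lambda>_::'d. lborel :: 'a measure" ..
  have meas [measurable]: "vec_lambda \<in> borel_measurable (Pi\<^sub>M UNIV (\<lambda>_::'d. lborel :: 'a measure))"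
    unfolding borel_measurable_euclidean_space[of vec_lambda]
    by (auto simp: Basis_vec_def inner_axis)
  fix l u :: "'a ^ 'd" assume le: "\<And>b. b \<in> Basis \<Longrightarrow> l \<bullet> b \<le> u \<bullet> b"
  have le': "l $ i \<bullet> b \<le> u $ i \<bullet> b" if "b \<in> Basis" for i b
    using le[of "axis i b"] that by (auto simp: Basis_vec_def inner_axis)
  have box: "box l u = {x. \<forall>i. x $ i \<in> box (l $ i) (u $ i)}"
    by (auto simp: box_def Basis_vec_def inner_axis)
  have "emeasure (distr (Pi\<^sub>M UNIV (\<lambda>_. lborel)) borel vec_lambda) (box l u)
      = emeasure (Pi\<^sub>M UNIV (\<lambda>_::'d. lborel :: 'a measure)) (vec_lambda -` box l u \<inter> space (Pi\<^sub>M UNIV (\<lambda>_. lborel)))"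
    by (rule emeasure_distr) auto
  also have "vec_lambda -` box l u \<inter> space (Pi\<^sub>M UNIV (\<lambda>_. lborel)) = Pi\<^sub>E UNIV (\<lambda>i. box (l $ i) (u $ i))"
    by (auto simp: box space_PiM PiE_iff)
  also have "emeasure (Pi\<^sub>M UNIV (\<lambda>_::'d. lborel :: 'a measure)) \<dots> = (\<Prod>i\<in>UNIV. emeasure lborel (box (l $ i) (u $ i)))"
    by (rule emeasure_PiM) auto
  also have "\<dots> = (\<Prod>i\<in>UNIV. ennreal (\<Prod>b\<in>Basis. (u $ i - l $ i) \<bullet> b))"
    using le' by (intro prod.cong refl emeasure_lborel_box) auto
  also have "\<dots> = ennreal (\<Prod>i\<in>UNIV. \<Prod>b\<in>Basis. (u $ i - l $ i) \<bullet> b)"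
    using le' by (intro prod_ennreal prod_nonneg) (auto simp: inner_diff_left)
  \<comment> \<open>The basis vectors of the power space are the \<open>axis i b\<close>, so the
    product of side lengths is a double product. The reindexing is injective because basis vectors
    are nonzero.\<close>
  also have "(\<Prod>i\<in>UNIV. \<Prod>b\<in>Basis. (u $ i - l $ i) \<bullet> b) = (\<Prod>p\<in>UNIV \<times> Basis. (u - l) \<bullet> axis (fst p) (snd p))"
    by (subst prod.cartesian_product) (auto simp: inner_axis case_prod_beta)
  also have "\<dots> = (\<Prod>b\<in>Basis. (u - l) \<bullet> b)"
  proof (rule prod.reindex_bij_betw[where h="\<lambda>p. axis (fst p) (snd p)"])
    have "axis i b = axis j c \<Longrightarrow> b \<in> Basis \<Longrightarrow> i = j \<and> b = c" for i j :: 'd and b c :: 'a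
      using nonzero_Basis by (auto simp: axis_eq_axis)
    then show "bij_betw (\<lambda>p. axis (fst p) (snd p)) (UNIV \<times> Basis) (Basis :: ('a ^ 'd) set)"
      unfolding bij_betw_def inj_on_def Basis_vec_def image_def by auto
  qed
  finally show "emeasure (distr (Pi\<^sub>M UNIV (\<lambda>_. lborel)) borel vec_lambda) (box l u)
      = ennreal (\<Prod>b\<in>Basis. (u - l) \<bullet> b)" .
qed simp

lemma nn_integral_lborel_vec_prod:
  fixes f :: "'d::finite \<Rightarrow> 'a::euclidean_space \<Rightarrow> ennreal"
  assumes [measurable]: "\<And>i. f i \<in> borel_measurable borel"
  shows "(\<integral>\<^sup>+z. (\<Prod>i\<in>UNIV. f i (z $ i)) \<partial>lborel) = (\<Prod>i\<in>UNIV. \<integral>\<^sup>+x. f i x \<partial>lborel)"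
proof -
  interpret product_sigma_finite "\<lambda>_::'d. lborel :: 'a measure" ..
  have meas [measurable]: "vec_lambda \<in> borel_measurable (Pi\<^sub>M UNIV (\<lambda>_::'d. lborel :: 'a measure))"
    unfolding borel_measurable_euclidean_space[of vec_lambda]
    by (auto simp: Basis_vec_def inner_axis)
  have [measurable]: "(\<lambda>z :: 'a ^ 'd. z $ i) \<in> borel_measurable borel" for i
    by (intro borel_measurable_continuous_onI continuous_intros)
  have "(\<integral>\<^sup>+z. (\<Prod>i\<in>UNIV. f i (z $ i)) \<partial>(lborel :: ('a ^ 'd) measure))
      = (\<integral>\<^sup>+x. (\<Prod>i\<in>UNIV. f i (x i)) \<partial>Pi\<^sub>M UNIV (\<lambda>_::'d. lborel :: 'a measure))"
    by (subst lborel_vec[symmetric], subst nn_integral_distr) auto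
  also have "\<dots> = (\<Prod>i\<in>UNIV. \<integral>\<^sup>+x. f i x \<partial>lborel)"
    by (rule product_nn_integral_prod) auto
  finally show ?thesis .
qed

lemma nn_integral_lborel_translate:
  fixes f :: "'a::euclidean_space \<Rightarrow> ennreal"
  assumes [measurable]: "f \<in> borel_measurable borel"
  shows "(\<integral>\<^sup>+x. f (c + x) \<partial>lborel) = (\<integral>\<^sup>+x. f x \<partial>lborel)"
proof -
  have "(\<integral>\<^sup>+x. f x \<partial>lborel) = (\<integral>\<^sup>+x. f x \<partial>distr lborel borel ((+) c))"
    by (simp add: lborel_distr_plus)
  then show ?thesis
    by (simp add: nn_integral_distr)
qed

text \<open>
  Both sides of \<open>\<lambda>(U\<inverse> A) \<lambda>(B) = \<lambda>(A) \<lambda>(B)\<close>, for the unit ball \<open>B\<close>, arise by integrating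
  \<open>1\<^sub>A(U x + y) 1\<^sub>B(y)\<close> in the two possible orders.
\<close>

lemma lborel_distr_isometry:
  fixes U :: "'a::euclidean_space \<Rightarrow> 'a"
  assumes lin: "linear U" and iso: "\<And>x. norm (U x) = norm x"
  shows "distr lborel borel U = lborel"
proof (rule measure_eqI)
  have [measurable]: "U \<in> borel_measurable borel"
    by (intro borel_measurable_continuous_onI linear_continuous_on lin[unfolded linear_conv_bounded_linear])
  have inj: "inj U"
    using lin iso by (metis linear_injective_0 norm_eq_zero)
  then have surj: "surj U"
    using lin linear_injective_imp_surjective by blast
  fix A assume "A \<in> sets (distr lborel borel U)"
  then have [measurable]: "A \<in> sets borel" by simp
  define B :: "'a set" where "B = ball 0 1"
  have [measurable]: "B \<in> sets borel" by (simp add: B_def)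
  \<comment> \<open>Since U is onto, a shift by y after U is a shift before U, which Lebesgue
    measure ignores.\<close>
  have trans: "(\<integral>\<^sup>+x. indicator A (U x + y) \<partial>lborel) = (\<integral>\<^sup>+x. indicator A (U x) \<partial>lborel)" for y :: 'a
  proof -
    obtain c where c: "U c = y" using surj by (metis surjD)
    have "(\<integral>\<^sup>+x. indicator A (U x + y) \<partial>lborel) = (\<integral>\<^sup>+x. indicator A (U (c + x)) \<partial>lborel)"
      using c lin by (simp add: linear_add add.commute)
    also have "\<dots> = (\<integral>\<^sup>+x. indicator A (U x) \<partial>lborel)"
      by (rule nn_integral_lborel_translate) simp
    finally show ?thesis .
  qed
  have ballB: "(\<integral>\<^sup>+x. indicator B (y - U x) \<partial>lborel) = emeasure lborel B" for y
  proof -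
    obtain c where c: "U c = y" using surj by (metis surjD)
    have "dist y (U x) = dist c x" for x
      using c lin iso by (metis linear_diff dist_norm)
    then have "(\<integral>\<^sup>+x. indicator B (y - U x) \<partial>lborel) = (\<integral>\<^sup>+x. indicator (ball c 1) x \<partial>lborel)"
      by (intro nn_integral_cong) (simp add: B_def indicator_def dist_norm[symmetric])
    also have "\<dots> = emeasure lborel B"
      by (simp add: B_def emeasure_ball)
    finally show ?thesis .
  qed
  have "emeasure (distr lborel borel U) A * emeasure lborel B
      = (\<integral>\<^sup>+y. (\<integral>\<^sup>+x. indicator A (U x) \<partial>lborel) * indicator B y \<partial>lborel)"
  proof -
    have "emeasure (distr lborel borel U) A = (\<integral>\<^sup>+x. indicator A x \<partial>distr lborel borel U)"
      by simp
    also have "\<dots> = (\<integral>\<^sup>+x. indicator A (U x) \<partial>lborel)"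
      by (rule nn_integral_distr) simp_all
    finally show ?thesis by (simp add: nn_integral_cmult)
  qed
  also have "\<dots> = (\<integral>\<^sup>+y. (\<integral>\<^sup>+x. indicator A (U x + y) * indicator B y \<partial>lborel) \<partial>lborel)"
    by (simp add: nn_integral_multc trans)
  also have "\<dots> = (\<integral>\<^sup>+x. (\<integral>\<^sup>+y. indicator A (U x + y) * indicator B y \<partial>lborel) \<partial>lborel)"
    by (rule lborel_pair.Fubini') measurable
  also have "\<dots> = (\<integral>\<^sup>+x. (\<integral>\<^sup>+y. indicator A y * indicator B (y - U x) \<partial>lborel) \<partial>lborel)"
  proof (rule nn_integral_cong)
    fix x
    show "(\<integral>\<^sup>+y. indicator A (U x + y) * indicator B y \<partial>lborel)
        = (\<integral>\<^sup>+y. indicator A y * indicator B (y - U x) \<partial>lborel)"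
      using nn_integral_lborel_translate[of "\<lambda>y. indicator A y * indicator B (y - U x)" "U x"] by simp
  qed
  also have "\<dots> = (\<integral>\<^sup>+y. (\<integral>\<^sup>+x. indicator A y * indicator B (y - U x) \<partial>lborel) \<partial>lborel)"
    by (rule lborel_pair.Fubini') measurable
  also have "\<dots> = emeasure lborel A * emeasure lborel B"
    by (simp add: nn_integral_cmult ballB nn_integral_multc)
  finally have *: "emeasure (distr lborel borel U) A * emeasure lborel B = emeasure lborel A * emeasure lborel B" .
  \<comment> \<open>Cancelling the factor of the ball in \<open>ennreal\<close> requires it to be
    nonzero and finite.\<close>
  have "emeasure lborel B \<noteq> 0" "emeasure lborel B \<noteq> \<infinity>"
    using unit_ball_vol_pos[of "real DIM('a)"] by (auto simp: B_def emeasure_ball simp del: unit_ball_vol_pos)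
  with arg_cong[OF *, of "\<lambda>x. x / emeasure lborel B"]
  show "emeasure (distr lborel borel U) A = emeasure lborel A"
    by (simp add: mult_divide_eq_ennreal)
qed simp

text \<open>The disc |z|^2 < x has area pi x, which is linear in x, and half-lines form a generating
  family stable under intersection. This takes the place of polar coordinates.\<close>

lemma distr_lborel_cmod_square:
  "distr lborel borel (\<lambda>z::complex. (norm z)\<^sup>2) = density lborel (\<lambda>t::real. ennreal pi * indicator {0..} t)"
proof (rule measure_eqI_generator_eq_countable[where E="range lessThan" and \<Omega>=UNIV and A="(\<lambda>n. {..<real n}) ` UNIV"])
  have sb: "sets (borel :: real measure) = sigma_sets UNIV (range lessThan)"
    by (subst borel_Iio, rule sets_measure_of) simp
  show "Int_stable (range (lessThan :: real \<Rightarrow> _))"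
  proof (rule Int_stableI_image)
    fix a b :: real
    have "{..<a} \<inter> {..<b} = {..<min a b}" by auto
    then show "\<exists>c\<in>UNIV. {..<a} \<inter> {..<b} = {..<c}" by blast
  qed
  have em: "emeasure (distr lborel borel (\<lambda>z::complex. (norm z)\<^sup>2)) {..<x} = ennreal (pi * max 0 x)" for x
  proof -
    have "(\<lambda>z::complex. (norm z)\<^sup>2) -` {..<x} = ball 0 (sqrt (max 0 x))"
    proof (cases "x \<ge> 0")
      case True
      have "(norm z)\<^sup>2 < x \<longleftrightarrow> norm z < sqrt x" for z :: complex
        using real_sqrt_less_iff[of "(norm z)\<^sup>2" x] by simp
      with True show ?thesis by (auto simp: max_def)
    next
      case False
      then have "\<not> (norm z)\<^sup>2 < x" for z :: complex
        using zero_le_power2[of "norm z"] by linarith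
      with False show ?thesis by (auto simp: max_def)
    qed
    then show ?thesis
      by (simp add: emeasure_distr emeasure_ball unit_ball_vol_2)
  qed
  have em2: "emeasure (density lborel (\<lambda>t::real. ennreal pi * indicator {0..} t)) {..<x} = ennreal (pi * max 0 x)" for x
  proof -
    have "emeasure (density lborel (\<lambda>t::real. ennreal pi * indicator {0..} t)) {..<x}
        = (\<integral>\<^sup>+t. ennreal pi * indicator {0..<x} t \<partial>lborel)"
      by (subst emeasure_density) (auto intro!: nn_integral_cong simp: indicator_def)
    also have "\<dots> = ennreal pi * emeasure lborel {0..<x}"
      by (subst nn_integral_cmult) auto
    also have "\<dots> = ennreal (pi * max 0 x)"
      by (cases "x \<ge> 0") (auto simp: ennreal_mult)
    finally show ?thesis .
  qed
  show "\<And>X. X \<in> range lessThan \<Longrightarrow> emeasure (distr lborel borel (\<lambda>z::complex. (norm z)\<^sup>2)) X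
      = emeasure (density lborel (\<lambda>t::real. ennreal pi * indicator {0..} t)) X"
    using em em2 by auto
  show "sets (distr lborel borel (\<lambda>z::complex. (norm z)\<^sup>2)) = sigma_sets UNIV (range lessThan)"
       "sets (density lborel (\<lambda>t::real. ennreal pi * indicator {0..} t)) = sigma_sets UNIV (range lessThan)"
    using sb by simp_all
  show "(\<Union>n. {..<real n}) = UNIV"
    using reals_Archimedean2 by auto
  show "\<And>a. a \<in> range (\<lambda>n. {..<real n}) \<Longrightarrow> emeasure (distr lborel borel (\<lambda>z::complex. (norm z)\<^sup>2)) a \<noteq> \<infinity>"
    using em by auto
qed auto

lemma complex_gaussian_moment:
  "(\<integral>\<^sup>+(z::complex). ennreal ((norm z)\<^sup>2 ^ k * exp (- (norm z)\<^sup>2)) \<partial>lborel) = ennreal (pi * fact k)"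
proof -
  have "(\<integral>\<^sup>+(z::complex). ennreal ((norm z)\<^sup>2 ^ k * exp (- (norm z)\<^sup>2)) \<partial>lborel)
      = (\<integral>\<^sup>+t. ennreal (t ^ k * exp (- t)) \<partial>distr lborel borel (\<lambda>z::complex. (norm z)\<^sup>2))"
    by (subst nn_integral_distr) auto
  also have "\<dots> = (\<integral>\<^sup>+t. ennreal pi * (ennreal (t ^ k * exp (- t)) * indicator {0..} t) \<partial>lborel)"
    unfolding distr_lborel_cmod_square by (subst nn_integral_density) (auto simp: mult_ac)
  also have "\<dots> = ennreal pi * ennreal (real_of_nat (fact k))"
    by (subst nn_integral_cmult) (auto simp: nn_intergal_power_times_exp_Ici)
  finally show ?thesis by (simp add: ennreal_mult)
qed

section \<open>Monomial weights and their integrals over the ball\<close>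

lemma norm_vec_square: "(norm (z :: 'a::real_normed_vector ^ 'd::finite))\<^sup>2 = (\<Sum>i\<in>UNIV. (norm (z $ i))\<^sup>2)"
  by (simp add: norm_vec_def L2_set_def sum_nonneg)

lemma vec_nth_borel_measurable [measurable]:
  "(\<lambda>z :: 'a::euclidean_space ^ 'd::finite. z $ i) \<in> borel_measurable borel"
  by (intro borel_measurable_continuous_onI continuous_intros)

text \<open>The squared modulus of the monomial z^k, written with real factors so that it splits
  over the coordinates.\<close>

definition monomial_weight :: "('d::finite \<Rightarrow> nat) \<Rightarrow> complex ^ 'd \<Rightarrow> real" where
  "monomial_weight k z = (\<Prod>i\<in>UNIV. (norm (z $ i))\<^sup>2 ^ k i)"

lemma ball_borel [measurable]: "ball (c :: 'a::metric_space) r \<in> sets borel"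
  by (rule borel_open[OF open_ball])

lemma monomial_weight_nonneg [simp]: "0 \<le> monomial_weight k z"
  by (simp add: monomial_weight_def prod_nonneg)

lemma monomial_weight_measurable [measurable]: "monomial_weight k \<in> borel_measurable borel"
  unfolding monomial_weight_def[abs_def] by measurable

lemma monomial_weight_scaleR:
  "monomial_weight k (c *\<^sub>R z) = (c\<^sup>2) ^ (\<Sum>i\<in>UNIV. k i) * monomial_weight k z"
  by (simp add: monomial_weight_def power_mult_distrib prod.distrib power_sum)

text \<open>Raising one index affects a single factor. It serves the recursion in
  \<open>monomial_ball\<close>, for the weights and for the factorials alike.\<close>

lemma prod_Suc_update:
  fixes g :: "'d::finite \<Rightarrow> nat \<Rightarrow> 'a::comm_monoid_mult"
  assumes "\<And>j. g j (Suc (k j)) = c j * g j (k j)"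
  shows "(\<Prod>j\<in>UNIV. g j ((k(i := Suc (k i))) j)) = c i * (\<Prod>j\<in>UNIV. g j (k j))"
proof -
  have "(\<Prod>j\<in>UNIV. g j ((k(i := Suc (k i))) j)) = (\<Prod>j\<in>UNIV. (if j = i then c j else 1) * g j (k j))"
    using assms by (intro prod.cong) auto
  also have "\<dots> = c i * (\<Prod>j\<in>UNIV. g j (k j))"
    by (subst prod.distrib) simp
  finally show ?thesis .
qed

lemma sum_Suc_update: "(\<Sum>j\<in>UNIV. (k(i := Suc (k i))) j) = Suc (\<Sum>j\<in>UNIV. k (j::'d::finite))"
proof -
  have "(\<Sum>j\<in>UNIV. (k(i := Suc (k i))) j) = (\<Sum>j\<in>UNIV. (if j = i then 1 else 0) + k j)"
    by (intro sum.cong) auto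
  then show ?thesis by (simp add: sum.distrib)
qed

lemma monomial_weight_Suc:
  "monomial_weight (k(i := Suc (k i))) z = (norm (z $ i))\<^sup>2 * monomial_weight k z"
  unfolding monomial_weight_def by (rule prod_Suc_update) simp

text \<open>Unlike the indicator of the ball, the Gaussian is a product over the coordinates, so the
  integral factors into one-dimensional moments.\<close>

lemma monomial_gaussian:
  "(\<integral>\<^sup>+z. ennreal (monomial_weight k z * exp (- (norm z)\<^sup>2)) \<partial>(lborel :: (complex ^ 'd::finite) measure))
     = ennreal (pi ^ CARD('d) * (\<Prod>i\<in>UNIV. fact (k i)))"
proof -
  have "monomial_weight k z * exp (- (norm z)\<^sup>2) = (\<Prod>i\<in>UNIV. (norm (z $ i))\<^sup>2 ^ k i * exp (- (norm (z $ i))\<^sup>2))"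
    for z :: "complex ^ 'd"
    by (simp add: monomial_weight_def norm_vec_square exp_sum prod.distrib flip: sum_negf)
  then have "(\<integral>\<^sup>+z. ennreal (monomial_weight k z * exp (- (norm z)\<^sup>2)) \<partial>(lborel :: (complex ^ 'd::finite) measure))
     = (\<integral>\<^sup>+z. (\<Prod>i\<in>UNIV. ennreal ((norm (z $ i))\<^sup>2 ^ k i * exp (- (norm (z $ i))\<^sup>2))) \<partial>(lborel :: (complex ^ 'd::finite) measure))"
    by (simp add: prod_ennreal)
  also have "\<dots> = (\<Prod>i\<in>UNIV. \<integral>\<^sup>+(z::complex). ennreal ((norm z)\<^sup>2 ^ k i * exp (- (norm z)\<^sup>2)) \<partial>lborel)"
    by (rule nn_integral_lborel_vec_prod) measurable
  also have "\<dots> = ennreal (pi ^ CARD('d) * (\<Prod>i\<in>UNIV. fact (k i)))"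
    by (simp add: complex_gaussian_moment prod_ennreal prod.distrib)
  finally show ?thesis .
qed

lemma nn_integral_lborel_scaleR:
  fixes f :: "'a::euclidean_space \<Rightarrow> ennreal"
  assumes [measurable]: "f \<in> borel_measurable borel" and "c > 0"
  shows "(\<integral>\<^sup>+x. f x \<partial>lborel) = ennreal (c ^ DIM('a)) * (\<integral>\<^sup>+x. f (c *\<^sub>R x) \<partial>lborel)"
  using \<open>c > 0\<close>
  by (subst lborel_affine[of c 0]) (simp_all add: nn_integral_density nn_integral_distr nn_integral_cmult)

lemma exp_tail_integral: "(\<integral>\<^sup>+r. ennreal (exp (- r)) * indicator {a<..} r \<partial>lborel) = ennreal (exp (- a :: real))"
proof -
  have "(\<integral>\<^sup>+r. ennreal (exp (- r)) * indicator {a<..} r \<partial>lborel) = (\<integral>\<^sup>+r. ennreal (exp (- r)) * indicator {a..} r \<partial>lborel)"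
    using AE_lborel_singleton[of a] by (intro nn_integral_cong_AE) (auto simp: indicator_def elim!: eventually_mono)
  also have "\<dots> = ennreal (0 - (- exp (- a)))"
  proof (rule nn_integral_FTC_atLeast)
    show "((\<lambda>x::real. - exp (- x)) \<longlongrightarrow> 0) at_top"
      by real_asymp
  qed (auto intro!: derivative_eq_intros)
  finally show ?thesis by simp
qed

text \<open>The layer-cake formula \<open>exp (- \<bar>z\<bar>\<^sup>2) = \<integral> exp (- r) 1(\<bar>z\<bar>\<^sup>2 < r) dr\<close> reduces the ball to the Gaussian.\<close>

lemma monomial_ball_0:
  "(\<integral>\<^sup>+z. ennreal (monomial_weight k z) * indicator (ball 0 1) z \<partial>(lborel :: (complex ^ 'd::finite) measure))
     = ennreal (pi ^ CARD('d) * (\<Prod>i\<in>UNIV. fact (k i)) / fact ((\<Sum>i\<in>UNIV. k i) + CARD('d)))"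
proof -
  let ?w = "\<lambda>z. ennreal (monomial_weight k z)"
  let ?D = "(\<Sum>i\<in>UNIV. k i) + CARD('d)"
  define G where "G = (\<integral>\<^sup>+z. ?w z * indicator (ball 0 1) z \<partial>(lborel :: (complex ^ 'd) measure))"
  \<comment> \<open>Substituting z = sqrt r times z', the weight contributes r^|k| and Lebesgue
    measure in real dimension 2d contributes r^d.\<close>
  have scale: "(\<integral>\<^sup>+z. ?w z * indicator {(norm z)\<^sup>2<..} r \<partial>(lborel :: (complex ^ 'd) measure)) = ennreal (r ^ ?D) * G"
    if "r > 0" for r
  proof -
    have "(\<integral>\<^sup>+z. ?w z * indicator {(norm z)\<^sup>2<..} r \<partial>(lborel :: (complex ^ 'd) measure))
        = (\<integral>\<^sup>+z. ?w z * indicator {z. (norm z)\<^sup>2 < r} z \<partial>(lborel :: (complex ^ 'd) measure))"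
      by (intro nn_integral_cong) (simp add: indicator_def)
    also have "\<dots> = ennreal (sqrt r ^ DIM(complex ^ 'd)) *
       (\<integral>\<^sup>+z. ?w (sqrt r *\<^sub>R z) * indicator {z. (norm z)\<^sup>2 < r} (sqrt r *\<^sub>R z) \<partial>(lborel :: (complex ^ 'd) measure))"
      using that by (intro nn_integral_lborel_scaleR) auto
    also have "(\<integral>\<^sup>+z. ?w (sqrt r *\<^sub>R z) * indicator {z. (norm z)\<^sup>2 < r} (sqrt r *\<^sub>R z) \<partial>(lborel :: (complex ^ 'd) measure))
       = (\<integral>\<^sup>+z. ennreal (r ^ (\<Sum>i\<in>UNIV. k i)) * (?w z * indicator (ball 0 1) z) \<partial>(lborel :: (complex ^ 'd) measure))"
      using that by (intro nn_integral_cong)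
        (simp add: indicator_def monomial_weight_scaleR power_mult_distrib ennreal_mult power_less_one_iff)
    also have "\<dots> = ennreal (r ^ (\<Sum>i\<in>UNIV. k i)) * G"
      unfolding G_def by (intro nn_integral_cmult) measurable
    also have "sqrt r ^ DIM(complex ^ 'd) = r ^ CARD('d)"
      using that by (simp add: mult.commute[of "CARD('d)"] power_mult)
    finally show ?thesis
      using that by (simp add: power_add ennreal_mult mult_ac)
  qed
  have "ennreal (pi ^ CARD('d) * (\<Prod>i\<in>UNIV. fact (k i)))
      = (\<integral>\<^sup>+z. ?w z * ennreal (exp (- (norm z)\<^sup>2)) \<partial>(lborel :: (complex ^ 'd) measure))"
    by (simp add: monomial_gaussian[symmetric] ennreal_mult)
  also have "\<dots> = (\<integral>\<^sup>+z. (\<integral>\<^sup>+r. ?w z * (ennreal (exp (- r)) * indicator {(norm z)\<^sup>2<..} r) \<partial>lborel) \<partial>(lborel :: (complex ^ 'd) measure))"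
    by (simp add: nn_integral_cmult exp_tail_integral)
  also have "\<dots> = (\<integral>\<^sup>+r. (\<integral>\<^sup>+z. ?w z * (ennreal (exp (- r)) * indicator {(norm z)\<^sup>2<..} r) \<partial>(lborel :: (complex ^ 'd) measure)) \<partial>lborel)"
  proof (rule lborel_pair.Fubini')
    have "(\<lambda>(r, z :: complex ^ 'd). ?w z * (ennreal (exp (- r)) * indicator {p. (norm (snd p))\<^sup>2 < fst p} (r, z)))
        \<in> borel_measurable (lborel \<Otimes>\<^sub>M lborel)"
      by measurable
    then show "(\<lambda>(r, z :: complex ^ 'd). ?w z * (ennreal (exp (- r)) * indicator {(norm z)\<^sup>2<..} r))
        \<in> borel_measurable (lborel \<Otimes>\<^sub>M lborel)"
      by (simp add: indicator_def)
  qed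
  also have "\<dots> = (\<integral>\<^sup>+r. G * (ennreal (r ^ ?D * exp (- r)) * indicator {0..} r) \<partial>lborel)"
  proof (rule nn_integral_cong_AE, rule AE_mp[OF AE_lborel_singleton[of 0]], rule AE_I2, rule impI)
    fix r :: real assume "r \<noteq> 0"
    show "(\<integral>\<^sup>+z. ?w z * (ennreal (exp (- r)) * indicator {(norm z)\<^sup>2<..} r) \<partial>(lborel :: (complex ^ 'd) measure))
        = G * (ennreal (r ^ ?D * exp (- r)) * indicator {0..} r)"
    proof (cases "r > 0")
      case True
      have "(\<integral>\<^sup>+z. ?w z * (ennreal (exp (- r)) * indicator {(norm z)\<^sup>2<..} r) \<partial>(lborel :: (complex ^ 'd) measure))
          = (\<integral>\<^sup>+z. ennreal (exp (- r)) * (?w z * indicator {z. (norm z)\<^sup>2 < r} z) \<partial>(lborel :: (complex ^ 'd) measure))"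
        by (intro nn_integral_cong) (simp add: indicator_def mult.commute)
      also have "\<dots> = ennreal (exp (- r)) * (\<integral>\<^sup>+z. ?w z * indicator {z. (norm z)\<^sup>2 < r} z \<partial>(lborel :: (complex ^ 'd) measure))"
        by (intro nn_integral_cmult) measurable
      also have "(\<integral>\<^sup>+z. ?w z * indicator {z. (norm z)\<^sup>2 < r} z \<partial>(lborel :: (complex ^ 'd) measure)) = ennreal (r ^ ?D) * G"
        using scale[OF True] by (simp add: indicator_def)
      finally show ?thesis
        using True by (simp add: ennreal_mult mult_ac)
    next
      case False
      with \<open>r \<noteq> 0\<close> have "r < 0" by simp
      then have "indicator {(norm z)\<^sup>2<..} r = (0::ennreal)" for z :: "complex ^ 'd"
        using order.strict_trans1[OF zero_le_power2[of "norm z"], of r] by (auto simp: indicator_def simp del: zero_le_power2)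
      with \<open>r < 0\<close> show ?thesis by simp
    qed
  qed
  \<comment> \<open>What is left in r is the Gamma integral at ?D + 1, so G is the Gaussian value
    divided by a factorial.\<close>
  also have "\<dots> = G * ennreal (fact ?D)"
    by (subst nn_integral_cmult) (auto simp: nn_intergal_power_times_exp_Ici)
  finally have "G * ennreal (fact ?D) = ennreal (pi ^ CARD('d) * (\<Prod>i\<in>UNIV. fact (k i)))" ..
  then have "G = ennreal (pi ^ CARD('d) * (\<Prod>i\<in>UNIV. fact (k i))) / ennreal (fact ?D)"
    by (simp add: ennreal_mult_divide_eq flip: \<open>G * ennreal (fact ?D) = _\<close>)
  then show ?thesis
    unfolding G_def by (simp add: divide_ennreal prod_nonneg)
qed

text \<open>Multiplying the integrand by 1 = (1 - |z|^2) + sum of the |z_i|^2 gives I(k, m) = I(k,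
  m+1) + sum over i of I(k + e_i, m). All terms except I(k, m+1) have exponent m, so induction on m
  works provided that k is arbitrary.\<close>

lemma monomial_ball:
  "(\<integral>\<^sup>+z. ennreal (monomial_weight k z * (1 - (norm z)\<^sup>2) ^ m) * indicator (ball 0 1) z \<partial>(lborel :: (complex ^ 'd::finite) measure))
     = ennreal (pi ^ CARD('d) * (\<Prod>i\<in>UNIV. fact (k i)) * fact m / fact ((\<Sum>i\<in>UNIV. k i) + CARD('d) + m))"
proof (induction m arbitrary: k)
  case 0
  then show ?case by (simp add: monomial_ball_0)
next
  case (Suc m)
  let ?I = "\<lambda>k m. \<integral>\<^sup>+z. ennreal (monomial_weight k z * (1 - (norm z)\<^sup>2) ^ m) * indicator (ball 0 1) z \<partial>(lborel :: (complex ^ 'd) measure)"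
  let ?P = "pi ^ CARD('d) * (\<Prod>i\<in>UNIV. fact (k i)) * fact m :: real"
  let ?F = "fact ((\<Sum>i\<in>UNIV. k i) + CARD('d) + m) :: real"
  let ?S = "real ((\<Sum>i\<in>UNIV. k i) + CARD('d))"
  have nn: "0 \<le> (1 - (norm z)\<^sup>2) ^ j" if "z \<in> ball 0 1" for z :: "complex ^ 'd" and j
    using that by (simp add: power_le_one)
  have upd: "(\<Prod>j\<in>UNIV. fact ((k(i := Suc (k i))) j)) = real (Suc (k i)) * (\<Prod>j\<in>UNIV. fact (k j))" for i
    by (rule prod_Suc_update) simp
  have Ii: "?I (k(i := Suc (k i))) m = ennreal (real (Suc (k i)) * (?P / (?F * (?S + real m + 1))))" for i
    unfolding Suc.IH upd sum_Suc_update by (simp add: algebra_simps)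
  have "?I k m = ?I k (Suc m) + (\<Sum>i\<in>UNIV. ?I (k(i := Suc (k i))) m)"
  proof -
    have "?I k (Suc m) + (\<Sum>i\<in>UNIV. ?I (k(i := Suc (k i))) m)
      = (\<integral>\<^sup>+z. ennreal (monomial_weight k z * (1 - (norm z)\<^sup>2) ^ Suc m) * indicator (ball 0 1) z
          + (\<Sum>i\<in>UNIV. ennreal (monomial_weight (k(i := Suc (k i))) z * (1 - (norm z)\<^sup>2) ^ m) * indicator (ball 0 1) z) \<partial>(lborel :: (complex ^ 'd) measure))"
    proof -
      have "(\<Sum>i\<in>UNIV. ?I (k(i := Suc (k i))) m)
        = (\<integral>\<^sup>+z. (\<Sum>i\<in>UNIV. ennreal (monomial_weight (k(i := Suc (k i))) z * (1 - (norm z)\<^sup>2) ^ m) * indicator (ball 0 1) z) \<partial>(lborel :: (complex ^ 'd) measure))"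
        by (rule nn_integral_sum[symmetric]) measurable
      then show ?thesis
        by (simp only:) (rule nn_integral_add[symmetric]; measurable)
    qed
    also have "\<dots> = ?I k m"
    proof (rule nn_integral_cong)
      fix z :: "complex ^ 'd"
      show "ennreal (monomial_weight k z * (1 - (norm z)\<^sup>2) ^ Suc m) * indicator (ball 0 1) z
          + (\<Sum>i\<in>UNIV. ennreal (monomial_weight (k(i := Suc (k i))) z * (1 - (norm z)\<^sup>2) ^ m) * indicator (ball 0 1) z)
        = ennreal (monomial_weight k z * (1 - (norm z)\<^sup>2) ^ m) * indicator (ball 0 1) z"
      proof (cases "z \<in> ball 0 1")
        case True
        have "(\<Sum>i\<in>UNIV. monomial_weight (k(i := Suc (k i))) z * (1 - (norm z)\<^sup>2) ^ m)
            = (norm z)\<^sup>2 * (monomial_weight k z * (1 - (norm z)\<^sup>2) ^ m)"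
          unfolding monomial_weight_Suc norm_vec_square[of z] sum_distrib_right by (simp add: mult_ac)
        then show ?thesis
          using True nn[OF True] nn[OF True, of "Suc m"]
          by (simp add: sum_ennreal ennreal_plus_if algebra_simps mult_left_mono)
      qed simp
    qed
    finally show ?thesis ..
  qed
  \<comment> \<open>The i-th term carries the factor k_i + 1; over all coordinates these add up to
    |k| + d, which is ?S.\<close>
  also have "(\<Sum>i\<in>UNIV. ?I (k(i := Suc (k i))) m) = ennreal (?S * (?P / (?F * (?S + real m + 1))))"
  proof -
    define c where "c = ?P / (?F * (?S + real m + 1))"
    have "0 \<le> c"
      unfolding c_def by (intro mult_nonneg_nonneg divide_nonneg_nonneg add_nonneg_nonneg prod_nonneg) (auto simp del: of_nat_sum of_nat_add)
    then have "(\<Sum>i\<in>UNIV. ennreal (real (Suc (k i)) * c)) = ennreal (\<Sum>i\<in>UNIV. real (Suc (k i)) * c)"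
      by (intro sum_ennreal) auto
    also have "(\<Sum>i\<in>UNIV. real (Suc (k i)) * c) = ?S * c"
      by (simp add: sum_distrib_right[symmetric] sum.distrib add.commute)
    finally show ?thesis unfolding Ii c_def .
  qed
  finally have "ennreal (?P / ?F) = ?I k (Suc m) + ennreal (?S * (?P / (?F * (?S + real m + 1))))"
    unfolding Suc.IH .
  \<comment> \<open>The subtraction is legitimate in \<open>ennreal\<close> because the subtracted
    term is finite.\<close>
  then have "?I k (Suc m) = ennreal (?P / ?F) - ennreal (?S * (?P / (?F * (?S + real m + 1))))"
    by (simp add: ennreal_add_diff_cancel_right)
  also have "\<dots> = ennreal (?P / ?F - ?S * (?P / (?F * (?S + real m + 1))))"
    by (intro ennreal_minus mult_nonneg_nonneg divide_nonneg_nonneg add_nonneg_nonneg prod_nonneg) (auto simp del: of_nat_sum of_nat_add)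
  also have "?P / ?F - ?S * (?P / (?F * (?S + real m + 1))) = ?P * (real m + 1) / (?F * (?S + real m + 1))"
  proof -
    have "P / F - S * (P / (F * (S + q + 1))) = P * (q + 1) / (F * (S + q + 1))"
      if "F > 0" "S + q + 1 > 0" for P F S q :: real
      using that by (simp add: divide_simps) (simp add: algebra_simps)
    moreover have "?S + real m + 1 > 0"
      by (simp add: sum_nonneg add_nonneg_pos del: of_nat_sum)
    ultimately show ?thesis by simp
  qed
  finally show ?case
    by (simp add: algebra_simps)
qed

section \<open>Analytic functions on the ball\<close>

definition unity_root :: "nat \<Rightarrow> nat \<Rightarrow> complex" where
  "unity_root N j = exp (2 * of_real pi * \<i> * of_nat j / of_nat N)"

lemma cmod_unity_root [simp]: "cmod (unity_root N j) = 1"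
  by (simp add: unity_root_def norm_exp_eq_Re)

lemma unity_root_power: "unity_root N j ^ l = unity_root N l ^ j"
  by (simp add: unity_root_def exp_of_nat_mult[symmetric] mult_ac)

lemma unity_root_nonzero [simp]: "unity_root N j \<noteq> 0"
  by (simp add: unity_root_def)

text \<open>For distinct exponents below N the quotient q is a nontrivial N-th root of unity, so its
  geometric sum over N terms vanishes.\<close>

lemma unity_root_orthogonal:
  assumes "l < N" "m < N"
  shows "(\<Sum>j<N. unity_root N j ^ l / unity_root N j ^ m) = (if l = m then of_nat N else 0)"
proof (cases "l = m")
  case False
  define q where "q = unity_root N l / unity_root N m"
  have "q \<noteq> 1"
    using False assms complex_root_unity_eq[of N l m] by (auto simp: q_def unity_root_def)
  have one: "unity_root N j ^ N = 1" for j
    using assms complex_root_unity[of N j] by (simp add: unity_root_def)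
  have "(\<Sum>j<N. unity_root N j ^ l / unity_root N j ^ m) = (\<Sum>j<N. q ^ j)"
    by (intro sum.cong refl) (simp add: q_def power_divide unity_root_power[of N _ l] unity_root_power[of N _ m])
  also have "\<dots> = (1 - q ^ N) / (1 - q)"
    using \<open>q \<noteq> 1\<close> by (simp add: sum_gp0 sum_gp_strict)
  also have "q ^ N = 1" by (simp add: q_def power_divide one)
  finally show ?thesis using False by simp
qed simp

text \<open>A Riemann sum, over the N-th roots of unity, of the Cauchy integral for the m-th Taylor
  coefficient at 0. Being a finite sum, it inherits analyticity, measurability and bounds directly
  from g.\<close>

definition unity_average :: "nat \<Rightarrow> nat \<Rightarrow> (complex \<Rightarrow> complex) \<Rightarrow> complex" where
  "unity_average N m g = (\<Sum>j<N. g (unity_root N j) / unity_root N j ^ m) / of_nat N"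

lemma cmod_unity_average_le:
  assumes "\<And>j. cmod (g (unity_root N j)) \<le> B" "N > 0"
  shows "cmod (unity_average N m g) \<le> B"
proof -
  have "cmod (\<Sum>j<N. g (unity_root N j) / unity_root N j ^ m) \<le> (\<Sum>j<N. B)"
    using assms by (intro sum_norm_le) (simp add: norm_divide norm_power)
  then show ?thesis
    using assms(2) by (simp add: unity_average_def norm_divide divide_simps mult.commute)
qed

text \<open>The average is exact on polynomials of degree below N by orthogonality, and the Taylor
  tail is geometric by Cauchy's inequality. The bound depends on g only through M and r, which later
  makes the convergence uniform in a parameter.\<close>

lemma unity_average_error:
  assumes hol: "g holomorphic_on ball 0 R" and r: "1 < r" "r < R"
    and bd: "\<And>s. cmod s \<le> r \<Longrightarrow> cmod (g s) \<le> M" and "m < N"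
  shows "cmod (unity_average N m g - (deriv ^^ m) g 0 / fact m) \<le> M * (1 / r) ^ N / (1 - 1 / r)"
proof -
  define a where "a l = (deriv ^^ l) g 0 / fact l" for l
  have N: "N > 0" using \<open>m < N\<close> by simp
  have q: "0 < 1 / r" "1 / r < 1" using r by auto
  have a: "cmod (a l) \<le> M * (1 / r) ^ l" for l
  proof -
    have "cmod ((deriv ^^ l) g 0) \<le> fact l * M / r ^ l"
    proof (rule Cauchy_inequality)
      show "g holomorphic_on ball 0 r"
        using hol r by (meson ball_subset_ball_iff holomorphic_on_subset less_imp_le subset_ball)
      have "cball 0 r \<subseteq> ball (0::complex) R" using r by auto
      then show "continuous_on (cball 0 r) g"
        using hol holomorphic_on_imp_continuous_on continuous_on_subset by blast
      show "\<And>x. cmod (0 - x) = r \<Longrightarrow> cmod (g x) \<le> M" using bd by simp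
    qed (use r in simp)
    then show ?thesis
      using r by (simp add: a_def norm_divide field_simps)
  qed
  have tail: "cmod (g s - (\<Sum>l<N. a l * s ^ l)) \<le> M * (1 / r) ^ N / (1 - 1 / r)" if "cmod s = 1" for s
  proof -
    have sums: "(\<lambda>l. a l * s ^ l) sums g s"
      using holomorphic_power_series[OF hol, of s] that r by (simp add: a_def)
    have "(\<lambda>l. a (l + N) * s ^ (l + N)) sums (g s - (\<Sum>l<N. a l * s ^ l))"
      by (rule sums_split_initial_segment[OF sums])
    moreover have "(\<lambda>l. M * (1 / r) ^ N * (1 / r) ^ l) sums (M * (1 / r) ^ N * (1 / (1 - 1 / r)))"
      using q by (intro sums_mult geometric_sums) simp
    moreover have "cmod (a (l + N) * s ^ (l + N)) \<le> M * (1 / r) ^ N * (1 / r) ^ l" for l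
      using a[of "l + N"] that by (simp add: norm_mult norm_power power_add mult_ac)
    ultimately have "cmod (g s - (\<Sum>l<N. a l * s ^ l)) \<le> M * (1 / r) ^ N * (1 / (1 - 1 / r))"
      by (rule norm_sums_le)
    then show ?thesis by simp
  qed
  have "unity_average N m (\<lambda>s. \<Sum>l<N. a l * s ^ l) = a m"
  proof -
    have "(\<Sum>j<N. (\<Sum>l<N. a l * unity_root N j ^ l) / unity_root N j ^ m)
        = (\<Sum>l<N. a l * (\<Sum>j<N. unity_root N j ^ l / unity_root N j ^ m))"
      by (simp add: sum_divide_distrib sum_distrib_left) (rule sum.swap)
    also have "\<dots> = (\<Sum>l<N. a l * (if l = m then of_nat N else 0))"
      using \<open>m < N\<close> by (intro sum.cong) (auto simp: unity_root_orthogonal)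
    also have "\<dots> = a m * of_nat N"
      using \<open>m < N\<close> by (simp add: if_distrib[of "(*) _"] cong: if_cong)
    finally show ?thesis using N by (simp add: unity_average_def)
  qed
  then have "unity_average N m g - a m = unity_average N m (\<lambda>s. g s - (\<Sum>l<N. a l * s ^ l))"
    by (simp add: unity_average_def diff_divide_distrib sum_subtractf)
  then show ?thesis
    using cmod_unity_average_le[of "\<lambda>s. g s - (\<Sum>l<N. a l * s ^ l)", OF tail] N by (simp add: a_def)
qed

lemma unity_average_tendsto:
  assumes hol: "g holomorphic_on ball 0 R" and "1 < R"
  shows "(\<lambda>N. unity_average N m g) \<longlonglongrightarrow> (deriv ^^ m) g 0 / fact m"
proof -
  define r where "r = (1 + R) / 2"
  have r: "1 < r" "r < R" using \<open>1 < R\<close> by (auto simp: r_def)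
  have sub: "cball 0 r \<subseteq> ball (0::complex) R" using r by auto
  then have "compact (g ` cball 0 r)"
    by (intro compact_continuous_image holomorphic_on_imp_continuous_on) (use hol holomorphic_on_subset in auto)
  then obtain M where M: "\<And>s. cmod s \<le> r \<Longrightarrow> cmod (g s) \<le> M"
    by (meson bounded_iff compact_imp_bounded image_eqI mem_cball_0)
  have lim: "(\<lambda>N. M * (1 / r) ^ N / (1 - 1 / r)) \<longlonglongrightarrow> 0"
    using r by (auto intro!: tendsto_eq_intros LIMSEQ_power_zero)
  show ?thesis
    unfolding LIM_zero_iff[symmetric, of _ "_ / _"]
    by (rule Lim_null_comparison[OF _ lim])
      (use unity_average_error[OF hol r M] in \<open>auto simp: eventually_at_top_linorder intro!: exI[of _ "Suc m"]\<close>)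
qed

section \<open>Several complex variables through one-variable slices\<close>

lemma analytic_on_ball_slice:
  assumes f: "analytic_on_ball (f :: ('d::finite) cfun)"
  shows "(\<lambda>t. f (a + t *s v)) holomorphic_on {t. a + t *s v \<in> ball 0 1}"
    and "\<lbrakk>(f has_derivative f') (at (a + t *s v)); \<And>c v. f' (c *s v) = c * f' v\<rbrakk>
      \<Longrightarrow> ((\<lambda>t. f (a + t *s v)) has_field_derivative f' v) (at t)"
proof -
  have bl: "bounded_linear (\<lambda>t. t *s v)"
  proof -
    have "linear (\<lambda>t. t *s v :: complex ^ 'd)"
      by (auto intro!: linearI simp: vec_eq_iff algebra_simps)
    then show ?thesis by (simp add: linear_conv_bounded_linear)
  qed
  show *: "((\<lambda>t. f (a + t *s v)) has_field_derivative f' v) (at t)"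
    if f': "(f has_derivative f') (at (a + t *s v))" and cl: "\<And>c v. f' (c *s v) = c * f' v" for f' t
  proof -
    have "((\<lambda>t. a + t *s v) has_derivative (\<lambda>t. t *s v)) (at t)"
      using bounded_linear_imp_has_derivative[OF bl] by (auto intro!: derivative_eq_intros)
    from has_derivative_compose[OF this f'] have "((\<lambda>t. f (a + t *s v)) has_derivative (\<lambda>t. f' (t *s v))) (at t)" .
    moreover have "(\<lambda>t. f' (t *s v)) = (*) (f' v)"
      by (rule ext) (simp add: cl mult.commute)
    ultimately show ?thesis by (simp add: has_field_derivative_def)
  qed
  show "(\<lambda>t. f (a + t *s v)) holomorphic_on {t. a + t *s v \<in> ball 0 1}"
    unfolding holomorphic_on_def field_differentiable_def
  proof
    fix t assume "t \<in> {t. a + t *s v \<in> ball 0 1}"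
    then obtain f' where "(f has_derivative f') (at (a + t *s v))" "\<And>c v. f' (c *s v) = c * f' v"
      using f unfolding analytic_on_ball_def by blast
    from *[OF this] show "\<exists>f'. ((\<lambda>t. f (a + t *s v)) has_field_derivative f') (at t within {t. a + t *s v \<in> ball 0 1})"
      using has_field_derivative_at_within by blast
  qed
qed

lemma norm_vector_smult: "norm (c *s v) = cmod c * norm (v :: complex ^ 'd::finite)"
proof -
  have "norm (c *s v) = sqrt (\<Sum>i\<in>UNIV. (cmod c)\<^sup>2 * (cmod (v $ i))\<^sup>2)"
    by (simp add: norm_vec_def L2_set_def norm_mult power_mult_distrib)
  also have "\<dots> = cmod c * norm v"
    by (simp add: norm_vec_def L2_set_def real_sqrt_mult sum_distrib_left[symmetric])
  finally show ?thesis .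
qed

text \<open>Cauchy's inequality on the slice through z in direction v: the disc of radius \<delta> /
  |v| in the parameter stays in the closed ball of radius \<delta> around z.\<close>

lemma analytic_on_ball_derivative_bound:
  assumes f: "analytic_on_ball (f :: ('d::finite) cfun)" and sub: "cball z \<delta> \<subseteq> ball 0 1" "\<delta> > 0"
    and bd: "\<And>w. w \<in> cball z \<delta> \<Longrightarrow> cmod (f w) \<le> B"
    and f': "(f has_derivative f') (at z)" "\<And>c v. f' (c *s v) = c * f' v"
  shows "cmod (f' v) \<le> B / \<delta> * norm v"
proof (cases "v = 0")
  case True
  have "f' (0 *s v) = 0" unfolding f'(2) by simp
  then show ?thesis using True by simp
next
  case False
  let ?g = "\<lambda>t. f (z + t *s v)"
  let ?\<rho> = "\<delta> / norm v"
  have in_ball: "z + t *s v \<in> cball z \<delta>" if "cmod t \<le> ?\<rho>" for t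
    using that False by (simp add: dist_norm norm_vector_smult field_simps)
  have "cball 0 ?\<rho> \<subseteq> {t. z + t *s v \<in> ball 0 1}"
    using in_ball sub by (metis (mono_tags, lifting) mem_Collect_eq mem_cball_0 subset_eq)
  with analytic_on_ball_slice(1)[OF f, of z v] have hol: "?g holomorphic_on cball 0 ?\<rho>"
    using holomorphic_on_subset by blast
  have "cmod ((deriv ^^ 1) ?g 0) \<le> fact 1 * B / ?\<rho> ^ 1"
  proof (rule Cauchy_inequality)
    show "?g holomorphic_on ball 0 ?\<rho>" using hol ball_subset_cball holomorphic_on_subset by blast
    show "continuous_on (cball 0 ?\<rho>) ?g" using hol holomorphic_on_imp_continuous_on by blast
    show "\<And>x. cmod (0 - x) = ?\<rho> \<Longrightarrow> cmod (?g x) \<le> B" using in_ball bd by auto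
  qed (use False sub in auto)
  moreover have "deriv ?g 0 = f' v"
    using analytic_on_ball_slice(2)[OF f, of f' z 0 v] f' by (intro DERIV_imp_deriv) simp
  ultimately show ?thesis using False by (simp add: field_simps)
qed

lemma analytic_on_ball_uminus_add:
  assumes "analytic_on_ball f" "analytic_on_ball g"
  shows "analytic_on_ball (\<lambda>z. c * f z + d * g z)"
  unfolding analytic_on_ball_def
proof
  fix z :: "complex ^ 'a" assume z: "z \<in> ball 0 1"
  obtain f' where f': "(f has_derivative f') (at z)" "\<And>c v. f' (c *s v) = c * f' v"
    using assms(1) z unfolding analytic_on_ball_def by blast
  obtain g' where g': "(g has_derivative g') (at z)" "\<And>c v. g' (c *s v) = c * g' v"
    using assms(2) z unfolding analytic_on_ball_def by blast
  have "((\<lambda>z. c * f z + d * g z) has_derivative (\<lambda>v. c * f' v + d * g' v)) (at z)"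
    using f'(1) g'(1) by (auto intro!: derivative_eq_intros)
  moreover have "c * f' (e *s v) + d * g' (e *s v) = e * (c * f' v + d * g' v)" for e v
    unfolding f'(2) g'(2) by (simp add: algebra_simps)
  ultimately show "\<exists>f'. ((\<lambda>z. c * f z + d * g z) has_derivative f') (at z) \<and> (\<forall>c v. f' (c *s v) = c * f' v)"
    by blast
qed

text \<open>Weierstrass' theorem. Cauchy's derivative bound, applied to differences of members of
  the sequence, makes the derivatives uniformly Cauchy on smaller balls; complex linearity survives
  the pointwise limit of the derivatives.\<close>

lemma analytic_on_ball_limit:
  fixes F :: "nat \<Rightarrow> ('d::finite) cfun"
  assumes F: "\<And>N. analytic_on_ball (F N)"
    and lim: "\<And>r. \<lbrakk>0 < r; r < 1\<rbrakk> \<Longrightarrow> uniform_limit (cball 0 r) F f sequentially"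
  shows "analytic_on_ball f"
  unfolding analytic_on_ball_def
proof
  fix z0 :: "complex ^ 'd" assume "z0 \<in> ball 0 1"
  define r where "r = (1 + norm z0) / 2"
  have r: "norm z0 < r" "r < 1" "0 < r" using \<open>z0 \<in> ball 0 1\<close> by (auto simp: r_def add_pos_nonneg)
  \<comment> \<open>Derivatives are controlled on the ball of radius r; the margin \<delta> is the
    room that the Cauchy estimate needs around its points.\<close>
  define \<delta> where "\<delta> = (1 - r) / 2"
  have \<delta>: "\<delta> > 0" "r + \<delta> < 1" using r by (auto simp: \<delta>_def field_simps)
  define P where "P N z f' \<longleftrightarrow> (F N has_derivative f') (at z) \<and> (\<forall>c v. f' (c *s v) = c * f' v)" for N z f'
  define D where "D N z = (SOME f'. P N z f')" for N z
  have PD: "P N z (D N z)" if "z \<in> ball 0 1" for N z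
  proof -
    have "\<exists>f'. P N z f'"
      using F[of N] that unfolding analytic_on_ball_def P_def by blast
    then show ?thesis unfolding D_def by (rule someI_ex)
  qed
  then have D: "(F N has_derivative D N z) (at z)" and Dc: "D N z (c *s v) = c * D N z v"
    if "z \<in> ball 0 1" for N z c v
    using that unfolding P_def by blast+
  have unif: "\<exists>N0. \<forall>N\<ge>N0. \<forall>M\<ge>N0. \<forall>z\<in>ball 0 r. \<forall>v. cmod (D N z v - D M z v) \<le> e * norm v" if "e > 0" for e
  proof -
    \<comment> \<open>Half of e \<delta> for each of two members bounds their difference by e
      \<delta>; the derivative bound divides by \<delta>.\<close>
    have "\<forall>\<^sub>F N in sequentially. \<forall>x\<in>cball 0 (r + \<delta>). dist (F N x) (f x) < e * \<delta> / 2"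
      using lim[of "r + \<delta>"] r \<delta> that by (intro uniform_limitD) auto
    then obtain N0 where N0: "\<And>N x. \<lbrakk>N \<ge> N0; x \<in> cball 0 (r + \<delta>)\<rbrakk> \<Longrightarrow> dist (F N x) (f x) < e * \<delta> / 2"
      unfolding eventually_sequentially by blast
    show ?thesis
    proof (intro exI allI impI ballI)
      fix N M z v assume NM: "N0 \<le> N" "N0 \<le> M" and z: "z \<in> ball (0 :: complex ^ 'd) r"
      have z1: "z \<in> ball 0 1" using z r by auto
      have sub: "cball z \<delta> \<subseteq> cball 0 (r + \<delta>)" using z by (auto simp: dist_norm) (smt (verit) norm_triangle_sub norm_minus_commute)
      have "cmod ((\<lambda>v. 1 * D N z v + (-1) * D M z v) v) \<le> e * \<delta> / \<delta> * norm v"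
      proof (rule analytic_on_ball_derivative_bound)
        show "analytic_on_ball (\<lambda>z. 1 * F N z + (-1) * F M z)"
          by (intro analytic_on_ball_uminus_add F)
        show "cball z \<delta> \<subseteq> ball 0 1" using sub \<delta> by auto
        show "((\<lambda>z. 1 * F N z + (-1) * F M z) has_derivative (\<lambda>v. 1 * D N z v + (-1) * D M z v)) (at z)"
          using D[OF z1] by (auto intro!: derivative_eq_intros)
        fix w assume "w \<in> cball z \<delta>"
        then have "w \<in> cball 0 (r + \<delta>)" using sub by blast
        from N0[OF NM(1) this] N0[OF NM(2) this] have "dist (F N w) (F M w) < e * \<delta>"
          using dist_triangle_half_r[of "f w" "F N w" "e * \<delta>" "F M w"] by (simp add: dist_commute)
        then show "cmod (1 * F N w + (-1) * F M w) \<le> e * \<delta>" by (simp add: dist_norm)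
      qed (use \<delta> in \<open>auto simp: Dc[OF z1] algebra_simps\<close>)
      then show "cmod (D N z v - D M z v) \<le> e * norm v" using \<delta> by simp
    qed
  qed
  define G where "G z v = lim (\<lambda>N. D N z v)" for z v
  have G: "(\<lambda>N. D N z v) \<longlonglongrightarrow> G z v" if "z \<in> ball 0 r" for z v
  proof -
    have "Cauchy (\<lambda>N. D N z v)"
    proof (rule CauchyI)
      fix e :: real assume "e > 0"
      \<comment> \<open>The summand 1 admits v = 0 and makes the resulting inequality
        strict.\<close>
      define e' where "e' = e / (norm v + 1)"
      have "e' > 0" using \<open>e > 0\<close> by (simp add: e'_def add_nonneg_pos)
      have "e' * norm v < e"
        using \<open>e > 0\<close> by (simp add: e'_def divide_simps add_nonneg_pos)
      moreover obtain N0 where "\<forall>N\<ge>N0. \<forall>M\<ge>N0. \<forall>z\<in>ball 0 r. \<forall>v. cmod (D N z v - D M z v) \<le> e' * norm v"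
        using unif[OF \<open>e' > 0\<close>] by blast
      then have "cmod (D m z v - D n z v) \<le> e' * norm v" if "m \<ge> N0" "n \<ge> N0" for m n
        using that \<open>z \<in> ball 0 r\<close> by simp
      ultimately show "\<exists>M. \<forall>m\<ge>M. \<forall>n\<ge>M. norm (D m z v - D n z v) < e"
        by (intro exI[of _ N0]) fastforce
    qed
    then show ?thesis
      unfolding G_def by (simp add: Cauchy_convergent_iff convergent_LIMSEQ_iff)
  qed
  have "\<exists>g. \<forall>x\<in>ball 0 r. (\<lambda>n. F n x) \<longlonglongrightarrow> g x \<and> (g has_derivative G x) (at x within ball 0 r)"
  proof -
    have der: "\<And>N x. x \<in> ball 0 r \<Longrightarrow> (F N has_derivative D N x) (at x within ball 0 r)"
      by (rule has_derivative_at_withinI[OF D]) (use r in simp)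
    have near: "\<forall>\<^sub>F N in sequentially. \<forall>x\<in>ball 0 r. \<forall>h. norm (D N x h - G x h) \<le> e * norm h" if "e > 0" for e
    proof -
      obtain N0 where N0: "\<forall>N\<ge>N0. \<forall>M\<ge>N0. \<forall>z\<in>ball 0 r. \<forall>v. cmod (D N z v - D M z v) \<le> e * norm v"
        using unif[OF \<open>e > 0\<close>] by blast
      show ?thesis
        unfolding eventually_sequentially
      proof (intro exI[of _ N0] allI impI ballI)
        fix N x h assume N: "N0 \<le> N" and x: "x \<in> ball (0 :: complex ^ 'd) r"
        have "(\<lambda>M. cmod (D N x h - D M x h)) \<longlonglongrightarrow> cmod (D N x h - G x h)"
          by (intro tendsto_intros G x)
        moreover have "\<forall>\<^sub>F M in sequentially. cmod (D N x h - D M x h) \<le> e * norm h"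
          by (rule eventually_sequentiallyI[of N0]) (use N0 N x in simp)
        ultimately show "norm (D N x h - G x h) \<le> e * norm h"
          by (rule tendsto_upperbound) simp
      qed
    qed
    have lim0: "(\<lambda>n. F n 0) \<longlonglongrightarrow> f 0"
      using lim[of r] r by (auto intro: tendsto_uniform_limitI)
    have zero: "0 \<in> ball (0 :: complex ^ 'd) r" using r by simp
    show ?thesis
      by (rule has_derivative_sequence[OF convex_ball der near zero lim0])
  qed
  then obtain g where g: "\<And>x. x \<in> ball 0 r \<Longrightarrow> (\<lambda>n. F n x) \<longlonglongrightarrow> g x"
      and g': "\<And>x. x \<in> ball 0 r \<Longrightarrow> (g has_derivative G x) (at x within ball 0 r)" by blast
  have fg: "f x = g x" if "x \<in> ball 0 r" for x
  proof (rule LIMSEQ_unique[OF _ g[OF that]])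
    show "(\<lambda>n. F n x) \<longlonglongrightarrow> f x"
      using lim[of r] r that by (auto intro: tendsto_uniform_limitI)
  qed
  have z0: "z0 \<in> ball 0 r" using r by simp
  have "(f has_derivative G z0) (at z0)"
  proof (rule has_derivative_transform_within_open[OF _ open_ball[of 0 r]])
    show "(g has_derivative G z0) (at z0)"
      using g'[OF z0] z0 by (simp add: at_within_open[OF _ open_ball])
  qed (use z0 fg in auto)
  moreover have "G z0 (c *s v) = c * G z0 v" for c v
  proof (rule LIMSEQ_unique[OF G[OF z0]])
    have "(\<lambda>N. c * D N z0 v) \<longlonglongrightarrow> c * G z0 v" by (intro tendsto_intros G z0)
    then show "(\<lambda>N. D N z0 (c *s v)) \<longlonglongrightarrow> c * G z0 v" using Dc \<open>z0 \<in> ball 0 1\<close> by simp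
  qed
  ultimately show "\<exists>f'. (f has_derivative f') (at z0) \<and> (\<forall>c v. f' (c *s v) = c * f' v)" by blast
qed

section \<open>Taylor components in a single coordinate and separate homogeneity\<close>

definition coord_scale :: "('d \<Rightarrow> complex) \<Rightarrow> complex ^ 'd \<Rightarrow> complex ^ 'd::finite" where
  "coord_scale s z = (\<chi> i. s i * z $ i)"

abbreviation coord_scale1 :: "'d \<Rightarrow> complex \<Rightarrow> complex ^ 'd \<Rightarrow> complex ^ 'd::finite" where
  "coord_scale1 i t \<equiv> coord_scale ((\<lambda>_. 1)(i := t))"

lemma coord_scale_nth [simp]: "coord_scale s z $ i = s i * z $ i"
  by (simp add: coord_scale_def)

lemma coord_scale_one [simp]: "coord_scale (\<lambda>_. 1) z = z"
  by (simp add: vec_eq_iff)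

lemma norm_coord_scale_le:
  assumes "\<And>i. cmod (s i) \<le> c" "0 \<le> c"
  shows "norm (coord_scale s z) \<le> c * norm z"
proof -
  have "(norm (coord_scale s z))\<^sup>2 \<le> (\<Sum>i\<in>UNIV. c\<^sup>2 * (norm (z $ i))\<^sup>2)"
    unfolding norm_vec_square using assms
    by (intro sum_mono) (simp add: norm_mult power_mult_distrib mult_right_mono power_mono)
  also have "\<dots> = (c * norm z)\<^sup>2"
    by (simp add: norm_vec_square power_mult_distrib sum_distrib_left)
  finally show ?thesis
    using assms(2) by (auto intro: power2_le_imp_le)
qed

lemma norm_coord_scale_eq:
  assumes "\<And>i. cmod (s i) = 1"
  shows "norm (coord_scale s z) = norm z"
  using assms by (simp add: norm_vec_def L2_set_def norm_mult)

lemma coord_scale_in_ball: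
  assumes "\<And>i. cmod (s i) \<le> 1" "z \<in> ball 0 r"
  shows "coord_scale s z \<in> ball 0 r"
  using norm_coord_scale_le[of s 1 z] assms by simp

lemma coord_scale1_in_ball:
  assumes "cmod t \<le> 1" "z \<in> ball 0 r"
  shows "coord_scale1 i t z \<in> ball 0 r"
  by (rule coord_scale_in_ball) (use assms in auto)

lemma linear_coord_scale: "linear (coord_scale s)"
  by (rule linearI) (auto simp: vec_eq_iff algebra_simps)

lemma analytic_on_ball_coord_scale:
  assumes f: "analytic_on_ball f" and s: "\<And>i. cmod (s i) \<le> 1"
  shows "analytic_on_ball (\<lambda>z. f (coord_scale s z))"
  unfolding analytic_on_ball_def
proof
  fix z :: "complex ^ 'a" assume "z \<in> ball 0 1"
  then have "coord_scale s z \<in> ball 0 1" by (rule coord_scale_in_ball[OF s])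
  then obtain f' where f': "(f has_derivative f') (at (coord_scale s z))" "\<And>c v. f' (c *s v) = c * f' v"
    using f unfolding analytic_on_ball_def by blast
  have "(coord_scale s has_derivative coord_scale s) (at z)"
    by (rule linear_imp_has_derivative[OF linear_coord_scale])
  from has_derivative_compose[OF this f'(1)]
  have "((\<lambda>z. f (coord_scale s z)) has_derivative (\<lambda>v. f' (coord_scale s v))) (at z)" .
  moreover have "coord_scale s (c *s v) = c *s coord_scale s v" for c v
    by (simp add: vec_eq_iff)
  ultimately show "\<exists>f'. ((\<lambda>z. f (coord_scale s z)) has_derivative f') (at z) \<and> (\<forall>c v. f' (c *s v) = c * f' v)"
    using f'(2) by (intro exI[of _ "\<lambda>v. f' (coord_scale s v)"]) simp
qed

lemma analytic_on_ball_sum: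
  assumes "\<And>j. j \<in> A \<Longrightarrow> analytic_on_ball (g j)"
  shows "analytic_on_ball (\<lambda>z. \<Sum>j\<in>A. c j * g j z)"
  using assms
proof (induction A rule: infinite_finite_induct)
  case (insert x A)
  then show ?case
    using analytic_on_ball_uminus_add[of "g x" "\<lambda>z. \<Sum>j\<in>A. c j * g j z" "c x" 1] by simp
qed (auto simp: analytic_on_ball_def intro!: exI[of _ "\<lambda>_. 0"])

lemma analytic_on_ball_continuous_on:
  "analytic_on_ball f \<Longrightarrow> continuous_on (ball 0 1) f"
  unfolding analytic_on_ball_def
  by (meson has_derivative_continuous continuous_at_imp_continuous_on)

lemma analytic_on_ball_bounded:
  assumes "analytic_on_ball f" "r < 1"
  obtains M where "\<And>z. norm z \<le> r \<Longrightarrow> cmod (f z) \<le> M"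
proof -
  have "compact (f ` cball 0 r)"
    using analytic_on_ball_continuous_on[OF assms(1)] assms(2)
    by (intro compact_continuous_image) (auto elim: continuous_on_subset)
  then obtain M where "\<forall>y\<in>f ` cball 0 r. cmod y \<le> M"
    by (metis bounded_iff compact_imp_bounded)
  then show ?thesis by (intro that[of M]) simp
qed

text \<open>The \<open>m\<close>-th Taylor coefficient of \<open>f\<close> in its \<open>i\<close>-th variable, multiplied by \<open>z\<^sub>i\<close> to the \<open>m\<close>.\<close>

definition taylor_part :: "'d \<Rightarrow> nat \<Rightarrow> ('d::finite) cfun \<Rightarrow> 'd cfun" where
  "taylor_part i m f z = (deriv ^^ m) (\<lambda>t. f (coord_scale1 i t z)) 0 / fact m"

text \<open>From |z| < r and R r \<le> 1 the scaled point stays in the unit ball for |t| < R. In the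
  applications R > 1, so the roots of unity lie inside the disc of holomorphy.\<close>

lemma coord_scale1_slice_holomorphic:
  assumes f: "analytic_on_ball f" and z: "norm z < r" and r: "R * r \<le> 1" "1 \<le> R"
  shows "(\<lambda>t. f (coord_scale1 i t z)) holomorphic_on ball 0 R"
proof -
  have eq: "coord_scale1 i t z = (z - axis i (z $ i)) + t *s axis i (z $ i)" for t
    by (simp add: vec_eq_iff axis_def)
  have "coord_scale1 i t z \<in> ball 0 1" if "t \<in> ball 0 R" for t
  proof -
    have "norm (coord_scale1 i t z) \<le> R * norm z"
      using that r by (intro norm_coord_scale_le) auto
    also have "\<dots> < R * r" using z r by simp
    finally show ?thesis using r by simp
  qed
  then have "ball 0 R \<subseteq> {t. (z - axis i (z $ i)) + t *s axis i (z $ i) \<in> ball 0 1}"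
    unfolding eq by blast
  then show ?thesis
    unfolding eq by (rule holomorphic_on_subset[OF analytic_on_ball_slice(1)[OF f]])
qed

lemma radius_margin:
  assumes "z \<in> ball (0 :: 'a::real_normed_vector) 1"
  obtains r R where "norm z < r" "R * r \<le> 1" "1 < R" "r < 1" "(0::real) < r"
proof -
  define r where "r = (1 + norm z) / 2"
  have r: "norm z < r" "r < 1" "0 < r" using assms by (auto simp: r_def add_pos_nonneg)
  then show ?thesis by (intro that[of r "1 / r"]) auto
qed

lemma taylor_part_sums:
  assumes f: "analytic_on_ball f" and z: "z \<in> ball 0 1"
  shows "(\<lambda>m. taylor_part i m f z) sums f z"
proof -
  obtain r R where "norm z < r" "R * r \<le> 1" "1 < R"
    using radius_margin[OF z] by blast
  then have "(\<lambda>t. f (coord_scale1 i t z)) holomorphic_on ball 0 R"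
    using f by (intro coord_scale1_slice_holomorphic) auto
  \<comment> \<open>At t = 1 the scaling is the identity, so the power series of the slice sums to f
    z.\<close>
  from holomorphic_power_series[OF this, of 1] show ?thesis
    using \<open>1 < R\<close> by (simp add: taylor_part_def fun_upd_def)
qed

lemma taylor_part_limit:
  assumes f: "analytic_on_ball f" and z: "z \<in> ball 0 1"
  shows "(\<lambda>N. unity_average N m (\<lambda>t. f (coord_scale1 i t z))) \<longlonglongrightarrow> taylor_part i m f z"
proof -
  obtain r R where "norm z < r" "R * r \<le> 1" "1 < R"
    using radius_margin[OF z] by blast
  then have "(\<lambda>t. f (coord_scale1 i t z)) holomorphic_on ball 0 R"
    using f by (intro coord_scale1_slice_holomorphic) auto
  from unity_average_tendsto[OF this \<open>1 < R\<close>] show ?thesis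
    by (simp add: taylor_part_def)
qed

lemma taylor_part_uniform_limit:
  assumes f: "analytic_on_ball f" and \<rho>: "0 < \<rho>" "\<rho> < 1"
  shows "uniform_limit (cball 0 \<rho>) (\<lambda>N z. unity_average N m (\<lambda>t. f (coord_scale1 i t z))) (taylor_part i m f) sequentially"
proof (rule uniform_limitI)
  fix e :: real assume "e > 0"
  \<comment> \<open>One disc must serve all |z| \<le> \<rho>: r0 fixes the common slice radius R = 1
    / r0 > 1, and r lies between 1 and R so that r \<rho> < 1 still gives a common bound M.\<close>
  define r0 where "r0 = (1 + \<rho>) / 2"
  have r0: "\<rho> < r0" "r0 < 1" using \<rho> by (auto simp: r0_def)
  define R where "R = 1 / r0"
  have R: "R * r0 \<le> 1" "1 < R" using r0 \<rho> by (auto simp: R_def)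
  define r where "r = (1 + R) / 2"
  have r: "1 < r" "r < R" using R by (auto simp: r_def)
  have r\<rho>: "r * \<rho> < 1"
  proof -
    have "r * \<rho> < R * r0" using r r0 \<rho> by (intro mult_strict_mono) auto
    then show ?thesis using R by simp
  qed
  obtain M where M: "\<And>z. norm z \<le> r * \<rho> \<Longrightarrow> cmod (f z) \<le> M"
    using analytic_on_ball_bounded[OF f r\<rho>] by blast
  have err: "cmod (unity_average N m (\<lambda>t. f (coord_scale1 i t z)) - taylor_part i m f z) \<le> M * (1 / r) ^ N / (1 - 1 / r)"
    if "z \<in> cball 0 \<rho>" "m < N" for z N
    unfolding taylor_part_def
  proof (rule unity_average_error[OF _ r])
    show "(\<lambda>t. f (coord_scale1 i t z)) holomorphic_on ball 0 R"
      using that r0 R by (intro coord_scale1_slice_holomorphic[OF f, of _ r0]) auto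
    fix s assume s: "cmod s \<le> r"
    have "norm (coord_scale1 i s z) \<le> r * norm z"
      using s r by (intro norm_coord_scale_le) auto
    also have "\<dots> \<le> r * \<rho>" using that r by simp
    finally show "cmod (f (coord_scale1 i s z)) \<le> M" by (rule M)
  qed (use that in simp)
  have "(\<lambda>N. M * (1 / r) ^ N / (1 - 1 / r)) \<longlonglongrightarrow> 0"
    using r by (auto intro!: tendsto_eq_intros LIMSEQ_power_zero)
  then have "\<forall>\<^sub>F N in sequentially. M * (1 / r) ^ N / (1 - 1 / r) < e"
    using \<open>e > 0\<close> by (auto dest: order_tendstoD)
  with eventually_gt_at_top[of m]
  show "\<forall>\<^sub>F N in sequentially. \<forall>z\<in>cball 0 \<rho>. dist (unity_average N m (\<lambda>t. f (coord_scale1 i t z))) (taylor_part i m f z) < e"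
  proof eventually_elim
    case (elim N)
    then show ?case using err[of _ N] by (fastforce simp: dist_norm)
  qed
qed

lemma analytic_on_ball_unity_average:
  assumes "analytic_on_ball f"
  shows "analytic_on_ball (\<lambda>z. unity_average N m (\<lambda>t. f (coord_scale1 i t z)))"
proof -
  have "analytic_on_ball (\<lambda>z. \<Sum>j<N. (1 / unity_root N j ^ m / of_nat N) * f (coord_scale1 i (unity_root N j) z))"
    by (intro analytic_on_ball_sum analytic_on_ball_coord_scale assms) auto
  then show ?thesis
    by (simp add: unity_average_def sum_divide_distrib mult.commute)
qed

lemma analytic_on_ball_taylor_part:
  assumes "analytic_on_ball f"
  shows "analytic_on_ball (taylor_part i m f)"
  by (rule analytic_on_ball_limit[OF analytic_on_ball_unity_average taylor_part_uniform_limit])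
     (use assms in auto)

lemma taylor_part_homogeneous:
  assumes f: "analytic_on_ball f" and z: "z \<in> ball 0 1" and s: "cmod s \<le> 1"
  shows "taylor_part i m f (coord_scale1 i s z) = s ^ m * taylor_part i m f z"
proof -
  obtain r R where R: "norm z < r" "R * r \<le> 1" "1 < R"
    using radius_margin[OF z] by blast
  let ?g = "\<lambda>t. f (coord_scale1 i t z)"
  have hol: "?g holomorphic_on ball 0 R"
    using R f by (intro coord_scale1_slice_holomorphic) auto
  have "(\<lambda>t. f (coord_scale1 i t (coord_scale1 i s z))) = (\<lambda>t. ?g (s * t))"
    by (rule ext, rule arg_cong[of _ _ f]) (auto simp: vec_eq_iff)
  moreover have "(deriv ^^ m) (\<lambda>t. ?g (s * t)) 0 = s ^ m * (deriv ^^ m) ?g (s * 0)"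
  proof (rule higher_deriv_compose_linear[OF hol])
    fix w assume "w \<in> ball (0::complex) R"
    then show "s * w \<in> ball 0 R"
      using s mult_left_le_one_le[of "cmod w" "cmod s"] by (simp add: norm_mult)
  qed (use R in auto)
  ultimately show ?thesis
    by (simp add: taylor_part_def)
qed

text \<open>Scalings in distinct coordinates commute, so homogeneity already achieved in coordinate
  j survives every average in coordinate i, and hence their limit.\<close>

lemma taylor_part_homogeneous_other:
  assumes f: "analytic_on_ball f" and z: "z \<in> ball 0 1" and s: "cmod s \<le> 1" and "i \<noteq> j"
    and hom: "\<And>z. z \<in> ball 0 1 \<Longrightarrow> f (coord_scale1 j s z) = c * f z"
  shows "taylor_part i m f (coord_scale1 j s z) = c * taylor_part i m f z"
proof (rule LIMSEQ_unique)
  have jz: "coord_scale1 j s z \<in> ball 0 1" by (rule coord_scale1_in_ball) (use s z in auto)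
  show "(\<lambda>N. unity_average N m (\<lambda>t. f (coord_scale1 i t (coord_scale1 j s z)))) \<longlonglongrightarrow> taylor_part i m f (coord_scale1 j s z)"
    by (rule taylor_part_limit[OF f jz])
  have "unity_average N m (\<lambda>t. f (coord_scale1 i t (coord_scale1 j s z))) = c * unity_average N m (\<lambda>t. f (coord_scale1 i t z))" for N
  proof -
    have "f (coord_scale1 i (unity_root N l) (coord_scale1 j s z)) = c * f (coord_scale1 i (unity_root N l) z)" for l
    proof -
      have "coord_scale1 i (unity_root N l) (coord_scale1 j s z) = coord_scale1 j s (coord_scale1 i (unity_root N l) z)"
        using \<open>i \<noteq> j\<close> by (auto simp: vec_eq_iff)
      moreover have "coord_scale1 i (unity_root N l) z \<in> ball 0 1"
        by (rule coord_scale1_in_ball) (use z in auto)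
      ultimately show ?thesis using hom by simp
    qed
    then show ?thesis by (simp add: unity_average_def sum_distrib_left)
  qed
  then show "(\<lambda>N. unity_average N m (\<lambda>t. f (coord_scale1 i t (coord_scale1 j s z)))) \<longlonglongrightarrow> c * taylor_part i m f z"
    using tendsto_mult_left[OF taylor_part_limit[OF f z, of m i], of c] by simp
qed

definition separately_homogeneous :: "'d set \<Rightarrow> ('d \<Rightarrow> nat) \<Rightarrow> ('d::finite) cfun \<Rightarrow> bool" where
  "separately_homogeneous J k f \<longleftrightarrow>
     (\<forall>i\<in>J. \<forall>s z. cmod s \<le> 1 \<longrightarrow> z \<in> ball 0 1 \<longrightarrow> f (coord_scale1 i s z) = s ^ k i * f z)"

lemma separately_homogeneous_scale:
  assumes f: "separately_homogeneous UNIV k f" and s: "\<And>i. cmod (s i) \<le> 1" and z: "z \<in> ball 0 1"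
  shows "f (coord_scale s z) = (\<Prod>i\<in>UNIV. s i ^ k i) * f z"
proof -
  have "finite I \<Longrightarrow> f (coord_scale (\<lambda>i. if i \<in> I then s i else 1) z) = (\<Prod>i\<in>I. s i ^ k i) * f z" for I
  proof (induction I rule: finite_induct)
    case (insert j I)
    let ?w = "coord_scale (\<lambda>i. if i \<in> I then s i else 1) z"
    have "coord_scale (\<lambda>i. if i \<in> insert j I then s i else 1) z = coord_scale1 j (s j) ?w"
      using insert.hyps by (auto simp: vec_eq_iff)
    moreover have "?w \<in> ball 0 1"
      by (rule coord_scale_in_ball) (use s z in auto)
    ultimately show ?case
      using f s insert unfolding separately_homogeneous_def by simp
  qed simp
  from this[of UNIV] show ?thesis by simp
qed

text \<open>Scaling z by a small number \<epsilon> gives the same point as scaling w = (\<epsilon>,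
  ..., \<epsilon>) by the coordinates of z. Evaluating f there in both ways expresses f z as a
  constant times z^k.\<close>

lemma separately_homogeneous_monomial:
  fixes f :: "('d::finite) cfun"
  assumes f: "separately_homogeneous UNIV k f"
  obtains a where "\<And>z. z \<in> ball 0 1 \<Longrightarrow> f z = a * (\<Prod>i\<in>UNIV. (z $ i) ^ k i)"
proof -
  \<comment> \<open>Small enough that w lies in the unit ball: its norm is at most d \<epsilon> <
    1.\<close>
  define \<epsilon> :: real where "\<epsilon> = 1 / (real CARD('d) + 1)"
  have \<epsilon>: "0 < \<epsilon>" "\<epsilon> \<le> 1" by (auto simp: \<epsilon>_def)
  define w :: "complex ^ 'd" where "w = (\<chi> i. of_real \<epsilon>)"
  have "norm w \<le> (\<Sum>i\<in>(UNIV :: 'd set). cmod (w $ i))" unfolding norm_vec_def by (rule L2_set_le_sum) simp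
  also have "\<dots> = real CARD('d) * \<epsilon>" using \<epsilon> by (simp add: w_def)
  also have "\<dots> < 1" by (simp add: \<epsilon>_def)
  finally have w: "w \<in> ball 0 1" by simp
  define c :: complex where "c = (\<Prod>i\<in>(UNIV :: 'd set). of_real \<epsilon> ^ k i)"
  have "c \<noteq> 0" using \<epsilon> by (simp add: c_def)
  show ?thesis
  proof (rule that[of "f w / c"])
    fix z :: "complex ^ 'd" assume z: "z \<in> ball 0 1"
    have "coord_scale (\<lambda>_. of_real \<epsilon>) z = coord_scale (\<lambda>i. z $ i) w"
      by (simp add: vec_eq_iff w_def)
    moreover have "f (coord_scale (\<lambda>_. of_real \<epsilon>) z) = c * f z"
      unfolding c_def by (rule separately_homogeneous_scale[OF f]) (use z \<epsilon> in auto)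
    moreover have "f (coord_scale (\<lambda>i. z $ i) w) = (\<Prod>i\<in>UNIV. (z $ i) ^ k i) * f w"
    proof (rule separately_homogeneous_scale[OF f _ w])
      show "cmod (z $ i) \<le> 1" for i
        using Finite_Cartesian_Product.norm_nth_le[of z i] z by simp
    qed
    ultimately show "f z = f w / c * (\<Prod>i\<in>UNIV. (z $ i) ^ k i)"
      using \<open>c \<noteq> 0\<close> by (simp add: field_simps)
  qed
qed

section \<open>The Bergman space\<close>

lemma sets_ball_measure [simp, measurable_cong]: "sets (ball_measure n) = sets borel"
  and space_ball_measure [simp]: "space (ball_measure n) = UNIV"
  by (simp_all add: ball_measure_def)

definition ball_density :: "nat \<Rightarrow> complex ^ 'd::finite \<Rightarrow> real" where
  "ball_density n z = indicator (ball 0 1) z *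
     (fact n / (fact (n - CARD('d)) * pi ^ CARD('d)) * (1 - (norm z)\<^sup>2) ^ (n - CARD('d)))"

lemma ball_measure_eq: "ball_measure n = density lborel (\<lambda>z. ennreal (ball_density n z))"
  by (simp add: ball_measure_def ball_density_def)

lemma ball_density_measurable [measurable]: "ball_density n \<in> borel_measurable borel"
  unfolding ball_density_def[abs_def] by measurable

lemma nn_integral_ball_measure:
  assumes [measurable]: "f \<in> borel_measurable borel"
  shows "(\<integral>\<^sup>+z. f z \<partial>ball_measure n) = (\<integral>\<^sup>+z. ennreal (ball_density n z) * f z \<partial>lborel)"
  unfolding ball_measure_eq by (rule nn_integral_density) measurable

lemma AE_ball_measure: "AE z in ball_measure n. z \<in> ball 0 1"
  unfolding ball_measure_eq by (subst AE_density) (auto simp: ball_density_def indicator_def)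

text \<open>The additional power of 1 - |z|^2 only raises the exponent n - d of the density. The
  case j = 0 yields norms; general j yields the eigenvalues of Toeplitz operators with radial
  symbols.\<close>

lemma monomial_weight_ball_measure:
  assumes n: "CARD('d) \<le> n"
  shows "(\<integral>\<^sup>+z. ennreal (monomial_weight k z * (1 - (norm z)\<^sup>2) ^ j) \<partial>(ball_measure n :: (complex ^ 'd::finite) measure))
    = ennreal (fact n / fact (n - CARD('d)) * (\<Prod>i\<in>UNIV. fact (k i)) * fact (n - CARD('d) + j) / fact ((\<Sum>i\<in>UNIV. k i) + n + j))"
proof -
  let ?c = "fact n / (fact (n - CARD('d)) * pi ^ CARD('d)) :: real"
  have "(\<integral>\<^sup>+z. ennreal (monomial_weight k z * (1 - (norm z)\<^sup>2) ^ j) \<partial>(ball_measure n :: (complex ^ 'd) measure))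
      = (\<integral>\<^sup>+z. ennreal ?c * (ennreal (monomial_weight k z * (1 - (norm z)\<^sup>2) ^ (n - CARD('d) + j)) * indicator (ball 0 1) z) \<partial>(lborel :: (complex ^ 'd) measure))"
    by (subst nn_integral_ball_measure)
       (auto intro!: nn_integral_cong simp: ball_density_def indicator_def power_add mult_ac power_le_one simp flip: ennreal_mult'')
  also have "\<dots> = ennreal ?c * ennreal (pi ^ CARD('d) * (\<Prod>i\<in>UNIV. fact (k i)) * fact (n - CARD('d) + j) / fact ((\<Sum>i\<in>UNIV. k i) + CARD('d) + (n - CARD('d) + j)))"
    by (subst nn_integral_cmult) (auto simp: monomial_ball)
  also have "\<dots> = ennreal (?c * (pi ^ CARD('d) * (\<Prod>i\<in>UNIV. fact (k i)) * fact (n - CARD('d) + j) / fact ((\<Sum>i\<in>UNIV. k i) + CARD('d) + (n - CARD('d) + j))))"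
    by (subst ennreal_mult) (auto intro!: divide_nonneg_nonneg mult_nonneg_nonneg prod_nonneg)
  finally show ?thesis
    using n by (simp add: add.assoc field_simps)
qed

lemma prob_space_ball_measure:
  assumes n: "CARD('d) \<le> n"
  shows "prob_space (ball_measure n :: (complex ^ 'd::finite) measure)"
proof
  show "emeasure (ball_measure n :: (complex ^ 'd) measure) (space (ball_measure n)) = 1"
    using monomial_weight_ball_measure[OF n, of "\<lambda>_. 0" 0] by (simp add: monomial_weight_def)
qed

text \<open>Lebesgue measure is invariant and the density depends on |z| alone.\<close>

lemma distr_ball_measure_isometry:
  fixes U :: "complex ^ 'd::finite \<Rightarrow> complex ^ 'd"
  assumes lin: "linear U" and iso: "\<And>x. norm (U x) = norm x"
  shows "distr (ball_measure n) borel U = ball_measure n"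
proof (rule measure_eqI)
  have [measurable]: "U \<in> borel_measurable borel"
    by (intro borel_measurable_continuous_onI linear_continuous_on lin[unfolded linear_conv_bounded_linear])
  fix A assume "A \<in> sets (distr (ball_measure n) borel U)"
  then have [measurable]: "A \<in> sets borel" by simp
  have "emeasure (distr (ball_measure n) borel U) A = (\<integral>\<^sup>+z. indicator A (U z) \<partial>ball_measure n)"
    using nn_integral_distr[of U "ball_measure n" borel "indicator A"] by simp
  also have "\<dots> = (\<integral>\<^sup>+z. ennreal (ball_density n z) * indicator A (U z) \<partial>lborel)"
    by (rule nn_integral_ball_measure) measurable
  also have "\<dots> = (\<integral>\<^sup>+z. ennreal (ball_density n (U z)) * indicator A (U z) \<partial>lborel)"
    by (simp add: ball_density_def indicator_def iso)
  also have "\<dots> = (\<integral>\<^sup>+z. ennreal (ball_density n z) * indicator A z \<partial>distr lborel borel U)"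
    by (subst nn_integral_distr) auto
  also have "\<dots> = (\<integral>\<^sup>+z. indicator A z \<partial>ball_measure n)"
    unfolding lborel_distr_isometry[OF lin iso] by (rule nn_integral_ball_measure[symmetric]) measurable
  finally show "emeasure (distr (ball_measure n) borel U) A = emeasure (ball_measure n) A" by simp
qed simp

lemma coord_scale_borel_measurable [measurable]: "coord_scale s \<in> borel_measurable borel"
  by (intro borel_measurable_continuous_onI linear_continuous_on
      linear_coord_scale[unfolded linear_conv_bounded_linear])

lemma integral_ball_measure_coord_scale:
  fixes f :: "complex ^ 'd::finite \<Rightarrow> complex"
  assumes "f \<in> borel_measurable borel" "\<And>i. cmod (s i) = 1"
  shows "(LINT z|ball_measure n. f (coord_scale s z)) = (LINT z|ball_measure n. f z)"
proof -
  have "(LINT z|ball_measure n. f z) = (LINT z|distr (ball_measure n) borel (coord_scale s). f z)"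
    using assms by (simp add: distr_ball_measure_isometry linear_coord_scale norm_coord_scale_eq)
  also have "\<dots> = (LINT z|ball_measure n. f (coord_scale s z))"
    using assms by (subst integral_distr) auto
  finally show ?thesis ..
qed

section \<open>The L^2 pairing and its inequalities\<close>

definition square_integrable :: "nat \<Rightarrow> ('d::finite) cfun \<Rightarrow> bool" where
  "square_integrable n f \<longleftrightarrow> f \<in> borel_measurable borel \<and> integrable (ball_measure n) (\<lambda>z. (cmod (f z))\<^sup>2)"

lemma square_integrable_measurable [measurable_dest]:
  "square_integrable n f \<Longrightarrow> f \<in> borel_measurable borel"
  by (simp add: square_integrable_def)

lemma cnj_borel_measurable [measurable]: "cnj \<in> borel_measurable borel"
  by (intro borel_measurable_continuous_onI continuous_intros)

lemma integrable_inner: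
  assumes f: "square_integrable n f" and g: "square_integrable n g"
  shows "integrable (ball_measure n) (\<lambda>z. f z * cnj (g z))"
proof (rule Bochner_Integration.integrable_bound)
  show "integrable (ball_measure n) (\<lambda>z. (cmod (f z))\<^sup>2 + (cmod (g z))\<^sup>2)"
    using f g by (auto simp: square_integrable_def)
  show "(\<lambda>z. f z * cnj (g z)) \<in> borel_measurable (ball_measure n)"
    using square_integrable_measurable[OF f] square_integrable_measurable[OF g] by measurable
  have "a * b \<le> a\<^sup>2 + b\<^sup>2" if "0 \<le> a" "0 \<le> b" for a b :: real
    using sum_squares_bound[of a b] mult_nonneg_nonneg[OF that] by linarith
  then show "AE z in ball_measure n. norm (f z * cnj (g z)) \<le> norm ((cmod (f z))\<^sup>2 + (cmod (g z))\<^sup>2)"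
    by (simp add: norm_mult)
qed

lemma square_integrable_cmult:
  assumes "square_integrable n f"
  shows "square_integrable n (\<lambda>z. c * f z)"
  using assms by (auto simp: square_integrable_def norm_mult power_mult_distrib)

lemma square_integrable_add:
  assumes f: "square_integrable n f" and g: "square_integrable n g"
  shows "square_integrable n (\<lambda>z. f z + g z)"
  unfolding square_integrable_def
proof
  show m: "(\<lambda>z. f z + g z) \<in> borel_measurable borel"
    using square_integrable_measurable[OF f] square_integrable_measurable[OF g] by measurable
  show "integrable (ball_measure n) (\<lambda>z. (cmod (f z + g z))\<^sup>2)"
  proof (rule Bochner_Integration.integrable_bound)
    show "integrable (ball_measure n) (\<lambda>z. 2 * (cmod (f z))\<^sup>2 + 2 * (cmod (g z))\<^sup>2)"
      using f g by (auto simp: square_integrable_def)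
    show "(\<lambda>z. (cmod (f z + g z))\<^sup>2) \<in> borel_measurable (ball_measure n)" using m by measurable
    have "(cmod (a + b))\<^sup>2 \<le> 2 * (cmod a)\<^sup>2 + 2 * (cmod b)\<^sup>2" for a b
    proof -
      have "(cmod (a + b))\<^sup>2 \<le> (cmod a + cmod b)\<^sup>2"
        by (intro power_mono norm_triangle_ineq) simp
      also have "\<dots> \<le> 2 * (cmod a)\<^sup>2 + 2 * (cmod b)\<^sup>2"
        using sum_squares_bound[of "cmod a" "cmod b"] by (simp add: power2_sum)
      finally show ?thesis .
    qed
    then show "AE z in ball_measure n. norm ((cmod (f z + g z))\<^sup>2) \<le> norm (2 * (cmod (f z))\<^sup>2 + 2 * (cmod (g z))\<^sup>2)"
      by simp
  qed
qed

lemma square_integrable_diff: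
  "square_integrable n f \<Longrightarrow> square_integrable n g \<Longrightarrow> square_integrable n (\<lambda>z. f z - g z)"
  using square_integrable_add[of n f "\<lambda>z. -1 * g z"] square_integrable_cmult[of n g "-1"] by simp

lemma square_integrable_zero: "square_integrable n (\<lambda>_. 0)"
  by (simp add: square_integrable_def)

lemma square_integrable_sum:
  "(\<And>j. j \<in> A \<Longrightarrow> square_integrable n (g j)) \<Longrightarrow> square_integrable n (\<lambda>z. \<Sum>j\<in>A. c j * g j z)"
  by (induction A rule: infinite_finite_induct)
     (auto intro!: square_integrable_zero square_integrable_add square_integrable_cmult)

lemma square_integrable_mult_bounded:
  assumes f: "square_integrable n f" and [measurable]: "h \<in> borel_measurable borel"
    and h: "\<And>z. z \<in> ball 0 1 \<Longrightarrow> cmod (h z) \<le> B"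
  shows "square_integrable n (\<lambda>z. h z * f z)"
  unfolding square_integrable_def
proof
  show m: "(\<lambda>z. h z * f z) \<in> borel_measurable borel"
    using square_integrable_measurable[OF f] by measurable
  show "integrable (ball_measure n) (\<lambda>z. (cmod (h z * f z))\<^sup>2)"
  proof (rule Bochner_Integration.integrable_bound)
    show "integrable (ball_measure n) (\<lambda>z. B\<^sup>2 * (cmod (f z))\<^sup>2)"
      using f by (auto simp: square_integrable_def)
    show "(\<lambda>z. (cmod (h z * f z))\<^sup>2) \<in> borel_measurable (ball_measure n)" using m by measurable
    show "AE z in ball_measure n. norm ((cmod (h z * f z))\<^sup>2) \<le> norm (B\<^sup>2 * (cmod (f z))\<^sup>2)"
      using AE_ball_measure by eventually_elim (use h in \<open>auto simp: norm_mult power_mult_distrib intro!: mult_right_mono power_mono\<close>)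
  qed
qed

lemma bergman_inner_cnj: "bergman_inner n g f = cnj (bergman_inner n f g)"
  unfolding bergman_inner_def by (simp add: mult.commute flip: Bochner_Integration.integral_cnj)

lemma bergman_inner_add_left:
  assumes "square_integrable n f" "square_integrable n g" "square_integrable n h"
  shows "bergman_inner n (\<lambda>z. f z + g z) h = bergman_inner n f h + bergman_inner n g h"
  using assms by (simp add: bergman_inner_def algebra_simps integrable_inner)

lemma bergman_inner_diff_left:
  assumes "square_integrable n f" "square_integrable n g" "square_integrable n h"
  shows "bergman_inner n (\<lambda>z. f z - g z) h = bergman_inner n f h - bergman_inner n g h"
  using assms by (simp add: bergman_inner_def algebra_simps integrable_inner)

lemma bergman_inner_cmult_left: "bergman_inner n (\<lambda>z. c * f z) h = c * bergman_inner n f h"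
  by (simp add: bergman_inner_def mult.assoc)

lemma bergman_inner_add_right:
  assumes "square_integrable n f" "square_integrable n g" "square_integrable n h"
  shows "bergman_inner n h (\<lambda>z. f z + g z) = bergman_inner n h f + bergman_inner n h g"
  using bergman_inner_add_left[OF assms] by (simp add: bergman_inner_cnj[of n h])

lemma bergman_inner_diff_right:
  assumes "square_integrable n f" "square_integrable n g" "square_integrable n h"
  shows "bergman_inner n h (\<lambda>z. f z - g z) = bergman_inner n h f - bergman_inner n h g"
  using bergman_inner_diff_left[OF assms] by (simp add: bergman_inner_cnj[of n h])

lemma bergman_inner_cmult_right: "bergman_inner n h (\<lambda>z. c * f z) = cnj c * bergman_inner n h f"
  using bergman_inner_cmult_left[of n c f h] by (simp add: bergman_inner_cnj[of n h])

lemma bergman_inner_zero_left [simp]: "bergman_inner n (\<lambda>_. 0) h = 0"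
  and bergman_inner_zero_right [simp]: "bergman_inner n h (\<lambda>_. 0) = 0"
  by (simp_all add: bergman_inner_def)

lemma bergman_inner_sum_left:
  assumes "\<And>j. j \<in> A \<Longrightarrow> square_integrable n (g j)" "square_integrable n h"
  shows "bergman_inner n (\<lambda>z. \<Sum>j\<in>A. c j * g j z) h = (\<Sum>j\<in>A. c j * bergman_inner n (g j) h)"
  using assms(1)
proof (induction A rule: infinite_finite_induct)
  case (insert x A)
  then show ?case
    using assms(2) by (simp add: bergman_inner_add_left bergman_inner_cmult_left square_integrable_cmult square_integrable_sum)
qed simp_all

lemma bergman_norm_nonneg [simp]: "0 \<le> bergman_norm n f"
  by (simp add: bergman_norm_def)

lemma bergman_norm_square: "(bergman_norm n f)\<^sup>2 = (LINT z|ball_measure n. (cmod (f z))\<^sup>2)"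
  by (simp add: bergman_norm_def)

lemma bergman_inner_self: "bergman_inner n f f = of_real ((bergman_norm n f)\<^sup>2)"
  unfolding bergman_norm_square bergman_inner_def integral_complex_of_real[symmetric]
  by (simp flip: complex_norm_square)

lemma bergman_norm_zero [simp]: "bergman_norm n (\<lambda>_. 0) = 0"
  by (simp add: bergman_norm_def)

lemma bergman_norm_cmult: "bergman_norm n (\<lambda>z. c * f z) = cmod c * bergman_norm n f"
  by (simp add: bergman_norm_def norm_mult power_mult_distrib real_sqrt_mult)

text \<open>The one quadratic identity behind the Cauchy-Schwarz, triangle and Bessel
  inequalities.\<close>

lemma bergman_norm_square_diff_cmult:
  assumes f: "square_integrable n f" and g: "square_integrable n g"
  shows "(bergman_norm n (\<lambda>z. f z - c * g z))\<^sup>2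
    = (bergman_norm n f)\<^sup>2 - 2 * Re (cnj c * bergman_inner n f g) + (cmod c)\<^sup>2 * (bergman_norm n g)\<^sup>2"
proof -
  note cg = square_integrable_cmult[OF g, of c]
  have "complex_of_real ((bergman_norm n (\<lambda>z. f z - c * g z))\<^sup>2)
      = bergman_inner n (\<lambda>z. f z - c * g z) (\<lambda>z. f z - c * g z)"
    by (simp add: bergman_inner_self)
  also have "\<dots> = bergman_inner n f f - cnj c * bergman_inner n f g - (c * bergman_inner n g f - c * (cnj c * bergman_inner n g g))"
    using f cg square_integrable_diff[OF f cg]
    using g by (simp add: bergman_inner_diff_left bergman_inner_diff_right bergman_inner_cmult_left bergman_inner_cmult_right algebra_simps)
  finally have "(bergman_norm n (\<lambda>z. f z - c * g z))\<^sup>2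
      = Re (bergman_inner n f f - cnj c * bergman_inner n f g - (c * bergman_inner n g f - c * (cnj c * bergman_inner n g g)))"
    by (metis Re_complex_of_real)
  also have "\<dots> = (bergman_norm n f)\<^sup>2 - Re (cnj c * bergman_inner n f g) - Re (cnj (cnj c * bergman_inner n f g)) + Re (c * cnj c * of_real ((bergman_norm n g)\<^sup>2))"
    unfolding bergman_inner_self bergman_inner_cnj[of n g f] by (simp add: mult_ac del: of_real_power)
  also have "c * cnj c = of_real ((cmod c)\<^sup>2)"
    by (simp flip: complex_norm_square)
  finally show ?thesis by simp
qed

lemma bergman_Cauchy_Schwarz:
  assumes f: "square_integrable n f" and g: "square_integrable n g"
  shows "cmod (bergman_inner n f g) \<le> bergman_norm n f * bergman_norm n g"
proof (cases "bergman_norm n g = 0")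
  case True
  \<comment> \<open>Elements here are functions rather than classes: norm zero makes g vanish only
    almost everywhere, which suffices under the integral.\<close>
  then have "(LINT z|ball_measure n. (cmod (g z))\<^sup>2) = 0"
    using bergman_norm_square[of n g] by simp
  then have "AE z in ball_measure n. (cmod (g z))\<^sup>2 = 0"
    using g by (subst (asm) integral_nonneg_eq_0_iff_AE) (auto simp: square_integrable_def)
  then have "AE z in ball_measure n. f z * cnj (g z) = 0"
    by eventually_elim simp
  then have "bergman_inner n f g = 0"
    unfolding bergman_inner_def by (rule integral_eq_zero_AE)
  then show ?thesis by simp
next
  case False
  define b where "b = (bergman_norm n g)\<^sup>2"
  have b: "b > 0" using False by (simp add: b_def)
  \<comment> \<open>The coefficient x / b, with b the squared norm of g, minimizes the distance from
    f to the multiples of g.\<close>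
  define x where "x = bergman_inner n f g"
  have "0 \<le> (bergman_norm n f)\<^sup>2 - 2 * Re (cnj (x / of_real b) * x) + (cmod (x / of_real b))\<^sup>2 * b"
    using bergman_norm_square_diff_cmult[OF f g, of "x / of_real b"] by (metis zero_le_power2 x_def b_def)
  also have "cnj (x / of_real b) * x = of_real ((cmod x)\<^sup>2 / b)"
    by (simp add: mult.commute[of "cnj x"] flip: complex_norm_square)
  also have "(cmod (x / of_real b))\<^sup>2 * b = (cmod x)\<^sup>2 / b"
    using b by (simp add: norm_divide power_divide power2_eq_square)
  finally have "(cmod x)\<^sup>2 \<le> (bergman_norm n f)\<^sup>2 * b"
    using b by (simp add: field_simps)
  also have "\<dots> = (bergman_norm n f * bergman_norm n g)\<^sup>2"
    by (simp add: b_def power_mult_distrib)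
  finally show ?thesis
    unfolding x_def by (rule power2_le_imp_le) simp
qed

lemma bergman_norm_triangle_diff:
  assumes f: "square_integrable n f" and g: "square_integrable n g"
  shows "bergman_norm n (\<lambda>z. f z - g z) \<le> bergman_norm n f + bergman_norm n g"
proof -
  have "(bergman_norm n (\<lambda>z. f z - g z))\<^sup>2 = (bergman_norm n f)\<^sup>2 - 2 * Re (bergman_inner n f g) + (bergman_norm n g)\<^sup>2"
    using bergman_norm_square_diff_cmult[OF f g, of 1] by simp
  also have "\<dots> \<le> (bergman_norm n f + bergman_norm n g)\<^sup>2"
    using bergman_Cauchy_Schwarz[OF f g] abs_Re_le_cmod[of "bergman_inner n f g"] by (simp add: power2_sum)
  finally show ?thesis by (rule power2_le_imp_le) simp
qed

lemma bergman_norm_triangle: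
  assumes f: "square_integrable n f" and g: "square_integrable n g"
  shows "bergman_norm n (\<lambda>z. f z + g z) \<le> bergman_norm n f + bergman_norm n g"
  using bergman_norm_triangle_diff[OF f square_integrable_cmult[OF g, of "-1"]] bergman_norm_cmult[of n "-1" g] by simp

lemma analytic_borel_measurable:
  fixes f :: "('d::finite) cfun"
  assumes "analytic_on_ball f" "\<And>z. z \<notin> ball 0 1 \<Longrightarrow> f z = 0"
  shows "f \<in> borel_measurable borel"
proof -
  have "(\<lambda>z. if z \<in> ball 0 1 then f z else 0) \<in> borel_measurable borel"
    by (intro borel_measurable_continuous_on_if analytic_on_ball_continuous_on[OF assms(1)] continuous_on_const) simp_all
  moreover have "(\<lambda>z. if z \<in> ball 0 1 then f z else 0) = f" using assms(2) by auto
  ultimately show ?thesis by simp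
qed

lemma bergman_square_integrable: "f \<in> bergman n \<Longrightarrow> square_integrable n f"
  by (auto simp: bergman_def square_integrable_def intro!: analytic_borel_measurable)

lemma bergmanI:
  "analytic_on_ball f \<Longrightarrow> (\<And>z. z \<notin> ball 0 1 \<Longrightarrow> f z = 0) \<Longrightarrow> square_integrable n f \<Longrightarrow> f \<in> bergman n"
  by (simp add: bergman_def square_integrable_def)

lemma bergman_linear:
  assumes "f \<in> bergman n" "g \<in> bergman n"
  shows "(\<lambda>z. c * f z + d * g z) \<in> bergman n"
  using assms bergman_square_integrable[OF assms(1)] bergman_square_integrable[OF assms(2)]
  by (intro bergmanI analytic_on_ball_uminus_add square_integrable_add square_integrable_cmult) (auto simp: bergman_def)

lemma bergman_zero: "(\<lambda>_. 0) \<in> bergman n"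
  by (auto simp: bergman_def analytic_on_ball_def intro!: exI[of _ "\<lambda>_. 0"])

lemma bergman_cmult: "f \<in> bergman n \<Longrightarrow> (\<lambda>z. c * f z) \<in> bergman n"
  using bergman_linear[of f n f c 0] by simp

lemma bergman_add: "f \<in> bergman n \<Longrightarrow> g \<in> bergman n \<Longrightarrow> (\<lambda>z. f z + g z) \<in> bergman n"
  using bergman_linear[of f n g 1 1] by simp

lemma bergman_diff: "f \<in> bergman n \<Longrightarrow> g \<in> bergman n \<Longrightarrow> (\<lambda>z. f z - g z) \<in> bergman n"
  using bergman_linear[of f n g 1 "-1"] by simp

lemma bergman_sum: "(\<And>j. j \<in> A \<Longrightarrow> g j \<in> bergman n) \<Longrightarrow> (\<lambda>z. \<Sum>j\<in>A. c j * g j z) \<in> bergman n"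
  by (induction A rule: infinite_finite_induct)
     (auto intro!: bergman_zero bergman_add bergman_cmult)

section \<open>Monomials: analyticity, norms and orthogonality\<close>

lemma analytic_on_ball_mult:
  assumes "analytic_on_ball f" "analytic_on_ball g"
  shows "analytic_on_ball (\<lambda>z. f z * g z)"
  unfolding analytic_on_ball_def
proof
  fix z :: "complex ^ 'a" assume z: "z \<in> ball 0 1"
  obtain f' where f': "(f has_derivative f') (at z)" "\<And>c v. f' (c *s v) = c * f' v"
    using assms(1) z unfolding analytic_on_ball_def by blast
  obtain g' where g': "(g has_derivative g') (at z)" "\<And>c v. g' (c *s v) = c * g' v"
    using assms(2) z unfolding analytic_on_ball_def by blast
  have "((\<lambda>z. f z * g z) has_derivative (\<lambda>v. f z * g' v + f' v * g z)) (at z)"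
    by (rule has_derivative_mult[OF f'(1) g'(1)])
  moreover have "f z * g' (c *s v) + f' (c *s v) * g z = c * (f z * g' v + f' v * g z)" for c v
    unfolding f'(2) g'(2) by (simp add: algebra_simps)
  ultimately show "\<exists>f'. ((\<lambda>z. f z * g z) has_derivative f') (at z) \<and> (\<forall>c v. f' (c *s v) = c * f' v)"
    by blast
qed

lemma analytic_on_ball_const: "analytic_on_ball (\<lambda>_. c)"
  by (auto simp: analytic_on_ball_def intro!: exI[of _ "\<lambda>_. 0"])

lemma analytic_on_ball_nth: "analytic_on_ball (\<lambda>z. z $ i)"
  by (auto simp: analytic_on_ball_def intro!: exI[of _ "\<lambda>v. v $ i"]
      bounded_linear_imp_has_derivative bounded_linear_vec_nth)

lemma analytic_on_ball_power: "analytic_on_ball f \<Longrightarrow> analytic_on_ball (\<lambda>z. f z ^ m)"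
  by (induction m) (auto intro: analytic_on_ball_const analytic_on_ball_mult)

lemma analytic_on_ball_prod: "(\<And>i. i \<in> A \<Longrightarrow> analytic_on_ball (f i)) \<Longrightarrow> analytic_on_ball (\<lambda>z. \<Prod>i\<in>A. f i z)"
  by (induction A rule: infinite_finite_induct) (auto intro: analytic_on_ball_const analytic_on_ball_mult)

lemma analytic_on_ball_cong:
  assumes "analytic_on_ball f" "\<And>z. z \<in> ball 0 1 \<Longrightarrow> f z = g z"
  shows "analytic_on_ball g"
  unfolding analytic_on_ball_def
proof
  fix z :: "complex ^ 'a" assume z: "z \<in> ball 0 1"
  obtain f' where f': "(f has_derivative f') (at z)" "\<And>c v. f' (c *s v) = c * f' v"
    using assms(1) z unfolding analytic_on_ball_def by blast
  have "(g has_derivative f') (at z)"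
    by (rule has_derivative_transform_within_open[OF f'(1) open_ball z]) (rule assms(2))
  with f'(2) show "\<exists>f'. (g has_derivative f') (at z) \<and> (\<forall>c v. f' (c *s v) = c * f' v)"
    by blast
qed

lemma cmod_nth_le: "z \<in> ball 0 1 \<Longrightarrow> cmod ((z :: complex ^ 'd::finite) $ i) \<le> 1"
  using Finite_Cartesian_Product.norm_nth_le[of z i] by simp

definition monomial_coeff :: "nat \<Rightarrow> ('d::finite \<Rightarrow> nat) \<Rightarrow> real" where
  "monomial_coeff n k = sqrt (fact ((\<Sum>i\<in>UNIV. k i) + n) / ((\<Prod>i\<in>UNIV. fact (k i)) * fact n))"

lemma monomial_coeff_pos: "monomial_coeff n k > 0"
  by (auto simp: monomial_coeff_def intro!: divide_pos_pos mult_pos_pos prod_pos)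

lemma monomial_basis_in: "z \<in> ball 0 1 \<Longrightarrow> monomial_basis n k z = of_real (monomial_coeff n k) * (\<Prod>i\<in>UNIV. (z $ i) ^ k i)"
  and monomial_basis_out: "z \<notin> ball 0 1 \<Longrightarrow> monomial_basis n k z = 0"
  by (simp_all add: monomial_basis_def monomial_coeff_def)

lemma analytic_on_ball_monomial_basis: "analytic_on_ball (monomial_basis n k)"
  by (rule analytic_on_ball_cong[of "\<lambda>z. of_real (monomial_coeff n k) * (\<Prod>i\<in>UNIV. (z $ i) ^ k i)"])
     (auto simp: monomial_basis_in simp del: mem_ball_0 mem_ball
       intro!: analytic_on_ball_mult analytic_on_ball_const analytic_on_ball_prod analytic_on_ball_power analytic_on_ball_nth)

lemma cmod_monomial_basis_le: "cmod (monomial_basis n k z) \<le> monomial_coeff n k"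
proof (cases "z \<in> ball 0 1")
  case True
  have "cmod (\<Prod>i\<in>UNIV. (z $ i) ^ k i) \<le> 1"
    unfolding prod_norm[symmetric] norm_power
    by (intro prod_le_1) (auto intro!: power_le_one cmod_nth_le[OF True])
  then show ?thesis
    using monomial_coeff_pos[of n k] by (simp add: monomial_basis_in[OF True] norm_mult mult_left_le)
next
  case False
  then show ?thesis using monomial_coeff_pos[of n k] by (simp add: monomial_basis_out)
qed

lemma monomial_basis_measurable [measurable]: "monomial_basis n k \<in> borel_measurable borel"
  by (rule analytic_borel_measurable[OF analytic_on_ball_monomial_basis]) (rule monomial_basis_out)

lemma integrable_bounded_ball_measure:
  fixes f :: "complex ^ 'd::finite \<Rightarrow> 'b::{banach, second_countable_topology}"
  assumes n: "CARD('d) \<le> n" and "f \<in> borel_measurable borel"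
    and "\<And>z. z \<in> ball 0 1 \<Longrightarrow> norm (f z) \<le> B"
  shows "integrable (ball_measure n) f"
proof -
  interpret prob_space "ball_measure n :: (complex ^ 'd) measure" by (rule prob_space_ball_measure[OF n])
  show ?thesis
  proof (rule integrable_const_bound[where B=B])
    show "AE z in ball_measure n. norm (f z) \<le> B"
      using AE_ball_measure by eventually_elim (rule assms(3))
  qed (use assms(2) in simp)
qed

lemma square_integrable_bounded:
  fixes f :: "('d::finite) cfun"
  assumes n: "CARD('d) \<le> n" and f: "f \<in> borel_measurable borel"
    and B: "\<And>z. z \<in> ball 0 1 \<Longrightarrow> cmod (f z) \<le> B"
  shows "square_integrable n f"
  unfolding square_integrable_def
  by (intro conjI f integrable_bounded_ball_measure[OF n, where B="B\<^sup>2"])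
     (use f B in \<open>auto intro!: power_mono\<close>)

lemma monomial_basis_bergman:
  fixes k :: "'d::finite \<Rightarrow> nat"
  assumes "CARD('d) \<le> n"
  shows "monomial_basis n k \<in> bergman n"
  by (intro bergmanI analytic_on_ball_monomial_basis monomial_basis_out square_integrable_bounded[OF assms])
     (auto intro: cmod_monomial_basis_le)

lemma cmod_monomial_square: "(cmod (\<Prod>i\<in>UNIV. (z $ i) ^ k i))\<^sup>2 = monomial_weight k (z :: complex ^ 'd::finite)"
  by (simp add: monomial_weight_def norm_power prod_power_distrib power_mult[symmetric] mult.commute flip: prod_norm)

lemma monomial_weighted_integral:
  fixes k :: "'d::finite \<Rightarrow> nat"
  assumes n: "CARD('d) \<le> n"
  shows "(LINT z|ball_measure n. (1 - (norm z)\<^sup>2) ^ j * (cmod (monomial_basis n k z))\<^sup>2)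
     = fact (n - CARD('d) + j) / fact (n - CARD('d)) * (fact ((\<Sum>i\<in>UNIV. k i) + n) / fact ((\<Sum>i\<in>UNIV. k i) + n + j))"
proof -
  let ?c = "monomial_coeff n k"
  have "(LINT z|ball_measure n. (1 - (norm z)\<^sup>2) ^ j * (cmod (monomial_basis n k z))\<^sup>2)
      = (LINT z|(ball_measure n :: (complex ^ 'd) measure). ?c\<^sup>2 * (monomial_weight k z * (1 - (norm z)\<^sup>2) ^ j))"
  proof (rule Bochner_Integration.integral_cong_AE)
    show "AE z in ball_measure n. (1 - (norm z)\<^sup>2) ^ j * (cmod (monomial_basis n k z))\<^sup>2
        = ?c\<^sup>2 * (monomial_weight k z * (1 - (norm z)\<^sup>2) ^ j)"
      using AE_ball_measure
      by eventually_elim (simp add: monomial_basis_in norm_mult power_mult_distrib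
          cmod_monomial_square abs_of_pos[OF monomial_coeff_pos] del: mem_ball mem_ball_0)
  qed measurable
  also have "\<dots> = ?c\<^sup>2 * (LINT z|(ball_measure n :: (complex ^ 'd) measure). monomial_weight k z * (1 - (norm z)\<^sup>2) ^ j)"
    by simp
  also have "(LINT z|(ball_measure n :: (complex ^ 'd) measure). monomial_weight k z * (1 - (norm z)\<^sup>2) ^ j)
      = enn2real (\<integral>\<^sup>+z. ennreal (monomial_weight k z * (1 - (norm z)\<^sup>2) ^ j) \<partial>(ball_measure n :: (complex ^ 'd) measure))"
  proof (rule integral_eq_nn_integral)
    show "AE z in (ball_measure n :: (complex ^ 'd) measure). 0 \<le> monomial_weight k z * (1 - (norm z)\<^sup>2) ^ j"
      using AE_ball_measure by eventually_elim (simp add: power_le_one)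
  qed measurable
  also have "\<dots> = fact n / fact (n - CARD('d)) * (\<Prod>i\<in>UNIV. fact (k i)) * fact (n - CARD('d) + j) / fact ((\<Sum>i\<in>UNIV. k i) + n + j)"
    unfolding monomial_weight_ball_measure[OF n]
    by (intro enn2real_ennreal divide_nonneg_nonneg mult_nonneg_nonneg prod_nonneg) auto
  also have "?c\<^sup>2 = fact ((\<Sum>i\<in>UNIV. k i) + n) / ((\<Prod>i\<in>UNIV. fact (k i)) * fact n)"
    unfolding monomial_coeff_def
    by (intro real_sqrt_pow2 divide_nonneg_nonneg mult_nonneg_nonneg prod_nonneg) auto
  finally show ?thesis by (simp add: field_simps)
qed

lemma bergman_norm_monomial_basis:
  fixes k :: "'d::finite \<Rightarrow> nat"
  assumes n: "CARD('d) \<le> n"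
  shows "bergman_norm n (monomial_basis n k) = 1"
  using monomial_weighted_integral[OF n, of 0 k] by (simp add: bergman_norm_def)

lemma monomial_basis_coord_scale1:
  assumes "cmod s = 1"
  shows "monomial_basis n k (coord_scale1 i s z) = s ^ k i * monomial_basis n k z"
proof -
  have nrm: "norm (coord_scale1 i s z) = norm z"
    using assms by (intro norm_coord_scale_eq) auto
  have "(\<Prod>j\<in>UNIV. (coord_scale1 i s z $ j) ^ k j) = (\<Prod>j\<in>UNIV. (if j = i then s ^ k j else 1) * (z $ j) ^ k j)"
    by (intro prod.cong) (auto simp: power_mult_distrib)
  also have "\<dots> = s ^ k i * (\<Prod>j\<in>UNIV. (z $ j) ^ k j)"
    by (subst prod.distrib) simp
  finally show ?thesis
    by (simp add: monomial_basis_def nrm)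
qed

lemma cnj_unity_root: "cnj (unity_root N j) = 1 / unity_root N j"
  using complex_norm_square[of "unity_root N j"] by (simp add: field_simps)

text \<open>Rotating a coordinate in which k and l differ multiplies the pairing by a nontrivial
  character, and averaging over N-th roots of unity, N above both exponents, annihilates it. The
  invariant weight h covers radial symbols, whose Toeplitz operators are therefore diagonal.\<close>

lemma monomial_basis_orthogonal_weighted:
  fixes h :: "('d::finite) cfun"
  assumes [measurable]: "h \<in> borel_measurable borel"
    and inv: "\<And>i s z. cmod s = 1 \<Longrightarrow> h (coord_scale1 i s z) = h z" and "k \<noteq> l"
  shows "bergman_inner n (\<lambda>z. h z * monomial_basis n k z) (monomial_basis n l) = 0"
proof -
  obtain i where i: "k i \<noteq> l i" using \<open>k \<noteq> l\<close> by auto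
  define N where "N = Suc (max (k i) (l i))"
  let ?x = "bergman_inner n (\<lambda>z. h z * monomial_basis n k z) (monomial_basis n l)"
  let ?u = "unity_root N"
  have "?x = ?u j ^ k i / ?u j ^ l i * ?x" for j
  proof -
    have "?x = (LINT z|ball_measure n. h (coord_scale1 i (?u j) z) * monomial_basis n k (coord_scale1 i (?u j) z) * cnj (monomial_basis n l (coord_scale1 i (?u j) z)))"
      unfolding bergman_inner_def
      by (rule integral_ball_measure_coord_scale[symmetric]) auto
    also have "\<dots> = (LINT z|ball_measure n. ?u j ^ k i / ?u j ^ l i * (h z * monomial_basis n k z * cnj (monomial_basis n l z)))"
      by (intro Bochner_Integration.integral_cong) (simp_all add: inv monomial_basis_coord_scale1 cnj_unity_root power_divide)
    also have "\<dots> = ?u j ^ k i / ?u j ^ l i * ?x"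
      unfolding bergman_inner_def by (rule integral_mult_right_zero)
    finally show ?thesis .
  qed
  then have "(\<Sum>j<N. ?x) = (\<Sum>j<N. ?u j ^ k i / ?u j ^ l i) * ?x"
    unfolding sum_distrib_right by (intro sum.cong) auto
  also have "(\<Sum>j<N. ?u j ^ k i / ?u j ^ l i) = 0"
    using i by (subst unity_root_orthogonal) (auto simp: N_def)
  finally have "of_nat N * ?x = 0" by simp
  then show ?thesis by (simp add: N_def del: of_nat_Suc)
qed

lemma bergman_inner_monomial_basis:
  fixes k l :: "'d::finite \<Rightarrow> nat"
  assumes n: "CARD('d) \<le> n"
  shows "bergman_inner n (monomial_basis n k) (monomial_basis n l) = (if k = l then 1 else 0)"
proof (cases "k = l")
  case True
  then show ?thesis by (simp add: bergman_inner_self bergman_norm_monomial_basis[OF n])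
next
  case False
  then show ?thesis using monomial_basis_orthogonal_weighted[of "\<lambda>_. 1" k l] by simp
qed

section \<open>Completeness of the monomials\<close>

definition ball_inner :: "nat \<Rightarrow> real \<Rightarrow> ('d::finite) cfun \<Rightarrow> ('d \<Rightarrow> nat) \<Rightarrow> complex" where
  "ball_inner n r f k = (LINT z|ball_measure n. (if z \<in> ball 0 r then f z else 0) * cnj (monomial_basis n k z))"

lemma analytic_restrict_measurable [measurable]:
  assumes "analytic_on_ball f" "r < 1"
  shows "(\<lambda>z. if z \<in> ball 0 r then f z else 0) \<in> borel_measurable borel"
proof -
  have "ball 0 r \<subseteq> ball (0 :: complex ^ 'a) 1" using assms(2) by auto
  then have "continuous_on (ball 0 r) f"
    using analytic_on_ball_continuous_on[OF assms(1)] continuous_on_subset by blast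
  then show ?thesis
    by (intro borel_measurable_continuous_on_if continuous_on_const) simp_all
qed

text \<open>An analytic function is bounded on every ball of radius r < 1, so this truncated pairing
  makes sense without square integrability on the whole ball. That matters for Taylor components,
  for which only analyticity has been established.\<close>

lemma ball_inner_integrable:
  fixes f :: "('d::finite) cfun"
  assumes n: "CARD('d) \<le> n" and f: "analytic_on_ball f" and r: "r < 1"
  shows "integrable (ball_measure n) (\<lambda>z. (if z \<in> ball 0 r then f z else 0) * cnj (monomial_basis n k z))"
proof -
  obtain M where M: "\<And>z. norm z \<le> r \<Longrightarrow> cmod (f z) \<le> M"
    using analytic_on_ball_bounded[OF f r] by blast
  have "cmod ((if z \<in> ball 0 r then f z else 0) * cnj (monomial_basis n k z)) \<le> \<bar>M\<bar> * monomial_coeff n k" for z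
    unfolding norm_mult complex_mod_cnj
    using M[of z] by (intro mult_mono cmod_monomial_basis_le) (auto intro: order_trans)
  moreover have "(\<lambda>z. (if z \<in> ball 0 r then f z else 0) * cnj (monomial_basis n k z)) \<in> borel_measurable borel"
    by (intro borel_measurable_times analytic_restrict_measurable[OF f r]) measurable
  ultimately show ?thesis
    by (intro integrable_bounded_ball_measure[OF n, where B="\<bar>M\<bar> * monomial_coeff n k"]) auto
qed

lemma ball_inner_rotate:
  fixes f :: "('d::finite) cfun"
  assumes f: "analytic_on_ball f" and r: "r < 1"
  shows "ball_inner n r (\<lambda>z. f (coord_scale1 i (unity_root N j) z)) k = unity_root N j ^ k i * ball_inner n r f k"
proof -
  let ?u = "unity_root N j"
  let ?F = "\<lambda>z. (if z \<in> ball 0 r then f z else 0) * cnj (monomial_basis n k z)"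
  have F: "?F \<in> borel_measurable borel"
    by (intro borel_measurable_times analytic_restrict_measurable[OF f r]) measurable
  have nrm: "norm (coord_scale1 i ?u z) = norm z" for z :: "complex ^ 'd"
    by (intro norm_coord_scale_eq) auto
  have "ball_inner n r f k = (LINT z|ball_measure n. ?F (coord_scale1 i ?u z))"
    unfolding ball_inner_def by (rule integral_ball_measure_coord_scale[OF F, symmetric]) simp
  also have "\<dots> = (LINT z|ball_measure n. (1 / ?u ^ k i) * ((if z \<in> ball 0 r then f (coord_scale1 i ?u z) else 0) * cnj (monomial_basis n k z)))"
    by (intro Bochner_Integration.integral_cong) (simp_all add: nrm monomial_basis_coord_scale1 cnj_unity_root power_divide)
  also have "\<dots> = (1 / ?u ^ k i) * ball_inner n r (\<lambda>z. f (coord_scale1 i ?u z)) k"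
    unfolding ball_inner_def by (rule integral_mult_right_zero)
  finally show ?thesis by (simp add: field_simps)
qed

text \<open>Each average has the same pairing with the k-th monomial as f, because every rotated
  copy of f contributes exactly the factor that the average divides out. Dominated convergence
  transfers this to the limit.\<close>

lemma ball_inner_taylor_part:
  fixes f :: "('d::finite) cfun"
  assumes n: "CARD('d) \<le> n" and f: "analytic_on_ball f" and r: "r < 1"
  shows "ball_inner n r (taylor_part i (k i) f) k = ball_inner n r f k"
proof -
  \<comment> \<open>\<open>Suc N\<close> excludes the empty average, whose value would be 0.\<close>
  let ?A = "\<lambda>N z. unity_average (Suc N) (k i) (\<lambda>t. f (coord_scale1 i t z))"
  obtain M where M: "\<And>z. norm z \<le> r \<Longrightarrow> cmod (f z) \<le> M"
    using analytic_on_ball_bounded[OF f r] by blast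
  have const: "ball_inner n r (?A N) k = ball_inner n r f k" for N
  proof -
    let ?u = "unity_root (Suc N)"
    have an: "analytic_on_ball (\<lambda>z. f (coord_scale1 i (?u j) z))" for j
      by (intro analytic_on_ball_coord_scale f) auto
    have "ball_inner n r (?A N) k = (LINT z|ball_measure n. (\<Sum>j<Suc N. (1 / ?u j ^ k i / of_nat (Suc N)) *
        ((if z \<in> ball 0 r then f (coord_scale1 i (?u j) z) else 0) * cnj (monomial_basis n k z))))"
      unfolding ball_inner_def
      by (intro Bochner_Integration.integral_cong) (simp_all add: unity_average_def sum_divide_distrib sum_distrib_right sum_distrib_left del: sum.lessThan_Suc)
    also have "\<dots> = (\<Sum>j<Suc N. (1 / ?u j ^ k i / of_nat (Suc N)) * ball_inner n r (\<lambda>z. f (coord_scale1 i (?u j) z)) k)"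
      unfolding ball_inner_def
      by (subst Bochner_Integration.integral_sum)
         (intro integrable_mult_right ball_inner_integrable[OF n an r], simp only: integral_mult_right_zero)
    also have "\<dots> = (\<Sum>j<Suc N. ball_inner n r f k / of_nat (Suc N))"
      by (intro sum.cong refl) (simp add: ball_inner_rotate[OF f r])
    also have "\<dots> = ball_inner n r f k" by (simp del: sum.lessThan_Suc of_nat_Suc)
    finally show ?thesis .
  qed
  have "(\<lambda>N. ball_inner n r (?A N) k) \<longlonglongrightarrow> ball_inner n r (taylor_part i (k i) f) k"
    unfolding ball_inner_def
  proof (rule integral_dominated_convergence[where w="\<lambda>_. \<bar>M\<bar> * monomial_coeff n k"])
    show "integrable (ball_measure n :: (complex ^ 'd) measure) (\<lambda>_. \<bar>M\<bar> * monomial_coeff n k)"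
      by (rule integrable_bounded_ball_measure[OF n]) auto
    show "(\<lambda>z. (if z \<in> ball 0 r then taylor_part i (k i) f z else 0) * cnj (monomial_basis n k z)) \<in> borel_measurable (ball_measure n)"
      using analytic_restrict_measurable[OF analytic_on_ball_taylor_part[OF f] r] by measurable
    show "(\<lambda>z. (if z \<in> ball 0 r then ?A N z else 0) * cnj (monomial_basis n k z)) \<in> borel_measurable (ball_measure n)" for N
      using analytic_restrict_measurable[OF analytic_on_ball_unity_average[OF f] r] by measurable
    show "AE z in ball_measure n. (\<lambda>N. (if z \<in> ball 0 r then ?A N z else 0) * cnj (monomial_basis n k z))
        \<longlonglongrightarrow> (if z \<in> ball 0 r then taylor_part i (k i) f z else 0) * cnj (monomial_basis n k z)"
    proof (rule AE_I2)
      fix z :: "complex ^ 'd"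
      show "(\<lambda>N. (if z \<in> ball 0 r then ?A N z else 0) * cnj (monomial_basis n k z))
        \<longlonglongrightarrow> (if z \<in> ball 0 r then taylor_part i (k i) f z else 0) * cnj (monomial_basis n k z)"
      proof (cases "z \<in> ball 0 r")
        case True
        then have "z \<in> ball 0 1" using r by auto
        from LIMSEQ_Suc[OF taylor_part_limit[OF f this, of "k i" i]] True show ?thesis
          by (auto intro!: tendsto_intros)
      qed simp
    qed
    show "AE z in ball_measure n. norm ((if z \<in> ball 0 r then ?A N z else 0) * cnj (monomial_basis n k z)) \<le> \<bar>M\<bar> * monomial_coeff n k" for N
    proof (rule AE_I2)
      fix z :: "complex ^ 'd"
      have "cmod (?A N z) \<le> \<bar>M\<bar>" if "z \<in> ball 0 r"
      proof (rule cmod_unity_average_le)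
        fix j
        have "coord_scale1 i (unity_root (Suc N) j) z \<in> ball 0 r"
          using that by (intro coord_scale1_in_ball) auto
        then show "cmod (f (coord_scale1 i (unity_root (Suc N) j) z)) \<le> \<bar>M\<bar>"
          using M[of "coord_scale1 i (unity_root (Suc N) j) z"] by simp
      qed simp
      then show "norm ((if z \<in> ball 0 r then ?A N z else 0) * cnj (monomial_basis n k z)) \<le> \<bar>M\<bar> * monomial_coeff n k"
        unfolding norm_mult complex_mod_cnj by (intro mult_mono cmod_monomial_basis_le) auto
    qed
  qed
  then show ?thesis
    unfolding const by (simp add: LIMSEQ_const_iff)
qed

lemma ball_inner_tendsto:
  fixes f :: "('d::finite) cfun"
  assumes n: "CARD('d) \<le> n" and f: "square_integrable n f"
  shows "(\<lambda>N. ball_inner n (1 - 1 / real (Suc N)) f k) \<longlonglongrightarrow> bergman_inner n f (monomial_basis n k)"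
  unfolding ball_inner_def bergman_inner_def
proof (rule integral_dominated_convergence[where w="\<lambda>z. cmod (f z * cnj (monomial_basis n k z))"])
  note f_meas [measurable] = square_integrable_measurable[OF f]
  show "integrable (ball_measure n) (\<lambda>z. cmod (f z * cnj (monomial_basis n k z)))"
    by (intro integrable_norm integrable_inner f bergman_square_integrable monomial_basis_bergman n)
  show "(\<lambda>z. f z * cnj (monomial_basis n k z)) \<in> borel_measurable (ball_measure n)" by measurable
  show "(\<lambda>z. (if z \<in> ball 0 (1 - 1 / real (Suc N)) then f z else 0) * cnj (monomial_basis n k z)) \<in> borel_measurable (ball_measure n)" for N
    by measurable
  show "AE z in ball_measure n. (\<lambda>N. (if z \<in> ball 0 (1 - 1 / real (Suc N)) then f z else 0) * cnj (monomial_basis n k z))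
      \<longlonglongrightarrow> f z * cnj (monomial_basis n k z)"
    using AE_ball_measure
  proof eventually_elim
    case (elim z)
    have "(\<lambda>N. 1 - 1 / real (Suc N)) \<longlonglongrightarrow> 1 - 0"
      by (intro tendsto_intros LIMSEQ_Suc lim_1_over_n)
    then have "\<forall>\<^sub>F N in sequentially. norm z < 1 - 1 / real (Suc N)"
      using elim by (intro order_tendstoD) auto
    then have "\<forall>\<^sub>F N in sequentially. (if z \<in> ball 0 (1 - 1 / real (Suc N)) then f z else 0) * cnj (monomial_basis n k z) = f z * cnj (monomial_basis n k z)"
      by eventually_elim simp
    then show ?case by (rule tendsto_eventually)
  qed
qed (auto simp: norm_mult)

text \<open>Coordinates are treated one at a time. The components in a coordinate sum to the
  function, so some component of exponent m does not vanish, and passing to it changes no pairing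
  with a monomial of exponent m in that coordinate.\<close>

lemma exists_separately_homogeneous_part:
  fixes f :: "('d::finite) cfun"
  assumes n: "CARD('d) \<le> n" and f: "analytic_on_ball f" and z0: "z0 \<in> ball 0 1" "f z0 \<noteq> 0"
  shows "\<exists>k g. analytic_on_ball g \<and> (\<exists>z\<in>ball 0 1. g z \<noteq> 0) \<and> separately_homogeneous J k g \<and>
    (\<forall>l. (\<forall>i\<in>J. l i = k i) \<longrightarrow> (\<forall>r<1. ball_inner n r g l = ball_inner n r f l))"
proof (induction J rule: finite_induct[OF finite])
  case 1
  show ?case using f z0 by (intro exI[of _ "\<lambda>_. 0"] exI[of _ f]) (auto simp: separately_homogeneous_def)
next
  case (2 i J)
  then obtain k g z where g: "analytic_on_ball g" and z: "z \<in> ball 0 1" "g z \<noteq> 0"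
      and hom: "separately_homogeneous J k g"
      and inn: "\<And>l r. \<lbrakk>\<forall>i\<in>J. l i = k i; r < 1\<rbrakk> \<Longrightarrow> ball_inner n r g l = ball_inner n r f l"
    by blast
  have "\<exists>m. taylor_part i m g z \<noteq> 0"
  proof (rule ccontr)
    assume "\<nexists>m. taylor_part i m g z \<noteq> 0"
    then have "(\<lambda>m. 0) sums g z" using taylor_part_sums[OF g z(1), of i] by simp
    with z(2) show False using sums_0 sums_unique2 by blast
  qed
  then obtain m where m: "taylor_part i m g z \<noteq> 0" by blast
  let ?h = "taylor_part i m g" and ?k = "k(i := m)"
  have "separately_homogeneous (insert i J) ?k ?h"
    unfolding separately_homogeneous_def
  proof (intro ballI allI impI)
    fix j s and w :: "complex ^ 'd" assume j: "j \<in> insert i J" and s: "cmod s \<le> 1" and w: "w \<in> ball 0 1"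
    show "?h (coord_scale1 j s w) = s ^ ?k j * ?h w"
    proof (cases "j = i")
      case True
      then show ?thesis using taylor_part_homogeneous[OF g w s] by simp
    next
      case False
      then have "?h (coord_scale1 j s w) = s ^ k j * ?h w"
        using j hom s by (intro taylor_part_homogeneous_other[OF g w s]) (auto simp: separately_homogeneous_def)
      with False show ?thesis by simp
    qed
  qed
  moreover have "ball_inner n r ?h l = ball_inner n r f l" if l: "\<forall>j\<in>insert i J. l j = ?k j" and "r < 1" for l r
  proof -
    have "ball_inner n r ?h l = ball_inner n r g l"
      using ball_inner_taylor_part[OF n g \<open>r < 1\<close>, of i l] l by simp
    also have "\<dots> = ball_inner n r f l"
      using l \<open>i \<notin> J\<close> \<open>r < 1\<close> by (intro inn) auto
    finally show ?thesis .
  qed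
  ultimately show ?case
    using analytic_on_ball_taylor_part[OF g, of i m] m z(1) by (intro exI[of _ ?k] exI[of _ ?h]) blast
qed

text \<open>A nonzero f would have a nonzero separately homogeneous part, necessarily b times a
  basis monomial. Its truncated pairings with that monomial agree with those of f, and letting r
  tend to 1 gives b = 0.\<close>

lemma bergman_orthogonal_monomials_zero:
  fixes f :: "('d::finite) cfun"
  assumes n: "CARD('d) \<le> n" and f: "f \<in> bergman n"
    and orth: "\<And>k. bergman_inner n f (monomial_basis n k) = 0"
  shows "f = (\<lambda>_. 0)"
proof (rule ccontr)
  assume "f \<noteq> (\<lambda>_. 0)"
  then obtain z0 where z0: "f z0 \<noteq> 0" by auto
  then have "z0 \<in> ball 0 1" using f by (auto simp: bergman_def)
  have an: "analytic_on_ball f" using f by (simp add: bergman_def)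
  obtain k g z where "analytic_on_ball g" and z: "z \<in> ball 0 1" "g z \<noteq> 0"
      and hom: "separately_homogeneous UNIV k g"
      and inn: "\<And>l r. \<lbrakk>\<forall>i\<in>UNIV. l i = k i; r < 1\<rbrakk> \<Longrightarrow> ball_inner n r g l = ball_inner n r f l"
    using exists_separately_homogeneous_part[OF n an \<open>z0 \<in> ball 0 1\<close> z0, of UNIV] by blast
  obtain a where a: "\<And>z. z \<in> ball 0 1 \<Longrightarrow> g z = a * (\<Prod>i\<in>UNIV. (z $ i) ^ k i)"
    using separately_homogeneous_monomial[OF hom] by blast
  define b where "b = a / of_real (monomial_coeff n k)"
  have g: "g w = b * monomial_basis n k w" if "w \<in> ball 0 1" for w
    using that monomial_coeff_pos[of n k] by (simp add: a monomial_basis_in b_def)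
  have "b \<noteq> 0" using z g by auto
  have "ball_inner n r f k = ball_inner n r (\<lambda>z. b * monomial_basis n k z) k" if "r < 1" for r
  proof -
    have "ball_inner n r f k = ball_inner n r g k" using inn[of k r] that by simp
    also have "\<dots> = ball_inner n r (\<lambda>z. b * monomial_basis n k z) k"
      unfolding ball_inner_def using that
      by (intro Bochner_Integration.integral_cong) (auto simp: g)
    finally show ?thesis .
  qed
  then have eq: "ball_inner n (1 - 1 / real (Suc N)) f k = ball_inner n (1 - 1 / real (Suc N)) (\<lambda>z. b * monomial_basis n k z) k" for N
    by simp
  have "bergman_inner n f (monomial_basis n k) = bergman_inner n (\<lambda>z. b * monomial_basis n k z) (monomial_basis n k)"
  proof (rule LIMSEQ_unique)
    show "(\<lambda>N. ball_inner n (1 - 1 / real (Suc N)) f k) \<longlonglongrightarrow> bergman_inner n f (monomial_basis n k)"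
      by (rule ball_inner_tendsto[OF n bergman_square_integrable[OF f]])
    show "(\<lambda>N. ball_inner n (1 - 1 / real (Suc N)) f k) \<longlonglongrightarrow> bergman_inner n (\<lambda>z. b * monomial_basis n k z) (monomial_basis n k)"
      unfolding eq
      by (rule ball_inner_tendsto[OF n bergman_square_integrable[OF bergman_cmult[OF monomial_basis_bergman[OF n]]]])
  qed
  then have "b = 0"
    by (simp add: orth bergman_inner_cmult_left bergman_inner_monomial_basis[OF n])
  with \<open>b \<noteq> 0\<close> show False ..
qed

section \<open>Point evaluations and completeness of the Bergman space\<close>

lemma linear_vector_smult: "linear (\<lambda>v :: complex ^ 'd::finite. c *s v)"
  by (rule linearI) (auto simp: vec_eq_iff algebra_simps)

lemma vector_smult_measurable [measurable]: "(\<lambda>v :: complex ^ 'd::finite. c *s v) \<in> borel_measurable borel"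
  by (intro borel_measurable_continuous_onI linear_continuous_on
      linear_vector_smult[unfolded linear_conv_bounded_linear])

lemma cmod_unity_average_square_le:
  "(cmod (unity_average N m g))\<^sup>2 \<le> (\<Sum>j<N. (cmod (g (unity_root N j)))\<^sup>2) / real N"
proof (cases "N = 0")
  case False
  have "cmod (unity_average N m g) \<le> (\<Sum>j<N. cmod (g (unity_root N j))) / real N"
  proof -
    have "cmod (\<Sum>j<N. g (unity_root N j) / unity_root N j ^ m) \<le> (\<Sum>j<N. cmod (g (unity_root N j)))"
      by (rule order_trans[OF norm_sum]) (simp add: norm_divide norm_power)
    then show ?thesis
      by (simp add: unity_average_def norm_divide divide_right_mono)
  qed
  then have "(cmod (unity_average N m g))\<^sup>2 \<le> ((\<Sum>j<N. cmod (g (unity_root N j))) / real N)\<^sup>2"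
    by (intro power_mono) auto
  also have "\<dots> \<le> ((\<Sum>j<N. (cmod (g (unity_root N j)))\<^sup>2) * real N) / (real N)\<^sup>2"
    unfolding power_divide using sum_squared_le_sum_of_squares[of "\<lambda>j. cmod (g (unity_root N j))" "{..<N}"]
    by (intro divide_right_mono) auto
  also have "\<dots> = (\<Sum>j<N. (cmod (g (unity_root N j)))\<^sup>2) / real N"
    using False by (simp add: power2_eq_square)
  finally show ?thesis .
qed (simp add: unity_average_def)

text \<open>The mean value inequality; Fatou's lemma is applied to the averages of \<open>f (z + \<omega> v)\<close> over roots of unity \<open>\<omega>\<close>.\<close>

lemma analytic_mean_value_le:
  fixes f :: "('d::finite) cfun"
  assumes f: "analytic_on_ball f" and meas [measurable]: "f \<in> borel_measurable borel"
    and z: "norm z + 3 / 2 * \<delta> \<le> 1" and \<delta>: "0 < \<delta>"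
  shows "ennreal ((cmod (f z))\<^sup>2) * emeasure lborel (ball (0 :: complex ^ 'd) \<delta>)
    \<le> (\<integral>\<^sup>+w. ennreal ((cmod (f w))\<^sup>2) * indicator (ball z \<delta>) w \<partial>lborel)"
proof -
  let ?A = "\<lambda>N v. unity_average (Suc N) 0 (\<lambda>t. f (z + t *s v))"
  let ?K = "\<integral>\<^sup>+w. ennreal ((cmod (f w))\<^sup>2) * indicator (ball z \<delta>) w \<partial>lborel"
  have lim: "(\<lambda>N. ?A N v) \<longlonglongrightarrow> f z" if v: "v \<in> ball 0 \<delta>" for v
  proof -
    \<comment> \<open>The factor 3/2 in the hypothesis lets the slice reach past |t| = 1, where the
      roots of unity lie.\<close>
    have "z + t *s v \<in> ball 0 1" if "t \<in> ball 0 (3 / 2)" for t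
    proof -
      have "norm (z + t *s v) \<le> norm z + cmod t * norm v"
        using norm_triangle_ineq[of z "t *s v"] by (simp add: norm_vector_smult)
      also have "cmod t * norm v \<le> 3 / 2 * norm v"
        using that by (intro mult_right_mono) auto
      also have "\<dots> < 3 / 2 * \<delta>" using v by simp
      finally show ?thesis using z by simp
    qed
    then have "(\<lambda>t. f (z + t *s v)) holomorphic_on ball 0 (3 / 2)"
      by (intro holomorphic_on_subset[OF analytic_on_ball_slice(1)[OF f]]) blast
    from LIMSEQ_Suc[OF unity_average_tendsto[OF this, of 0]] show ?thesis by simp
  qed
  \<comment> \<open>Multiplication by a root of unity is an isometry, so every rotated copy has the
    same integral.\<close>
  have rot: "(\<integral>\<^sup>+v. ennreal ((cmod (f (z + unity_root N j *s v)))\<^sup>2) * indicator (ball 0 \<delta>) v \<partial>lborel) = ?K" for N j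
  proof -
    let ?u = "unity_root N j"
    have nrm: "norm (?u *s v) = norm v" for v :: "complex ^ 'd" by (simp add: norm_vector_smult)
    have "(\<integral>\<^sup>+v. ennreal ((cmod (f (z + ?u *s v)))\<^sup>2) * indicator (ball 0 \<delta>) v \<partial>lborel)
        = (\<integral>\<^sup>+v. ennreal ((cmod (f (z + ?u *s v)))\<^sup>2) * indicator (ball 0 \<delta>) (?u *s v) \<partial>lborel)"
      by (simp add: indicator_def nrm)
    also have "\<dots> = (\<integral>\<^sup>+v. ennreal ((cmod (f (z + v)))\<^sup>2) * indicator (ball 0 \<delta>) v \<partial>distr lborel borel (\<lambda>v. ?u *s v))"
      by (subst nn_integral_distr) auto
    also have "\<dots> = (\<integral>\<^sup>+v. ennreal ((cmod (f (z + v)))\<^sup>2) * indicator (ball 0 \<delta>) v \<partial>lborel)"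
      by (simp add: lborel_distr_isometry[OF linear_vector_smult nrm])
    also have "\<dots> = (\<integral>\<^sup>+v. (\<lambda>w. ennreal ((cmod (f w))\<^sup>2) * indicator (ball z \<delta>) w) (z + v) \<partial>lborel)"
      by (simp add: indicator_def dist_norm)
    also have "\<dots> = ?K"
      by (rule nn_integral_lborel_translate) measurable
    finally show ?thesis .
  qed
  have bound: "(\<integral>\<^sup>+v. ennreal ((cmod (?A N v))\<^sup>2) * indicator (ball 0 \<delta>) v \<partial>lborel) \<le> ?K" for N
  proof -
    have "(\<integral>\<^sup>+v. ennreal ((cmod (?A N v))\<^sup>2) * indicator (ball 0 \<delta>) v \<partial>lborel)
        \<le> (\<integral>\<^sup>+v. (\<Sum>j<Suc N. ennreal (1 / real (Suc N)) * (ennreal ((cmod (f (z + unity_root (Suc N) j *s v)))\<^sup>2) * indicator (ball 0 \<delta>) v)) \<partial>lborel)"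
    proof (rule nn_integral_mono)
      fix v :: "complex ^ 'd"
      have "ennreal ((cmod (?A N v))\<^sup>2) \<le> ennreal ((\<Sum>j<Suc N. (cmod (f (z + unity_root (Suc N) j *s v)))\<^sup>2) / real (Suc N))"
        by (intro ennreal_leI cmod_unity_average_square_le)
      also have "\<dots> = (\<Sum>j<Suc N. ennreal (1 / real (Suc N)) * ennreal ((cmod (f (z + unity_root (Suc N) j *s v)))\<^sup>2))"
        by (subst ennreal_mult[symmetric]) (simp_all add: sum_divide_distrib sum_ennreal del: sum.lessThan_Suc)
      finally show "ennreal ((cmod (?A N v))\<^sup>2) * indicator (ball 0 \<delta>) v
          \<le> (\<Sum>j<Suc N. ennreal (1 / real (Suc N)) * (ennreal ((cmod (f (z + unity_root (Suc N) j *s v)))\<^sup>2) * indicator (ball 0 \<delta>) v))"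
        by (simp add: indicator_def del: sum.lessThan_Suc)
    qed
    also have "\<dots> = (\<Sum>j<Suc N. ennreal (1 / real (Suc N)) * ?K)"
      by (subst nn_integral_sum, measurable, intro sum.cong refl, subst nn_integral_cmult, measurable) (simp only: rot)
    also have "\<dots> = ennreal (real (Suc N)) * ennreal (1 / real (Suc N)) * ?K"
      by (simp add: mult.assoc ennreal_of_nat_eq_real_of_nat del: sum.lessThan_Suc of_nat_Suc)
    also have "ennreal (real (Suc N)) * ennreal (1 / real (Suc N)) = 1"
      by (subst ennreal_mult[symmetric]) (simp_all del: of_nat_Suc)
    finally show ?thesis by simp
  qed
  have "ennreal ((cmod (f z))\<^sup>2) * emeasure lborel (ball (0 :: complex ^ 'd) \<delta>)
      = (\<integral>\<^sup>+v. ennreal ((cmod (f z))\<^sup>2) * indicator (ball (0 :: complex ^ 'd) \<delta>) v \<partial>lborel)"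
    by (simp add: nn_integral_cmult)
  also have "\<dots> = (\<integral>\<^sup>+v. liminf (\<lambda>N. ennreal ((cmod (?A N v))\<^sup>2) * indicator (ball 0 \<delta>) v) \<partial>lborel)"
  proof (intro nn_integral_cong)
    fix v :: "complex ^ 'd"
    show "ennreal ((cmod (f z))\<^sup>2) * indicator (ball 0 \<delta>) v = liminf (\<lambda>N. ennreal ((cmod (?A N v))\<^sup>2) * indicator (ball 0 \<delta>) v)"
    proof (cases "v \<in> ball 0 \<delta>")
      case True
      then have "(\<lambda>N. ennreal ((cmod (?A N v))\<^sup>2) * indicator (ball 0 \<delta>) v) \<longlonglongrightarrow> ennreal ((cmod (f z))\<^sup>2) * indicator (ball 0 \<delta>) v"
        using tendsto_ennrealI[OF tendsto_power[OF tendsto_norm[OF lim[OF True]], of 2]] by simp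
      then show ?thesis by (intro lim_imp_Liminf[symmetric]) simp_all
    qed (simp add: Liminf_const)
  qed
  also have "\<dots> \<le> liminf (\<lambda>N. \<integral>\<^sup>+v. ennreal ((cmod (?A N v))\<^sup>2) * indicator (ball 0 \<delta>) v \<partial>lborel)"
    by (rule nn_integral_liminf) (simp add: unity_average_def)
  also have "\<dots> \<le> liminf (\<lambda>N::nat. ?K)"
    by (intro Liminf_mono always_eventually allI bound)
  also have "\<dots> = ?K" by (simp add: Liminf_const)
  finally show ?thesis .
qed

lemma square_integrable_nn_integral:
  assumes "square_integrable n f"
  shows "(\<integral>\<^sup>+w. ennreal ((cmod (f w))\<^sup>2) \<partial>ball_measure n) = ennreal ((bergman_norm n f)\<^sup>2)"
  using assms unfolding bergman_norm_square square_integrable_def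
  by (intro nn_integral_eq_integral) auto

text \<open>On the ball of radius \<rho> + \<delta> < 1 the density of the measure is bounded below,
  so the Lebesgue mean value inequality becomes a locally uniform bound for point evaluations. It
  turns norm convergence into locally uniform convergence and norm zero into f = 0 at every
  point.\<close>

lemma bergman_evaluation_bound:
  fixes \<rho> :: real
  assumes \<rho>: "0 \<le> \<rho>" "\<rho> < 1"
  shows "\<exists>C\<ge>0. \<forall>f\<in>bergman n. \<forall>z :: complex ^ 'd::finite. norm z \<le> \<rho> \<longrightarrow> cmod (f z) \<le> C * bergman_norm n f"
proof -
  \<comment> \<open>Then \<rho> + (3/2) \<delta> = 1 - (1 - \<rho>) / 4, as the mean value
    inequality demands.\<close>
  define \<delta> where "\<delta> = (1 - \<rho>) / 2"
  have \<delta>: "0 < \<delta>" "\<rho> + \<delta> < 1" "\<rho> + 3 / 2 * \<delta> \<le> 1" using \<rho> by (auto simp: \<delta>_def field_simps)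
  define c where "c = fact n / (fact (n - CARD('d)) * pi ^ CARD('d)) * (1 - (\<rho> + \<delta>)\<^sup>2) ^ (n - CARD('d))"
  have c: "c > 0"
    unfolding c_def using \<rho> \<delta> by (intro mult_pos_pos divide_pos_pos zero_less_power) (auto simp: power_less_one_iff)
  define V where "V = measure lborel (ball (0 :: complex ^ 'd) \<delta>)"
  have V: "V > 0" using \<delta> by (simp add: V_def content_ball)
  have dens: "c \<le> ball_density n w" if "w \<in> ball z \<delta>" "norm z \<le> \<rho>" for z w :: "complex ^ 'd"
  proof -
    have "norm w \<le> \<rho> + \<delta>"
      using that norm_triangle_sub[of w z] by (simp add: dist_norm norm_minus_commute)
    then have "(norm w)\<^sup>2 \<le> (\<rho> + \<delta>)\<^sup>2" by (intro power_mono) auto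
    moreover have "(\<rho> + \<delta>)\<^sup>2 \<le> 1" using \<rho> \<delta> by (intro power_le_one) auto
    ultimately have "(1 - (\<rho> + \<delta>)\<^sup>2) ^ (n - CARD('d)) \<le> (1 - (norm w)\<^sup>2) ^ (n - CARD('d))"
      by (intro power_mono) auto
    moreover have "w \<in> ball 0 1" using \<open>norm w \<le> \<rho> + \<delta>\<close> \<delta> by simp
    then have "ball_density n w = fact n / (fact (n - CARD('d)) * pi ^ CARD('d)) * (1 - (norm w)\<^sup>2) ^ (n - CARD('d))"
      by (simp add: ball_density_def)
    ultimately show ?thesis
      unfolding c_def by (simp only:) (intro mult_left_mono, auto)
  qed
  have "cmod (f z) \<le> sqrt (1 / (c * V)) * bergman_norm n f" if f: "f \<in> bergman n" and z: "norm z \<le> \<rho>" for f and z :: "complex ^ 'd"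
  proof -
    have an: "analytic_on_ball f" using f by (simp add: bergman_def)
    note sq = bergman_square_integrable[OF f]
    note m [measurable] = square_integrable_measurable[OF sq]
    have "ennreal c * (ennreal ((cmod (f z))\<^sup>2) * emeasure lborel (ball (0 :: complex ^ 'd) \<delta>))
        \<le> ennreal c * (\<integral>\<^sup>+w. ennreal ((cmod (f w))\<^sup>2) * indicator (ball z \<delta>) w \<partial>lborel)"
      using z \<delta> by (intro mult_left_mono analytic_mean_value_le[OF an m]) auto
    also have "\<dots> = (\<integral>\<^sup>+w. ennreal c * (ennreal ((cmod (f w))\<^sup>2) * indicator (ball z \<delta>) w) \<partial>lborel)"
      by (rule nn_integral_cmult[symmetric]) measurable
    also have "\<dots> \<le> (\<integral>\<^sup>+w. ennreal (ball_density n w) * ennreal ((cmod (f w))\<^sup>2) \<partial>lborel)"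
    proof (rule nn_integral_mono)
      fix w
      show "ennreal c * (ennreal ((cmod (f w))\<^sup>2) * indicator (ball z \<delta>) w) \<le> ennreal (ball_density n w) * ennreal ((cmod (f w))\<^sup>2)"
        using dens[OF _ z, of w] by (cases "w \<in> ball z \<delta>") (auto intro!: mult_right_mono ennreal_leI)
    qed
    also have "\<dots> = (\<integral>\<^sup>+w. ennreal ((cmod (f w))\<^sup>2) \<partial>ball_measure n)"
      by (rule nn_integral_ball_measure[symmetric]) measurable
    also have "\<dots> = ennreal ((bergman_norm n f)\<^sup>2)" by (rule square_integrable_nn_integral[OF sq])
    also have "emeasure lborel (ball (0 :: complex ^ 'd) \<delta>) = ennreal V"
      unfolding V_def using \<delta> by (simp add: emeasure_ball content_ball)
    finally have "c * ((cmod (f z))\<^sup>2 * V) \<le> (bergman_norm n f)\<^sup>2"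
      using c V by (simp add: ennreal_mult[symmetric])
    then have "(cmod (f z))\<^sup>2 \<le> 1 / (c * V) * (bergman_norm n f)\<^sup>2"
      using c V by (simp add: field_simps)
    also have "\<dots> = (sqrt (1 / (c * V)) * bergman_norm n f)\<^sup>2"
      using c V by (simp add: power_mult_distrib power_divide real_sqrt_divide)
    finally show ?thesis
      by (rule power2_le_imp_le) (use c V in auto)
  qed
  then show ?thesis
    using c V by (intro exI[of _ "sqrt (1 / (c * V))"]) auto
qed

lemma bergman_norm_eq_zero:
  assumes f: "f \<in> bergman n" and "bergman_norm n f = 0"
  shows "f = (\<lambda>_. 0)"
proof
  fix z
  show "f z = 0"
  proof (cases "z \<in> ball 0 1")
    case True
    then obtain C where "cmod (f z) \<le> C * bergman_norm n f"
      using bergman_evaluation_bound[of "norm z" n] f by fastforce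
    then show ?thesis using assms(2) by simp
  next
    case False
    then show ?thesis using f by (simp add: bergman_def)
  qed
qed

text \<open>Evaluation bounds make a norm-Cauchy sequence locally uniformly Cauchy, so a pointwise
  limit exists and is analytic; Fatou's lemma then bounds the norm distance to this limit.\<close>

lemma bergman_complete:
  fixes F :: "nat \<Rightarrow> ('d::finite) cfun"
  assumes F: "\<And>N. F N \<in> bergman n"
    and cauchy: "\<And>e. e > 0 \<Longrightarrow> \<exists>N0. \<forall>M\<ge>N0. \<forall>N\<ge>N0. bergman_norm n (\<lambda>z. F M z - F N z) \<le> e"
  obtains h where "h \<in> bergman n" "(\<lambda>N. bergman_norm n (\<lambda>z. F N z - h z)) \<longlonglongrightarrow> 0"
proof -
  have unif: "\<exists>N0. \<forall>M\<ge>N0. \<forall>N\<ge>N0. \<forall>z. norm z \<le> \<rho> \<longrightarrow> cmod (F M z - F N z) \<le> e"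
    if \<rho>: "0 \<le> \<rho>" "\<rho> < 1" and "e > 0" for \<rho> e
  proof -
    obtain C where C: "C \<ge> 0" "\<And>f z. f \<in> bergman n \<Longrightarrow> norm (z :: complex ^ 'd) \<le> \<rho> \<Longrightarrow> cmod (f z) \<le> C * bergman_norm n f"
      using bergman_evaluation_bound[OF \<rho>, of n] by blast
    obtain N0 where N0: "\<And>M N. M \<ge> N0 \<Longrightarrow> N \<ge> N0 \<Longrightarrow> bergman_norm n (\<lambda>z. F M z - F N z) \<le> e / (C + 1)"
      using cauchy[of "e / (C + 1)"] C(1) \<open>e > 0\<close> by (auto simp: add_nonneg_pos)
    have "cmod (F M z - F N z) \<le> e" if "M \<ge> N0" "N \<ge> N0" "norm z \<le> \<rho>" for M N z
    proof -
      have "cmod (F M z - F N z) \<le> C * bergman_norm n (\<lambda>z. F M z - F N z)"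
        using C(2)[OF bergman_diff[OF F[of M] F[of N]] that(3)] .
      also have "\<dots> \<le> C * (e / (C + 1))"
        using N0[OF that(1,2)] C(1) by (rule mult_left_mono)
      also have "\<dots> \<le> e"
        using C(1) \<open>e > 0\<close> by (simp add: field_simps)
      finally show ?thesis .
    qed
    then show ?thesis by blast
  qed
  define h where "h z = lim (\<lambda>N. F N z)" for z
  have lim: "(\<lambda>N. F N z) \<longlonglongrightarrow> h z" for z
  proof (cases "z \<in> ball 0 1")
    case True
    have "Cauchy (\<lambda>N. F N z)"
    proof (rule CauchyI)
      fix e :: real assume "e > 0"
      then obtain N0 where "\<And>M N. M \<ge> N0 \<Longrightarrow> N \<ge> N0 \<Longrightarrow> cmod (F M z - F N z) \<le> e / 2"
        using unif[of "norm z" "e / 2"] True by auto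
      then show "\<exists>M. \<forall>m\<ge>M. \<forall>n\<ge>M. norm (F m z - F n z) < e"
        using \<open>e > 0\<close> by (intro exI[of _ N0]) (smt (verit) field_sum_of_halves)
    qed
    then show ?thesis
      unfolding h_def by (simp add: Cauchy_convergent_iff convergent_LIMSEQ_iff)
  next
    case False
    then have "F N z = 0" for N using F[of N] by (simp add: bergman_def)
    then show ?thesis unfolding h_def by simp
  qed
  have an: "analytic_on_ball h"
  proof (rule analytic_on_ball_limit)
    show "analytic_on_ball (F N)" for N using F[of N] by (simp add: bergman_def)
    fix r :: real assume r: "0 < r" "r < 1"
    show "uniform_limit (cball 0 r) F h sequentially"
    proof (rule uniform_limitI)
      fix e :: real assume "e > 0"
      then obtain N0 where N0: "\<And>M N z. M \<ge> N0 \<Longrightarrow> N \<ge> N0 \<Longrightarrow> norm z \<le> r \<Longrightarrow> cmod (F M z - F N z) \<le> e / 2"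
        using unif[of r "e / 2"] r by auto
      show "\<forall>\<^sub>F N in sequentially. \<forall>z\<in>cball 0 r. dist (F N z) (h z) < e"
      proof (rule eventually_sequentiallyI[of N0], rule ballI)
        fix N and z :: "complex ^ 'd" assume N: "N0 \<le> N" and z: "z \<in> cball 0 r"
        have "(\<lambda>M. cmod (F N z - F M z)) \<longlonglongrightarrow> cmod (F N z - h z)"
          by (intro tendsto_intros lim)
        moreover have "\<forall>\<^sub>F M in sequentially. cmod (F N z - F M z) \<le> e / 2"
          by (rule eventually_sequentiallyI[of N0]) (use N0 N z in auto)
        ultimately have "cmod (F N z - h z) \<le> e / 2"
          by (rule tendsto_upperbound) simp
        then show "dist (F N z) (h z) < e" using \<open>e > 0\<close> by (simp add: dist_norm)
      qed
    qed
  qed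
  have out: "h z = 0" if "z \<notin> ball 0 1" for z
  proof -
    have "F N z = 0" for N using that F[of N] by (simp add: bergman_def)
    then show ?thesis unfolding h_def by simp
  qed
  note [measurable] = analytic_borel_measurable[OF an out] square_integrable_measurable[OF bergman_square_integrable[OF F]]
  have fatou: "(\<integral>\<^sup>+w. ennreal ((cmod (F N w - h w))\<^sup>2) \<partial>ball_measure n) \<le> ennreal (e\<^sup>2)"
    if N0: "\<And>M. M \<ge> N0 \<Longrightarrow> bergman_norm n (\<lambda>z. F N z - F M z) \<le> e" for N N0 e
  proof -
    have "(\<integral>\<^sup>+w. ennreal ((cmod (F N w - h w))\<^sup>2) \<partial>ball_measure n)
        = (\<integral>\<^sup>+w. liminf (\<lambda>M. ennreal ((cmod (F N w - F M w))\<^sup>2)) \<partial>ball_measure n)"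
    proof (intro nn_integral_cong)
      fix w
      show "ennreal ((cmod (F N w - h w))\<^sup>2) = liminf (\<lambda>M. ennreal ((cmod (F N w - F M w))\<^sup>2))"
        by (rule lim_imp_Liminf[symmetric]) (auto intro!: tendsto_intros lim)
    qed
    also have "\<dots> \<le> liminf (\<lambda>M. \<integral>\<^sup>+w. ennreal ((cmod (F N w - F M w))\<^sup>2) \<partial>ball_measure n)"
      by (rule nn_integral_liminf) measurable
    also have "\<dots> \<le> liminf (\<lambda>M::nat. ennreal (e\<^sup>2))"
    proof (intro Liminf_mono eventually_sequentiallyI[of N0])
      fix M assume "N0 \<le> M"
      then have "(bergman_norm n (\<lambda>z. F N z - F M z))\<^sup>2 \<le> e\<^sup>2"
        by (intro power_mono N0) auto
      then show "(\<integral>\<^sup>+w. ennreal ((cmod (F N w - F M w))\<^sup>2) \<partial>ball_measure n) \<le> ennreal (e\<^sup>2)"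
        using square_integrable_nn_integral[OF bergman_square_integrable[OF bergman_diff[OF F[of N] F[of M]]]]
        by (simp add: ennreal_leI)
    qed
    also have "\<dots> = ennreal (e\<^sup>2)" by (simp add: Liminf_const)
    finally show ?thesis .
  qed
  obtain N1 where N1: "\<And>M N. M \<ge> N1 \<Longrightarrow> N \<ge> N1 \<Longrightarrow> bergman_norm n (\<lambda>z. F M z - F N z) \<le> 1"
    using cauchy[of 1] by auto
  \<comment> \<open>The limit h is square integrable because F N1 and F N1 - h are.\<close>
  have "(\<integral>\<^sup>+w. ennreal ((cmod (F N1 w - h w))\<^sup>2) \<partial>ball_measure n) \<le> ennreal (1\<^sup>2)"
    by (rule fatou[of N1]) (rule N1, simp_all)
  then have "(\<integral>\<^sup>+w. ennreal ((cmod (F N1 w - h w))\<^sup>2) \<partial>ball_measure n) < \<infinity>"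
    using ennreal_one_less_top by (simp add: order_le_less_trans)
  then have "square_integrable n (\<lambda>z. F N1 z - h z)"
    unfolding square_integrable_def by (auto intro!: integrableI_nonneg)
  from square_integrable_diff[OF bergman_square_integrable[OF F[of N1]] this]
  have h: "h \<in> bergman n" by (intro bergmanI an out) simp_all
  have "(\<lambda>N. bergman_norm n (\<lambda>z. F N z - h z)) \<longlonglongrightarrow> 0"
  proof (rule LIMSEQ_I)
    fix e :: real assume "e > 0"
    then obtain N0 where N0: "\<And>M N. M \<ge> N0 \<Longrightarrow> N \<ge> N0 \<Longrightarrow> bergman_norm n (\<lambda>z. F M z - F N z) \<le> e / 2"
      using cauchy[of "e / 2"] by auto
    have "bergman_norm n (\<lambda>z. F N z - h z) \<le> e / 2" if "N \<ge> N0" for N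
    proof -
      have "ennreal ((bergman_norm n (\<lambda>z. F N z - h z))\<^sup>2) \<le> ennreal ((e / 2)\<^sup>2)"
        using fatou[of N0 N "e / 2"] N0 that
          square_integrable_nn_integral[OF bergman_square_integrable[OF bergman_diff[OF F[of N] h]]] by simp
      then have "(bergman_norm n (\<lambda>z. F N z - h z))\<^sup>2 \<le> (e / 2)\<^sup>2" by simp
      then show ?thesis by (rule power2_le_imp_le) (use \<open>e > 0\<close> in auto)
    qed
    then show "\<exists>no. \<forall>N\<ge>no. norm (bergman_norm n (\<lambda>z. F N z - h z) - 0) < e"
      using \<open>e > 0\<close> by (intro exI[of _ N0]) fastforce
  qed
  with h show ?thesis by (rule that)
qed

lemma bergman_norm_minus_commute: "bergman_norm n (\<lambda>z. f z - g z) = bergman_norm n (\<lambda>z. g z - f z)"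
  by (simp add: bergman_norm_def norm_minus_commute)

lemma bergman_inner_sum_right:
  assumes "\<And>j. j \<in> A \<Longrightarrow> square_integrable n (g j)" "square_integrable n h"
  shows "bergman_inner n h (\<lambda>z. \<Sum>j\<in>A. c j * g j z) = (\<Sum>j\<in>A. cnj (c j) * bergman_inner n h (g j))"
  using bergman_inner_sum_left[OF assms, where c=c] by (simp add: bergman_inner_cnj[of n h])

section \<open>Operators and their matrices\<close>

locale bergman_basis =
  fixes n :: nat and \<kappa> :: "nat \<Rightarrow> ('d::finite \<Rightarrow> nat)"
  assumes n: "CARD('d) \<le> n" and \<kappa>: "bij_betw \<kappa> {1..} UNIV"
begin

text \<open>The enumeration \<kappa> starts at 1. Shifting it lets indices range over all naturals,
  and the weight base i + j of the statement becomes i + j + 2.\<close>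

definition basis :: "nat \<Rightarrow> 'd cfun" where
  "basis j = monomial_basis n (\<kappa> (Suc j))"

definition coeff :: "'d cfun \<Rightarrow> nat \<Rightarrow> complex" where
  "coeff g j = bergman_inner n g (basis j)"

definition partial_expansion :: "nat \<Rightarrow> 'd cfun \<Rightarrow> 'd cfun" where
  "partial_expansion N g = (\<lambda>z. \<Sum>j<N. coeff g j * basis j z)"

lemma basis_bergman: "basis j \<in> bergman n"
  unfolding basis_def by (rule monomial_basis_bergman[OF n])

lemmas basis_square_integrable = bergman_square_integrable[OF basis_bergman]

lemma basis_surj: "\<exists>j. monomial_basis n k = basis j"
proof -
  obtain i where "i \<in> {1..}" "\<kappa> i = k"
    using \<kappa> by (metis UNIV_I bij_betw_def imageE)
  then show ?thesis by (intro exI[of _ "i - 1"]) (simp add: basis_def)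
qed

lemma inner_basis: "bergman_inner n (basis i) (basis j) = (if i = j then 1 else 0)"
proof -
  have "\<kappa> (Suc i) = \<kappa> (Suc j) \<longleftrightarrow> i = j"
    using \<kappa> by (auto simp: bij_betw_def inj_on_def)
  then show ?thesis by (simp add: basis_def bergman_inner_monomial_basis[OF n])
qed

lemma norm_basis: "bergman_norm n (basis j) = 1"
  unfolding basis_def by (rule bergman_norm_monomial_basis[OF n])

lemma basis_sum_bergman: "(\<lambda>z. \<Sum>j\<in>A. c j * basis j z) \<in> bergman n"
  by (intro bergman_sum basis_bergman)

lemma inner_basis_sum:
  assumes "finite A"
  shows "bergman_inner n (\<lambda>z. \<Sum>i\<in>A. c i * basis i z) (basis j) = (if j \<in> A then c j else 0)"
  using assms by (subst bergman_inner_sum_left) (auto simp: basis_square_integrable inner_basis if_distrib cong: if_cong)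

lemma norm_basis_sum:
  assumes "finite A"
  shows "(bergman_norm n (\<lambda>z. \<Sum>i\<in>A. c i * basis i z))\<^sup>2 = (\<Sum>i\<in>A. (cmod (c i))\<^sup>2)"
proof -
  let ?S = "\<lambda>z. \<Sum>i\<in>A. c i * basis i z"
  have "complex_of_real ((bergman_norm n ?S)\<^sup>2) = bergman_inner n ?S ?S"
    by (simp add: bergman_inner_self)
  also have "\<dots> = (\<Sum>i\<in>A. cnj (c i) * bergman_inner n ?S (basis i))"
    by (rule bergman_inner_sum_right) (auto intro: basis_square_integrable bergman_square_integrable basis_sum_bergman)
  also have "\<dots> = (\<Sum>i\<in>A. cnj (c i) * c i)"
    using assms by (intro sum.cong refl) (simp add: inner_basis_sum)
  also have "\<dots> = complex_of_real (\<Sum>i\<in>A. (cmod (c i))\<^sup>2)"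
    by (simp add: mult.commute[of "cnj _"] flip: complex_norm_square)
  finally show ?thesis by (simp only: of_real_eq_iff)
qed

lemma partial_expansion_bergman: "partial_expansion N g \<in> bergman n"
  unfolding partial_expansion_def by (rule basis_sum_bergman)

lemmas partial_expansion_square_integrable = bergman_square_integrable[OF partial_expansion_bergman]

lemma norm_partial_expansion: "(bergman_norm n (partial_expansion N g))\<^sup>2 = (\<Sum>j<N. (cmod (coeff g j))\<^sup>2)"
  unfolding partial_expansion_def by (rule norm_basis_sum) simp

lemma coeff_partial_expansion: "coeff (partial_expansion N g) j = (if j < N then coeff g j else 0)"
  unfolding coeff_def[of "partial_expansion N g"] unfolding partial_expansion_def by (subst inner_basis_sum) auto

lemma Bessel:
  assumes g: "square_integrable n g"
  shows "(\<Sum>j<N. (cmod (coeff g j))\<^sup>2) \<le> (bergman_norm n g)\<^sup>2"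
proof -
  let ?S = "partial_expansion N g"
  have "bergman_inner n g ?S = (\<Sum>j<N. cnj (coeff g j) * coeff g j)"
    unfolding partial_expansion_def using g
    by (subst bergman_inner_sum_right) (auto intro: basis_square_integrable simp: coeff_def)
  also have "\<dots> = of_real (\<Sum>j<N. (cmod (coeff g j))\<^sup>2)"
    by (simp add: mult.commute[of "cnj _"] flip: complex_norm_square)
  finally have "Re (bergman_inner n g ?S) = (\<Sum>j<N. (cmod (coeff g j))\<^sup>2)" by simp
  moreover have "0 \<le> (bergman_norm n g)\<^sup>2 - 2 * Re (bergman_inner n g ?S) + (bergman_norm n ?S)\<^sup>2"
    using bergman_norm_square_diff_cmult[OF g partial_expansion_square_integrable[of N g], of 1]
      zero_le_power2[of "bergman_norm n (\<lambda>z. g z - 1 * ?S z)"] by simp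
  ultimately show ?thesis by (simp add: norm_partial_expansion)
qed

lemma norm_partial_expansion_le: "square_integrable n g \<Longrightarrow> bergman_norm n (partial_expansion N g) \<le> bergman_norm n g"
  by (rule power2_le_imp_le) (simp_all add: norm_partial_expansion Bessel)

lemma cmod_coeff_le: "square_integrable n g \<Longrightarrow> cmod (coeff g j) \<le> bergman_norm n g"
  using bergman_Cauchy_Schwarz[OF _ basis_square_integrable, of g j] by (simp add: coeff_def norm_basis)

text \<open>Riesz-Fischer. Since g is not assumed analytic, h is in general different from g; it
  turns out to be its orthogonal projection.\<close>

lemma expansion_limit:
  assumes g: "square_integrable n g"
  obtains h where "h \<in> bergman n" "(\<lambda>N. bergman_norm n (\<lambda>z. partial_expansion N g z - h z)) \<longlonglongrightarrow> 0"
    "\<And>j. coeff h j = coeff g j"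
proof -
  let ?a = "\<lambda>j. (cmod (coeff g j))\<^sup>2"
  have "summable ?a"
    by (rule summableI_nonneg_bounded[where x="(bergman_norm n g)\<^sup>2"]) (auto intro: Bessel g)
  have diff: "(bergman_norm n (\<lambda>z. partial_expansion M g z - partial_expansion N g z))\<^sup>2 = sum ?a {N..<M}" if "N \<le> M" for M N
  proof -
    have "(\<Sum>j<M. c j) - (\<Sum>j<N. c j) = (\<Sum>j\<in>{N..<M}. c j)" for c :: "nat \<Rightarrow> complex"
      using sum_diff_nat_ivl[of 0 N M c] that by (simp add: atLeast0LessThan)
    then show ?thesis
      unfolding partial_expansion_def by (simp add: norm_basis_sum)
  qed
  obtain h where h: "h \<in> bergman n" and lim: "(\<lambda>N. bergman_norm n (\<lambda>z. partial_expansion N g z - h z)) \<longlonglongrightarrow> 0"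
  proof (rule bergman_complete)
    show "partial_expansion N g \<in> bergman n" for N by (rule partial_expansion_bergman)
    fix e :: real assume "e > 0"
    then have "e\<^sup>2 > 0" by simp
    then obtain N0 where N0: "\<And>m k. m \<ge> N0 \<Longrightarrow> norm (sum ?a {m..<k}) < e\<^sup>2"
      using \<open>summable ?a\<close> unfolding summable_Cauchy by blast
    have le: "bergman_norm n (\<lambda>z. partial_expansion M g z - partial_expansion N g z) \<le> e" if "N0 \<le> N" "N \<le> M" for M N
    proof (rule power2_le_imp_le)
      show "(bergman_norm n (\<lambda>z. partial_expansion M g z - partial_expansion N g z))\<^sup>2 \<le> e\<^sup>2"
        using N0[of N M] that by (simp add: diff)
    qed (use \<open>e > 0\<close> in simp)
    show "\<exists>N0. \<forall>M\<ge>N0. \<forall>N\<ge>N0. bergman_norm n (\<lambda>z. partial_expansion M g z - partial_expansion N g z) \<le> e"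
    proof (intro exI[of _ N0] allI impI)
      fix M N assume "N0 \<le> M" "N0 \<le> N"
      then show "bergman_norm n (\<lambda>z. partial_expansion M g z - partial_expansion N g z) \<le> e"
        using le[of N M] le[of M N] bergman_norm_minus_commute[of n "partial_expansion M g"] by (cases "N \<le> M") auto
    qed
  qed
  moreover have "coeff h j = coeff g j" for j
  proof -
    note hs = bergman_square_integrable[OF h]
    have "(\<lambda>N. coeff (partial_expansion N g) j) \<longlonglongrightarrow> coeff h j"
    proof (rule LIM_zero_cancel, rule Lim_null_comparison[OF _ lim])
      show "\<forall>\<^sub>F N in sequentially. norm (coeff (partial_expansion N g) j - coeff h j)
          \<le> bergman_norm n (\<lambda>z. partial_expansion N g z - h z)"
      proof (rule always_eventually, rule allI)
        fix N
        have "coeff (partial_expansion N g) j - coeff h j = coeff (\<lambda>z. partial_expansion N g z - h z) j"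
          unfolding coeff_def[of "partial_expansion N g"] coeff_def[of h] coeff_def[of "\<lambda>z. partial_expansion N g z - h z"]
          by (simp add: bergman_inner_diff_left partial_expansion_square_integrable hs basis_square_integrable)
        then show "norm (coeff (partial_expansion N g) j - coeff h j) \<le> bergman_norm n (\<lambda>z. partial_expansion N g z - h z)"
          using cmod_coeff_le[OF square_integrable_diff[OF partial_expansion_square_integrable hs]] by simp
      qed
    qed
    moreover have "(\<lambda>N. coeff (partial_expansion N g) j) \<longlonglongrightarrow> coeff g j"
    proof (rule tendsto_eventually, rule eventually_sequentiallyI[of "Suc j"])
      show "coeff (partial_expansion N g) j = coeff g j" if "Suc j \<le> N" for N
        using that by (simp add: coeff_partial_expansion)
    qed
    ultimately show ?thesis by (rule LIMSEQ_unique)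
  qed
  ultimately show ?thesis by (rule that)
qed

lemma bergman_coeff_zero:
  assumes f: "f \<in> bergman n" and "\<And>j. coeff f j = 0"
  shows "f = (\<lambda>_. 0)"
proof (rule bergman_orthogonal_monomials_zero[OF n f])
  fix k
  obtain j where "monomial_basis n k = basis j" using basis_surj by blast
  then show "bergman_inner n f (monomial_basis n k) = 0" using assms(2)[of j] by (simp add: coeff_def)
qed

lemma expansion_converges:
  assumes f: "f \<in> bergman n"
  shows "(\<lambda>N. bergman_norm n (\<lambda>z. partial_expansion N f z - f z)) \<longlonglongrightarrow> 0"
proof -
  note fs = bergman_square_integrable[OF f]
  obtain h where h: "h \<in> bergman n" and lim: "(\<lambda>N. bergman_norm n (\<lambda>z. partial_expansion N f z - h z)) \<longlonglongrightarrow> 0"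
      and co: "\<And>j. coeff h j = coeff f j"
    using expansion_limit[OF fs] by blast
  have "(\<lambda>z. f z - h z) = (\<lambda>_. 0)"
  proof (rule bergman_coeff_zero[OF bergman_diff[OF f h]])
    fix j
    show "coeff (\<lambda>z. f z - h z) j = 0"
      using co[of j] unfolding coeff_def
      by (simp add: bergman_inner_diff_left fs bergman_square_integrable[OF h] basis_square_integrable)
  qed
  then have "f = h" by (simp add: fun_eq_iff)
  with lim show ?thesis by simp
qed

text \<open>The residual g - h is orthogonal to every basis vector, and partial expansions
  approximate each u in norm, so Cauchy-Schwarz makes the residual orthogonal to u.\<close>

lemma projection_exists:
  fixes g :: "'d cfun"
  assumes g: "square_integrable n g"
  obtains h where "h \<in> bergman n" "\<And>u. u \<in> bergman n \<Longrightarrow> bergman_inner n (\<lambda>z. g z - h z) u = 0"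
proof -
  obtain h where h: "h \<in> bergman n" and co: "\<And>j. coeff h j = coeff g j"
    using expansion_limit[OF g] by blast
  note hs = bergman_square_integrable[OF h]
  let ?d = "\<lambda>z. g z - h z"
  have ds: "square_integrable n ?d" by (rule square_integrable_diff[OF g hs])
  have d: "bergman_inner n ?d (basis j) = 0" for j
    using co[of j] unfolding coeff_def by (simp add: bergman_inner_diff_left g hs basis_square_integrable)
  have "bergman_inner n ?d u = 0" if u: "u \<in> bergman n" for u
  proof -
    note us = bergman_square_integrable[OF u]
    have "cmod (bergman_inner n ?d u) \<le> bergman_norm n ?d * bergman_norm n (\<lambda>z. partial_expansion N u z - u z)" for N
    proof -
      have "bergman_inner n ?d (partial_expansion N u) = 0"
        unfolding partial_expansion_def by (subst bergman_inner_sum_right) (auto simp: basis_square_integrable ds d)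
      then have "bergman_inner n ?d (\<lambda>z. partial_expansion N u z - u z) = - bergman_inner n ?d u"
        by (simp add: bergman_inner_diff_right partial_expansion_square_integrable us ds)
      then show ?thesis
        using bergman_Cauchy_Schwarz[OF ds square_integrable_diff[OF partial_expansion_square_integrable us], of N u]
        by (metis norm_minus_cancel)
    qed
    moreover have "(\<lambda>N. bergman_norm n ?d * bergman_norm n (\<lambda>z. partial_expansion N u z - u z)) \<longlonglongrightarrow> bergman_norm n ?d * 0"
      by (intro tendsto_intros expansion_converges u)
    ultimately have "cmod (bergman_inner n ?d u) \<le> bergman_norm n ?d * 0"
      by (intro LIMSEQ_le_const) auto
    then show ?thesis by simp
  qed
  with h show ?thesis by (rule that)
qed

text \<open>The projection is a definite description, so nothing can be derived about it before
  existence and uniqueness. Two candidates differ by an element orthogonal to itself.\<close>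

lemma bergman_projection:
  fixes g :: "'d cfun"
  assumes g: "square_integrable n g"
  shows "bergman_projection n g \<in> bergman n"
    and "u \<in> bergman n \<Longrightarrow> bergman_inner n (bergman_projection n g) u = bergman_inner n g u"
proof -
  let ?P = "\<lambda>h. h \<in> bergman n \<and> (\<forall>u\<in>bergman n. bergman_inner n (g - h) u = 0)"
  have "\<exists>!h. ?P h"
  proof (rule ex_ex1I)
    obtain h where "h \<in> bergman n" "\<And>u. u \<in> bergman n \<Longrightarrow> bergman_inner n (\<lambda>z. g z - h z) u = 0"
      using projection_exists[OF g] by blast
    then show "\<exists>h. ?P h"
      by (intro exI[of _ h]) (simp add: fun_diff_def)
    fix h h' assume h: "?P h" and h': "?P h'"
    then have hs: "square_integrable n h" "square_integrable n h'" by (auto intro: bergman_square_integrable)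
    have d: "(\<lambda>z. h z - h' z) \<in> bergman n" using h h' by (intro bergman_diff) auto
    then have "bergman_inner n (\<lambda>z. h z - h' z) (\<lambda>z. h z - h' z)
        = bergman_inner n (g - h') (\<lambda>z. h z - h' z) - bergman_inner n (g - h) (\<lambda>z. h z - h' z)"
      using hs g by (simp add: fun_diff_def bergman_inner_diff_left bergman_square_integrable)
    also have "\<dots> = 0" using h h' d by simp
    finally have "bergman_norm n (\<lambda>z. h z - h' z) = 0"
      by (simp add: bergman_inner_self)
    from bergman_norm_eq_zero[OF d this] show "h = h'" by (simp add: fun_eq_iff)
  qed
  then have P: "?P (bergman_projection n g)"
    unfolding bergman_projection_def by (rule theI')
  then show m: "bergman_projection n g \<in> bergman n" by blast
  assume u: "u \<in> bergman n"
  with P have "bergman_inner n (\<lambda>z. g z - bergman_projection n g z) u = 0" by (simp add: fun_diff_def)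
  then show "bergman_inner n (bergman_projection n g) u = bergman_inner n g u"
    using u m g by (simp add: bergman_inner_diff_left bergman_square_integrable)
qed

section \<open>Toeplitz operators as compressions of multiplications\<close>

lemma symbol_mult_square_integrable:
  fixes f :: "'d cfun"
  assumes \<phi>: "continuous_on (cball 0 1) \<phi>" and f: "f \<in> bergman n"
  shows "square_integrable n (\<lambda>z. \<phi> z * f z)"
proof -
  obtain B where "\<forall>y\<in>\<phi> ` cball 0 1. cmod y \<le> B"
    using compact_imp_bounded[OF compact_continuous_image[OF \<phi> compact_cball]] by (metis bounded_iff)
  then have B: "cmod (\<phi> z) \<le> B" if "z \<in> cball 0 1" for z using that by blast
  have "continuous_on (ball 0 1) \<phi>" using \<phi> ball_subset_cball continuous_on_subset by blast
  \<comment> \<open>Outside the closed ball the symbol is arbitrary and possibly not measurable. It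
    is cut off there, which leaves the product unchanged because f vanishes outside the open
    ball.\<close>
  then have "(\<lambda>z. if z \<in> ball 0 1 then \<phi> z else 0) \<in> borel_measurable borel"
    by (intro borel_measurable_continuous_on_if continuous_on_const) simp_all
  then have "square_integrable n (\<lambda>z. (if z \<in> ball 0 1 then \<phi> z else 0) * f z)"
    by (rule square_integrable_mult_bounded[OF bergman_square_integrable[OF f], where B=B]) (use B in auto)
  moreover have "(\<lambda>z. (if z \<in> ball 0 1 then \<phi> z else 0) * f z) = (\<lambda>z. \<phi> z * f z)"
    using f by (auto simp: bergman_def fun_eq_iff)
  ultimately show ?thesis by simp
qed

lemma toeplitz_bergman:
  fixes f :: "'d cfun"
  assumes "continuous_on (cball 0 1) \<phi>" "f \<in> bergman n"
  shows "toeplitz n \<phi> f \<in> bergman n"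
  using bergman_projection(1)[OF symbol_mult_square_integrable[OF assms]] assms by (simp add: toeplitz_def)

lemma inner_toeplitz:
  fixes f :: "'d cfun"
  assumes "continuous_on (cball 0 1) \<phi>" "f \<in> bergman n" "u \<in> bergman n"
  shows "bergman_inner n (toeplitz n \<phi> f) u = bergman_inner n (\<lambda>z. \<phi> z * f z) u"
  using bergman_projection(2)[OF symbol_mult_square_integrable[OF assms(1,2)] assms(3)] assms by (simp add: toeplitz_def)

end

section \<open>Bounded operators and estimates from matrix entries\<close>

context bergman_basis begin

definition entry :: "'d operator \<Rightarrow> nat \<Rightarrow> nat \<Rightarrow> complex" where
  "entry T i j = bergman_inner n (T (basis i)) (basis j)"

lemma matrix_entry_Suc: "matrix_entry n \<kappa> T (Suc i) (Suc j) = entry T i j"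
  by (simp add: matrix_entry_def entry_def basis_def)

lemma bounded_operator_bergman: "T \<in> bounded_operators n \<Longrightarrow> f \<in> bergman n \<Longrightarrow> T f \<in> bergman n"
  by (simp add: bounded_operators_def)

lemma bounded_operator_cmult:
  "T \<in> bounded_operators n \<Longrightarrow> f \<in> bergman n \<Longrightarrow> T (\<lambda>z. c * f z) = (\<lambda>z. c * T f z)"
  by (simp add: bounded_operators_def)

lemma bounded_operator_add:
  assumes "T \<in> bounded_operators n" "f \<in> bergman n" "g \<in> bergman n"
  shows "T (\<lambda>z. f z + g z) = (\<lambda>z. T f z + T g z)"
proof -
  have "T (f + g) = T f + T g" using assms by (simp add: bounded_operators_def)
  then show ?thesis by (simp add: plus_fun_def)
qed

lemma bounded_operator_diff:
  assumes "T \<in> bounded_operators n" "f \<in> bergman n" "g \<in> bergman n"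
  shows "T (\<lambda>z. f z - g z) = (\<lambda>z. T f z - T g z)"
  using bounded_operator_add[OF assms(1,2) bergman_cmult[OF assms(3), of "-1"]]
    bounded_operator_cmult[OF assms(1,3), of "-1"] by simp

lemma bounded_operator_zero:
  assumes "T \<in> bounded_operators n"
  shows "T (\<lambda>_. 0) = (\<lambda>_. 0)"
  using bounded_operator_cmult[OF assms bergman_zero, of 0] by simp

lemma bounded_operator_basis_sum:
  assumes T: "T \<in> bounded_operators n"
  shows "T (\<lambda>z. \<Sum>j\<in>A. c j * basis j z) = (\<lambda>z. \<Sum>j\<in>A. c j * T (basis j) z)"
proof (induction A rule: infinite_finite_induct)
  case (insert x A)
  then show ?case
    using bounded_operator_add[OF T bergman_cmult[OF basis_bergman] basis_sum_bergman, of "c x" x c A]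
      bounded_operator_cmult[OF T basis_bergman] by simp
qed (simp_all add: bounded_operator_zero[OF T])

lemma bounded_operator_bound:
  fixes T :: "'d operator"
  assumes "T \<in> bounded_operators n"
  obtains C where "C \<ge> 0" "\<And>f. f \<in> bergman n \<Longrightarrow> bergman_norm n (T f) \<le> C * bergman_norm n f"
proof -
  obtain C where C: "\<And>f. f \<in> bergman n \<Longrightarrow> bergman_norm n (T f) \<le> C * bergman_norm n f"
    using assms unfolding bounded_operators_def by blast
  have "bergman_norm n (T f) \<le> \<bar>C\<bar> * bergman_norm n f" if "f \<in> bergman n" for f
    using C[OF that] mult_right_mono[OF abs_ge_self[of C] bergman_norm_nonneg[of n f]] by linarith
  then show ?thesis by (intro that[of "\<bar>C\<bar>"]) auto
qed

lemma bounded_operatorI: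
  fixes T :: "'d operator"
  assumes "\<And>f. f \<in> bergman n \<Longrightarrow> T f \<in> bergman n" "\<And>f. f \<notin> bergman n \<Longrightarrow> T f = 0"
    "\<And>f g. f \<in> bergman n \<Longrightarrow> g \<in> bergman n \<Longrightarrow> T (f + g) = T f + T g"
    "\<And>f c. f \<in> bergman n \<Longrightarrow> T (\<lambda>z. c * f z) = (\<lambda>z. c * T f z)"
    "\<And>f. f \<in> bergman n \<Longrightarrow> bergman_norm n (T f) \<le> C * bergman_norm n f"
  shows "T \<in> bounded_operators n"
  using assms unfolding bounded_operators_def by blast

lemma bounded_operators_add:
  fixes S T :: "'d operator"
  assumes S: "S \<in> bounded_operators n" and T: "T \<in> bounded_operators n"
  shows "S + T \<in> bounded_operators n"
proof -
  obtain C where C: "\<And>f. f \<in> bergman n \<Longrightarrow> bergman_norm n (S f) \<le> C * bergman_norm n f"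
    using bounded_operator_bound[OF S] by blast
  obtain D where D: "\<And>f. f \<in> bergman n \<Longrightarrow> bergman_norm n (T f) \<le> D * bergman_norm n f"
    using bounded_operator_bound[OF T] by blast
  show ?thesis
  proof (rule bounded_operatorI[where C="C + D"])
    fix f :: "'d cfun" assume f: "f \<in> bergman n"
    show "(S + T) f \<in> bergman n"
      using bergman_add[OF bounded_operator_bergman[OF S f] bounded_operator_bergman[OF T f]] by (simp add: plus_fun_def)
    show "bergman_norm n ((S + T) f) \<le> (C + D) * bergman_norm n f"
      using bergman_norm_triangle[OF bergman_square_integrable[OF bounded_operator_bergman[OF S f]]
        bergman_square_integrable[OF bounded_operator_bergman[OF T f]]] C[OF f] D[OF f]
      by (simp add: plus_fun_def algebra_simps)
    show "(S + T) (\<lambda>z. c * f z) = (\<lambda>z. c * (S + T) f z)" for c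
      using bounded_operator_cmult[OF S f] bounded_operator_cmult[OF T f] by (simp add: plus_fun_def algebra_simps)
    fix g :: "'d cfun" assume g: "g \<in> bergman n"
    have "S (f + g) = S f + S g" "T (f + g) = T f + T g"
      using S T f g by (simp_all add: bounded_operators_def)
    then show "(S + T) (f + g) = (S + T) f + (S + T) g"
      by (simp add: algebra_simps)
  next
    fix f :: "'d cfun" assume "f \<notin> bergman n"
    then show "(S + T) f = 0" using S T by (simp add: bounded_operators_def)
  qed
qed

lemma bounded_operators_cmult:
  fixes T :: "'d operator"
  assumes T: "T \<in> bounded_operators n"
  shows "(\<lambda>f z. c * T f z) \<in> bounded_operators n"
proof -
  obtain D where D: "\<And>f. f \<in> bergman n \<Longrightarrow> bergman_norm n (T f) \<le> D * bergman_norm n f"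
    using bounded_operator_bound[OF T] by blast
  show ?thesis
  proof (rule bounded_operatorI[where C="cmod c * D"])
    fix f :: "'d cfun" assume f: "f \<in> bergman n"
    show "(\<lambda>z. c * T f z) \<in> bergman n"
      by (rule bergman_cmult[OF bounded_operator_bergman[OF T f]])
    show "bergman_norm n (\<lambda>z. c * T f z) \<le> cmod c * D * bergman_norm n f"
      using mult_left_mono[OF D[OF f], of "cmod c"] by (simp add: bergman_norm_cmult mult.assoc)
    show "(\<lambda>z. c * T (\<lambda>z. b * f z) z) = (\<lambda>z. b * (c * T f z))" for b
      using bounded_operator_cmult[OF T f] by (simp add: algebra_simps)
    fix g :: "'d cfun" assume g: "g \<in> bergman n"
    have "T (f + g) = T f + T g"
      using T f g by (simp add: bounded_operators_def)
    then show "(\<lambda>z. c * T (f + g) z) = (\<lambda>z. c * T f z) + (\<lambda>z. c * T g z)"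
      by (simp add: fun_eq_iff algebra_simps)
  next
    fix f :: "'d cfun" assume "f \<notin> bergman n"
    then show "(\<lambda>z. c * T f z) = 0" using T by (simp add: bounded_operators_def fun_eq_iff)
  qed
qed

lemma bounded_operators_diff:
  fixes S T :: "'d operator"
  assumes "S \<in> bounded_operators n" "T \<in> bounded_operators n"
  shows "S - T \<in> bounded_operators n"
proof -
  have eq: "S - T = S + (\<lambda>f z. -1 * T f z)" by (simp add: fun_eq_iff)
  show ?thesis unfolding eq by (intro bounded_operators_add bounded_operators_cmult assms)
qed

lemma entry_diff:
  assumes "S \<in> bounded_operators n" "T \<in> bounded_operators n"
  shows "entry (S - T) i j = entry S i j - entry T i j"
  unfolding entry_def
  by (simp add: fun_diff_def bergman_inner_diff_left basis_square_integrable
      bergman_square_integrable[OF bounded_operator_bergman[OF assms(1) basis_bergman]]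
      bergman_square_integrable[OF bounded_operator_bergman[OF assms(2) basis_bergman]])

lemma entry_cmult: "entry (\<lambda>f z. c * T f z) i j = c * entry T i j"
  by (simp add: entry_def bergman_inner_cmult_left)

lemma form_finite:
  assumes T: "T \<in> bounded_operators n"
  shows "bergman_inner n (T (partial_expansion N f)) (partial_expansion N g)
    = (\<Sum>i<N. \<Sum>j<N. coeff f i * cnj (coeff g j) * entry T i j)"
proof -
  have sq: "square_integrable n (T (basis i))" for i
    by (intro bergman_square_integrable bounded_operator_bergman[OF T] basis_bergman)
  have T_eq: "T (partial_expansion N f) = (\<lambda>z. \<Sum>i<N. coeff f i * T (basis i) z)"
    unfolding partial_expansion_def by (rule bounded_operator_basis_sum[OF T])
  have row: "bergman_inner n (T (basis i)) (partial_expansion N g) = (\<Sum>j<N. cnj (coeff g j) * entry T i j)" for i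
    unfolding partial_expansion_def entry_def by (rule bergman_inner_sum_right[OF basis_square_integrable sq])
  have "bergman_inner n (T (partial_expansion N f)) (partial_expansion N g)
      = (\<Sum>i<N. coeff f i * bergman_inner n (T (basis i)) (partial_expansion N g))"
    unfolding T_eq by (rule bergman_inner_sum_left[OF sq partial_expansion_square_integrable])
  then show ?thesis by (simp add: row sum_distrib_left mult.assoc)
qed

text \<open>The error splits into T applied to the expansion error of f and the expansion error of
  g; boundedness of T and norm convergence of the expansions control both.\<close>

lemma form_limit:
  assumes T: "T \<in> bounded_operators n" and f: "f \<in> bergman n" and g: "g \<in> bergman n"
  shows "(\<lambda>N. bergman_inner n (T (partial_expansion N f)) (partial_expansion N g)) \<longlonglongrightarrow> bergman_inner n (T f) g"
proof -
  obtain C where C: "C \<ge> 0" "\<And>f. f \<in> bergman n \<Longrightarrow> bergman_norm n (T f) \<le> C * bergman_norm n f"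
    using bounded_operator_bound[OF T] by blast
  note fs = bergman_square_integrable[OF f] and gs = bergman_square_integrable[OF g]
  let ?f = "\<lambda>N. partial_expansion N f" and ?g = "\<lambda>N. partial_expansion N g"
  have Tf: "square_integrable n (T f)" and TfN: "square_integrable n (T (?f N))" for N
    by (intro bergman_square_integrable bounded_operator_bergman[OF T] f partial_expansion_bergman)+
  have le: "cmod (bergman_inner n (T (?f N)) (?g N) - bergman_inner n (T f) g)
      \<le> C * bergman_norm n (\<lambda>z. ?f N z - f z) * bergman_norm n g + bergman_norm n (T f) * bergman_norm n (\<lambda>z. ?g N z - g z)" for N
  proof -
    have d: "(\<lambda>z. ?f N z - f z) \<in> bergman n" by (intro bergman_diff partial_expansion_bergman f)
    have Td: "T (\<lambda>z. ?f N z - f z) = (\<lambda>z. T (?f N) z - T f z)"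
      by (intro bounded_operator_diff[OF T] partial_expansion_bergman f)
    have eq: "bergman_inner n (T (?f N)) (?g N) - bergman_inner n (T f) g
        = bergman_inner n (T (\<lambda>z. ?f N z - f z)) (?g N) + bergman_inner n (T f) (\<lambda>z. ?g N z - g z)"
      unfolding Td
      by (simp add: bergman_inner_diff_left bergman_inner_diff_right Tf TfN gs partial_expansion_square_integrable)
    have "cmod (bergman_inner n (T (?f N)) (?g N) - bergman_inner n (T f) g)
        \<le> cmod (bergman_inner n (T (\<lambda>z. ?f N z - f z)) (?g N)) + cmod (bergman_inner n (T f) (\<lambda>z. ?g N z - g z))"
      unfolding eq by (rule norm_triangle_ineq)
    also have "\<dots> \<le> bergman_norm n (T (\<lambda>z. ?f N z - f z)) * bergman_norm n (?g N) + bergman_norm n (T f) * bergman_norm n (\<lambda>z. ?g N z - g z)"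
    proof (rule add_mono)
      show "cmod (bergman_inner n (T (\<lambda>z. ?f N z - f z)) (?g N)) \<le> bergman_norm n (T (\<lambda>z. ?f N z - f z)) * bergman_norm n (?g N)"
        by (rule bergman_Cauchy_Schwarz[OF bergman_square_integrable[OF bounded_operator_bergman[OF T d]] partial_expansion_square_integrable])
      show "cmod (bergman_inner n (T f) (\<lambda>z. ?g N z - g z)) \<le> bergman_norm n (T f) * bergman_norm n (\<lambda>z. ?g N z - g z)"
        by (rule bergman_Cauchy_Schwarz[OF Tf square_integrable_diff[OF partial_expansion_square_integrable gs]])
    qed
    also have "\<dots> \<le> C * bergman_norm n (\<lambda>z. ?f N z - f z) * bergman_norm n g + bergman_norm n (T f) * bergman_norm n (\<lambda>z. ?g N z - g z)"
      by (rule add_right_mono, rule mult_mono[OF C(2)[OF d] norm_partial_expansion_le[OF gs]]) (use C(1) in simp_all)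
    finally show ?thesis .
  qed
  have "(\<lambda>N. C * bergman_norm n (\<lambda>z. ?f N z - f z) * bergman_norm n g + bergman_norm n (T f) * bergman_norm n (\<lambda>z. ?g N z - g z))
      \<longlonglongrightarrow> C * 0 * bergman_norm n g + bergman_norm n (T f) * 0"
    by (intro tendsto_intros expansion_converges f g)
  then have lim0: "(\<lambda>N. C * bergman_norm n (\<lambda>z. ?f N z - f z) * bergman_norm n g + bergman_norm n (T f) * bergman_norm n (\<lambda>z. ?g N z - g z))
      \<longlonglongrightarrow> 0" by simp
  show ?thesis
    by (rule LIM_zero_cancel, rule Lim_null_comparison[OF always_eventually lim0], rule allI, rule le)
qed

text \<open>Every operator estimate below is a bound on finite sections of the matrix, uniform in
  the size N of the section.\<close>

lemma form_bound:
  assumes T: "T \<in> bounded_operators n" and f: "f \<in> bergman n" and g: "g \<in> bergman n"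
    and B: "\<And>N. cmod (\<Sum>i<N. \<Sum>j<N. coeff f i * cnj (coeff g j) * entry T i j) \<le> B"
  shows "cmod (bergman_inner n (T f) g) \<le> B"
proof (rule tendsto_upperbound[OF tendsto_norm[OF form_limit[OF T f g]]])
  show "\<forall>\<^sub>F N in sequentially. cmod (bergman_inner n (T (partial_expansion N f)) (partial_expansion N g)) \<le> B"
    unfolding form_finite[OF T] by (rule always_eventually, rule allI, rule B)
qed simp

text \<open>Each coefficient is at most the norm, so the sum of the moduli of the entries dominates
  the operator. This is crude, but Lip(K) has summable matrices.\<close>

lemma operator_bound_entries:
  assumes T: "T \<in> bounded_operators n" and f: "f \<in> bergman n" and g: "g \<in> bergman n"
    and B: "\<And>N. (\<Sum>i<N. \<Sum>j<N. cmod (entry T i j)) \<le> B"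
  shows "cmod (bergman_inner n (T f) g) \<le> B * (bergman_norm n f * bergman_norm n g)"
proof (rule form_bound[OF T f g])
  fix N
  have "cmod (\<Sum>i<N. \<Sum>j<N. coeff f i * cnj (coeff g j) * entry T i j)
      \<le> (\<Sum>i<N. \<Sum>j<N. cmod (entry T i j) * (bergman_norm n f * bergman_norm n g))"
  proof (intro order_trans[OF norm_sum] sum_mono)
    fix i j
    have "cmod (coeff f i) * cmod (coeff g j) \<le> bergman_norm n f * bergman_norm n g"
      by (intro mult_mono cmod_coeff_le bergman_square_integrable f g) auto
    from mult_left_mono[OF this norm_ge_zero[of "entry T i j"]]
    show "cmod (coeff f i * cnj (coeff g j) * entry T i j) \<le> cmod (entry T i j) * (bergman_norm n f * bergman_norm n g)"
      by (simp add: norm_mult mult_ac)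
  qed
  also have "\<dots> = (\<Sum>i<N. \<Sum>j<N. cmod (entry T i j)) * (bergman_norm n f * bergman_norm n g)"
    by (simp add: sum_distrib_right)
  also have "\<dots> \<le> B * (bergman_norm n f * bergman_norm n g)"
    by (intro mult_right_mono B) auto
  finally show "cmod (\<Sum>i<N. \<Sum>j<N. coeff f i * cnj (coeff g j) * entry T i j) \<le> B * (bergman_norm n f * bergman_norm n g)" .
qed

text \<open>For a diagonal matrix the form is a single sum, and Cauchy-Schwarz with Bessel leaves
  the supremum of the entries.\<close>

lemma operator_bound_diagonal:
  assumes T: "T \<in> bounded_operators n" and f: "f \<in> bergman n" and g: "g \<in> bergman n"
    and off: "\<And>i j. i \<noteq> j \<Longrightarrow> entry T i j = 0" and diag: "\<And>i. cmod (entry T i i) \<le> B" and "0 \<le> B"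
  shows "cmod (bergman_inner n (T f) g) \<le> B * (bergman_norm n f * bergman_norm n g)"
proof (rule form_bound[OF T f g])
  fix N
  have L2: "L2_set (\<lambda>i. cmod (coeff h i)) {..<N} \<le> bergman_norm n h" if "h \<in> bergman n" for h
    unfolding L2_set_def using Bessel[OF bergman_square_integrable[OF that], of N] by (intro real_le_lsqrt) auto
  have "(\<Sum>i<N. \<Sum>j<N. coeff f i * cnj (coeff g j) * entry T i j) = (\<Sum>i<N. coeff f i * cnj (coeff g i) * entry T i i)"
  proof (intro sum.cong refl)
    fix i assume "i \<in> {..<N}"
    have "(\<Sum>j<N. coeff f i * cnj (coeff g j) * entry T i j) = (\<Sum>j<N. if j = i then coeff f i * cnj (coeff g i) * entry T i i else 0)"
      using off by (intro sum.cong) auto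
    then show "(\<Sum>j<N. coeff f i * cnj (coeff g j) * entry T i j) = coeff f i * cnj (coeff g i) * entry T i i"
      using \<open>i \<in> {..<N}\<close> by simp
  qed
  also have "cmod \<dots> \<le> (\<Sum>i<N. B * (cmod (coeff f i) * cmod (coeff g i)))"
  proof (intro order_trans[OF norm_sum] sum_mono)
    fix i
    show "cmod (coeff f i * cnj (coeff g i) * entry T i i) \<le> B * (cmod (coeff f i) * cmod (coeff g i))"
      using mult_right_mono[OF diag[of i], of "cmod (coeff f i) * cmod (coeff g i)"] by (simp add: norm_mult mult.commute)
  qed
  also have "\<dots> = B * (\<Sum>i<N. \<bar>cmod (coeff f i)\<bar> * \<bar>cmod (coeff g i)\<bar>)"
    by (simp add: sum_distrib_left)
  also have "\<dots> \<le> B * (L2_set (\<lambda>i. cmod (coeff f i)) {..<N} * L2_set (\<lambda>i. cmod (coeff g i)) {..<N})"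
    by (intro mult_left_mono L2_set_mult_ineq \<open>0 \<le> B\<close>)
  also have "\<dots> \<le> B * (bergman_norm n f * bergman_norm n g)"
    by (intro mult_left_mono mult_mono L2 f g \<open>0 \<le> B\<close>) (auto simp: L2_set_nonneg)
  finally show "cmod (\<Sum>i<N. \<Sum>j<N. coeff f i * cnj (coeff g j) * entry T i j) \<le> B * (bergman_norm n f * bergman_norm n g)" .
qed

text \<open>Testing the form against g = T f bounds the norm of T f. Nonnegativity is a separate
  conclusion because a real supremum is informative only once its set is known to be
  bounded.\<close>

lemma operator_norm_le:
  assumes T: "T \<in> bounded_operators n" and "0 \<le> B"
    and B: "\<And>f g. f \<in> bergman n \<Longrightarrow> g \<in> bergman n \<Longrightarrow> cmod (bergman_inner n (T f) g) \<le> B * (bergman_norm n f * bergman_norm n g)"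
  shows "0 \<le> operator_norm n T" "operator_norm n T \<le> B"
proof -
  have le: "bergman_norm n (T f) \<le> B" if "f \<in> bergman n" "bergman_norm n f \<le> 1" for f
  proof -
    have "(bergman_norm n (T f))\<^sup>2 \<le> B * (bergman_norm n f * bergman_norm n (T f))"
      using B[OF that(1) bounded_operator_bergman[OF T that(1)]] unfolding bergman_inner_self norm_of_real by simp
    also have "\<dots> \<le> B * (1 * bergman_norm n (T f))"
      using that \<open>0 \<le> B\<close> by (intro mult_left_mono mult_right_mono) auto
    finally have "bergman_norm n (T f) * bergman_norm n (T f) \<le> B * bergman_norm n (T f)"
      by (simp add: power2_eq_square)
    then show ?thesis
      using bergman_norm_nonneg[of n "T f"] \<open>0 \<le> B\<close> by (cases "bergman_norm n (T f) = 0") (auto dest: mult_right_le_imp_le)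
  qed
  have ne: "(\<lambda>_. 0) \<in> {f \<in> bergman n. bergman_norm n f \<le> 1}" by (simp add: bergman_zero)
  show "operator_norm n T \<le> B"
    unfolding operator_norm_def using ne le by (intro cSUP_least) auto
  show "0 \<le> operator_norm n T"
    unfolding operator_norm_def
    by (rule cSUP_upper2[OF _ ne]) (use le in \<open>auto intro!: bdd_aboveI[of _ B]\<close>)
qed

text \<open>The matrix unit that sends the basis vector i to the basis vector j.\<close>

definition rank_one :: "nat \<Rightarrow> nat \<Rightarrow> 'd operator" where
  "rank_one i j = (\<lambda>f. if f \<in> bergman n then (\<lambda>z. coeff f i * basis j z) else 0)"

lemma rank_one_bounded: "rank_one i j \<in> bounded_operators n"
proof (rule bounded_operatorI[where C=1])
  fix f :: "'d cfun" assume f: "f \<in> bergman n"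
  note fs = bergman_square_integrable[OF f]
  show "rank_one i j f \<in> bergman n"
    using f by (simp add: rank_one_def bergman_cmult basis_bergman)
  show "bergman_norm n (rank_one i j f) \<le> 1 * bergman_norm n f"
    using f cmod_coeff_le[OF fs, of i] by (simp add: rank_one_def bergman_norm_cmult norm_basis)
  show "rank_one i j (\<lambda>z. c * f z) = (\<lambda>z. c * rank_one i j f z)" for c
    using f by (simp add: rank_one_def bergman_cmult coeff_def bergman_inner_cmult_left mult.assoc)
  fix g :: "'d cfun" assume g: "g \<in> bergman n"
  have "coeff (\<lambda>z. f z + g z) i = coeff f i + coeff g i"
    unfolding coeff_def by (intro bergman_inner_add_left fs bergman_square_integrable g basis_bergman)
  then show "rank_one i j (f + g) = rank_one i j f + rank_one i j g"
    using f g bergman_add[OF f g] by (simp add: rank_one_def plus_fun_def algebra_simps)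
qed (simp add: rank_one_def)

lemma entry_rank_one: "entry (rank_one i j) k l = (if k = i \<and> l = j then 1 else 0)"
  by (auto simp: entry_def rank_one_def basis_bergman bergman_inner_cmult_left coeff_def inner_basis)

lemma entry_toeplitz:
  assumes "continuous_on (cball 0 1) \<phi>"
  shows "entry (toeplitz n \<phi>) i j = bergman_inner n (\<lambda>z. \<phi> z * basis i z) (basis j)"
  unfolding entry_def by (rule inner_toeplitz[OF assms basis_bergman basis_bergman])

end

section \<open>Lipschitz compact operators lie in the Toeplitz algebra\<close>

text \<open>Each term is at most the corresponding difference of 1 / (2 x^2), so the sum telescopes.
  The explicit constant feeds the choice of truncation in the total boundedness argument.\<close>

lemma inverse_cube_sum_le:
  fixes c :: real
  assumes "0 < c + real a"
  shows "(\<Sum>j\<in>{a..<b}. 1 / (c + real j + 1) ^ 3) \<le> 1 / (2 * (c + real a)\<^sup>2)"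
proof (cases "a \<le> b")
  case True
  then have "(\<Sum>j\<in>{a..<b}. 1 / (c + real j + 1) ^ 3) \<le> 1 / (2 * (c + real a)\<^sup>2) - 1 / (2 * (c + real b)\<^sup>2)"
  proof (induction b rule: dec_induct)
    case (step b)
    define x where "x = c + real b"
    have x: "x > 0" using assms step.hyps by (simp add: x_def)
    have "2 * x\<^sup>2 * (x + 1)\<^sup>2 \<le> (2 * x + 1) * (x + 1) * (x + 1)\<^sup>2"
      using x by (intro mult_right_mono) (auto simp: power2_eq_square algebra_simps)
    then have "1 / (x + 1) ^ 3 \<le> (2 * x + 1) / (2 * x\<^sup>2 * (x + 1)\<^sup>2)"
      using x by (simp add: divide_simps power2_eq_square power3_eq_cube mult_ac)
    also have "\<dots> = 1 / (2 * x\<^sup>2) - 1 / (2 * (x + 1)\<^sup>2)"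
      using x by (simp add: divide_simps) (simp add: power2_eq_square algebra_simps)
    finally have "1 / (c + real b + 1) ^ 3 \<le> 1 / (2 * (c + real b)\<^sup>2) - 1 / (2 * (c + real (Suc b))\<^sup>2)"
      by (simp add: x_def add_ac)
    then show ?case
      using step by (simp del: of_nat_Suc)
  qed simp
  also have "\<dots> \<le> 1 / (2 * (c + real a)\<^sup>2)" by simp
  finally show ?thesis .
qed simp

lemma inverse_square_sum_le:
  fixes c :: real
  assumes "0 < c + real a"
  shows "(\<Sum>i\<in>{a..<b}. 1 / (2 * (c + real i + 1)\<^sup>2)) \<le> 1 / (2 * (c + real a))"
proof (cases "a \<le> b")
  case True
  then have "(\<Sum>i\<in>{a..<b}. 1 / (2 * (c + real i + 1)\<^sup>2)) \<le> 1 / (2 * (c + real a)) - 1 / (2 * (c + real b))"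
  proof (induction b rule: dec_induct)
    case (step b)
    define x where "x = c + real b"
    have x: "x > 0" using assms step.hyps by (simp add: x_def)
    have "1 / (2 * (x + 1)\<^sup>2) \<le> 1 / (2 * x * (x + 1))"
      using x by (intro divide_left_mono) (auto simp: power2_eq_square)
    also have "\<dots> = 1 / (2 * x) - 1 / (2 * (x + 1))"
      using x by (simp add: divide_simps)
    finally have "1 / (2 * (c + real b + 1)\<^sup>2) \<le> 1 / (2 * (c + real b)) - 1 / (2 * (c + real (Suc b)))"
      by (simp add: x_def add_ac)
    then show ?case
      using step by (simp del: of_nat_Suc distrib_left_numeral)
  qed simp
  also have "\<dots> \<le> 1 / (2 * (c + real a))" using assms True by simp
  finally show ?thesis .
qed (use assms in simp)

lemma sum_lessThan_if_less: "(\<Sum>j<M. if j < N then x else 0) \<le> real N * x" if "0 \<le> x" for x :: real and M N :: nat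
proof -
  have "(\<Sum>j<M. if j < N then x else 0) = real (card ({..<M} \<inter> {j. j < N})) * x"
    by (simp add: sum.If_cases)
  also have "\<dots> \<le> real N * x"
    using that card_mono[of "{..<N}" "{..<M} \<inter> {j. j < N}"] by (intro mult_right_mono) auto
  finally show ?thesis .
qed

text \<open>The N x N block contributes at most N^2 \<eta>. Outside it, rows with i < N begin at
  column N and the remaining rows at column 0; each kind sums to at most C / (2 N). The bound serves
  twice: with \<eta> = 0 for approximation by finite matrices, and with \<eta> a rounding error for
  total boundedness.\<close>

lemma truncated_sum_le:
  fixes u :: "nat \<Rightarrow> nat \<Rightarrow> real"
  assumes N: "N \<ge> 1" and C: "0 \<le> C" and \<eta>: "0 \<le> \<eta>"
    and out: "\<And>i j. \<not> (i < N \<and> j < N) \<Longrightarrow> u i j \<le> C / real (i + j + 2) ^ 3"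
    and ins: "\<And>i j. i < N \<Longrightarrow> j < N \<Longrightarrow> u i j \<le> \<eta>"
  shows "(\<Sum>i<M. \<Sum>j<M. u i j) \<le> (real N)\<^sup>2 * \<eta> + C / real N"
proof -
  let ?w = "\<lambda>i j. 1 / real (i + j + 2) ^ 3"
  let ?out = "\<lambda>i j. if i < N \<and> j < N then 0 else ?w i j"
  \<comment> \<open>The row bounds are again inverse squares of consecutive numbers, beginning at N
    + 1 in the first case and, as i \<ge> N, also at N + 1 in the second.\<close>
  have row: "(\<Sum>j<M. ?out i j) \<le> (if i < N then 1 / (2 * (real N + real i + 1)\<^sup>2) else 1 / (2 * (0 + real i + 1)\<^sup>2))" for i
  proof (cases "i < N")
    case True
    have "(\<Sum>j<M. ?out i j) = (\<Sum>j\<in>{N..<M}. ?w i j)"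
      using True by (intro sum.mono_neutral_cong_right) auto
    also have "\<dots> \<le> 1 / (2 * (real i + 1 + real N)\<^sup>2)"
      using inverse_cube_sum_le[of "real i + 1" N M] by (simp add: add_ac)
    finally show ?thesis using True by (simp add: add_ac)
  next
    case False
    then have "(\<Sum>j<M. ?out i j) = (\<Sum>j\<in>{0..<M}. ?w i j)"
      by (intro sum.cong) auto
    also have "\<dots> \<le> 1 / (2 * (real i + 1 + real 0)\<^sup>2)"
      using inverse_cube_sum_le[of "real i + 1" 0 M] by (simp add: add_ac)
    finally show ?thesis using False by simp
  qed
  have "(\<Sum>i<M. \<Sum>j<M. ?out i j) \<le> (\<Sum>i<M. (if i < N then 1 / (2 * (real N + real i + 1)\<^sup>2) else 1 / (2 * (0 + real i + 1)\<^sup>2)))"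
    by (intro sum_mono row)
  also have "\<dots> \<le> (\<Sum>i<M. 1 / (2 * (real N + real i + 1)\<^sup>2) + (if i < N then 0 else 1 / (2 * (0 + real i + 1)\<^sup>2)))"
    by (intro sum_mono) auto
  also have "\<dots> = (\<Sum>i\<in>{0..<M}. 1 / (2 * (real N + real i + 1)\<^sup>2)) + (\<Sum>i\<in>{N..<M}. 1 / (2 * (0 + real i + 1)\<^sup>2))"
  proof -
    have "(\<Sum>i<M. (if i < N then 0 else 1 / (2 * (0 + real i + 1)\<^sup>2))) = (\<Sum>i\<in>{N..<M}. 1 / (2 * (0 + real i + 1)\<^sup>2))"
      by (intro sum.mono_neutral_cong_right) auto
    then show ?thesis by (simp add: sum.distrib atLeast0LessThan)
  qed
  also have "\<dots> \<le> 1 / (2 * (real N + real 0)) + 1 / (2 * (0 + real N))"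
    using N by (intro add_mono inverse_square_sum_le) auto
  also have "\<dots> = 1 / real N" by simp
  finally have out_sum: "(\<Sum>i<M. \<Sum>j<M. ?out i j) \<le> 1 / real N" .
  have "(\<Sum>i<M. \<Sum>j<M. u i j) \<le> (\<Sum>i<M. \<Sum>j<M. (if i < N then if j < N then \<eta> else 0 else 0) + C * ?out i j)"
  proof (intro sum_mono)
    fix i j
    show "u i j \<le> (if i < N then if j < N then \<eta> else 0 else 0) + C * ?out i j"
      using out[of i j] ins[of i j] by auto
  qed
  also have "\<dots> = (\<Sum>i<M. \<Sum>j<M. (if i < N then if j < N then \<eta> else 0 else 0)) + C * (\<Sum>i<M. \<Sum>j<M. ?out i j)"
    by (simp add: sum.distrib sum_distrib_left)
  also have "(\<Sum>i<M. \<Sum>j<M. (if i < N then if j < N then \<eta> else 0 else 0)) \<le> (\<Sum>i<M. if i < N then real N * \<eta> else 0)"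
    using sum_lessThan_if_less[OF \<eta>] by (intro sum_mono) auto
  also have "\<dots> \<le> real N * (real N * \<eta>)"
    using \<eta> by (intro sum_lessThan_if_less) simp
  finally show ?thesis
    using mult_left_mono[OF out_sum C] by (simp add: power2_eq_square mult.assoc)
qed

lemma cstar_subalgebra_limit:
  assumes "cstar_subalgebra n \<A>" "T \<in> bounded_operators n" "\<And>m. X m \<in> \<A>"
    "(\<lambda>m. operator_norm n (X m - T)) \<longlonglongrightarrow> 0"
  shows "T \<in> \<A>"
proof -
  have "\<forall>X. \<forall>T\<in>bounded_operators n. (\<forall>m::nat. X m \<in> \<A>) \<longrightarrow>
      (\<lambda>m. operator_norm n (X m - T)) \<longlonglongrightarrow> 0 \<longrightarrow> T \<in> \<A>"
    using assms(1) unfolding cstar_subalgebra_def by (elim conjE)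
  from bspec[OF spec[OF this, of X] assms(2)] assms(3,4) show ?thesis by iprover
qed

section \<open>Matrix units and their norm limits in the Toeplitz algebra\<close>

context bergman_basis begin

lemma n_pos: "n \<ge> 1"
  using n zero_less_card_finite[where 'a='d] by linarith

lemma truncated_form_bound:
  assumes T: "T \<in> bounded_operators n" and f: "f \<in> bergman n" and g: "g \<in> bergman n"
    and "N \<ge> 1" "0 \<le> C" "0 \<le> \<eta>"
    and out: "\<And>i j. \<not> (i < N \<and> j < N) \<Longrightarrow> cmod (entry T i j) \<le> C / real (i + j + 2) ^ 3"
    and ins: "\<And>i j. i < N \<Longrightarrow> j < N \<Longrightarrow> cmod (entry T i j) \<le> \<eta>"
  shows "cmod (bergman_inner n (T f) g) \<le> ((real N)\<^sup>2 * \<eta> + C / real N) * (bergman_norm n f * bergman_norm n g)"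
  by (rule operator_bound_entries[OF T f g]) (rule truncated_sum_le[OF assms(4-8)])

lemma lip_compact_weighted_entry_le:
  assumes K: "K \<in> lip_compact n \<kappa>"
  shows "real (i + j + 2) ^ (n + 2) * cmod (entry K i j) \<le> lip_compact_norm n \<kappa> K"
proof -
  let ?g = "\<lambda>(i, j). real (i + j) ^ (n + 2) * cmod (matrix_entry n \<kappa> K i j)"
  have bdd: "bdd_above (?g ` ({1..} \<times> {1..}))" using K by (simp add: lip_compact_def)
  show ?thesis
    using cSUP_upper[OF _ bdd, of "(Suc i, Suc j)"] by (simp add: lip_compact_norm_def matrix_entry_Suc)
qed

text \<open>As d is positive, n + 2 is at least 3 and the base i + j + 2 exceeds 1, so the weight
  may be lowered to the cube. Cubic decay is all that the summation estimates require.\<close>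

lemma lip_compact_entry:
  assumes K: "K \<in> lip_compact n \<kappa>"
  shows "cmod (entry K i j) \<le> lip_compact_norm n \<kappa> K / real (i + j + 2) ^ 3"
    and "0 \<le> lip_compact_norm n \<kappa> K"
proof -
  note le = lip_compact_weighted_entry_le[OF K]
  from order_trans[OF _ le[of 0 0]] show "0 \<le> lip_compact_norm n \<kappa> K" by simp
  have "real (i + j + 2) ^ 3 * cmod (entry K i j) \<le> real (i + j + 2) ^ (n + 2) * cmod (entry K i j)"
    using n_pos by (intro mult_right_mono power_increasing) auto
  also note le
  finally show "cmod (entry K i j) \<le> lip_compact_norm n \<kappa> K / real (i + j + 2) ^ 3"
    by (simp add: field_simps)
qed

lemma lip_compact_bounded: "K \<in> lip_compact n \<kappa> \<Longrightarrow> K \<in> bounded_operators n"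
  by (simp add: lip_compact_def compact_operators_def)

lemma bergman_projection_id:
  assumes g: "g \<in> bergman n"
  shows "bergman_projection n g = (g :: 'd cfun)"
proof -
  note gs = bergman_square_integrable[OF g]
  have m: "bergman_projection n g \<in> bergman n" by (rule bergman_projection(1)[OF gs])
  have d: "(\<lambda>z. bergman_projection n g z - g z) \<in> bergman n" by (rule bergman_diff[OF m g])
  have "bergman_inner n (\<lambda>z. bergman_projection n g z - g z) (\<lambda>z. bergman_projection n g z - g z) = 0"
    using bergman_projection(2)[OF gs d] gs
    by (simp add: bergman_inner_diff_left bergman_square_integrable[OF m] bergman_square_integrable[OF d])
  then have "bergman_norm n (\<lambda>z. bergman_projection n g z - g z) = 0" by (simp add: bergman_inner_self)
  from bergman_norm_eq_zero[OF d this] show ?thesis by (simp add: fun_eq_iff)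
qed

text \<open>The position of the constant function 1 in the enumeration, which is not
  prescribed.\<close>

definition vacuum :: nat where
  "vacuum = (SOME j. monomial_basis n (\<lambda>_. 0) = basis j)"

lemma basis_vacuum: "basis vacuum z = (if z \<in> ball 0 1 then 1 else 0)"
proof -
  have "monomial_basis n (\<lambda>_. 0) = basis vacuum"
    unfolding vacuum_def by (rule someI_ex[OF basis_surj])
  then have "basis vacuum z = monomial_basis n (\<lambda>_. 0) z" by simp
  then show ?thesis by (simp add: monomial_basis_def)
qed

abbreviation degree_of :: "nat \<Rightarrow> nat" where
  "degree_of i \<equiv> \<Sum>l\<in>UNIV. \<kappa> (Suc i) l"

lemma degree_vacuum: "degree_of vacuum = 0" and degree_pos: "i \<noteq> vacuum \<Longrightarrow> degree_of i \<ge> 1"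
proof -
  have eq: "monomial_basis n (\<lambda>_. 0) = basis vacuum"
    unfolding vacuum_def by (rule someI_ex[OF basis_surj])
  have \<kappa>0: "\<kappa> (Suc vacuum) = (\<lambda>_. 0)"
  proof (rule ccontr)
    assume "\<kappa> (Suc vacuum) \<noteq> (\<lambda>_. 0)"
    then have "bergman_inner n (basis vacuum) (basis vacuum) = 0"
      using bergman_inner_monomial_basis[OF n, of "\<lambda>_. 0" "\<kappa> (Suc vacuum)"] unfolding eq
      by (auto simp: basis_def)
    then show False by (simp add: inner_basis)
  qed
  then show "degree_of vacuum = 0" by simp
  assume "i \<noteq> vacuum"
  then have "\<kappa> (Suc i) \<noteq> \<kappa> (Suc vacuum)"
    using \<kappa> by (auto simp: bij_betw_def inj_on_def)
  then obtain l where "\<kappa> (Suc i) l \<noteq> 0" unfolding \<kappa>0 by auto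
  then show "degree_of i \<ge> 1"
    using member_le_sum[of l UNIV "\<kappa> (Suc i)"] by simp
qed

definition radial_symbol :: "nat \<Rightarrow> 'd cfun" where
  "radial_symbol m z = of_real ((1 - (norm z)\<^sup>2) ^ m)"

lemma radial_symbol_continuous: "continuous_on A (radial_symbol m)"
  unfolding radial_symbol_def[abs_def] by (intro continuous_intros)

lemma entry_radial_off:
  assumes "i \<noteq> j"
  shows "entry (toeplitz n (radial_symbol m)) i j = 0"
proof -
  have "\<kappa> (Suc i) \<noteq> \<kappa> (Suc j)"
    using \<kappa> assms by (auto simp: bij_betw_def inj_on_def)
  moreover have "radial_symbol m \<in> borel_measurable borel"
    by (intro borel_measurable_continuous_onI radial_symbol_continuous)
  moreover have "radial_symbol m (coord_scale1 l s z) = radial_symbol m z" if "cmod s = 1" for l s z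
  proof -
    have "norm (coord_scale1 l s z) = norm z" using that by (intro norm_coord_scale_eq) auto
    then show ?thesis by (simp add: radial_symbol_def)
  qed
  ultimately show ?thesis
    unfolding entry_toeplitz[OF radial_symbol_continuous] basis_def
    by (intro monomial_basis_orthogonal_weighted) auto
qed

lemma entry_radial_diag:
  "entry (toeplitz n (radial_symbol m)) i i
    = of_real (fact (n - CARD('d) + m) / fact (n - CARD('d)) * (fact (degree_of i + n) / fact (degree_of i + n + m)))"
proof -
  have "entry (toeplitz n (radial_symbol m)) i i
      = (LINT z|ball_measure n. of_real ((1 - (norm z)\<^sup>2) ^ m * (cmod (monomial_basis n (\<kappa> (Suc i)) z))\<^sup>2))"
    unfolding entry_toeplitz[OF radial_symbol_continuous] bergman_inner_def basis_def
    by (intro Bochner_Integration.integral_cong) (simp_all add: radial_symbol_def mult.assoc flip: complex_norm_square)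
  then show ?thesis
    unfolding integral_complex_of_real monomial_weighted_integral[OF n] .
qed

text \<open>The quotient decreases in K, so degree 1 is the worst case. There it equals its value at
  degree 0 times (n + 1) / (n + m + 1), a factor that tends to 0 as m grows.\<close>

lemma factorial_ratio_le:
  assumes "K \<ge> 1"
  shows "fact (K + n) / fact (K + n + m) \<le> (real n + 1) / (real n + real m + 1) * (fact n / fact (n + m) :: real)"
  using assms
proof (induction K rule: dec_induct)
  case base
  show ?case by (simp add: field_simps)
next
  case (step K)
  have "(fact (Suc K + n) / fact (Suc K + n + m) :: real)
      = (real (Suc (K + n)) / real (Suc (K + n + m))) * (fact (K + n) / fact (K + n + m))"
    by (simp del: of_nat_Suc)
  also have "\<dots> \<le> 1 * (fact (K + n) / fact (K + n + m))"
    by (intro mult_right_mono) auto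
  finally show ?case using step.IH by simp
qed

text \<open>Radial Toeplitz operators are diagonal with eigenvalues depending on the degree only.
  After normalization the eigenvalue at degree 0 is 1 and all others tend to 0 uniformly, so the
  limit is in norm.\<close>

lemma vacuum_projection_in_algebra:
  assumes A: "cstar_subalgebra n \<A>" and toep: "\<And>\<phi>. continuous_on (cball 0 1) \<phi> \<Longrightarrow> toeplitz n \<phi> \<in> \<A>"
  shows "rank_one vacuum vacuum \<in> \<A>"
proof -
  have BO: "\<A> \<subseteq> bounded_operators n" using A by (simp add: cstar_subalgebra_def)
  \<comment> \<open>The eigenvalue of the m-th radial operator at the constants, by which
    \<open>X m\<close> is normalized.\<close>
  let ?a = "\<lambda>m. fact (n - CARD('d) + m) / fact (n - CARD('d)) * (fact n / fact (n + m)) :: real"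
  let ?T = "\<lambda>m. toeplitz n (radial_symbol m)"
  define X where "X m = (\<lambda>f z. of_real (1 / ?a m) * ?T m f z)" for m
  have T: "?T m \<in> \<A>" for m by (rule toep[OF radial_symbol_continuous])
  have X: "X m \<in> \<A>" for m
    using A T[of m] unfolding X_def cstar_subalgebra_def by blast
  have a: "?a m > 0" for m by simp
  have D: "X m - rank_one vacuum vacuum \<in> bounded_operators n" for m
    using X BO by (intro bounded_operators_diff rank_one_bounded) auto
  have ent: "entry (X m - rank_one vacuum vacuum) i j
      = of_real (1 / ?a m) * entry (?T m) i j - (if i = vacuum \<and> j = vacuum then 1 else 0)" for m i j
  proof -
    have "entry (X m) i j = of_real (1 / ?a m) * entry (?T m) i j" by (simp only: X_def entry_cmult)
    then show ?thesis
      using X BO by (subst entry_diff[OF _ rank_one_bounded]) (auto simp: entry_rank_one)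
  qed
  have bound: "cmod (bergman_inner n ((X m - rank_one vacuum vacuum) f) g)
      \<le> (real n + 1) / (real n + real m + 1) * (bergman_norm n f * bergman_norm n g)"
    if "f \<in> bergman n" "g \<in> bergman n" for m f g
  proof (rule operator_bound_diagonal[OF D that])
    show "entry (X m - rank_one vacuum vacuum) i j = 0" if "i \<noteq> j" for i j
      using that by (auto simp: ent entry_radial_off)
    show "cmod (entry (X m - rank_one vacuum vacuum) i i) \<le> (real n + 1) / (real n + real m + 1)" for i
    proof (cases "i = vacuum")
      case True
      have "of_real (1 / ?a m) * entry (?T m) i i = 1"
        unfolding entry_radial_diag of_real_mult[symmetric] True degree_vacuum using a[of m] by simp
      then show ?thesis using True by (simp add: ent)
    next
      case False
      have "entry (X m - rank_one vacuum vacuum) i i = of_real ((fact (degree_of i + n) / fact (degree_of i + n + m)) / (fact n / fact (n + m)))"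
        using False unfolding ent entry_radial_diag by (simp add: mult_ac)
      then have "cmod (entry (X m - rank_one vacuum vacuum) i i) = (fact (degree_of i + n) / fact (degree_of i + n + m)) / (fact n / fact (n + m))"
        by (simp only: norm_of_real) simp
      also have "\<dots> \<le> (real n + 1) / (real n + real m + 1)"
        using factorial_ratio_le[OF degree_pos[OF False], of m]
        by (subst pos_divide_le_eq) auto
      finally show ?thesis .
    qed
  qed simp
  have le: "0 \<le> operator_norm n (X m - rank_one vacuum vacuum)"
    "operator_norm n (X m - rank_one vacuum vacuum) \<le> (real n + 1) / (real n + real m + 1)" for m
    by (rule operator_norm_le[OF D _ bound]; simp)+
  have "(\<lambda>m. operator_norm n (X m - rank_one vacuum vacuum)) \<longlonglongrightarrow> 0"
  proof (rule tendsto_sandwich[OF _ _ tendsto_const])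
    show "\<forall>\<^sub>F m in sequentially. 0 \<le> operator_norm n (X m - rank_one vacuum vacuum)"
      "\<forall>\<^sub>F m in sequentially. operator_norm n (X m - rank_one vacuum vacuum) \<le> (real n + 1) / (real n + real m + 1)"
      by (intro always_eventually allI le)+
    show "(\<lambda>m. (real n + 1) / (real n + real m + 1)) \<longlonglongrightarrow> 0" by real_asymp
  qed
  then show ?thesis
    by (rule cstar_subalgebra_limit[OF A rank_one_bounded, where X=X, OF X])
qed

text \<open>The basis polynomial on all of the space. A symbol must be continuous on the closed
  ball, whereas \<open>basis\<close> jumps to 0 at the sphere.\<close>

definition basis_symbol :: "nat \<Rightarrow> 'd cfun" where
  "basis_symbol i z = of_real (monomial_coeff n (\<kappa> (Suc i))) * (\<Prod>l\<in>UNIV. (z $ l) ^ \<kappa> (Suc i) l)"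

lemma basis_symbol_continuous: "continuous_on A (basis_symbol i)"
  unfolding basis_symbol_def[abs_def] by (intro continuous_intros)

lemma basis_out: "z \<notin> ball 0 1 \<Longrightarrow> basis i z = 0"
  by (simp add: basis_def monomial_basis_out del: mem_ball mem_ball_0)

lemma basis_symbol_eq: "z \<in> ball 0 1 \<Longrightarrow> basis_symbol i z = basis i z"
  by (simp add: basis_symbol_def basis_def monomial_basis_in del: mem_ball mem_ball_0)

text \<open>With P the projection onto the constants, the product of T with symbol e_j, of P, and of
  T with symbol cnj e_i is the matrix unit: the last factor gives f the constant coefficient of f
  along e_i, and the first sends the constant 1 to e_j.\<close>

lemma rank_one_in_algebra:
  assumes A: "cstar_subalgebra n \<A>" and toep: "\<And>\<phi>. continuous_on (cball 0 1) \<phi> \<Longrightarrow> toeplitz n \<phi> \<in> \<A>"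
  shows "rank_one i j \<in> \<A>"
proof -
  have BO: "\<A> \<subseteq> bounded_operators n" using A by (simp add: cstar_subalgebra_def)
  let ?S = "toeplitz n (basis_symbol j)" and ?T = "toeplitz n (\<lambda>z. cnj (basis_symbol i z))"
  have contT: "continuous_on (cball 0 1) (\<lambda>z. cnj (basis_symbol i z))"
    by (intro continuous_intros basis_symbol_continuous)
  have S: "?S \<in> \<A>" and T: "?T \<in> \<A>"
    by (rule toep[OF basis_symbol_continuous], rule toep[OF contT])
  note R = vacuum_projection_in_algebra[OF A toep]
  have Sb: "?S (basis vacuum) = basis j"
  proof -
    have "(\<lambda>z. basis_symbol j z * basis vacuum z) = basis j"
    proof
      fix z show "basis_symbol j z * basis vacuum z = basis j z"
        by (cases "z \<in> ball 0 1") (simp_all add: basis_vacuum basis_symbol_eq basis_out del: mem_ball mem_ball_0)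
    qed
    then show ?thesis
      by (simp add: toeplitz_def basis_bergman bergman_projection_id)
  qed
  have "?S \<circ> (rank_one vacuum vacuum \<circ> ?T) = rank_one i j"
  proof
    fix f
    show "(?S \<circ> (rank_one vacuum vacuum \<circ> ?T)) f = rank_one i j f"
    proof (cases "f \<in> bergman n")
      case True
      have Tf: "?T f \<in> bergman n" by (rule toeplitz_bergman[OF contT True])
      have "coeff (?T f) vacuum = bergman_inner n (\<lambda>z. cnj (basis_symbol i z) * f z) (basis vacuum)"
        unfolding coeff_def by (rule inner_toeplitz[OF contT True basis_bergman])
      also have "(\<lambda>z. cnj (basis_symbol i z) * f z * cnj (basis vacuum z)) = (\<lambda>z. f z * cnj (basis i z))"
      proof
        fix z show "cnj (basis_symbol i z) * f z * cnj (basis vacuum z) = f z * cnj (basis i z)"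
          using True by (cases "z \<in> ball 0 1") (auto simp: basis_vacuum basis_symbol_eq bergman_def simp del: mem_ball mem_ball_0)
      qed
      then have "bergman_inner n (\<lambda>z. cnj (basis_symbol i z) * f z) (basis vacuum) = coeff f i"
        by (simp add: bergman_inner_def coeff_def)
      finally have "rank_one vacuum vacuum (?T f) = (\<lambda>z. coeff f i * basis vacuum z)"
        using Tf by (simp add: rank_one_def)
      moreover have "?S (\<lambda>z. coeff f i * basis vacuum z) = (\<lambda>z. coeff f i * ?S (basis vacuum) z)"
        using S BO by (intro bounded_operator_cmult basis_bergman) auto
      ultimately show ?thesis
        using True by (simp add: Sb rank_one_def)
    next
      case False
      have "?T f = (\<lambda>_. 0)" using False by (simp add: toeplitz_def zero_fun_def)
      moreover have "rank_one vacuum vacuum (\<lambda>_. 0) = (\<lambda>_. 0)"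
        by (rule bounded_operator_zero[OF rank_one_bounded])
      moreover have "?S (\<lambda>_. 0) = (\<lambda>_. 0)"
        using S BO by (intro bounded_operator_zero) auto
      ultimately have "(?S \<circ> (rank_one vacuum vacuum \<circ> ?T)) f = (\<lambda>_. 0)" by (simp only: o_apply)
      then show ?thesis using False by (simp only:) (simp add: rank_one_def zero_fun_def)
    qed
  qed
  moreover have "?S \<circ> (rank_one vacuum vacuum \<circ> ?T) \<in> \<A>"
    using A S T R unfolding cstar_subalgebra_def by blast
  ultimately show ?thesis by simp
qed

lemma lip_compact_in_algebra:
  assumes A: "cstar_subalgebra n \<A>" and toep: "\<And>\<phi>. continuous_on (cball 0 1) \<phi> \<Longrightarrow> toeplitz n \<phi> \<in> \<A>"
    and K: "K \<in> lip_compact n \<kappa>"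
  shows "K \<in> \<A>"
proof -
  have BO: "\<A> \<subseteq> bounded_operators n" using A by (simp add: cstar_subalgebra_def)
  have fin: "finite P \<Longrightarrow> (\<lambda>f z. \<Sum>p\<in>P. c p * rank_one (fst p) (snd p) f z) \<in> \<A>" for P and c :: "nat \<times> nat \<Rightarrow> complex"
  proof (induction P rule: finite_induct)
    case empty
    have "(\<lambda>f z. \<Sum>p\<in>{}. c p * rank_one (fst p) (snd p) f z) = 0" by (simp add: zero_fun_def)
    then show ?case using A by (simp add: cstar_subalgebra_def)
  next
    case (insert p P)
    have "(\<lambda>f z. c p * rank_one (fst p) (snd p) f z) \<in> \<A>"
      using A rank_one_in_algebra[OF A toep, of "fst p" "snd p"] unfolding cstar_subalgebra_def by blast
    with insert.IH have "(\<lambda>f z. c p * rank_one (fst p) (snd p) f z) + (\<lambda>f z. \<Sum>p\<in>P. c p * rank_one (fst p) (snd p) f z) \<in> \<A>"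
      using A unfolding cstar_subalgebra_def by blast
    moreover have "(\<lambda>f z. c p * rank_one (fst p) (snd p) f z) + (\<lambda>f z. \<Sum>p\<in>P. c p * rank_one (fst p) (snd p) f z)
        = (\<lambda>f z. \<Sum>p\<in>insert p P. c p * rank_one (fst p) (snd p) f z)"
      using insert.hyps by (simp add: plus_fun_def)
    ultimately show ?case by simp
  qed
  \<comment> \<open>The N x N corner of K, a finite combination of matrix units.\<close>
  define X where "X N = (\<lambda>f z. \<Sum>p\<in>{..<N} \<times> {..<N}. entry K (fst p) (snd p) * rank_one (fst p) (snd p) f z)" for N
  have X: "X N \<in> \<A>" for N unfolding X_def by (rule fin) simp
  have Kb: "K \<in> bounded_operators n" by (rule lip_compact_bounded[OF K])
  have D: "X N - K \<in> bounded_operators n" for N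
    using X BO Kb by (intro bounded_operators_diff) auto
  have entX: "entry (X N) i j = (if i < N \<and> j < N then entry K i j else 0)" for N i j
  proof -
    have "entry (X N) i j = (\<Sum>p\<in>{..<N} \<times> {..<N}. entry K (fst p) (snd p) * entry (rank_one (fst p) (snd p)) i j)"
      unfolding X_def entry_def
      by (rule bergman_inner_sum_left)
         (intro bergman_square_integrable bounded_operator_bergman[OF rank_one_bounded] basis_bergman)+
    also have "\<dots> = (\<Sum>p\<in>{..<N} \<times> {..<N}. if p = (i, j) then entry K i j else 0)"
      by (intro sum.cong) (auto simp: entry_rank_one)
    also have "\<dots> = (if i < N \<and> j < N then entry K i j else 0)" by simp
    finally show ?thesis .
  qed
  let ?C = "lip_compact_norm n \<kappa> K"
  have ent: "entry (X N - K) i j = (if i < N \<and> j < N then 0 else - entry K i j)" for N i j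
    using X BO Kb by (subst entry_diff) (auto simp: entX)
  \<comment> \<open>Inside the corner the difference vanishes, so only the tail ?C / N of the
    truncated sum is left. \<open>Suc N\<close> keeps the denominator positive.\<close>
  have bound: "cmod (bergman_inner n ((X (Suc N) - K) f) g) \<le> ?C / real (Suc N) * (bergman_norm n f * bergman_norm n g)"
    if fg: "f \<in> bergman n" "g \<in> bergman n" for N f g
  proof -
    have "cmod (bergman_inner n ((X (Suc N) - K) f) g)
        \<le> ((real (Suc N))\<^sup>2 * 0 + ?C / real (Suc N)) * (bergman_norm n f * bergman_norm n g)"
      by (rule truncated_form_bound[OF D fg])
         (use lip_compact_entry[OF K] in \<open>auto simp: ent\<close>)
    then show ?thesis by simp
  qed
  have le: "0 \<le> operator_norm n (X (Suc N) - K)" "operator_norm n (X (Suc N) - K) \<le> ?C / real (Suc N)" for N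
    by (rule operator_norm_le[OF D _ bound]; simp add: lip_compact_entry(2)[OF K])+
  have "(\<lambda>N. operator_norm n (X (Suc N) - K)) \<longlonglongrightarrow> 0"
  proof (rule tendsto_sandwich[OF _ _ tendsto_const])
    show "\<forall>\<^sub>F N in sequentially. 0 \<le> operator_norm n (X (Suc N) - K)"
      "\<forall>\<^sub>F N in sequentially. operator_norm n (X (Suc N) - K) \<le> ?C / real (Suc N)"
      by (intro always_eventually allI le)+
    have "(\<lambda>N. ?C * (1 / real (Suc N))) \<longlonglongrightarrow> ?C * 0"
      by (intro tendsto_intros LIMSEQ_Suc lim_1_over_n)
    then show "(\<lambda>N. ?C / real (Suc N)) \<longlonglongrightarrow> 0" by simp
  qed
  then show ?thesis
    by (rule cstar_subalgebra_limit[OF A Kb, where X="\<lambda>N. X (Suc N)", OF X])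
qed

lemma lip_compact_toeplitz_algebra: "lip_compact n \<kappa> \<subseteq> toeplitz_algebra n"
proof
  fix K assume K: "K \<in> lip_compact n \<kappa>"
  show "K \<in> toeplitz_algebra n"
    unfolding toeplitz_algebra_def hull_def
  proof (rule InterI)
    fix \<A> :: "'d operator set"
    assume "\<A> \<in> {t. cstar_subalgebra n t \<and> {toeplitz n \<phi> |\<phi>. continuous_on (cball 0 1) \<phi>} \<subseteq> t}"
    then have A: "cstar_subalgebra n \<A>" and sub: "{toeplitz n \<phi> |\<phi>. continuous_on (cball 0 1) \<phi>} \<subseteq> \<A>"
      by simp_all
    show "K \<in> \<A>"
    proof (rule lip_compact_in_algebra[OF A _ K])
      fix \<phi> :: "'d cfun" assume "continuous_on (cball 0 1) \<phi>"
      then show "toeplitz n \<phi> \<in> \<A>" by (intro subsetD[OF sub]) blast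
    qed
  qed
qed

end

section \<open>Lip-norms from total boundedness\<close>

text \<open>Positivity of e makes the multiples r e increase with r, as \<open>le_unit_mono\<close>
  records.\<close>

locale order_unit =
  fixes A :: "'v::real_vector set" and le :: "'v \<Rightarrow> 'v \<Rightarrow> bool" and e :: 'v
  assumes ous: "order_unit_space A le e" and unit_pos: "le 0 e"
begin

lemma subspace_A: "subspace A" and unit_in: "e \<in> A"
  using ous by (simp_all add: order_unit_space_def)

lemma le_trans: "a \<in> A \<Longrightarrow> b \<in> A \<Longrightarrow> c \<in> A \<Longrightarrow> le a b \<Longrightarrow> le b c \<Longrightarrow> le a c"
  using ous unfolding order_unit_space_def by blast

lemma le_add: "a \<in> A \<Longrightarrow> b \<in> A \<Longrightarrow> c \<in> A \<Longrightarrow> le a b \<Longrightarrow> le (a + c) (b + c)"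
  using ous unfolding order_unit_space_def by blast

lemma le_scale: "a \<in> A \<Longrightarrow> b \<in> A \<Longrightarrow> 0 \<le> r \<Longrightarrow> le a b \<Longrightarrow> le (r *\<^sub>R a) (r *\<^sub>R b)"
  using ous unfolding order_unit_space_def by blast

lemma scale_in: "a \<in> A \<Longrightarrow> r *\<^sub>R a \<in> A" and add_in: "a \<in> A \<Longrightarrow> b \<in> A \<Longrightarrow> a + b \<in> A"
  and diff_in: "a \<in> A \<Longrightarrow> b \<in> A \<Longrightarrow> a - b \<in> A" and zero_in: "0 \<in> A"
  using subspace_A by (auto simp: subspace_add subspace_diff subspace_0 subspace_scale)

lemma le_unit_mono:
  assumes "r \<le> s"
  shows "le (r *\<^sub>R e) (s *\<^sub>R e)"
proof -
  have "le ((s - r) *\<^sub>R 0) ((s - r) *\<^sub>R e)"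
    using assms by (intro le_scale zero_in unit_in unit_pos) simp
  then have "le ((s - r) *\<^sub>R 0 + r *\<^sub>R e) ((s - r) *\<^sub>R e + r *\<^sub>R e)"
    by (intro le_add scale_in zero_in unit_in)
  then show ?thesis by (simp add: algebra_simps)
qed

text \<open>Both a and -a are dominated by multiples of e, so the set under the infimum is nonempty;
  a real \<open>Inf\<close> carries information only then.\<close>

lemma order_unit_norm_nonneg:
  assumes a: "a \<in> A"
  shows "0 \<le> order_unit_norm le e a"
proof -
  have bound: "\<exists>r. le b (r *\<^sub>R e)" if "b \<in> A" for b
    using ous that unfolding order_unit_space_def by blast
  obtain r where r: "le a (r *\<^sub>R e)" using bound[OF a] by blast
  obtain s where s: "le (- 1 *\<^sub>R a) (s *\<^sub>R e)" using bound[OF scale_in[OF a, of "- 1"]] by blast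
  define R where "R = max \<bar>r\<bar> \<bar>s\<bar>"
  have "le a (R *\<^sub>R e)"
    by (rule le_trans[OF a _ _ r le_unit_mono]) (auto simp: R_def intro: scale_in unit_in)
  moreover have "le (- R *\<^sub>R e) a"
  proof -
    have "le (- 1 *\<^sub>R a) (R *\<^sub>R e)"
      by (rule le_trans[OF _ _ _ s le_unit_mono]) (auto simp: R_def intro: scale_in[OF a, of "- 1", simplified] scale_in unit_in)
    then have "le (- 1 *\<^sub>R a + (a - R *\<^sub>R e)) (R *\<^sub>R e + (a - R *\<^sub>R e))"
      by (intro le_add scale_in diff_in a unit_in)
    then show ?thesis by simp
  qed
  ultimately have "R \<in> {r. 0 \<le> r \<and> le (- r *\<^sub>R e) a \<and> le a (r *\<^sub>R e)}"
    by (simp add: R_def)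
  then show ?thesis
    unfolding order_unit_norm_def by (intro cInf_greatest) auto
qed

lemma order_unit_norm_le:
  assumes "0 \<le> r" "le (- r *\<^sub>R e) a" "le a (r *\<^sub>R e)"
  shows "order_unit_norm le e a \<le> r"
  unfolding order_unit_norm_def
  by (rule cInf_lower) (use assms in \<open>auto intro!: bdd_belowI[of _ 0]\<close>)

lemma state_add: "\<mu> \<in> states A le e \<Longrightarrow> a \<in> A \<Longrightarrow> b \<in> A \<Longrightarrow> \<mu> (a + b) = \<mu> a + \<mu> b"
  and state_scale: "\<mu> \<in> states A le e \<Longrightarrow> a \<in> A \<Longrightarrow> \<mu> (r *\<^sub>R a) = r * \<mu> a"
  and state_unit: "\<mu> \<in> states A le e \<Longrightarrow> \<mu> e = 1"
  and state_extensional: "\<mu> \<in> states A le e \<Longrightarrow> \<mu> \<in> extensional A"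
  by (simp_all add: states_def)

lemma state_diff: "\<mu> \<in> states A le e \<Longrightarrow> a \<in> A \<Longrightarrow> b \<in> A \<Longrightarrow> \<mu> (a - b) = \<mu> a - \<mu> b"
  using state_add[of \<mu> a "-1 *\<^sub>R b"] state_scale[of \<mu> b "-1"] scale_in[of b "-1"] by simp

text \<open>The supremum in the definition of a state bounds its members only because the set is
  bounded above, and this comes from the boundedness constant C of the state.\<close>

lemma state_abs_le_one:
  assumes \<mu>: "\<mu> \<in> states A le e" and a: "a \<in> A" and "order_unit_norm le e a \<le> 1"
  shows "\<bar>\<mu> a\<bar> \<le> 1"
proof -
  obtain C where C: "\<forall>a\<in>A. \<bar>\<mu> a\<bar> \<le> C * order_unit_norm le e a"
    using \<mu> by (auto simp: states_def)
  have "bdd_above ((\<lambda>a. \<bar>\<mu> a\<bar>) ` {a \<in> A. order_unit_norm le e a \<le> 1})"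
  proof (rule bdd_aboveI2)
    fix b assume b: "b \<in> {a \<in> A. order_unit_norm le e a \<le> 1}"
    have "\<bar>\<mu> b\<bar> \<le> C * order_unit_norm le e b" using C b by simp
    also have "\<dots> \<le> \<bar>C\<bar> * 1" using b order_unit_norm_nonneg[of b] by (intro mult_mono) auto
    finally show "\<bar>\<mu> b\<bar> \<le> \<bar>C\<bar>" by simp
  qed
  then have "\<bar>\<mu> a\<bar> \<le> (SUP a\<in>{a\<in>A. order_unit_norm le e a \<le> 1}. \<bar>\<mu> a\<bar>)"
    using a assms(3) by (intro cSUP_upper) auto
  also have "\<dots> = 1" using \<mu> by (simp add: states_def)
  finally show ?thesis .
qed

text \<open>Rescaling by 1 / r brings a into the order-unit ball. From here on states are estimated
  through order intervals alone.\<close>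

lemma state_abs_le:
  assumes \<mu>: "\<mu> \<in> states A le e" and a: "a \<in> A" and r: "0 < r" "le (- r *\<^sub>R e) a" "le a (r *\<^sub>R e)"
  shows "\<bar>\<mu> a\<bar> \<le> r"
proof -
  have "le ((1 / r) *\<^sub>R (- r *\<^sub>R e)) ((1 / r) *\<^sub>R a)" "le ((1 / r) *\<^sub>R a) ((1 / r) *\<^sub>R (r *\<^sub>R e))"
    using r by (intro le_scale scale_in unit_in a; simp)+
  then have "order_unit_norm le e ((1 / r) *\<^sub>R a) \<le> 1"
    using r by (intro order_unit_norm_le) auto
  then have "\<bar>\<mu> ((1 / r) *\<^sub>R a)\<bar> \<le> 1"
    by (intro state_abs_le_one \<mu> scale_in a)
  then show ?thesis
    using r by (simp add: state_scale[OF \<mu> a] abs_mult field_simps)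
qed

end

text \<open>Total boundedness of the set L \<le> 1 modulo scalars, encoded by colourings: for each
  \<epsilon> there are finitely many colours, and elements of equal colour differ by a scalar up to
  \<epsilon> in the order. A rounding map of coordinates is such a colouring, so no net has to be
  exhibited inside A.\<close>

locale order_unit_seminorm = order_unit A le e
  for A :: "'v::real_vector set" and le :: "'v \<Rightarrow> 'v \<Rightarrow> bool" and e :: 'v +
  fixes L :: "'v \<Rightarrow> real" and col :: "real \<Rightarrow> 'v \<Rightarrow> 'c"
  assumes L_nonneg: "a \<in> A \<Longrightarrow> 0 \<le> L a"
    and L_add: "a \<in> A \<Longrightarrow> b \<in> A \<Longrightarrow> L (a + b) \<le> L a + L b"
    and L_scale: "a \<in> A \<Longrightarrow> L (r *\<^sub>R a) = \<bar>r\<bar> * L a"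
    and L_unit: "L e = 0"
    and col_finite: "\<epsilon> > 0 \<Longrightarrow> finite (col \<epsilon> ` {a \<in> A. L a \<le> 1})"
    and col_close: "\<lbrakk>\<epsilon> > 0; a \<in> A; b \<in> A; L a \<le> 1; L b \<le> 1; col \<epsilon> a = col \<epsilon> b\<rbrakk>
      \<Longrightarrow> \<exists>c. le (- \<epsilon> *\<^sub>R e) (a - b - c *\<^sub>R e) \<and> le (a - b - c *\<^sub>R e) (\<epsilon> *\<^sub>R e)"
begin

abbreviation S :: "('v \<Rightarrow> real) set" where "S \<equiv> states A le e"

definition dist_L :: "('v \<Rightarrow> real) \<Rightarrow> ('v \<Rightarrow> real) \<Rightarrow> real" where
  "dist_L \<mu> \<nu> = enn2real (state_distance A L \<mu> \<nu>)"

text \<open>One representative is kept for each colour. All states agree on c e, so the scalar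
  cancels in \<mu> a - \<nu> a, and each of the two states contributes an error \<epsilon>.\<close>

lemma finite_net:
  assumes "\<epsilon> > 0"
  obtains F where "finite F" "F \<subseteq> A"
    "\<And>a \<mu> \<nu>. \<lbrakk>a \<in> A; L a \<le> 1; \<mu> \<in> S; \<nu> \<in> S\<rbrakk> \<Longrightarrow> \<exists>b\<in>F. \<bar>(\<mu> a - \<nu> a) - (\<mu> b - \<nu> b)\<bar> \<le> 2 * \<epsilon>"
proof -
  let ?U = "{a \<in> A. L a \<le> 1}"
  define rep where "rep c = (SOME a. a \<in> ?U \<and> col \<epsilon> a = c)" for c
  have rep: "rep (col \<epsilon> a) \<in> ?U \<and> col \<epsilon> (rep (col \<epsilon> a)) = col \<epsilon> a" if "a \<in> ?U" for a
    unfolding rep_def by (rule someI[of "\<lambda>b. b \<in> ?U \<and> col \<epsilon> b = col \<epsilon> a" a]) (use that in simp)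
  show ?thesis
  proof (rule that[of "rep ` col \<epsilon> ` ?U"])
    show "finite (rep ` col \<epsilon> ` ?U)" by (intro finite_imageI col_finite assms)
    show "rep ` col \<epsilon> ` ?U \<subseteq> A" using rep by auto
    fix a \<mu> \<nu> assume a: "a \<in> A" "L a \<le> 1" and \<mu>: "\<mu> \<in> S" and \<nu>: "\<nu> \<in> S"
    define b where "b = rep (col \<epsilon> a)"
    have b: "b \<in> A" "L b \<le> 1" "col \<epsilon> a = col \<epsilon> b" using rep[of a] a by (auto simp: b_def)
    obtain c where c: "le (- \<epsilon> *\<^sub>R e) (a - b - c *\<^sub>R e)" "le (a - b - c *\<^sub>R e) (\<epsilon> *\<^sub>R e)"
      using col_close[OF assms a(1) b(1) a(2) b(2) b(3)] by blast
    have in_A: "a - b - c *\<^sub>R e \<in> A" by (intro diff_in scale_in a b unit_in)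
    have val: "\<rho> (a - b - c *\<^sub>R e) = \<rho> a - \<rho> b - c" if "\<rho> \<in> S" for \<rho>
      using that a b by (simp add: state_diff state_scale state_unit diff_in scale_in unit_in)
    have "\<bar>\<mu> a - \<mu> b - c\<bar> \<le> \<epsilon>" "\<bar>\<nu> a - \<nu> b - c\<bar> \<le> \<epsilon>"
      using state_abs_le[OF \<mu> in_A assms c] state_abs_le[OF \<nu> in_A assms c] by (simp_all add: val \<mu> \<nu>)
    then have "\<bar>(\<mu> a - \<nu> a) - (\<mu> b - \<nu> b)\<bar> \<le> 2 * \<epsilon>" by linarith
    then show "\<exists>b\<in>rep ` col \<epsilon> ` ?U. \<bar>(\<mu> a - \<nu> a) - (\<mu> b - \<nu> b)\<bar> \<le> 2 * \<epsilon>"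
      using a by (intro bexI[of _ b]) (auto simp: b_def)
  qed
qed

lemma state_distance_le:
  assumes "\<And>a. a \<in> A \<Longrightarrow> L a \<le> 1 \<Longrightarrow> \<bar>\<mu> a - \<nu> a\<bar> \<le> t"
  shows "state_distance A L \<mu> \<nu> \<le> ennreal t"
  unfolding state_distance_def using assms by (intro SUP_least ennreal_leI) auto

lemma state_distance_finite:
  assumes \<mu>: "\<mu> \<in> S" and \<nu>: "\<nu> \<in> S"
  shows "state_distance A L \<mu> \<nu> < \<infinity>"
proof -
  obtain F where F: "finite F" "F \<subseteq> A"
    "\<And>a \<mu> \<nu>. \<lbrakk>a \<in> A; L a \<le> 1; \<mu> \<in> S; \<nu> \<in> S\<rbrakk> \<Longrightarrow> \<exists>b\<in>F. \<bar>(\<mu> a - \<nu> a) - (\<mu> b - \<nu> b)\<bar> \<le> 2 * 1"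
    using finite_net[of 1] by auto
  \<comment> \<open>Summing over the whole finite net bounds all its members at once without taking
    a maximum.\<close>
  have "state_distance A L \<mu> \<nu> \<le> ennreal (2 + (\<Sum>b\<in>F. \<bar>\<mu> b - \<nu> b\<bar>))"
  proof (rule state_distance_le)
    fix a assume "a \<in> A" "L a \<le> 1"
    then obtain b where b: "b \<in> F" "\<bar>(\<mu> a - \<nu> a) - (\<mu> b - \<nu> b)\<bar> \<le> 2" using F(3)[OF _ _ \<mu> \<nu>] by auto
    have "\<bar>\<mu> b - \<nu> b\<bar> \<le> (\<Sum>b\<in>F. \<bar>\<mu> b - \<nu> b\<bar>)"
      by (rule member_le_sum[OF b(1)]) (use F(1) in auto)
    with b(2) show "\<bar>\<mu> a - \<nu> a\<bar> \<le> 2 + (\<Sum>b\<in>F. \<bar>\<mu> b - \<nu> b\<bar>)" by linarith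
  qed
  then show ?thesis by (simp add: order_le_less_trans)
qed

lemma dist_L_nonneg: "0 \<le> dist_L \<mu> \<nu>"
  by (simp add: dist_L_def)

lemma dist_L_ge:
  assumes "\<mu> \<in> S" "\<nu> \<in> S" "a \<in> A" "L a \<le> 1"
  shows "\<bar>\<mu> a - \<nu> a\<bar> \<le> dist_L \<mu> \<nu>"
proof -
  have "ennreal \<bar>\<mu> a - \<nu> a\<bar> \<le> state_distance A L \<mu> \<nu>"
    unfolding state_distance_def using assms by (intro SUP_upper) simp
  also have "\<dots> = ennreal (dist_L \<mu> \<nu>)"
    using state_distance_finite[OF assms(1,2)] by (simp add: dist_L_def ennreal_enn2real_if)
  finally show ?thesis by (simp add: dist_L_nonneg)
qed

lemma dist_L_le:
  assumes "0 \<le> t" "\<And>a. a \<in> A \<Longrightarrow> L a \<le> 1 \<Longrightarrow> \<bar>\<mu> a - \<nu> a\<bar> \<le> t"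
  shows "dist_L \<mu> \<nu> \<le> t"
proof -
  have "state_distance A L \<mu> \<nu> \<le> ennreal t" by (rule state_distance_le) (rule assms(2))
  then show ?thesis unfolding dist_L_def by (rule enn2real_leI[OF assms(1)])
qed

lemma state_diff_le:
  assumes "\<mu> \<in> S" "\<nu> \<in> S" "a \<in> A"
  shows "\<bar>\<mu> a - \<nu> a\<bar> \<le> (L a + 1) * dist_L \<mu> \<nu>"
proof -
  \<comment> \<open>The summand 1 is there because L a may be 0.\<close>
  let ?M = "L a + 1"
  have M: "?M > 0" using L_nonneg[OF assms(3)] by linarith
  have "\<bar>\<mu> ((1 / ?M) *\<^sub>R a) - \<nu> ((1 / ?M) *\<^sub>R a)\<bar> \<le> dist_L \<mu> \<nu>"
    using M by (intro dist_L_ge assms scale_in) (simp add: L_scale assms)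
  also have "\<mu> ((1 / ?M) *\<^sub>R a) - \<nu> ((1 / ?M) *\<^sub>R a) = (\<mu> a - \<nu> a) / ?M"
    using assms by (simp add: state_scale diff_divide_distrib)
  finally show ?thesis using M by (simp add: field_simps)
qed

text \<open>L is finite on A, so every a is a multiple of an element with L \<le> 1. Distance 0
  therefore forces equality on A, and states are extensional.\<close>

sublocale M: Metric_space S dist_L
proof
  show "0 \<le> dist_L \<mu> \<nu>" for \<mu> \<nu> by (rule dist_L_nonneg)
  show "dist_L \<mu> \<nu> = dist_L \<nu> \<mu>" for \<mu> \<nu>
    by (simp add: dist_L_def state_distance_def abs_minus_commute)
  show "dist_L \<mu> \<nu> = 0 \<longleftrightarrow> \<mu> = \<nu>" if "\<mu> \<in> S" "\<nu> \<in> S" for \<mu> \<nu>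
  proof
    assume "dist_L \<mu> \<nu> = 0"
    then have "\<mu> a = \<nu> a" if "a \<in> A" for a
      using state_diff_le[OF \<open>\<mu> \<in> S\<close> \<open>\<nu> \<in> S\<close> that] by simp
    then show "\<mu> = \<nu>"
      by (rule extensionalityI[OF state_extensional[OF \<open>\<mu> \<in> S\<close>] state_extensional[OF \<open>\<nu> \<in> S\<close>]])
  next
    assume "\<mu> = \<nu>"
    then have "dist_L \<mu> \<nu> \<le> 0" by (intro dist_L_le) auto
    then show "dist_L \<mu> \<nu> = 0" using dist_L_nonneg[of \<mu> \<nu>] by simp
  qed
  show "dist_L \<mu> \<rho> \<le> dist_L \<mu> \<nu> + dist_L \<nu> \<rho>" if "\<mu> \<in> S" "\<nu> \<in> S" "\<rho> \<in> S" for \<mu> \<nu> \<rho>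
  proof (rule dist_L_le)
    fix a assume "a \<in> A" "L a \<le> 1"
    then show "\<bar>\<mu> a - \<rho> a\<bar> \<le> dist_L \<mu> \<nu> + dist_L \<nu> \<rho>"
      using dist_L_ge[OF that(1,2), of a] dist_L_ge[OF that(2,3), of a] by linarith
  qed (simp add: dist_L_nonneg)
qed

lemma topspace_weak_star: "topspace (weak_star_topology A le e) = S"
  by (auto simp: weak_star_topology_def PiE_def dest: state_extensional)

lemma weak_star_eval: "a \<in> A \<Longrightarrow> continuous_map (weak_star_topology A le e) euclideanreal (\<lambda>\<mu>. \<mu> a)"
  unfolding weak_star_topology_def
  by (intro continuous_map_from_subtopology continuous_map_product_projection)

lemma mtopology_eval:
  assumes a: "a \<in> A"
  shows "continuous_map M.mtopology euclideanreal (\<lambda>\<mu>. \<mu> a)"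
  unfolding continuous_map_def
proof (intro conjI allI impI)
  fix U :: "real set" assume "openin euclideanreal U"
  then have U: "open U" by simp
  show "openin M.mtopology {\<mu> \<in> topspace M.mtopology. \<mu> a \<in> U}"
    unfolding M.openin_mtopology
  proof (intro conjI allI impI)
    fix \<mu> assume "\<mu> \<in> {\<mu> \<in> topspace M.mtopology. \<mu> a \<in> U}"
    then have \<mu>: "\<mu> \<in> S" "\<mu> a \<in> U" by auto
    obtain \<epsilon> where \<epsilon>: "\<epsilon> > 0" "ball (\<mu> a) \<epsilon> \<subseteq> U" using U \<mu>(2) open_contains_ball by blast
    have M: "L a + 1 > 0" using L_nonneg[OF a] by linarith
    have "M.mball \<mu> (\<epsilon> / (L a + 1)) \<subseteq> {\<mu> \<in> topspace M.mtopology. \<mu> a \<in> U}"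
    proof
      fix \<nu> assume \<nu>: "\<nu> \<in> M.mball \<mu> (\<epsilon> / (L a + 1))"
      then have "\<nu> \<in> S" "dist_L \<mu> \<nu> < \<epsilon> / (L a + 1)" by auto
      then have "\<bar>\<mu> a - \<nu> a\<bar> < \<epsilon>"
        using state_diff_le[OF \<mu>(1) \<open>\<nu> \<in> S\<close> a] M by (simp add: field_simps)
      then have "\<nu> a \<in> U" using \<epsilon>(2) by (auto simp: dist_real_def)
      then show "\<nu> \<in> {\<mu> \<in> topspace M.mtopology. \<mu> a \<in> U}" using \<open>\<nu> \<in> S\<close> by simp
    qed
    then show "\<exists>r>0. M.mball \<mu> r \<subseteq> {\<mu> \<in> topspace M.mtopology. \<mu> a \<in> U}"
      using \<epsilon>(1) M by (intro exI[of _ "\<epsilon> / (L a + 1)"]) simp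
  qed auto
qed simp

lemma mtopology_eq_weak_star: "M.mtopology = weak_star_topology A le e"
proof (rule topology_eq[THEN iffD2], intro allI iffI)
  fix U assume U: "openin M.mtopology U"
  show "openin (weak_star_topology A le e) U"
  proof (subst openin_subopen, intro ballI)
    fix \<mu> assume "\<mu> \<in> U"
    then obtain r where r: "r > 0" "M.mball \<mu> r \<subseteq> U" and \<mu>: "\<mu> \<in> S"
      using U unfolding M.openin_mtopology by blast
    \<comment> \<open>The net error 2 (r / 8) and the evaluation error r / 4 add up to r / 2 <
      r.\<close>
    have "r / 8 > 0" using r by simp
    then obtain F where F: "finite F" "F \<subseteq> A"
      and net: "\<And>a \<mu> \<nu>. \<lbrakk>a \<in> A; L a \<le> 1; \<mu> \<in> S; \<nu> \<in> S\<rbrakk> \<Longrightarrow> \<exists>b\<in>F. \<bar>(\<mu> a - \<nu> a) - (\<mu> b - \<nu> b)\<bar> \<le> 2 * (r / 8)"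
      using finite_net by metis
    let ?W = "weak_star_topology A le e"
    \<comment> \<open>The intersection with the space keeps the neighbourhood inside the set of
      states even when F is empty.\<close>
    let ?V = "(\<Inter>b\<in>F. {\<nu> \<in> topspace ?W. \<nu> b \<in> ball (\<mu> b) (r / 4)}) \<inter> topspace ?W"
    have "openin ?W ?V"
    proof (rule openin_INT[OF F(1)])
      fix b assume "b \<in> F"
      then show "openin ?W {\<nu> \<in> topspace ?W. \<nu> b \<in> ball (\<mu> b) (r / 4)}"
        using F(2) by (intro openin_continuous_map_preimage[OF weak_star_eval]) auto
    qed
    moreover have "\<mu> \<in> ?V" using \<mu> r by (simp add: topspace_weak_star)
    moreover have "?V \<subseteq> U"
    proof
      fix \<nu> assume \<nu>: "\<nu> \<in> ?V"
      then have \<nu>S: "\<nu> \<in> S" by (simp add: topspace_weak_star)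
      have "dist_L \<mu> \<nu> \<le> r / 2"
      proof (rule dist_L_le)
        fix a assume a: "a \<in> A" "L a \<le> 1"
        obtain b where b: "b \<in> F" "\<bar>(\<mu> a - \<nu> a) - (\<mu> b - \<nu> b)\<bar> \<le> 2 * (r / 8)"
          using net[OF a \<mu> \<nu>S] by blast
        have "\<bar>\<mu> b - \<nu> b\<bar> < r / 4" using \<nu> b(1) by (auto simp: dist_real_def)
        with b(2) show "\<bar>\<mu> a - \<nu> a\<bar> \<le> r / 2" by linarith
      qed (use r in simp)
      then have "\<nu> \<in> M.mball \<mu> r" using r \<mu> \<nu>S by simp
      then show "\<nu> \<in> U" using r(2) by blast
    qed
    ultimately show "\<exists>T. openin ?W T \<and> \<mu> \<in> T \<and> T \<subseteq> U" by blast
  qed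
next
  fix U assume U: "openin (weak_star_topology A le e) U"
  have "continuous_map M.mtopology (weak_star_topology A le e) (\<lambda>\<mu>. \<mu>)"
    unfolding weak_star_topology_def continuous_map_in_subtopology continuous_map_componentwise
    using mtopology_eval state_extensional by auto
  from openin_continuous_map_preimage[OF this U] have "openin M.mtopology {\<mu> \<in> S. \<mu> \<in> U}" by simp
  moreover have "{\<mu> \<in> S. \<mu> \<in> U} = U"
    using openin_subset[OF U] by (auto simp: topspace_weak_star)
  ultimately show "openin M.mtopology U" by simp
qed

lemma lip_norm_L: "lip_norm A le e L"
proof -
  have "Metric_space S (\<lambda>\<mu> \<nu>. enn2real (state_distance A L \<mu> \<nu>))"
    "Metric_space.mtopology S (\<lambda>\<mu> \<nu>. enn2real (state_distance A L \<mu> \<nu>)) = weak_star_topology A le e"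
    using M.Metric_space_axioms mtopology_eq_weak_star by (simp_all add: dist_L_def[abs_def])
  then show ?thesis
    unfolding lip_norm_def using L_nonneg L_add L_scale L_unit state_distance_finite by blast
qed

end

section \<open>Compact Toeplitz operators have vanishing symbol\<close>

definition peak_function :: "complex ^ 'd::finite \<Rightarrow> 'd cfun" where
  "peak_function \<zeta> z = (1 + (\<Sum>i\<in>UNIV. z $ i * cnj (\<zeta> $ i))) / 2"

lemma hermitian_Cauchy_Schwarz: "cmod (\<Sum>i\<in>UNIV. z $ i * cnj (w $ i)) \<le> norm z * norm (w :: complex ^ 'd::finite)"
proof -
  have "cmod (\<Sum>i\<in>UNIV. z $ i * cnj (w $ i)) \<le> (\<Sum>i\<in>UNIV. \<bar>cmod (z $ i)\<bar> * \<bar>cmod (w $ i)\<bar>)"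
    by (rule order_trans[OF norm_sum]) (simp add: norm_mult)
  also have "\<dots> \<le> norm z * norm w"
    unfolding norm_vec_def by (rule L2_set_mult_ineq)
  finally show ?thesis .
qed

lemma Re_hermitian: "Re (\<Sum>i\<in>UNIV. z $ i * cnj (w $ i)) = z \<bullet> (w :: complex ^ 'd::finite)"
  by (simp add: inner_vec_def inner_complex_def)

lemma analytic_on_ball_peak_function: "analytic_on_ball (peak_function \<zeta>)"
proof -
  have "analytic_on_ball (\<lambda>z. \<Sum>i\<in>UNIV. cnj (\<zeta> $ i) * z $ i)"
    by (intro analytic_on_ball_sum analytic_on_ball_nth)
  from analytic_on_ball_uminus_add[OF analytic_on_ball_const[of 1] this, of "1 / 2" "1 / 2"]
  show ?thesis
    by (simp add: peak_function_def[abs_def] add_divide_distrib mult.commute)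
qed

text \<open>With w the Hermitian product of z and \<zeta>, |w| \<le> 1 gives |1 + w|^2 \<le> 2 + 2
  Re w, while |z - \<zeta>|^2 \<le> 2 - 2 Re w. Adding the two yields the bound, with the squared
  distance entering linearly.\<close>

lemma peak_function_le:
  assumes \<zeta>: "norm \<zeta> = 1" and z: "norm z \<le> 1"
  shows "(cmod (peak_function \<zeta> z))\<^sup>2 \<le> 1 - (norm (z - \<zeta>))\<^sup>2 / 4"
proof -
  define w where "w = (\<Sum>i\<in>UNIV. z $ i * cnj (\<zeta> $ i))"
  have "cmod w \<le> 1"
    unfolding w_def using hermitian_Cauchy_Schwarz[of z \<zeta>] \<zeta> z by simp
  then have w: "(cmod w)\<^sup>2 \<le> 1" by (simp add: power_le_one)
  have "(norm (z - \<zeta>))\<^sup>2 = (norm z)\<^sup>2 + (norm \<zeta>)\<^sup>2 - 2 * (z \<bullet> \<zeta>)"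
    unfolding power2_norm_eq_inner by (simp add: inner_diff_left inner_diff_right inner_commute algebra_simps)
  also have "\<dots> \<le> 2 - 2 * Re w"
  proof -
    have "Re w = z \<bullet> \<zeta>" unfolding w_def by (rule Re_hermitian)
    then show ?thesis using \<zeta> z by (simp add: power_le_one)
  qed
  finally have d: "(norm (z - \<zeta>))\<^sup>2 \<le> 2 - 2 * Re w" .
  have "(cmod (1 + w))\<^sup>2 = 1 + 2 * Re w + (cmod w)\<^sup>2"
    unfolding cmod_power2 by (simp add: power2_sum)
  then have "(cmod (1 + w))\<^sup>2 \<le> 2 + 2 * Re w" using w by linarith
  then have "(cmod (1 + w))\<^sup>2 / 4 \<le> 1 - (norm (z - \<zeta>))\<^sup>2 / 4" using d by linarith
  then show ?thesis
    by (simp add: peak_function_def norm_divide power_divide w_def)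
qed

text \<open>The peak function equals 1 at \<zeta>, and 1 minus its value at z is half the Hermitian
  product of \<zeta> - z with \<zeta>, hence at most \<eta> / 2.\<close>

lemma peak_function_ge:
  assumes \<zeta>: "norm \<zeta> = 1" and z: "norm (z - \<zeta>) \<le> \<eta>" "\<eta> \<le> 1"
  shows "1 - \<eta> \<le> (cmod (peak_function \<zeta> z))\<^sup>2"
proof -
  have one: "(\<Sum>i\<in>UNIV. \<zeta> $ i * cnj (\<zeta> $ i)) = 1"
    using \<zeta> norm_vec_square[of \<zeta>] by (simp flip: complex_norm_square of_real_power of_real_sum)
  have eq: "1 - peak_function \<zeta> z = (\<Sum>i\<in>UNIV. (\<zeta> - z) $ i * cnj (\<zeta> $ i)) / 2"
    by (simp add: peak_function_def algebra_simps sum_subtractf one)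
  have "cmod (1 - peak_function \<zeta> z) \<le> norm (\<zeta> - z) * norm \<zeta> / 2"
    unfolding eq norm_divide using hermitian_Cauchy_Schwarz[of "\<zeta> - z" \<zeta>] by simp
  then have "cmod (1 - peak_function \<zeta> z) \<le> \<eta> / 2"
    using \<zeta> z by (simp add: norm_minus_commute)
  moreover have "1 \<le> cmod (1 - peak_function \<zeta> z) + cmod (peak_function \<zeta> z)"
    using norm_triangle_ineq[of "1 - peak_function \<zeta> z" "peak_function \<zeta> z"] by simp
  ultimately have "1 - \<eta> / 2 \<le> cmod (peak_function \<zeta> z)" by linarith
  then have "(1 - \<eta> / 2)\<^sup>2 \<le> (cmod (peak_function \<zeta> z))\<^sup>2"
    using z by (intro power_mono) auto
  moreover have "1 - \<eta> \<le> (1 - \<eta> / 2)\<^sup>2" by (simp add: power2_eq_square algebra_simps)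
  ultimately show ?thesis by linarith
qed

lemma measure_ball_measure_pos:
  fixes \<zeta> :: "complex ^ 'd::finite"
  assumes n: "CARD('d) \<le> n" and \<zeta>: "norm \<zeta> = 1" and \<eta>: "0 < \<eta>" "\<eta> \<le> 1"
  shows "0 < measure (ball_measure n) (ball \<zeta> \<eta>)"
proof -
  interpret prob_space "ball_measure n :: (complex ^ 'd) measure" by (rule prob_space_ball_measure[OF n])
  \<comment> \<open>Moving inwards by \<eta> / 2 along the radius makes room for a full ball of
    radius \<eta> / 2 inside both sets; the density is positive there.\<close>
  define w where "w = (1 - \<eta> / 2) *\<^sub>R \<zeta>"
  have sub: "ball w (\<eta> / 2) \<subseteq> ball \<zeta> \<eta> \<inter> ball 0 1"
  proof
    fix z assume "z \<in> ball w (\<eta> / 2)"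
    then have z: "norm (z - w) < \<eta> / 2" by (simp add: dist_norm norm_minus_commute)
    have "norm w = 1 - \<eta> / 2" using \<zeta> \<eta> by (simp add: w_def)
    moreover have "norm (w - \<zeta>) = \<eta> / 2"
    proof -
      have "w - \<zeta> = (- (\<eta> / 2)) *\<^sub>R \<zeta>" by (simp add: w_def algebra_simps)
      then show ?thesis using \<zeta> \<eta> by simp
    qed
    ultimately show "z \<in> ball \<zeta> \<eta> \<inter> ball 0 1"
      using z norm_triangle_sub[of z w] norm_triangle_ineq[of "z - w" "w - \<zeta>"]
      by (simp add: dist_norm norm_minus_commute)
  qed
  have dens: "0 < ball_density n z" if "z \<in> ball 0 1" for z :: "complex ^ 'd"
    using that by (auto simp: ball_density_def power_less_one_iff intro!: mult_pos_pos divide_pos_pos zero_less_power)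
  have "emeasure (ball_measure n) (ball w (\<eta> / 2)) \<noteq> 0"
  proof
    assume "emeasure (ball_measure n) (ball w (\<eta> / 2)) = 0"
    then have "(\<integral>\<^sup>+z. ennreal (ball_density n z) * indicator (ball w (\<eta> / 2)) z \<partial>lborel) = 0"
      using nn_integral_ball_measure[of "indicator (ball w (\<eta> / 2))" n] by simp
    then have "AE z in lborel. ennreal (ball_density n z) * indicator (ball w (\<eta> / 2)) z = 0"
      by (subst (asm) nn_integral_0_iff_AE) auto
    then have "AE z in lborel. z \<notin> ball w (\<eta> / 2)"
    proof eventually_elim
      case (elim z)
      show ?case
      proof
        assume "z \<in> ball w (\<eta> / 2)"
        with elim dens[of z] sub show False by (auto simp: ennreal_eq_0_iff)
      qed
    qed
    then have "emeasure lborel (ball w (\<eta> / 2)) = 0"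
      by (subst (asm) AE_iff_measurable[of "ball w (\<eta> / 2)"]) auto
    then have "measure lborel (ball w (\<eta> / 2)) = 0" by (simp add: measure_def)
    with content_ball_pos[of "\<eta> / 2" w] \<eta> show False by simp
  qed
  then have "0 < measure (ball_measure n) (ball w (\<eta> / 2))"
    by (simp add: emeasure_eq_measure zero_less_measure_iff)
  also have "\<dots> \<le> measure (ball_measure n) (ball \<zeta> \<eta>)"
    using sub by (intro finite_measure_mono) auto
  finally show ?thesis .
qed

section \<open>Normalized peaks: concentration and weak limits\<close>

context bergman_basis begin

definition peak :: "complex ^ 'd \<Rightarrow> nat \<Rightarrow> 'd cfun" where
  "peak \<zeta> m z = (if z \<in> ball 0 1 then peak_function \<zeta> z ^ m else 0)"

lemma cmod_peak_le: "norm \<zeta> = 1 \<Longrightarrow> cmod (peak \<zeta> m z) \<le> 1"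
proof -
  assume \<zeta>: "norm \<zeta> = 1"
  have "cmod (peak_function \<zeta> z) \<le> 1" if "z \<in> ball 0 1"
  proof (rule power2_le_imp_le)
    show "(cmod (peak_function \<zeta> z))\<^sup>2 \<le> 1\<^sup>2"
    proof -
      have "(cmod (peak_function \<zeta> z))\<^sup>2 \<le> 1 - (norm (z - \<zeta>))\<^sup>2 / 4"
        using that by (intro peak_function_le[OF \<zeta>]) simp
      also have "\<dots> \<le> 1" by simp
      finally show ?thesis by simp
    qed
  qed simp
  then show ?thesis by (auto simp: peak_def norm_power intro!: power_le_one)
qed

lemma peak_bergman: "norm \<zeta> = 1 \<Longrightarrow> peak \<zeta> m \<in> bergman n"
proof (rule bergmanI)
  assume \<zeta>: "norm \<zeta> = 1"
  show an: "analytic_on_ball (peak \<zeta> m)"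
    by (rule analytic_on_ball_cong[OF analytic_on_ball_power[OF analytic_on_ball_peak_function[of \<zeta>], of m]])
       (simp add: peak_def)
  show out: "peak \<zeta> m z = 0" if "z \<notin> ball 0 1" for z using that by (simp add: peak_def)
  show "square_integrable n (peak \<zeta> m)"
    by (rule square_integrable_bounded[OF n analytic_borel_measurable[OF an out] cmod_peak_le[OF \<zeta>]])
qed

definition far_mass :: "complex ^ 'd \<Rightarrow> real \<Rightarrow> 'd cfun \<Rightarrow> real" where
  "far_mass \<zeta> \<epsilon> u = (LINT z|ball_measure n. indicator (- ball \<zeta> \<epsilon>) z * (cmod (u z))\<^sup>2)"

text \<open>Near \<zeta> the squared peak function is at least q', far from \<zeta> at most q < q'.
  The quotient of far mass and total mass is thus at most (q / q')^m / V, where V is the measure of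
  a small ball at \<zeta>.\<close>

lemma peak_concentrates:
  assumes \<zeta>: "norm \<zeta> = 1" and \<epsilon>: "0 < \<epsilon>"
  shows "0 < bergman_norm n (peak \<zeta> m)"
    and "(\<lambda>m. far_mass \<zeta> \<epsilon> (peak \<zeta> m) / (bergman_norm n (peak \<zeta> m))\<^sup>2) \<longlonglongrightarrow> 0"
proof -
  interpret prob_space "ball_measure n :: (complex ^ 'd) measure" by (rule prob_space_ball_measure[OF n])
  define \<epsilon>' where "\<epsilon>' = min \<epsilon> 1"
  have \<epsilon>': "0 < \<epsilon>'" "\<epsilon>' \<le> 1" "\<epsilon>' \<le> \<epsilon>" using \<epsilon> by (auto simp: \<epsilon>'_def)
  \<comment> \<open>Far from \<zeta> the upper bound 1 - \<epsilon>'^2 / 4 equals 1 - 2 \<eta>,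
    whereas within distance \<eta> the lower bound is 1 - \<eta>. Capping \<epsilon>' at 1 keeps
    both positive.\<close>
  define \<eta> where "\<eta> = \<epsilon>'\<^sup>2 / 8"
  have \<eta>: "0 < \<eta>" "\<eta> \<le> 1 / 8" using \<epsilon>' by (auto simp: \<eta>_def power_le_one)
  define V where "V = measure (ball_measure n) (ball \<zeta> \<eta>)"
  have V: "V > 0" unfolding V_def using \<eta> by (intro measure_ball_measure_pos[OF n \<zeta>]) auto
  define q where "q = 1 - 2 * \<eta>"
  define q' where "q' = 1 - \<eta>"
  have q: "0 < q" "q < q'" using \<eta> by (auto simp: q_def q'_def)
  note sq = bergman_square_integrable[OF peak_bergman[OF \<zeta>]]
  have int: "integrable (ball_measure n) (\<lambda>z. (cmod (peak \<zeta> m z))\<^sup>2)" for m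
    using sq[of m] by (simp add: square_integrable_def)
  have [measurable]: "peak \<zeta> m \<in> borel_measurable borel" for m using sq by (rule square_integrable_measurable)
  have pk: "(cmod (peak \<zeta> m z))\<^sup>2 = ((cmod (peak_function \<zeta> z))\<^sup>2) ^ m" if "z \<in> ball 0 1" for m z
    using that by (simp add: peak_def norm_power mult.commute flip: power_mult)
  have near: "q' ^ m * V \<le> (bergman_norm n (peak \<zeta> m))\<^sup>2" for m
  proof -
    have "q' ^ m * V = (LINT z|ball_measure n. q' ^ m * indicator (ball \<zeta> \<eta>) z)"
      by (simp add: V_def)
    also have "\<dots> \<le> (LINT z|ball_measure n. (cmod (peak \<zeta> m z))\<^sup>2)"
    proof (rule integral_mono_AE[OF _ int])
      show "integrable (ball_measure n) (\<lambda>z. q' ^ m * indicator (ball \<zeta> \<eta>) z)"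
        by (intro integrable_mult_right integrable_real_indicator) (auto simp: emeasure_eq_measure)
      show "AE z in ball_measure n. q' ^ m * indicator (ball \<zeta> \<eta>) z \<le> (cmod (peak \<zeta> m z))\<^sup>2"
        using AE_ball_measure
      proof eventually_elim
        case (elim z)
        show ?case
        proof (cases "z \<in> ball \<zeta> \<eta>")
          case True
          then have "q' \<le> (cmod (peak_function \<zeta> z))\<^sup>2"
            using \<eta> unfolding q'_def by (intro peak_function_ge[OF \<zeta>]) (auto simp: dist_norm norm_minus_commute)
          then have "q' ^ m \<le> ((cmod (peak_function \<zeta> z))\<^sup>2) ^ m" using q by (intro power_mono) auto
          then show ?thesis using True by (simp add: pk[OF elim])
        qed simp
      qed
    qed
    finally show ?thesis by (simp add: bergman_norm_square)
  qed
  have pos: "0 < (bergman_norm n (peak \<zeta> m))\<^sup>2" for m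
    by (rule less_le_trans[OF _ near]) (use q V in simp)
  then show "0 < bergman_norm n (peak \<zeta> m)"
    using bergman_norm_nonneg[of n "peak \<zeta> m"] by (metis less_eq_real_def power_zero_numeral less_irrefl)
  have far: "far_mass \<zeta> \<epsilon> (peak \<zeta> m) \<le> q ^ m" for m
  proof -
    have "far_mass \<zeta> \<epsilon> (peak \<zeta> m) \<le> (LINT z|(ball_measure n :: (complex ^ 'd) measure). q ^ m)"
      unfolding far_mass_def
    proof (rule integral_mono_AE)
      show "integrable (ball_measure n) (\<lambda>z. indicator (- ball \<zeta> \<epsilon>) z * (cmod (peak \<zeta> m z))\<^sup>2)"
        by (rule Bochner_Integration.integrable_bound[OF int[of m]]) (auto simp: indicator_def)
      show "AE z in ball_measure n. indicator (- ball \<zeta> \<epsilon>) z * (cmod (peak \<zeta> m z))\<^sup>2 \<le> q ^ m"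
        using AE_ball_measure
      proof eventually_elim
        case (elim z)
        show ?case
        proof (cases "z \<in> ball \<zeta> \<epsilon>")
          case False
          then have "\<epsilon>' \<le> norm (z - \<zeta>)" using \<epsilon>' by (simp add: dist_norm norm_minus_commute)
          then have "\<epsilon>'\<^sup>2 \<le> (norm (z - \<zeta>))\<^sup>2" using \<epsilon>' by (intro power_mono) auto
          then have "(cmod (peak_function \<zeta> z))\<^sup>2 \<le> q"
            using peak_function_le[OF \<zeta>, of z] elim by (simp add: q_def \<eta>_def)
          then have "((cmod (peak_function \<zeta> z))\<^sup>2) ^ m \<le> q ^ m" by (intro power_mono) auto
          then show ?thesis using False by (simp add: pk[OF elim])
        qed (use q in simp)
      qed
    qed simp
    also have "\<dots> = q ^ m" using prob_space by simp
    finally show ?thesis .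
  qed
  show "(\<lambda>m. far_mass \<zeta> \<epsilon> (peak \<zeta> m) / (bergman_norm n (peak \<zeta> m))\<^sup>2) \<longlonglongrightarrow> 0"
  proof (rule tendsto_sandwich[OF _ _ tendsto_const])
    have "0 \<le> far_mass \<zeta> \<epsilon> (peak \<zeta> m)" for m
      unfolding far_mass_def by (intro Bochner_Integration.integral_nonneg) simp
    then show "\<forall>\<^sub>F m in sequentially. 0 \<le> far_mass \<zeta> \<epsilon> (peak \<zeta> m) / (bergman_norm n (peak \<zeta> m))\<^sup>2"
      by (intro always_eventually allI divide_nonneg_nonneg) auto
    have "far_mass \<zeta> \<epsilon> (peak \<zeta> m) / (bergman_norm n (peak \<zeta> m))\<^sup>2 \<le> (q / q') ^ m / V" for m
    proof -
      have "far_mass \<zeta> \<epsilon> (peak \<zeta> m) / (bergman_norm n (peak \<zeta> m))\<^sup>2 \<le> q ^ m / (q' ^ m * V)"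
        using q V by (intro frac_le far near) auto
      then show ?thesis by (simp add: power_divide)
    qed
    then show "\<forall>\<^sub>F m in sequentially. far_mass \<zeta> \<epsilon> (peak \<zeta> m) / (bergman_norm n (peak \<zeta> m))\<^sup>2 \<le> (q / q') ^ m / V"
      by (intro always_eventually allI)
    have "(\<lambda>m. (q / q') ^ m / V) \<longlonglongrightarrow> 0 / V"
      by (intro tendsto_divide LIMSEQ_power_zero tendsto_const) (use q V in auto)
    then show "(\<lambda>m. (q / q') ^ m / V) \<longlonglongrightarrow> 0" by simp
  qed
qed

definition unit_peak :: "complex ^ 'd \<Rightarrow> nat \<Rightarrow> 'd cfun" where
  "unit_peak \<zeta> m = (\<lambda>z. of_real (1 / bergman_norm n (peak \<zeta> m)) * peak \<zeta> m z)"

lemma unit_peak_bergman: "norm \<zeta> = 1 \<Longrightarrow> unit_peak \<zeta> m \<in> bergman n"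
  unfolding unit_peak_def by (intro bergman_cmult peak_bergman)

lemma norm_unit_peak: "norm \<zeta> = 1 \<Longrightarrow> bergman_norm n (unit_peak \<zeta> m) = 1"
  unfolding unit_peak_def bergman_norm_cmult using peak_concentrates(1)[of \<zeta> 1 m] by (simp add: norm_divide)

lemma far_mass_unit_peak:
  assumes \<zeta>: "norm \<zeta> = 1" and \<epsilon>: "0 < \<epsilon>"
  shows "(\<lambda>m. far_mass \<zeta> \<epsilon> (unit_peak \<zeta> m)) \<longlonglongrightarrow> 0"
proof -
  have "far_mass \<zeta> \<epsilon> (unit_peak \<zeta> m) = far_mass \<zeta> \<epsilon> (peak \<zeta> m) / (bergman_norm n (peak \<zeta> m))\<^sup>2" for m
  proof -
    have "far_mass \<zeta> \<epsilon> (unit_peak \<zeta> m) = (LINT z|ball_measure n. (indicator (- ball \<zeta> \<epsilon>) z * (cmod (peak \<zeta> m z))\<^sup>2) / (bergman_norm n (peak \<zeta> m))\<^sup>2)"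
      unfolding far_mass_def unit_peak_def
      by (intro Bochner_Integration.integral_cong) (simp_all add: norm_mult power_mult_distrib norm_divide power_divide)
    then show ?thesis by (simp add: far_mass_def)
  qed
  then show ?thesis using peak_concentrates(2)[OF assms] by simp
qed

text \<open>Split the pairing at a small ball around \<zeta>. Inside, g has small norm by dominated
  convergence and the peak has norm 1; outside, the mass of the peak tends to 0.\<close>

lemma unit_peak_weakly_null:
  assumes \<zeta>: "norm \<zeta> = 1" and g: "g \<in> bergman n"
  shows "(\<lambda>m. bergman_inner n g (unit_peak \<zeta> m)) \<longlonglongrightarrow> 0"
proof (rule LIMSEQ_I)
  fix e :: real assume e: "e > 0"
  note gs = bergman_square_integrable[OF g]
  note us = bergman_square_integrable[OF unit_peak_bergman[OF \<zeta>]]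
  let ?near = "\<lambda>\<epsilon> z. indicator (ball \<zeta> \<epsilon>) z * g z"
  have near_sq: "square_integrable n (?near \<epsilon>)" for \<epsilon>
    by (rule square_integrable_mult_bounded[OF gs, where B=1]) (auto simp: indicator_def)
  have far_sq: "square_integrable n (\<lambda>z. indicator (- ball \<zeta> \<epsilon>) z * unit_peak \<zeta> m z)" for \<epsilon> m
    by (rule square_integrable_mult_bounded[OF us, where B=1]) (auto simp: indicator_def)
  have "(\<lambda>k. LINT z|ball_measure n. (cmod (?near (1 / real (Suc k)) z))\<^sup>2) \<longlonglongrightarrow> (LINT z|(ball_measure n :: (complex ^ 'd) measure). 0)"
  proof (rule integral_dominated_convergence[where w="\<lambda>z. (cmod (g z))\<^sup>2"])
    show "integrable (ball_measure n) (\<lambda>z. (cmod (g z))\<^sup>2)" using gs by (simp add: square_integrable_def)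
    show "(\<lambda>z. (cmod (?near (1 / real (Suc k)) z))\<^sup>2) \<in> borel_measurable (ball_measure n)" for k
      using square_integrable_measurable[OF near_sq[of "1 / real (Suc k)"]] by measurable
    show "AE z in ball_measure n. (\<lambda>k. (cmod (?near (1 / real (Suc k)) z))\<^sup>2) \<longlonglongrightarrow> 0"
    proof (rule AE_I2)
      fix z
      show "(\<lambda>k. (cmod (?near (1 / real (Suc k)) z))\<^sup>2) \<longlonglongrightarrow> 0"
      proof (cases "z = \<zeta>")
        case True
        \<comment> \<open>The point \<zeta> lies on the sphere, where members of the Bergman space
          vanish by convention.\<close>
        then have "g z = 0" using g \<zeta> by (simp add: bergman_def)
        then show ?thesis by simp
      next
        case False
        have "(\<lambda>k. 1 / real (Suc k)) \<longlonglongrightarrow> 0" by (rule LIMSEQ_Suc[OF lim_1_over_n])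
        then have "\<forall>\<^sub>F k in sequentially. 1 / real (Suc k) < dist \<zeta> z"
          using False by (intro order_tendstoD) auto
        then have "\<forall>\<^sub>F k in sequentially. (cmod (?near (1 / real (Suc k)) z))\<^sup>2 = 0"
          by eventually_elim (simp add: indicator_def)
        then show ?thesis by (rule tendsto_eventually)
      qed
    qed
    show "AE z in ball_measure n. norm ((cmod (?near (1 / real (Suc k)) z))\<^sup>2) \<le> (cmod (g z))\<^sup>2" for k
      by (rule AE_I2) (simp add: indicator_def)
  qed simp
  then have "(\<lambda>k. (bergman_norm n (?near (1 / real (Suc k))))\<^sup>2) \<longlonglongrightarrow> 0"
    by (simp add: bergman_norm_square)
  moreover have "(e / 2)\<^sup>2 > 0" using e by simp
  ultimately have "\<forall>\<^sub>F k in sequentially. (bergman_norm n (?near (1 / real (Suc k))))\<^sup>2 < (e / 2)\<^sup>2"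
    by (rule order_tendstoD)
  then obtain k where k: "(bergman_norm n (?near (1 / real (Suc k))))\<^sup>2 < (e / 2)\<^sup>2"
    by (auto simp: eventually_sequentially)
  define \<epsilon> where "\<epsilon> = 1 / real (Suc k)"
  have \<epsilon>: "\<epsilon> > 0" by (simp add: \<epsilon>_def)
  have near_small: "bergman_norm n (?near \<epsilon>) < e / 2"
    unfolding \<epsilon>_def by (rule power2_less_imp_less[OF k]) (use e in simp)
  have "(\<lambda>m. bergman_norm n g * sqrt (far_mass \<zeta> \<epsilon> (unit_peak \<zeta> m))) \<longlonglongrightarrow> bergman_norm n g * sqrt 0"
    by (intro tendsto_intros far_mass_unit_peak \<zeta> \<epsilon>)
  then have "\<forall>\<^sub>F m in sequentially. bergman_norm n g * sqrt (far_mass \<zeta> \<epsilon> (unit_peak \<zeta> m)) < e / 2"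
    using e by (intro order_tendstoD) auto
  then obtain m0 where m0: "\<And>m. m \<ge> m0 \<Longrightarrow> bergman_norm n g * sqrt (far_mass \<zeta> \<epsilon> (unit_peak \<zeta> m)) < e / 2"
    by (auto simp: eventually_sequentially)
  show "\<exists>no. \<forall>m\<ge>no. norm (bergman_inner n g (unit_peak \<zeta> m) - 0) < e"
  proof (intro exI[of _ m0] allI impI)
    fix m assume m: "m0 \<le> m"
    let ?far = "\<lambda>z. indicator (- ball \<zeta> \<epsilon>) z * unit_peak \<zeta> m z"
    have "bergman_inner n g (unit_peak \<zeta> m)
        = (LINT z|ball_measure n. ?near \<epsilon> z * cnj (unit_peak \<zeta> m z) + g z * cnj (?far z))"
      unfolding bergman_inner_def by (intro Bochner_Integration.integral_cong) (auto simp: indicator_def)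
    also have "\<dots> = bergman_inner n (?near \<epsilon>) (unit_peak \<zeta> m) + bergman_inner n g ?far"
      unfolding bergman_inner_def
      by (rule Bochner_Integration.integral_add[OF integrable_inner[OF near_sq us] integrable_inner[OF gs far_sq]])
    finally have "cmod (bergman_inner n g (unit_peak \<zeta> m))
        \<le> cmod (bergman_inner n (?near \<epsilon>) (unit_peak \<zeta> m)) + cmod (bergman_inner n g ?far)"
      by (simp only: norm_triangle_ineq)
    moreover have "cmod (bergman_inner n (?near \<epsilon>) (unit_peak \<zeta> m)) \<le> bergman_norm n (?near \<epsilon>) * 1"
      using bergman_Cauchy_Schwarz[OF near_sq us, of \<epsilon> m] norm_unit_peak[OF \<zeta>] by simp
    moreover have "bergman_norm n ?far = sqrt (far_mass \<zeta> \<epsilon> (unit_peak \<zeta> m))"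
      unfolding bergman_norm_def far_mass_def
      by (intro arg_cong[of _ _ sqrt] Bochner_Integration.integral_cong) (auto simp: indicator_def)
    moreover have "cmod (bergman_inner n g ?far) \<le> bergman_norm n g * bergman_norm n ?far"
      by (rule bergman_Cauchy_Schwarz[OF gs far_sq])
    ultimately show "norm (bergman_inner n g (unit_peak \<zeta> m) - 0) < e"
      using near_small m0[OF m] by simp
  qed
qed

text \<open>The measures with density |u_m|^2 with respect to the ball measure form an approximate
  identity at \<zeta>: near \<zeta> continuity of the symbol makes the error small, and elsewhere 2
  B bounds its oscillation while the mass tends to 0.\<close>

lemma unit_peak_symbol:
  assumes \<zeta>: "norm \<zeta> = 1" and \<phi>: "continuous_on (cball 0 1) \<phi>"
  shows "(\<lambda>m. bergman_inner n (toeplitz n \<phi> (unit_peak \<zeta> m)) (unit_peak \<zeta> m)) \<longlonglongrightarrow> \<phi> \<zeta>"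
proof (rule LIMSEQ_I)
  fix e :: real assume e: "e > 0"
  let ?u = "unit_peak \<zeta>"
  note ub = unit_peak_bergman[OF \<zeta>]
  note us = bergman_square_integrable[OF ub]
  obtain B where B: "\<forall>y\<in>\<phi> ` cball 0 1. cmod y \<le> B"
    using compact_imp_bounded[OF compact_continuous_image[OF \<phi> compact_cball]] by (metis bounded_iff)
  have \<zeta>c: "\<zeta> \<in> cball 0 1" using \<zeta> by simp
  have B0: "0 \<le> B" using B \<zeta>c by (meson image_eqI norm_ge_zero order_trans)
  obtain \<epsilon> where \<epsilon>: "\<epsilon> > 0" "\<And>z. z \<in> cball 0 1 \<Longrightarrow> dist z \<zeta> < \<epsilon> \<Longrightarrow> dist (\<phi> z) (\<phi> \<zeta>) < e / 2"
    using \<phi> \<zeta>c e unfolding continuous_on_iff by (metis half_gt_zero)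
  have "(\<lambda>m. 2 * B * far_mass \<zeta> \<epsilon> (?u m)) \<longlonglongrightarrow> 2 * B * 0"
    by (intro tendsto_intros far_mass_unit_peak \<zeta> \<epsilon>)
  then have "\<forall>\<^sub>F m in sequentially. 2 * B * far_mass \<zeta> \<epsilon> (?u m) < e / 2"
    using e by (intro order_tendstoD) auto
  then obtain m0 where m0: "\<And>m. m \<ge> m0 \<Longrightarrow> 2 * B * far_mass \<zeta> \<epsilon> (?u m) < e / 2"
    by (auto simp: eventually_sequentially)
  show "\<exists>no. \<forall>m\<ge>no. norm (bergman_inner n (toeplitz n \<phi> (?u m)) (?u m) - \<phi> \<zeta>) < e"
  proof (intro exI[of _ m0] allI impI)
    fix m assume m: "m0 \<le> m"
    have int: "integrable (ball_measure n) (\<lambda>z. (cmod (?u m z))\<^sup>2)" using us by (simp add: square_integrable_def)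
    have one: "(LINT z|ball_measure n. (cmod (?u m z))\<^sup>2) = 1"
      using norm_unit_peak[OF \<zeta>, of m] bergman_norm_square[of n "?u m"] by simp
    have meas [measurable]: "?u m \<in> borel_measurable borel" by (rule square_integrable_measurable[OF us])
    have int_far: "integrable (ball_measure n) (\<lambda>z. indicator (- ball \<zeta> \<epsilon>) z * (cmod (?u m z))\<^sup>2)"
      by (rule Bochner_Integration.integrable_bound[OF int]) (auto simp: indicator_def)
    note int1 = integrable_inner[OF symbol_mult_square_integrable[OF \<phi> ub] us, of m m]
    note int2 = integrable_inner[OF square_integrable_cmult[OF us] us, of "\<phi> \<zeta>" m m]
    have "bergman_inner n (toeplitz n \<phi> (?u m)) (?u m) = bergman_inner n (\<lambda>z. \<phi> z * ?u m z) (?u m)"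
      by (rule inner_toeplitz[OF \<phi> ub ub])
    \<comment> \<open>The peak has norm 1, so a constant is its own expectation and may be
      subtracted under the integral.\<close>
    moreover have "\<phi> \<zeta> = bergman_inner n (\<lambda>z. \<phi> \<zeta> * ?u m z) (?u m)"
      by (simp add: bergman_inner_cmult_left bergman_inner_self norm_unit_peak[OF \<zeta>])
    ultimately have "bergman_inner n (toeplitz n \<phi> (?u m)) (?u m) - \<phi> \<zeta>
        = (LINT z|ball_measure n. \<phi> z * ?u m z * cnj (?u m z) - \<phi> \<zeta> * ?u m z * cnj (?u m z))"
      unfolding bergman_inner_def using Bochner_Integration.integral_diff[OF int1 int2] by simp
    also have "cmod \<dots> \<le> (LINT z|ball_measure n. e / 2 * (cmod (?u m z))\<^sup>2 + 2 * B * (indicator (- ball \<zeta> \<epsilon>) z * (cmod (?u m z))\<^sup>2))"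
    proof (rule order_trans[OF integral_norm_bound], rule Bochner_Integration.integral_mono)
      show "integrable (ball_measure n) (\<lambda>z. norm (\<phi> z * ?u m z * cnj (?u m z) - \<phi> \<zeta> * ?u m z * cnj (?u m z)))"
        by (rule integrable_norm[OF Bochner_Integration.integrable_diff[OF int1 int2]])
      show "integrable (ball_measure n) (\<lambda>z. e / 2 * (cmod (?u m z))\<^sup>2 + 2 * B * (indicator (- ball \<zeta> \<epsilon>) z * (cmod (?u m z))\<^sup>2))"
        by (intro Bochner_Integration.integrable_add integrable_mult_right int int_far)
      fix z
      have "norm (\<phi> z * ?u m z * cnj (?u m z) - \<phi> \<zeta> * ?u m z * cnj (?u m z)) = cmod (\<phi> z - \<phi> \<zeta>) * (cmod (?u m z))\<^sup>2"
        by (simp add: norm_mult power2_eq_square mult.assoc flip: left_diff_distrib)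
      also have "\<dots> \<le> (e / 2 + 2 * B * indicator (- ball \<zeta> \<epsilon>) z) * (cmod (?u m z))\<^sup>2"
      proof (cases "z \<in> ball 0 1")
        case True
        then have zc: "z \<in> cball 0 1" by simp
        have "cmod (\<phi> z - \<phi> \<zeta>) \<le> e / 2 + 2 * B * indicator (- ball \<zeta> \<epsilon>) z"
        proof (cases "z \<in> ball \<zeta> \<epsilon>")
          case True
          then show ?thesis using \<epsilon>(2)[OF zc] by (simp add: dist_norm norm_minus_commute less_imp_le)
        next
          case False
          have "cmod (\<phi> z) \<le> B" "cmod (\<phi> \<zeta>) \<le> B" using B zc \<zeta>c by blast+
          then have "cmod (\<phi> z - \<phi> \<zeta>) \<le> 2 * B" using norm_triangle_ineq4[of "\<phi> z" "\<phi> \<zeta>"] by linarith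
          then show ?thesis using False e by simp
        qed
        then show ?thesis by (intro mult_right_mono) auto
      next
        case False
        then have "?u m z = 0" by (simp add: unit_peak_def peak_def)
        then show ?thesis by simp
      qed
      finally show "norm (\<phi> z * ?u m z * cnj (?u m z) - \<phi> \<zeta> * ?u m z * cnj (?u m z))
          \<le> e / 2 * (cmod (?u m z))\<^sup>2 + 2 * B * (indicator (- ball \<zeta> \<epsilon>) z * (cmod (?u m z))\<^sup>2)"
        by (simp add: algebra_simps)
    qed
    also have "\<dots> = e / 2 + 2 * B * far_mass \<zeta> \<epsilon> (?u m)"
      using int int_far one by (simp add: far_mass_def)
    also have "\<dots> < e" using m0[OF m] by simp
    finally show "norm (bergman_inner n (toeplitz n \<phi> (?u m)) (?u m) - \<phi> \<zeta>) < e" .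
  qed
qed

text \<open>Along a subsequence the images of the peaks converge in norm to some g, and the peaks
  tend weakly to 0, so their quadratic form tends to 0. The same numbers tend to the symbol at
  \<zeta>.\<close>

lemma compact_toeplitz_symbol_zero:
  fixes \<phi> :: "'d cfun"
  assumes \<phi>: "continuous_on (cball 0 1) \<phi>" and T: "toeplitz n \<phi> \<in> compact_operators n"
    and \<zeta>: "\<zeta> \<in> sphere 0 1"
  shows "\<phi> \<zeta> = 0"
proof -
  have \<zeta>1: "norm \<zeta> = 1" using \<zeta> by simp
  let ?u = "unit_peak \<zeta>"
  note ub = unit_peak_bergman[OF \<zeta>1]
  note us = bergman_square_integrable[OF ub]
  have "\<forall>m. ?u m \<in> bergman n \<and> bergman_norm n (?u m) \<le> 1"
    using ub norm_unit_peak[OF \<zeta>1] by simp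
  then obtain g r where g: "g \<in> bergman n" and r: "strict_mono r"
      and lim: "(\<lambda>m. bergman_norm n (toeplitz n \<phi> (?u (r m)) - g)) \<longlonglongrightarrow> 0"
    using T unfolding compact_operators_def by blast
  note gs = bergman_square_integrable[OF g]
  have Ts: "square_integrable n (toeplitz n \<phi> (?u m))" for m
    by (rule bergman_square_integrable[OF toeplitz_bergman[OF \<phi> ub]])
  have "(\<lambda>m. bergman_inner n (toeplitz n \<phi> (?u (r m)) - g) (?u (r m))) \<longlonglongrightarrow> 0"
  proof (rule Lim_null_comparison[OF always_eventually lim], rule allI)
    fix m
    show "norm (bergman_inner n (toeplitz n \<phi> (?u (r m)) - g) (?u (r m))) \<le> bergman_norm n (toeplitz n \<phi> (?u (r m)) - g)"
      using bergman_Cauchy_Schwarz[OF square_integrable_diff[OF Ts gs] us, of "r m" "r m"] norm_unit_peak[OF \<zeta>1]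
      by (simp add: fun_diff_def)
  qed
  moreover have "(\<lambda>m. bergman_inner n g (?u (r m))) \<longlonglongrightarrow> 0"
    using LIMSEQ_subseq_LIMSEQ[OF unit_peak_weakly_null[OF \<zeta>1 g] r] by (simp add: o_def)
  ultimately have "(\<lambda>m. bergman_inner n (toeplitz n \<phi> (?u (r m)) - g) (?u (r m)) + bergman_inner n g (?u (r m))) \<longlonglongrightarrow> 0 + 0"
    by (rule tendsto_add)
  moreover have "bergman_inner n (toeplitz n \<phi> (?u (r m)) - g) (?u (r m)) + bergman_inner n g (?u (r m))
      = bergman_inner n (toeplitz n \<phi> (?u (r m))) (?u (r m))" for m
    by (simp add: fun_diff_def bergman_inner_diff_left Ts gs us)
  ultimately have "(\<lambda>m. bergman_inner n (toeplitz n \<phi> (?u (r m))) (?u (r m))) \<longlonglongrightarrow> 0" by simp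
  moreover have "(\<lambda>m. bergman_inner n (toeplitz n \<phi> (?u (r m))) (?u (r m))) \<longlonglongrightarrow> \<phi> \<zeta>"
    using LIMSEQ_subseq_LIMSEQ[OF unit_peak_symbol[OF \<zeta>1 \<phi>] r] by (simp add: o_def)
  ultimately show ?thesis by (metis LIMSEQ_unique)
qed

end

section \<open>Real quadratic forms, the operator order and compact operators\<close>

context bergman_basis begin

lemma form_add:
  assumes "S \<in> bounded_operators n" "T \<in> bounded_operators n" "f \<in> bergman n" "square_integrable n g"
  shows "bergman_inner n ((S + T) f) g = bergman_inner n (S f) g + bergman_inner n (T f) g"
  using bergman_inner_add_left[OF bergman_square_integrable[OF bounded_operator_bergman[OF assms(1,3)]]
      bergman_square_integrable[OF bounded_operator_bergman[OF assms(2,3)]] assms(4)]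
  by (simp add: plus_fun_def)

lemma form_scaleR: "bergman_inner n ((r *\<^sub>R T) f) g = of_real r * bergman_inner n (T f) g"
  using bergman_inner_cmult_left[of n "of_real r" "T f" g] by (simp add: scaleR_fun_def scaleR_conv_of_real)

lemma bounded_operators_scaleR:
  fixes T :: "'d operator"
  assumes "T \<in> bounded_operators n"
  shows "r *\<^sub>R T \<in> bounded_operators n"
proof -
  have "r *\<^sub>R T = (\<lambda>f z. of_real r * T f z)"
    by (simp add: scaleR_fun_def scaleR_conv_of_real)
  then show ?thesis using bounded_operators_cmult[OF assms, of "of_real r"] by simp
qed

lemma bounded_operators_zero: "(0 :: 'd operator) \<in> bounded_operators n"
  by (rule bounded_operatorI[where C=0]) (auto simp: zero_fun_def bergman_zero)

lemma form_expand:
  assumes T: "T \<in> bounded_operators n" and f: "f \<in> bergman n" and g: "g \<in> bergman n"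
  shows "bergman_inner n (T (\<lambda>z. f z + c * g z)) (\<lambda>z. f z + c * g z)
    = bergman_inner n (T f) f + cnj c * bergman_inner n (T f) g + c * bergman_inner n (T g) f
      + c * cnj c * bergman_inner n (T g) g"
proof -
  have cg: "(\<lambda>z. c * g z) \<in> bergman n" by (rule bergman_cmult[OF g])
  note sq = bergman_square_integrable[OF f] bergman_square_integrable[OF cg]
    bergman_square_integrable[OF bounded_operator_bergman[OF T f]]
    square_integrable_cmult[OF bergman_square_integrable[OF bounded_operator_bergman[OF T g]], of c]
  have "T (\<lambda>z. f z + c * g z) = (\<lambda>z. T f z + c * T g z)"
    using bounded_operator_add[OF T f cg] bounded_operator_cmult[OF T g, of c] by simp
  then have "bergman_inner n (T (\<lambda>z. f z + c * g z)) (\<lambda>z. f z + c * g z)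
      = bergman_inner n (T f) (\<lambda>z. f z + c * g z) + bergman_inner n (\<lambda>z. c * T g z) (\<lambda>z. f z + c * g z)"
    using bergman_inner_add_left[OF sq(3,4) square_integrable_add[OF sq(1,2)]] by simp
  then show ?thesis
    using bergman_inner_add_right[OF sq(1,2,3)] bergman_inner_add_right[OF sq(1,2,4)]
    by (simp add: bergman_inner_cmult_left bergman_inner_cmult_right algebra_simps)
qed

text \<open>Over complex scalars these are the bounded self-adjoint operators. The condition on the
  form is visibly linear and is the one that the operator order tests.\<close>

definition form_real :: "'d operator set" where
  "form_real = {T \<in> bounded_operators n. \<forall>f\<in>bergman n. bergman_inner n (T f) f \<in> \<real>}"

definition quad :: "'d operator \<Rightarrow> 'd cfun \<Rightarrow> real" where
  "quad T f = Re (bergman_inner n (T f) f)"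

lemma form_real_bounded: "T \<in> form_real \<Longrightarrow> T \<in> bounded_operators n"
  by (simp add: form_real_def)

lemma quad_eq: "T \<in> form_real \<Longrightarrow> f \<in> bergman n \<Longrightarrow> bergman_inner n (T f) f = of_real (quad T f)"
  by (simp add: form_real_def quad_def)

text \<open>Polarization: the form is real at f + c g for c = 1 and for c = i, which fixes the
  imaginary and the real part of the two mixed terms relative to each other.\<close>

lemma form_real_self_adjoint:
  assumes T: "T \<in> form_real"
  shows "self_adjoint n T"
  unfolding self_adjoint_def is_adjoint_def
proof (intro ballI)
  fix f g :: "'d cfun" assume f: "f \<in> bergman n" and g: "g \<in> bergman n"
  note Tb = form_real_bounded[OF T]
  have ex: "bergman_inner n (T f) f + cnj c * bergman_inner n (T f) g + c * bergman_inner n (T g) f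
      + c * cnj c * bergman_inner n (T g) g \<in> \<real>" for c
    using T bergman_add[OF f bergman_cmult[OF g, of c]] unfolding form_expand[OF Tb f g, symmetric] form_real_def by simp
  have "Im (bergman_inner n (T f) f) = 0" "Im (bergman_inner n (T g) g) = 0"
    by (simp_all add: quad_eq T f g)
  then have "bergman_inner n (T f) g = cnj (bergman_inner n (T g) f)"
    using ex[of 1] ex[of \<i>] by (simp add: complex_is_Real_iff complex_eq_iff)
  then show "bergman_inner n (T f) g = bergman_inner n f (T g)"
    by (simp add: bergman_inner_cnj[of n f])
qed

lemma subspace_form_real: "subspace form_real"
proof (rule subspaceI)
  show "0 \<in> form_real"
    using bounded_operators_zero by (simp add: form_real_def zero_fun_def)
  fix S T assume S: "S \<in> form_real" and T: "T \<in> form_real"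
  then show "S + T \<in> form_real"
    by (auto simp: form_real_def form_add bergman_square_integrable simp del: plus_fun_apply intro!: bounded_operators_add)
next
  fix r T assume "T \<in> form_real"
  then show "r *\<^sub>R T \<in> form_real"
    by (auto simp: form_real_def form_scaleR intro!: bounded_operators_scaleR)
qed

lemma quad_add: "S \<in> bounded_operators n \<Longrightarrow> T \<in> bounded_operators n \<Longrightarrow> f \<in> bergman n \<Longrightarrow> quad (S + T) f = quad S f + quad T f"
  unfolding quad_def by (simp add: form_add bergman_square_integrable del: plus_fun_apply)

lemma quad_scaleR: "quad (r *\<^sub>R T) f = r * quad T f"
  unfolding quad_def form_scaleR by simp

lemma quad_diff:
  assumes "S \<in> bounded_operators n" "T \<in> bounded_operators n" "f \<in> bergman n"
  shows "quad (S - T) f = quad S f - quad T f"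
  using quad_add[OF bounded_operators_diff[OF assms(1,2)] assms(2,3)] by simp

lemma id_form_real: "id_operator n \<in> form_real"
proof -
  have "(id_operator n :: 'd operator) \<in> bounded_operators n"
    by (rule bounded_operatorI[where C=1]) (auto simp: id_operator_def bergman_cmult plus_fun_def bergman_add)
  then show ?thesis by (simp add: form_real_def id_operator_def bergman_inner_self)
qed

lemma quad_id: "f \<in> bergman n \<Longrightarrow> quad (id_operator n) f = (bergman_norm n f)\<^sup>2"
  by (simp add: quad_def id_operator_def bergman_inner_self)

lemma operator_le_iff:
  assumes S: "S \<in> form_real" and T: "T \<in> form_real"
  shows "operator_le n S T \<longleftrightarrow> (\<forall>f\<in>bergman n. quad S f \<le> quad T f)"
proof -
  have D: "T - S \<in> form_real" by (rule subspace_diff[OF subspace_form_real T S])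
  have "operator_le n S T \<longleftrightarrow> (\<forall>f\<in>bergman n. 0 \<le> quad (T - S) f)"
    using D by (auto simp: operator_le_def positive_operator_def form_real_def quad_def simp del: minus_apply)
  also have "\<dots> \<longleftrightarrow> (\<forall>f\<in>bergman n. quad S f \<le> quad T f)"
    using quad_diff[OF form_real_bounded[OF T] form_real_bounded[OF S]] by auto
  finally show ?thesis .
qed

text \<open>Polarization with c = 1 and c = i again. It supplies the antisymmetry of the operator
  order.\<close>

lemma form_real_eqI:
  assumes S: "S \<in> form_real" and T: "T \<in> form_real" and eq: "\<And>f. f \<in> bergman n \<Longrightarrow> quad S f = quad T f"
  shows "S = T"
proof
  fix f
  let ?D = "S - T"
  have D: "?D \<in> form_real" by (rule subspace_diff[OF subspace_form_real S T])
  note Db = form_real_bounded[OF D]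
  have z: "bergman_inner n (?D f) f = 0" if "f \<in> bergman n" for f
    using quad_eq[OF D that] quad_diff[OF form_real_bounded[OF S] form_real_bounded[OF T] that] eq[OF that] by simp
  show "S f = T f"
  proof (cases "f \<in> bergman n")
    case True
    have "bergman_inner n (?D f) g = 0" if g: "g \<in> bergman n" for g
    proof -
      have ex: "cnj c * bergman_inner n (?D f) g + c * bergman_inner n (?D g) f = 0" for c
        using form_expand[OF Db True g, of c] z[OF bergman_add[OF True bergman_cmult[OF g, of c]]] z[OF True] z[OF g] by simp
      from ex[of 1] ex[of \<i>] show ?thesis by (simp add: complex_eq_iff)
    qed
    from this[OF bounded_operator_bergman[OF Db True]] have "bergman_norm n (?D f) = 0"
      by (simp add: bergman_inner_self)
    from bergman_norm_eq_zero[OF bounded_operator_bergman[OF Db True] this] show ?thesis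
      by (simp add: fun_eq_iff)
  next
    case False
    then show ?thesis
      using form_real_bounded[OF S] form_real_bounded[OF T] by (simp add: bounded_operators_def)
  qed
qed

lemma quad_bound:
  assumes T: "T \<in> bounded_operators n"
  obtains C where "\<And>f. f \<in> bergman n \<Longrightarrow> quad T f \<le> C * (bergman_norm n f)\<^sup>2"
proof -
  obtain C where C: "C \<ge> 0" "\<And>f. f \<in> bergman n \<Longrightarrow> bergman_norm n (T f) \<le> C * bergman_norm n f"
    using bounded_operator_bound[OF T] by blast
  have "quad T f \<le> C * (bergman_norm n f)\<^sup>2" if f: "f \<in> bergman n" for f
  proof -
    have "quad T f \<le> cmod (bergman_inner n (T f) f)" unfolding quad_def by (rule complex_Re_le_cmod)
    also have "\<dots> \<le> bergman_norm n (T f) * bergman_norm n f"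
      by (rule bergman_Cauchy_Schwarz[OF bergman_square_integrable[OF bounded_operator_bergman[OF T f]] bergman_square_integrable[OF f]])
    also have "\<dots> \<le> C * bergman_norm n f * bergman_norm n f"
      by (intro mult_right_mono C(2) f) simp
    finally show ?thesis by (simp add: power2_eq_square mult.assoc)
  qed
  then show ?thesis by (rule that)
qed

lemma order_unit_space_form_real:
  assumes A: "subspace A" "A \<subseteq> form_real" "id_operator n \<in> A"
  shows "order_unit_space A (operator_le n) (id_operator n)"
proof -
  have le: "operator_le n S T \<longleftrightarrow> (\<forall>f\<in>bergman n. quad S f \<le> quad T f)" if "S \<in> A" "T \<in> A" for S T
    using that A(2) by (intro operator_le_iff) auto
  note cl = subspace_add[OF A(1)] subspace_scale[OF A(1)] subspace_0[OF A(1)] A(3)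
  have bd: "T \<in> bounded_operators n" if "T \<in> A" for T using that A(2) form_real_bounded by blast
  have q0: "quad 0 f = 0" for f by (simp add: quad_def zero_fun_def)
  show ?thesis
    unfolding order_unit_space_def
  proof (intro conjI ballI allI impI)
    fix S T assume "S \<in> A" "T \<in> A" "operator_le n S T" "operator_le n T S"
    then show "S = T"
      using A(2) by (intro form_real_eqI) (auto simp: le intro: antisym)
  next
    fix S T U assume "S \<in> A" "T \<in> A" "U \<in> A" "operator_le n S T" "operator_le n T U"
    then show "operator_le n S U" by (auto simp: le intro: order_trans)
  next
    fix S T U assume "S \<in> A" "T \<in> A" "U \<in> A" "operator_le n S T"
    then show "operator_le n (S + U) (T + U)"
      by (simp add: le cl quad_add bd)
  next
    fix S T and r :: real assume "S \<in> A" "T \<in> A" "0 \<le> r" "operator_le n S T"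
    then show "operator_le n (r *\<^sub>R S) (r *\<^sub>R T)"
      by (simp add: le cl quad_scaleR mult_left_mono)
  next
    fix T assume T: "T \<in> A"
    obtain C where "\<And>f. f \<in> bergman n \<Longrightarrow> quad T f \<le> C * (bergman_norm n f)\<^sup>2"
      using quad_bound[OF bd[OF T]] by blast
    then have "operator_le n T (C *\<^sub>R id_operator n)"
      using T by (simp add: le cl quad_scaleR quad_id)
    then show "\<exists>r. operator_le n T (r *\<^sub>R id_operator n)" by blast
  next
    fix T assume T: "T \<in> A" and *: "\<forall>r>0. operator_le n T (r *\<^sub>R id_operator n)"
    have "quad T f \<le> 0" if f: "f \<in> bergman n" for f
    proof (rule field_le_epsilon)
      fix e :: real assume e: "e > 0"
      \<comment> \<open>The multiple depends on f, and the summand 1 covers f = 0; then r times the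
        squared norm is at most e.\<close>
      define r where "r = e / ((bergman_norm n f)\<^sup>2 + 1)"
      have "r > 0" using e by (simp add: r_def add_nonneg_pos)
      then have "operator_le n T (r *\<^sub>R id_operator n)" using * by blast
      then have "quad T f \<le> r * (bergman_norm n f)\<^sup>2"
        using T f by (simp add: le cl quad_scaleR quad_id)
      also have "\<dots> \<le> e" using e by (simp add: r_def divide_simps add_nonneg_pos)
      finally show "quad T f \<le> 0 + e" by simp
    qed
    then show "operator_le n T 0" using T by (simp add: le cl q0)
  qed (use A le in auto)
qed

lemma compact_operators_bounded: "T \<in> compact_operators n \<Longrightarrow> T \<in> bounded_operators n"
  by (simp add: compact_operators_def)

lemma compact_operatorE:
  fixes x :: "nat \<Rightarrow> 'd cfun"
  assumes "T \<in> compact_operators n" "\<And>m. x m \<in> bergman n" "\<And>m. bergman_norm n (x m) \<le> 1"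
  obtains g r where "g \<in> bergman n" "strict_mono r" "(\<lambda>m. bergman_norm n (\<lambda>z. T (x (r m)) z - g z)) \<longlonglongrightarrow> 0"
proof -
  have "\<forall>m. x m \<in> bergman n \<and> bergman_norm n (x m) \<le> 1" using assms(2,3) by blast
  then obtain g r where "g \<in> bergman n" "strict_mono r" "(\<lambda>m. bergman_norm n (T (x (r m)) - g)) \<longlonglongrightarrow> 0"
    using assms(1) unfolding compact_operators_def by blast
  then show ?thesis using that[of g r] by (simp add: fun_diff_def)
qed

lemma compact_operatorsI:
  fixes T :: "'d operator"
  assumes "T \<in> bounded_operators n"
    and "\<And>x :: nat \<Rightarrow> 'd cfun. (\<And>m. x m \<in> bergman n) \<Longrightarrow> (\<And>m. bergman_norm n (x m) \<le> 1) \<Longrightarrow>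
      \<exists>g r. g \<in> bergman n \<and> strict_mono r \<and> (\<lambda>m. bergman_norm n (\<lambda>z. T (x (r m)) z - g z)) \<longlonglongrightarrow> 0"
  shows "T \<in> compact_operators n"
  unfolding compact_operators_def
proof (intro CollectI conjI assms(1) allI impI)
  fix x :: "nat \<Rightarrow> 'd cfun" assume x: "\<forall>m. x m \<in> bergman n \<and> bergman_norm n (x m) \<le> 1"
  obtain g r where "g \<in> bergman n" "strict_mono r" "(\<lambda>m. bergman_norm n (\<lambda>z. T (x (r m)) z - g z)) \<longlonglongrightarrow> 0"
    using assms(2)[of x] x by blast
  then show "\<exists>g\<in>bergman n. \<exists>r. strict_mono r \<and> (\<lambda>m. bergman_norm n (T (x (r m)) - g)) \<longlonglongrightarrow> 0"
    by (intro bexI[of _ g] exI[of _ r]) (simp_all add: fun_diff_def)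
qed

lemma compact_operators_add:
  assumes S: "S \<in> compact_operators n" and T: "T \<in> compact_operators n"
  shows "S + T \<in> (compact_operators n :: 'd operator set)"
proof (rule compact_operatorsI)
  note Sb = compact_operators_bounded[OF S] and Tb = compact_operators_bounded[OF T]
  show "S + T \<in> bounded_operators n" by (rule bounded_operators_add[OF Sb Tb])
  fix x :: "nat \<Rightarrow> 'd cfun" assume x: "\<And>m. x m \<in> bergman n" "\<And>m. bergman_norm n (x m) \<le> 1"
  obtain g r where g: "g \<in> bergman n" "strict_mono r" and gl: "(\<lambda>m. bergman_norm n (\<lambda>z. S (x (r m)) z - g z)) \<longlonglongrightarrow> 0"
    using compact_operatorE[OF S, of x] x by blast
  \<comment> \<open>The second operator is applied along the subsequence already extracted for the
    first.\<close>
  obtain h s where h: "h \<in> bergman n" "strict_mono s" and hl: "(\<lambda>m. bergman_norm n (\<lambda>z. T (x (r (s m))) z - h z)) \<longlonglongrightarrow> 0"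
    using compact_operatorE[OF T, of "\<lambda>m. x (r m)"] x by blast
  have gl': "(\<lambda>m. bergman_norm n (\<lambda>z. S (x (r (s m))) z - g z)) \<longlonglongrightarrow> 0"
    using LIMSEQ_subseq_LIMSEQ[OF gl h(2)] by (simp add: o_def)
  have lim: "(\<lambda>m. bergman_norm n (\<lambda>z. S (x (r (s m))) z - g z) + bergman_norm n (\<lambda>z. T (x (r (s m))) z - h z)) \<longlonglongrightarrow> 0"
    using tendsto_add[OF gl' hl] by simp
  have "(\<lambda>m. bergman_norm n (\<lambda>z. (S + T) (x (r (s m))) z - (g z + h z))) \<longlonglongrightarrow> 0"
  proof (rule Lim_null_comparison[OF always_eventually lim], rule allI)
    fix m
    have "(\<lambda>z. S (x (r (s m))) z - g z) \<in> bergman n" "(\<lambda>z. T (x (r (s m))) z - h z) \<in> bergman n"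
      by (intro bergman_diff g h bounded_operator_bergman[OF Sb] bounded_operator_bergman[OF Tb] x)+
    from bergman_norm_triangle[OF this[THEN bergman_square_integrable]]
    show "norm (bergman_norm n (\<lambda>z. (S + T) (x (r (s m))) z - (g z + h z)))
        \<le> bergman_norm n (\<lambda>z. S (x (r (s m))) z - g z) + bergman_norm n (\<lambda>z. T (x (r (s m))) z - h z)"
      by (simp add: algebra_simps)
  qed
  moreover have "(\<lambda>z. g z + h z) \<in> bergman n" by (rule bergman_add[OF g(1) h(1)])
  moreover have "strict_mono (\<lambda>m. r (s m))" using strict_mono_o[OF g(2) h(2)] by (simp add: o_def)
  ultimately show "\<exists>g r. g \<in> bergman n \<and> strict_mono r \<and> (\<lambda>m. bergman_norm n (\<lambda>z. (S + T) (x (r m)) z - g z)) \<longlonglongrightarrow> 0"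
    by (intro exI[of _ "\<lambda>z. g z + h z"] exI[of _ "\<lambda>m. r (s m)"] conjI)
qed

lemma compact_operators_scaleR:
  assumes T: "T \<in> compact_operators n"
  shows "a *\<^sub>R T \<in> (compact_operators n :: 'd operator set)"
proof (rule compact_operatorsI)
  note Tb = compact_operators_bounded[OF T]
  show "a *\<^sub>R T \<in> bounded_operators n" by (rule bounded_operators_scaleR[OF Tb])
  fix x :: "nat \<Rightarrow> 'd cfun" assume x: "\<And>m. x m \<in> bergman n" "\<And>m. bergman_norm n (x m) \<le> 1"
  obtain g r where g: "g \<in> bergman n" "strict_mono r" and gl: "(\<lambda>m. bergman_norm n (\<lambda>z. T (x (r m)) z - g z)) \<longlonglongrightarrow> 0"
    using compact_operatorE[OF T, of x] x by blast
  have "bergman_norm n (\<lambda>z. (a *\<^sub>R T) (x (r m)) z - of_real a * g z) = \<bar>a\<bar> * bergman_norm n (\<lambda>z. T (x (r m)) z - g z)" for m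
    using bergman_norm_cmult[of n "of_real a" "\<lambda>z. T (x (r m)) z - g z"]
    by (simp add: scaleR_fun_def scaleR_conv_of_real right_diff_distrib)
  moreover have "(\<lambda>m. \<bar>a\<bar> * bergman_norm n (\<lambda>z. T (x (r m)) z - g z)) \<longlonglongrightarrow> \<bar>a\<bar> * 0"
    by (intro tendsto_intros gl)
  ultimately show "\<exists>g r. g \<in> bergman n \<and> strict_mono r \<and> (\<lambda>m. bergman_norm n (\<lambda>z. (a *\<^sub>R T) (x (r m)) z - g z)) \<longlonglongrightarrow> 0"
    using bergman_cmult[OF g(1), of "of_real a"] g(2) by (intro exI[of _ "\<lambda>z. of_real a * g z"] exI[of _ r]) simp
qed

lemma compact_operators_zero: "(0 :: 'd operator) \<in> compact_operators n"
proof (rule compact_operatorsI[OF bounded_operators_zero])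
  fix x :: "nat \<Rightarrow> 'd cfun"
  show "\<exists>g r. g \<in> bergman n \<and> strict_mono r \<and> (\<lambda>m. bergman_norm n (\<lambda>z. (0 :: 'd operator) (x (r m)) z - g z)) \<longlonglongrightarrow> 0"
    by (intro exI[of _ "\<lambda>_. 0"] exI[of _ "\<lambda>m. m"]) (simp add: bergman_zero strict_mono_def)
qed

lemma bergman_eqI:
  fixes f :: "'d cfun"
  assumes f: "f \<in> bergman n" and g: "g \<in> bergman n"
    and eq: "\<And>u. u \<in> bergman n \<Longrightarrow> bergman_inner n f u = bergman_inner n g u"
  shows "f = g"
proof -
  have d: "(\<lambda>z. f z - g z) \<in> bergman n" by (rule bergman_diff[OF f g])
  have "bergman_inner n (\<lambda>z. f z - g z) (\<lambda>z. f z - g z) = 0"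
    using eq[OF d] by (simp add: bergman_inner_diff_left bergman_square_integrable f g d)
  then have "bergman_norm n (\<lambda>z. f z - g z) = 0" by (simp add: bergman_inner_self)
  from bergman_norm_eq_zero[OF d this] show ?thesis by (simp add: fun_eq_iff)
qed

text \<open>The projection is accessible through inner products only. Linearity is thus checked by
  pairing with every u, and the norm bound comes from rewriting the squared norm of T f as the
  pairing of \<phi> f with T f.\<close>

lemma toeplitz_bounded:
  fixes \<phi> :: "'d cfun"
  assumes \<phi>: "continuous_on (cball 0 1) \<phi>"
  shows "toeplitz n \<phi> \<in> bounded_operators n"
proof -
  obtain B where "\<forall>y\<in>\<phi> ` cball 0 1. cmod y \<le> B"
    using compact_imp_bounded[OF compact_continuous_image[OF \<phi> compact_cball]] by (metis bounded_iff)
  then have B: "cmod (\<phi> z) \<le> B" if "z \<in> cball 0 1" for z using that by blast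
  have B0: "0 \<le> B" using order_trans[OF norm_ge_zero B[of 0]] by simp
  note mem = toeplitz_bergman[OF \<phi>] and inn = inner_toeplitz[OF \<phi>] and sqm = symbol_mult_square_integrable[OF \<phi>]
  show ?thesis
  proof (rule bounded_operatorI[where C=B])
    fix f :: "'d cfun" assume f: "f \<in> bergman n"
    show m: "toeplitz n \<phi> f \<in> bergman n" by (rule mem[OF f])
    have "(bergman_norm n (\<lambda>z. \<phi> z * f z))\<^sup>2 \<le> (LINT z|ball_measure n. B\<^sup>2 * (cmod (f z))\<^sup>2)"
      unfolding bergman_norm_square
    proof (rule Bochner_Integration.integral_mono)
      show "integrable (ball_measure n) (\<lambda>z. (cmod (\<phi> z * f z))\<^sup>2)" using sqm[OF f] by (simp add: square_integrable_def)
      show "integrable (ball_measure n) (\<lambda>z. B\<^sup>2 * (cmod (f z))\<^sup>2)"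
        using bergman_square_integrable[OF f] by (simp add: square_integrable_def)
      fix z
      show "(cmod (\<phi> z * f z))\<^sup>2 \<le> B\<^sup>2 * (cmod (f z))\<^sup>2"
      proof (cases "z \<in> ball 0 1")
        case True
        then show ?thesis
          using B[of z] by (simp add: norm_mult power_mult_distrib mult_right_mono power_mono)
      next
        case False
        then show ?thesis using f by (simp add: bergman_def)
      qed
    qed
    also have "\<dots> = (B * bergman_norm n f)\<^sup>2"
      by (simp add: power_mult_distrib bergman_norm_square)
    finally have le: "bergman_norm n (\<lambda>z. \<phi> z * f z) \<le> B * bergman_norm n f"
      by (rule power2_le_imp_le) (use B0 in simp)
    have "(bergman_norm n (toeplitz n \<phi> f))\<^sup>2 = cmod (bergman_inner n (toeplitz n \<phi> f) (toeplitz n \<phi> f))"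
      unfolding bergman_inner_self norm_of_real by simp
    also have "\<dots> \<le> bergman_norm n (\<lambda>z. \<phi> z * f z) * bergman_norm n (toeplitz n \<phi> f)"
      unfolding inn[OF f m] by (rule bergman_Cauchy_Schwarz[OF sqm[OF f] bergman_square_integrable[OF m]])
    finally have "bergman_norm n (toeplitz n \<phi> f) * bergman_norm n (toeplitz n \<phi> f)
        \<le> bergman_norm n (\<lambda>z. \<phi> z * f z) * bergman_norm n (toeplitz n \<phi> f)"
      by (simp add: power2_eq_square)
    then have "bergman_norm n (toeplitz n \<phi> f) \<le> bergman_norm n (\<lambda>z. \<phi> z * f z)"
      using bergman_norm_nonneg[of n "toeplitz n \<phi> f"] bergman_norm_nonneg[of n "\<lambda>z. \<phi> z * f z"]
      by (cases "bergman_norm n (toeplitz n \<phi> f) = 0") (auto dest: mult_right_le_imp_le)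
    with le show "bergman_norm n (toeplitz n \<phi> f) \<le> B * bergman_norm n f" by linarith
    show "toeplitz n \<phi> (\<lambda>z. c * f z) = (\<lambda>z. c * toeplitz n \<phi> f z)" for c
    proof (rule bergman_eqI[OF mem[OF bergman_cmult[OF f]] bergman_cmult[OF m]])
      fix u :: "'d cfun" assume u: "u \<in> bergman n"
      have "(\<lambda>z. \<phi> z * (c * f z)) = (\<lambda>z. c * (\<phi> z * f z))" by (simp add: mult_ac)
      then show "bergman_inner n (toeplitz n \<phi> (\<lambda>z. c * f z)) u = bergman_inner n (\<lambda>z. c * toeplitz n \<phi> f z) u"
        by (simp add: inn[OF bergman_cmult[OF f] u] inn[OF f u] bergman_inner_cmult_left)
    qed
    fix g :: "'d cfun" assume g: "g \<in> bergman n"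
    have "toeplitz n \<phi> (\<lambda>z. f z + g z) = (\<lambda>z. toeplitz n \<phi> f z + toeplitz n \<phi> g z)"
    proof (rule bergman_eqI[OF mem[OF bergman_add[OF f g]] bergman_add[OF m mem[OF g]]])
      fix u :: "'d cfun" assume u: "u \<in> bergman n"
      have "(\<lambda>z. \<phi> z * (f z + g z)) = (\<lambda>z. \<phi> z * f z + \<phi> z * g z)" by (simp add: algebra_simps)
      then show "bergman_inner n (toeplitz n \<phi> (\<lambda>z. f z + g z)) u = bergman_inner n (\<lambda>z. toeplitz n \<phi> f z + toeplitz n \<phi> g z) u"
        by (simp add: inn[OF bergman_add[OF f g] u] inn[OF f u] inn[OF g u] sqm f g
            bergman_inner_add_left bergman_square_integrable m mem u)
    qed
    then show "toeplitz n \<phi> (f + g) = toeplitz n \<phi> f + toeplitz n \<phi> g" by (simp add: plus_fun_def)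
  qed (simp add: toeplitz_def)
qed

end

section \<open>The chordal and the geodesic metric of the sphere\<close>

lemma geodesic_inner_range:
  assumes "z \<in> sphere 0 1" "w \<in> sphere 0 1"
  shows "-1 \<le> z \<bullet> w" "z \<bullet> w \<le> 1" "z \<bullet> w = 1 - (dist z w)\<^sup>2 / 2"
proof -
  have "\<bar>z \<bullet> w\<bar> \<le> 1" using Cauchy_Schwarz_ineq2[of z w] assms by simp
  then show "-1 \<le> z \<bullet> w" "z \<bullet> w \<le> 1" by linarith+
  have "(dist z w)\<^sup>2 = (norm z)\<^sup>2 + (norm w)\<^sup>2 - 2 * (z \<bullet> w)"
    unfolding dist_norm power2_norm_eq_inner by (simp add: inner_diff_left inner_diff_right inner_commute algebra_simps)
  then show "z \<bullet> w = 1 - (dist z w)\<^sup>2 / 2" using assms by (simp add: diff_divide_distrib)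
qed

text \<open>The features shared by both metrics. The bound 4 exceeds the chordal diameter 2 and the
  geodesic diameter pi; smallness of the geodesic distance follows from continuity of
  \<open>arccos\<close> at 1.\<close>

lemma sphere_metric:
  fixes \<delta> :: "complex ^ 'd::finite \<Rightarrow> complex ^ 'd \<Rightarrow> real"
  assumes "\<delta> = dist \<or> \<delta> = geodesic_dist"
  shows "\<And>z w. z \<in> sphere 0 1 \<Longrightarrow> w \<in> sphere 0 1 \<Longrightarrow> 0 \<le> \<delta> z w"
    and "\<And>z w. z \<in> sphere 0 1 \<Longrightarrow> w \<in> sphere 0 1 \<Longrightarrow> \<delta> z w \<le> 4"
    and "\<And>\<epsilon>. \<epsilon> > 0 \<Longrightarrow> \<exists>d>0. \<forall>z\<in>sphere 0 1. \<forall>w\<in>sphere 0 1. dist z w < d \<longrightarrow> \<delta> z w < \<epsilon>"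
proof -
  have "(\<forall>z\<in>sphere 0 1. \<forall>w\<in>sphere 0 1. 0 \<le> \<delta> z w \<and> \<delta> z w \<le> 4) \<and>
    (\<forall>\<epsilon>>0. \<exists>d>0. \<forall>z\<in>sphere 0 1. \<forall>w\<in>sphere 0 1. dist z w < d \<longrightarrow> \<delta> z w < \<epsilon>)"
    using assms
  proof
    assume \<delta>: "\<delta> = dist"
    have "dist z w \<le> 4" if "z \<in> sphere 0 1" "w \<in> sphere 0 1" for z w :: "complex ^ 'd"
      using dist_triangle[of z w 0] that by simp
    then show ?thesis unfolding \<delta> by auto
  next
    assume \<delta>: "\<delta> = geodesic_dist"
    have "0 \<le> geodesic_dist z w \<and> geodesic_dist z w \<le> 4" if "z \<in> sphere 0 1" "w \<in> sphere 0 1" for z w :: "complex ^ 'd"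
      using geodesic_inner_range[OF that] arccos_bounded[of "z \<bullet> w"] pi_less_4 by (simp add: geodesic_dist_def)
    moreover have "\<exists>d>0. \<forall>z\<in>sphere 0 1. \<forall>w\<in>sphere (0 :: complex ^ 'd) 1. dist z w < d \<longrightarrow> geodesic_dist z w < \<epsilon>" if "\<epsilon> > 0" for \<epsilon>
    proof -
      have "continuous_on {-1..1} arccos" by (rule continuous_on_arccos')
      then obtain s where s: "s > 0" "\<And>x. x \<in> {-1..1} \<Longrightarrow> dist x 1 < s \<Longrightarrow> dist (arccos x) (arccos 1) < \<epsilon>"
        using \<open>\<epsilon> > 0\<close> unfolding continuous_on_iff by force
      show ?thesis
      proof (intro exI[of _ "min 1 s"] conjI ballI impI)
        fix z w :: "complex ^ 'd" assume zw: "z \<in> sphere 0 1" "w \<in> sphere 0 1" and d: "dist z w < min 1 s"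
        \<comment> \<open>Below 1 the square is at most the distance itself, so the real inner
          product 1 - dist^2 / 2 is within s of 1.\<close>
        have "(dist z w)\<^sup>2 \<le> dist z w * 1"
          unfolding power2_eq_square using d by (intro mult_left_mono) auto
        moreover have "0 \<le> (dist z w)\<^sup>2" "dist z w < s" using d by auto
        ultimately have "dist (z \<bullet> w) 1 < s"
          unfolding geodesic_inner_range(3)[OF zw] dist_real_def by linarith
        from s(2)[OF _ this] show "geodesic_dist z w < \<epsilon>"
          using geodesic_inner_range[OF zw] arccos_bounded[of "z \<bullet> w"] by (simp add: geodesic_dist_def dist_real_def)
      qed (use s in simp)
    qed
    ultimately show ?thesis unfolding \<delta> by blast
  qed
  then show "\<And>z w. z \<in> sphere 0 1 \<Longrightarrow> w \<in> sphere 0 1 \<Longrightarrow> 0 \<le> \<delta> z w"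
    and "\<And>z w. z \<in> sphere 0 1 \<Longrightarrow> w \<in> sphere 0 1 \<Longrightarrow> \<delta> z w \<le> 4"
    and "\<And>\<epsilon>. \<epsilon> > 0 \<Longrightarrow> \<exists>d>0. \<forall>z\<in>sphere 0 1. \<forall>w\<in>sphere 0 1. dist z w < d \<longrightarrow> \<delta> z w < \<epsilon>"
    by blast+
qed

section \<open>The Lipschitz seminorm on the Toeplitz algebra\<close>

locale toeplitz_splitting = bergman_basis n \<kappa>
  for n :: nat and \<kappa> :: "nat \<Rightarrow> ('d::finite \<Rightarrow> nat)" +
  fixes \<sigma> :: "'d cfun \<Rightarrow> 'd operator" and \<delta> :: "complex ^ 'd \<Rightarrow> complex ^ 'd \<Rightarrow> real"
  assumes splitting: "positive_linear_splitting n \<sigma>"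
    and unital: "\<sigma> (indicator (sphere 0 1)) = id_operator n"
    and metric: "\<delta> = dist \<or> \<delta> = geodesic_dist"
begin

lemmas \<delta>_nonneg = sphere_metric(1)[OF metric] and \<delta>_le = sphere_metric(2)[OF metric]
  and \<delta>_small = sphere_metric(3)[OF metric]

abbreviation LC :: "'d operator set" where "LC \<equiv> lip_compact n \<kappa>"
abbreviation RL :: "'d cfun set" where "RL \<equiv> real_lipschitz \<delta>"
abbreviation lc :: "'d cfun \<Rightarrow> real" where "lc \<equiv> lipschitz_constant \<delta>"
abbreviation ln_K :: "'d operator \<Rightarrow> real" where "ln_K \<equiv> lip_compact_norm n \<kappa>"

lemma RL_sphere: "f \<in> RL \<Longrightarrow> f \<in> C_sphere" and RL_out: "f \<in> RL \<Longrightarrow> z \<notin> sphere 0 1 \<Longrightarrow> f z = 0"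
  and RL_real: "f \<in> RL \<Longrightarrow> z \<in> sphere 0 1 \<Longrightarrow> f z \<in> \<real>"
  by (auto simp: real_lipschitz_def C_sphere_def)

text \<open>The infimum is itself admissible: where \<delta> z w > 0, divide by it before passing to
  the infimum; where \<delta> z w = 0, any admissible constant already forces f z = f w.\<close>

lemma lc_bound:
  assumes f: "f \<in> RL" and z: "z \<in> sphere 0 1" and w: "w \<in> sphere 0 1"
  shows "cmod (f z - f w) \<le> lc f * \<delta> z w"
proof -
  let ?C = "{C. 0 \<le> C \<and> (\<forall>z\<in>sphere 0 1. \<forall>w\<in>sphere 0 1. cmod (f z - f w) \<le> C * \<delta> z w)}"
  obtain C where C: "C \<in> ?C" using f by (auto simp: real_lipschitz_def)
  show ?thesis
  proof (cases "\<delta> z w = 0")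
    case True
    have "cmod (f z - f w) \<le> C * \<delta> z w" using C z w by blast
    with True show ?thesis by simp
  next
    case False
    then have p: "\<delta> z w > 0" using \<delta>_nonneg[OF z w] by simp
    have "cmod (f z - f w) / \<delta> z w \<le> lc f"
      unfolding lipschitz_constant_def
    proof (rule cInf_greatest)
      show "?C \<noteq> {}" using C by blast
      fix D assume "D \<in> ?C"
      then have "cmod (f z - f w) \<le> D * \<delta> z w" using z w by blast
      then show "cmod (f z - f w) / \<delta> z w \<le> D" using p by (simp add: divide_le_eq)
    qed
    then show ?thesis using p by (simp add: divide_le_eq)
  qed
qed

lemma lc_nonneg: "f \<in> RL \<Longrightarrow> 0 \<le> lc f"
  unfolding lipschitz_constant_def by (rule cInf_greatest) (auto simp: real_lipschitz_def)

lemma lc_le: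
  assumes "0 \<le> C" "\<And>z w. z \<in> sphere 0 1 \<Longrightarrow> w \<in> sphere 0 1 \<Longrightarrow> cmod (f z - f w) \<le> C * \<delta> z w"
  shows "lc f \<le> C"
  unfolding lipschitz_constant_def
  by (rule cInf_lower) (use assms in \<open>auto intro!: bdd_belowI[of _ 0]\<close>)

lemma RL_I:
  assumes "continuous_on (sphere 0 1) f" "\<And>z. z \<notin> sphere 0 1 \<Longrightarrow> f z = 0" "\<And>z. z \<in> sphere 0 1 \<Longrightarrow> f z \<in> \<real>"
    "0 \<le> C" "\<And>z w. z \<in> sphere 0 1 \<Longrightarrow> w \<in> sphere 0 1 \<Longrightarrow> cmod (f z - f w) \<le> C * \<delta> z w"
  shows "f \<in> RL"
  using assms unfolding real_lipschitz_def C_sphere_def by blast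

lemma RL_add:
  assumes f: "f \<in> RL" and g: "g \<in> RL"
  shows "f + g \<in> RL" "lc (f + g) \<le> lc f + lc g"
proof -
  have le: "cmod ((f + g) z - (f + g) w) \<le> (lc f + lc g) * \<delta> z w" if "z \<in> sphere 0 1" "w \<in> sphere 0 1" for z w
  proof -
    have "cmod ((f + g) z - (f + g) w) \<le> cmod (f z - f w) + cmod (g z - g w)"
      using norm_triangle_ineq[of "f z - f w" "g z - g w"] by (simp add: algebra_simps)
    then show ?thesis using lc_bound[OF f that] lc_bound[OF g that] by (simp add: algebra_simps)
  qed
  show "f + g \<in> RL"
  proof (rule RL_I[OF _ _ _ _ le])
    show "continuous_on (sphere 0 1) (f + g)"
      unfolding plus_fun_def using RL_sphere[OF f] RL_sphere[OF g]
      by (auto simp: C_sphere_def intro!: continuous_intros)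
  qed (use RL_out[OF f] RL_out[OF g] RL_real[OF f] RL_real[OF g] lc_nonneg[OF f] lc_nonneg[OF g] in auto)
  show "lc (f + g) \<le> lc f + lc g"
    by (rule lc_le[OF _ le]) (use lc_nonneg[OF f] lc_nonneg[OF g] in auto)
qed

lemma RL_scaleR:
  assumes f: "f \<in> RL"
  shows "r *\<^sub>R f \<in> RL" "lc (r *\<^sub>R f) \<le> \<bar>r\<bar> * lc f"
proof -
  have le: "cmod ((r *\<^sub>R f) z - (r *\<^sub>R f) w) \<le> (\<bar>r\<bar> * lc f) * \<delta> z w" if "z \<in> sphere 0 1" "w \<in> sphere 0 1" for z w
  proof -
    have "cmod ((r *\<^sub>R f) z - (r *\<^sub>R f) w) = \<bar>r\<bar> * cmod (f z - f w)"
      by (simp add: scaleR_fun_def flip: scaleR_diff_right)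
    then show ?thesis using mult_left_mono[OF lc_bound[OF f that], of "\<bar>r\<bar>"] by (simp add: mult.assoc)
  qed
  show "r *\<^sub>R f \<in> RL"
  proof (rule RL_I[OF _ _ _ _ le])
    show "continuous_on (sphere 0 1) (r *\<^sub>R f)"
      unfolding scaleR_fun_def using RL_sphere[OF f]
      by (auto simp: C_sphere_def intro!: continuous_intros)
  qed (use RL_out[OF f] RL_real[OF f] lc_nonneg[OF f] in \<open>auto simp: scaleR_fun_def scaleR_conv_of_real\<close>)
  show "lc (r *\<^sub>R f) \<le> \<bar>r\<bar> * lc f"
    by (rule lc_le[OF _ le]) (use lc_nonneg[OF f] in auto)
qed

abbreviation one :: "'d cfun" where "one \<equiv> indicator (sphere 0 1)"

lemma RL_one: "one \<in> RL" "lc one = 0"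
proof -
  have le: "cmod (one z - one w) \<le> 0 * \<delta> z w" if "z \<in> sphere 0 1" "w \<in> sphere 0 1" for z w
    using that by simp
  show R: "one \<in> RL"
  proof (rule RL_I[OF _ _ _ _ le])
    have "continuous_on (sphere 0 1) (\<lambda>_ :: complex ^ 'd. 1 :: complex)" by (rule continuous_on_const)
    then show "continuous_on (sphere 0 1) one"
      by (subst continuous_on_cong[OF refl]) auto
  qed auto
  show "lc one = 0"
    using lc_le[OF _ le] lc_nonneg[OF R] by fastforce
qed

lemma RL_zero: "0 \<in> RL"
  using RL_scaleR(1)[OF RL_one(1), of 0] by simp

lemma subspace_RL: "subspace RL"
  by (rule subspaceI) (auto intro: RL_zero RL_add RL_scaleR)

lemma \<sigma>_add: "f \<in> RL \<Longrightarrow> g \<in> RL \<Longrightarrow> \<sigma> (f + g) = \<sigma> f + \<sigma> g"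
  using splitting RL_sphere unfolding positive_linear_splitting_def by blast

lemma \<sigma>_scaleR:
  assumes "f \<in> RL"
  shows "\<sigma> (r *\<^sub>R f) = r *\<^sub>R \<sigma> f"
proof -
  have "\<forall>f\<in>C_sphere. \<forall>c. \<sigma> (\<lambda>z. c * f z) = (\<lambda>h z. c * \<sigma> f h z)"
    using splitting unfolding positive_linear_splitting_def by (elim conjE)
  then have "\<sigma> (\<lambda>z. of_real r * f z) = (\<lambda>h z. of_real r * \<sigma> f h z)"
    using RL_sphere[OF assms] by blast
  then show ?thesis by (simp add: scaleR_fun_def scaleR_conv_of_real)
qed

lemma \<sigma>_diff: "f \<in> RL \<Longrightarrow> g \<in> RL \<Longrightarrow> \<sigma> (f - g) = \<sigma> f - \<sigma> g"
  using \<sigma>_add[OF _ RL_scaleR(1)[of g "-1"], of f] \<sigma>_scaleR[of g "-1"] by simp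

lemma \<sigma>_zero: "\<sigma> 0 = 0"
  using \<sigma>_scaleR[OF RL_one(1), of 0] by simp

lemma \<sigma>_symbol: "f \<in> RL \<Longrightarrow> has_symbol n (\<sigma> f) f"
  using splitting RL_sphere unfolding positive_linear_splitting_def by blast

lemma \<sigma>_bounded:
  assumes "f \<in> RL"
  shows "\<sigma> f \<in> bounded_operators n"
proof -
  obtain \<phi> K where "K \<in> compact_operators n" "continuous_on (cball 0 1) \<phi>" "\<sigma> f = toeplitz n \<phi> + K"
    using \<sigma>_symbol[OF assms] unfolding has_symbol_def by blast
  then show ?thesis
    by (simp add: bounded_operators_add toeplitz_bounded compact_operators_bounded)
qed

lemma RL_bounded:
  assumes f: "f \<in> RL"
  obtains B where "B \<ge> 0" "\<And>z. cmod (f z) \<le> B"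
proof -
  have "compact (f ` sphere 0 1)"
    using RL_sphere[OF f] by (intro compact_continuous_image) (auto simp: C_sphere_def)
  then obtain B where B: "\<forall>y\<in>f ` sphere 0 1. cmod y \<le> B" by (metis bounded_iff compact_imp_bounded)
  have "cmod (f z) \<le> \<bar>B\<bar>" for z
  proof (cases "z \<in> sphere 0 1")
    case True
    then have "cmod (f z) \<le> B" using B by blast
    then show ?thesis by linarith
  qed (use RL_out[OF f] in simp)
  then show ?thesis by (intro that[of "\<bar>B\<bar>"]) auto
qed

lemma \<sigma>_positive:
  assumes "f \<in> RL" "\<And>z. z \<in> sphere 0 1 \<Longrightarrow> 0 \<le> Re (f z)"
  shows "positive_operator n (\<sigma> f)"
  using splitting RL_sphere[OF assms(1)] RL_real[OF assms(1)] assms(2)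
  unfolding positive_linear_splitting_def by blast

text \<open>Positivity speaks about nonnegative functions only, so f is first raised by a bound B;
  unitality then allows B times the identity to be subtracted again.\<close>

lemma \<sigma>_form_real:
  assumes f: "f \<in> RL"
  shows "\<sigma> f \<in> form_real"
proof -
  obtain B where B: "B \<ge> 0" "\<And>z. cmod (f z) \<le> B" using RL_bounded[OF f] by blast
  have g: "f + B *\<^sub>R one \<in> RL" by (intro RL_add RL_scaleR RL_one f)
  have "positive_operator n (\<sigma> (f + B *\<^sub>R one))"
  proof (rule \<sigma>_positive[OF g])
    fix z :: "complex ^ 'd" assume "z \<in> sphere 0 1"
    then show "0 \<le> Re ((f + B *\<^sub>R one) z)"
      using B(2)[of z] abs_Re_le_cmod[of "f z"] by (simp add: scaleR_fun_def)
  qed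
  then have "\<sigma> (f + B *\<^sub>R one) \<in> form_real"
    using \<sigma>_bounded[OF g] by (simp add: form_real_def positive_operator_def)
  then have "\<sigma> (f + B *\<^sub>R one) - B *\<^sub>R id_operator n \<in> form_real"
    by (intro subspace_diff[OF subspace_form_real] subspace_scale[OF subspace_form_real] id_form_real)
  then show ?thesis
    by (simp add: \<sigma>_add \<sigma>_scaleR f RL_one RL_scaleR unital)
qed

text \<open>Positivity of the images of B - f and B + f, read through unitality, confines the form
  of \<sigma>(f) between -B and B times the squared norm.\<close>

lemma quad_\<sigma>_le:
  assumes f: "f \<in> RL" and B: "\<And>z. z \<in> sphere 0 1 \<Longrightarrow> cmod (f z) \<le> B" and h: "h \<in> bergman n"
  shows "\<bar>quad (\<sigma> f) h\<bar> \<le> B * (bergman_norm n h)\<^sup>2"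
proof -
  have nn: "0 \<le> quad (\<sigma> g) h" if "g \<in> RL" "\<And>z. z \<in> sphere 0 1 \<Longrightarrow> 0 \<le> Re (g z)" for g
    using \<sigma>_positive[OF that] h by (simp add: positive_operator_def quad_def)
  note bd = \<sigma>_bounded[OF f] form_real_bounded[OF id_form_real] bounded_operators_scaleR[OF form_real_bounded[OF id_form_real], of B]
  have "0 \<le> quad (\<sigma> (B *\<^sub>R one - f)) h"
  proof (rule nn)
    show "B *\<^sub>R one - f \<in> RL" by (intro subspace_diff[OF subspace_RL] RL_scaleR RL_one f)
    show "0 \<le> Re ((B *\<^sub>R one - f) z)" if "z \<in> sphere 0 1" for z
      using B[OF that] that abs_Re_le_cmod[of "f z"] by (simp add: scaleR_fun_def)
  qed
  moreover have "0 \<le> quad (\<sigma> (B *\<^sub>R one + f)) h"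
  proof (rule nn)
    show "B *\<^sub>R one + f \<in> RL" by (intro RL_add RL_scaleR RL_one f)
    show "0 \<le> Re ((B *\<^sub>R one + f) z)" if "z \<in> sphere 0 1" for z
      using B[OF that] that abs_Re_le_cmod[of "f z"] by (simp add: scaleR_fun_def)
  qed
  ultimately show ?thesis
    using h bd by (simp add: \<sigma>_diff \<sigma>_add \<sigma>_scaleR f RL_one RL_scaleR unital quad_diff quad_add quad_scaleR quad_id abs_le_iff)
qed

section \<open>Lipschitz compact operators as a real subspace\<close>

lemma LC_form_real:
  assumes "K \<in> LC"
  shows "K \<in> form_real"
proof -
  have sa: "self_adjoint n K" using assms by (simp add: lip_compact_def)
  have "bergman_inner n (K f) f \<in> \<real>" if "f \<in> bergman n" for f
  proof -
    have "bergman_inner n (K f) f = cnj (bergman_inner n (K f) f)"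
      using sa that bergman_inner_cnj[of n f "K f"] by (auto simp: self_adjoint_def is_adjoint_def)
    then show ?thesis by (metis Reals_cnj_iff)
  qed
  then show ?thesis using lip_compact_bounded[OF assms] by (simp add: form_real_def)
qed

lemma LC_compact: "K \<in> LC \<Longrightarrow> K \<in> compact_operators n"
  by (simp add: lip_compact_def)

lemma LC_entry_real: "K \<in> LC \<Longrightarrow> entry K i j \<in> \<real>"
  unfolding lip_compact_def by (auto simp flip: matrix_entry_Suc)

text \<open>Self-adjointness enters as real form, which linear combinations preserve, and one bound
  B yields membership together with the estimate of the seminorm.\<close>

lemma LC_I:
  assumes "K \<in> compact_operators n" "K \<in> form_real" "\<And>i j. entry K i j \<in> \<real>"
    and B: "\<And>i j. real (i + j + 2) ^ (n + 2) * cmod (entry K i j) \<le> B"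
  shows "K \<in> LC" "ln_K K \<le> B"
proof -
  let ?g = "\<lambda>(i, j). real (i + j) ^ (n + 2) * cmod (matrix_entry n \<kappa> K i j)"
  have le: "?g p \<le> B" if p: "p \<in> {1..} \<times> {1..}" for p
  proof -
    obtain i j where "p = (Suc i, Suc j)"
      using p by (cases p) (metis SigmaE2 atLeast_iff Suc_le_D One_nat_def)
    then show ?thesis using B[of i j] by (simp add: matrix_entry_Suc)
  qed
  have real: "matrix_entry n \<kappa> K i j \<in> \<real>" if "i \<ge> 1" "j \<ge> 1" for i j
    using that assms(3)[of "i - 1" "j - 1"] by (simp flip: matrix_entry_Suc)
  have "bdd_above (?g ` ({1..} \<times> {1..}))"
    by (rule bdd_aboveI2) (rule le)
  then show "K \<in> LC"
    unfolding lip_compact_def using assms(1) form_real_self_adjoint[OF assms(2)] real by blast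
  show "ln_K K \<le> B"
    unfolding lip_compact_norm_def by (rule cSUP_least) (use le in auto)
qed

lemma LC_add:
  assumes K: "K \<in> LC" and K': "K' \<in> LC"
  shows "K + K' \<in> LC" "ln_K (K + K') \<le> ln_K K + ln_K K'"
proof -
  have ent: "entry (K + K') i j = entry K i j + entry K' i j" for i j
    unfolding entry_def by (rule form_add[OF lip_compact_bounded[OF K] lip_compact_bounded[OF K'] basis_bergman basis_square_integrable])
  have le: "real (i + j + 2) ^ (n + 2) * cmod (entry (K + K') i j) \<le> ln_K K + ln_K K'" for i j
  proof -
    have "real (i + j + 2) ^ (n + 2) * cmod (entry (K + K') i j)
        \<le> real (i + j + 2) ^ (n + 2) * (cmod (entry K i j) + cmod (entry K' i j))"
      unfolding ent by (intro mult_left_mono norm_triangle_ineq) simp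
    then show ?thesis using lip_compact_weighted_entry_le[OF K, of i j] lip_compact_weighted_entry_le[OF K', of i j] by (simp add: distrib_left)
  qed
  have "K + K' \<in> compact_operators n" "K + K' \<in> form_real" "entry (K + K') i j \<in> \<real>" for i j
    by (intro compact_operators_add LC_compact K K',
        intro subspace_add[OF subspace_form_real] LC_form_real K K',
        simp add: ent LC_entry_real K K')
  from LC_I[OF this le] show "K + K' \<in> LC" "ln_K (K + K') \<le> ln_K K + ln_K K'" .
qed

lemma LC_scaleR:
  assumes K: "K \<in> LC"
  shows "r *\<^sub>R K \<in> LC" "ln_K (r *\<^sub>R K) \<le> \<bar>r\<bar> * ln_K K"
proof -
  have ent: "entry (r *\<^sub>R K) i j = of_real r * entry K i j" for i j
    unfolding entry_def by (rule form_scaleR)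
  have le: "real (i + j + 2) ^ (n + 2) * cmod (entry (r *\<^sub>R K) i j) \<le> \<bar>r\<bar> * ln_K K" for i j
    using mult_left_mono[OF lip_compact_weighted_entry_le[OF K, of i j], of "\<bar>r\<bar>"] by (simp add: ent norm_mult mult_ac)
  have "r *\<^sub>R K \<in> compact_operators n" "r *\<^sub>R K \<in> form_real" "entry (r *\<^sub>R K) i j \<in> \<real>" for i j
    by (intro compact_operators_scaleR LC_compact K,
        intro subspace_scale[OF subspace_form_real] LC_form_real K,
        simp add: ent LC_entry_real K)
  from LC_I[OF this le] show "r *\<^sub>R K \<in> LC" "ln_K (r *\<^sub>R K) \<le> \<bar>r\<bar> * ln_K K" .
qed

lemma LC_zero: "0 \<in> LC" "ln_K 0 = 0"
proof -
  have ent: "entry 0 i j = 0" for i j by (simp add: entry_def zero_fun_def)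
  have "(0 :: 'd operator) \<in> compact_operators n" "(0 :: 'd operator) \<in> form_real"
    by (rule compact_operators_zero, rule subspace_0[OF subspace_form_real])
  from LC_I[OF this, of 0] show m: "0 \<in> LC" and "ln_K 0 = 0"
    using lip_compact_entry(2)[of 0] by (simp_all add: ent)
qed

lemma subspace_LC: "subspace LC"
  by (rule subspaceI) (auto intro: LC_zero LC_add LC_scaleR)

text \<open>The operator \<sigma>(f) is a Toeplitz operator plus a compact one, with a symbol that
  restricts to f. If \<sigma>(f) is compact, so is that Toeplitz operator, and its symbol vanishes
  on the sphere.\<close>

lemma \<sigma>_compact_zero:
  assumes f: "f \<in> RL" and K: "\<sigma> f \<in> compact_operators n"
  shows "f = 0"
proof
  fix z
  obtain \<phi> K' where K': "K' \<in> compact_operators n" and \<phi>: "continuous_on (cball 0 1) \<phi>"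
      and eq: "\<sigma> f = toeplitz n \<phi> + K'" and on: "\<forall>z\<in>sphere 0 1. f z = \<phi> z"
    using \<sigma>_symbol[OF f] unfolding has_symbol_def by blast
  have "toeplitz n \<phi> = \<sigma> f + (-1) *\<^sub>R K'" unfolding eq by simp
  then have "toeplitz n \<phi> \<in> compact_operators n"
    using compact_operators_add[OF K compact_operators_scaleR[OF K', of "-1"]] by (simp only:)
  from compact_toeplitz_symbol_zero[OF \<phi> this] on show "f z = 0 z"
    using RL_out[OF f] by (cases "z \<in> sphere 0 1") auto
qed

section \<open>The direct sum and the seminorm on it\<close>

abbreviation LT :: "'d operator set" where "LT \<equiv> lip_toeplitz n \<kappa> \<delta> \<sigma>"

text \<open>The image of f - f' is a difference of compact operators, hence f = f'. Thus
  \<open>compact_part\<close> and \<open>symbol_part\<close> are determined on the sum, and the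
  seminorm is well defined.\<close>

lemma decomposition_unique:
  assumes "K \<in> LC" "K' \<in> LC" "f \<in> RL" "f' \<in> RL" "K + \<sigma> f = K' + \<sigma> f'"
  shows "K = K'" "f = f'"
proof -
  have d: "f - f' \<in> RL" by (rule subspace_diff[OF subspace_RL assms(3,4)])
  have "\<sigma> (f - f') = K' - K" using assms by (simp add: \<sigma>_diff algebra_simps)
  moreover have "K' - K \<in> compact_operators n"
    by (intro LC_compact subspace_diff[OF subspace_LC] assms)
  ultimately have "f - f' = 0" by (intro \<sigma>_compact_zero d) simp
  then show "f = f'" by simp
  then show "K = K'" using assms(5) by simp
qed

lemma direct_sum: "internal_direct_sum LT LC (\<sigma> ` RL)"
  unfolding internal_direct_sum_def
proof (intro conjI)
  show "subspace LC" by (rule subspace_LC)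
  show V: "subspace (\<sigma> ` RL)"
  proof (rule subspaceI)
    show "0 \<in> \<sigma> ` RL" by (rule image_eqI[OF _ RL_zero]) (simp add: \<sigma>_zero)
    fix x y assume "x \<in> \<sigma> ` RL" "y \<in> \<sigma> ` RL"
    then obtain f g where fg: "f \<in> RL" "x = \<sigma> f" "g \<in> RL" "y = \<sigma> g" by blast
    show "x + y \<in> \<sigma> ` RL"
      by (rule image_eqI[OF _ RL_add(1)[OF fg(1,3)]]) (simp add: fg \<sigma>_add)
  next
    fix c x assume "x \<in> \<sigma> ` RL"
    then obtain f where f: "f \<in> RL" "x = \<sigma> f" by blast
    show "c *\<^sub>R x \<in> \<sigma> ` RL"
      by (rule image_eqI[OF _ RL_scaleR(1)[OF f(1), of c]]) (simp add: f \<sigma>_scaleR)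
  qed
  show "LC \<inter> \<sigma> ` RL = {0}"
  proof
    show "LC \<inter> \<sigma> ` RL \<subseteq> {0}"
    proof
      fix T assume T: "T \<in> LC \<inter> \<sigma> ` RL"
      then have "T \<in> LC" "T \<in> \<sigma> ` RL" by simp_all
      then obtain f where f: "T = \<sigma> f" "f \<in> RL" by (elim imageE)
      have "\<sigma> f \<in> compact_operators n" using LC_compact[OF \<open>T \<in> LC\<close>] f(1) by simp
      then have "f = 0" by (rule \<sigma>_compact_zero[OF f(2)])
      then show "T \<in> {0}" using f(1) \<sigma>_zero by simp
    qed
    show "{0} \<subseteq> LC \<inter> \<sigma> ` RL" using LC_zero(1) subspace_0[OF V] by simp
  qed
  show "LT = {u + v |u v. u \<in> LC \<and> v \<in> \<sigma> ` RL}"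
    unfolding lip_toeplitz_def by blast
qed

lemma LT_I: "K \<in> LC \<Longrightarrow> f \<in> RL \<Longrightarrow> K + \<sigma> f \<in> LT"
  unfolding lip_toeplitz_def by blast

lemma LT_E:
  assumes "T \<in> LT"
  obtains K f where "K \<in> LC" "f \<in> RL" "T = K + \<sigma> f"
  using assms unfolding lip_toeplitz_def by blast

lemma LT_form_real: "LT \<subseteq> form_real"
proof
  fix T assume "T \<in> LT"
  then obtain K f where "K \<in> LC" "f \<in> RL" "T = K + \<sigma> f" by (rule LT_E)
  then show "T \<in> form_real"
    by (simp only:) (intro subspace_add[OF subspace_form_real] LC_form_real \<sigma>_form_real)
qed

lemma subspace_LT: "subspace LT"
proof (rule subspaceI)
  show "0 \<in> LT" using LT_I[OF LC_zero(1) RL_zero] by (simp add: \<sigma>_zero)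
  fix S T assume "S \<in> LT" "T \<in> LT"
  then obtain K f K' f' where KF: "K \<in> LC" "f \<in> RL" "S = K + \<sigma> f" "K' \<in> LC" "f' \<in> RL" "T = K' + \<sigma> f'"
    using LT_E by metis
  then have eq: "S + T = (K + K') + \<sigma> (f + f')" by (simp add: \<sigma>_add algebra_simps)
  show "S + T \<in> LT" unfolding eq by (intro LT_I LC_add(1) RL_add(1) KF)
next
  fix r T assume "T \<in> LT"
  then obtain K f where KF: "K \<in> LC" "f \<in> RL" "T = K + \<sigma> f" using LT_E by metis
  then have eq: "r *\<^sub>R T = r *\<^sub>R K + \<sigma> (r *\<^sub>R f)" by (simp add: \<sigma>_scaleR scaleR_add_right)
  show "r *\<^sub>R T \<in> LT" unfolding eq by (intro LT_I LC_scaleR(1) RL_scaleR(1) KF)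
qed

lemma id_LT: "id_operator n \<in> LT"
  using LT_I[OF LC_zero(1) RL_one(1)] by (simp add: unital)

definition compact_part :: "'d operator \<Rightarrow> 'd operator" where
  "compact_part T = (SOME K. K \<in> LC \<and> (\<exists>f\<in>RL. T = K + \<sigma> f))"

definition symbol_part :: "'d operator \<Rightarrow> 'd cfun" where
  "symbol_part T = (SOME f. f \<in> RL \<and> (\<exists>K\<in>LC. T = K + \<sigma> f))"

lemma parts:
  assumes K: "K \<in> LC" and f: "f \<in> RL"
  shows "compact_part (K + \<sigma> f) = K" "symbol_part (K + \<sigma> f) = f"
proof -
  show "compact_part (K + \<sigma> f) = K"
    unfolding compact_part_def
  proof (rule some_equality)
    show "K \<in> LC \<and> (\<exists>g\<in>RL. K + \<sigma> f = K + \<sigma> g)" by (intro conjI bexI[of _ f] K f refl)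
    fix K' assume "K' \<in> LC \<and> (\<exists>g\<in>RL. K + \<sigma> f = K' + \<sigma> g)"
    then obtain g where g: "K' \<in> LC" "g \<in> RL" "K + \<sigma> f = K' + \<sigma> g" by (elim conjE bexE)
    show "K' = K" by (rule decomposition_unique(1)[OF K g(1) f g(2,3), symmetric])
  qed
  show "symbol_part (K + \<sigma> f) = f"
    unfolding symbol_part_def
  proof (rule some_equality)
    show "f \<in> RL \<and> (\<exists>K'\<in>LC. K + \<sigma> f = K' + \<sigma> f)" by (intro conjI bexI[of _ K] K f refl)
    fix g assume "g \<in> RL \<and> (\<exists>K'\<in>LC. K + \<sigma> f = K' + \<sigma> g)"
    then obtain K' where g: "K' \<in> LC" "g \<in> RL" "K + \<sigma> f = K' + \<sigma> g" by (elim conjE bexE)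
    show "g = f" by (rule decomposition_unique(2)[OF K g(1) f g(2,3), symmetric])
  qed
qed

definition lip_L :: "'d operator \<Rightarrow> real" where
  "lip_L T = ln_K (compact_part T) + lc (symbol_part T)"

lemma lip_L_eq: "K \<in> LC \<Longrightarrow> f \<in> RL \<Longrightarrow> lip_L (K + \<sigma> f) = ln_K K + lc f"
  by (simp add: lip_L_def parts)

lemma lip_L_nonneg: "T \<in> LT \<Longrightarrow> 0 \<le> lip_L T"
  by (elim LT_E) (simp add: lip_L_eq lip_compact_entry(2) lc_nonneg)

lemma lip_L_add:
  assumes "S \<in> LT" "T \<in> LT"
  shows "lip_L (S + T) \<le> lip_L S + lip_L T"
proof -
  obtain K f K' f' where KF: "K \<in> LC" "f \<in> RL" "S = K + \<sigma> f" "K' \<in> LC" "f' \<in> RL" "T = K' + \<sigma> f'"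
    using assms LT_E by metis
  then have "S + T = (K + K') + \<sigma> (f + f')" by (simp add: \<sigma>_add algebra_simps)
  then have "lip_L (S + T) = ln_K (K + K') + lc (f + f')"
    using KF by (simp only:) (intro lip_L_eq LC_add RL_add)
  also have "\<dots> \<le> (ln_K K + ln_K K') + (lc f + lc f')"
    using KF by (intro add_mono LC_add RL_add)
  finally show ?thesis using KF by (simp add: lip_L_eq)
qed

lemma lip_L_scaleR_le:
  assumes "T \<in> LT"
  shows "lip_L (r *\<^sub>R T) \<le> \<bar>r\<bar> * lip_L T"
proof -
  obtain K f where KF: "K \<in> LC" "f \<in> RL" "T = K + \<sigma> f" using assms LT_E by metis
  then have "r *\<^sub>R T = r *\<^sub>R K + \<sigma> (r *\<^sub>R f)" by (simp add: \<sigma>_scaleR scaleR_add_right)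
  then have "lip_L (r *\<^sub>R T) = ln_K (r *\<^sub>R K) + lc (r *\<^sub>R f)"
    using KF by (simp only:) (intro lip_L_eq LC_scaleR RL_scaleR)
  also have "\<dots> \<le> \<bar>r\<bar> * ln_K K + \<bar>r\<bar> * lc f"
    using KF by (intro add_mono LC_scaleR RL_scaleR)
  finally show ?thesis using KF by (simp add: lip_L_eq distrib_left)
qed

text \<open>The bounds on supremum and infimum yield one inequality. The converse is the same
  inequality for 1 / r, and r = 0 is settled by nonnegativity.\<close>

lemma lip_L_scaleR:
  assumes T: "T \<in> LT"
  shows "lip_L (r *\<^sub>R T) = \<bar>r\<bar> * lip_L T"
proof (cases "r = 0")
  case True
  have "lip_L (r *\<^sub>R T) \<le> 0" using lip_L_scaleR_le[OF T, of r] True by simp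
  moreover have "0 \<le> lip_L (r *\<^sub>R T)" by (rule lip_L_nonneg[OF subspace_scale[OF subspace_LT T]])
  ultimately show ?thesis using True by simp
next
  case False
  have "lip_L T \<le> \<bar>1 / r\<bar> * lip_L (r *\<^sub>R T)"
    using lip_L_scaleR_le[OF subspace_scale[OF subspace_LT T], of "1 / r" r] False by simp
  then have "\<bar>r\<bar> * lip_L T \<le> lip_L (r *\<^sub>R T)"
    using False by (simp add: field_simps)
  with lip_L_scaleR_le[OF T, of r] show ?thesis by simp
qed

lemma lip_L_id: "lip_L (id_operator n) = 0"
  using lip_L_eq[OF LC_zero(1) RL_one(1)] by (simp add: unital LC_zero RL_one)

end

lemma toeplitz_algebra_add:
  fixes S T :: "('d::finite) operator"
  assumes "S \<in> toeplitz_algebra n" "T \<in> toeplitz_algebra n"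
  shows "S + T \<in> toeplitz_algebra n"
  unfolding toeplitz_algebra_def hull_def
proof (rule InterI)
  fix \<A> :: "'d operator set" assume A: "\<A> \<in> {t. cstar_subalgebra n t \<and> {toeplitz n \<phi> |\<phi>. continuous_on (cball 0 1) \<phi>} \<subseteq> t}"
  have "S \<in> \<A>" "T \<in> \<A>"
    using InterD[OF assms(1)[unfolded toeplitz_algebra_def hull_def] A]
      InterD[OF assms(2)[unfolded toeplitz_algebra_def hull_def] A] .
  moreover have "\<forall>S\<in>\<A>. \<forall>T\<in>\<A>. S + T \<in> \<A>"
    using A unfolding mem_Collect_eq cstar_subalgebra_def by (elim conjE)
  ultimately show "S + T \<in> \<A>" by (simp only:)
qed

section \<open>Total boundedness of the Lipschitz unit ball modulo scalars\<close>

lemma finite_integer_functions: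
  assumes "finite X"
  shows "finite {g. \<forall>x. (x \<in> X \<longrightarrow> g x \<in> {- b..b :: int}) \<and> (x \<notin> X \<longrightarrow> g x = 0)}"
  by (rule finite_set_of_finite_funs[OF assms]) simp

lemma floor_bound:
  fixes x s :: real
  assumes "\<bar>x\<bar> \<le> c" "0 \<le> s"
  shows "\<lfloor>x * s\<rfloor> \<in> {- (\<lceil>c * s\<rceil> + 1)..\<lceil>c * s\<rceil> + 1}"
proof -
  have "\<bar>x * s\<bar> \<le> c * s" using mult_right_mono[OF assms] assms(2) by (simp add: abs_mult)
  then have "x * s \<le> c * s" "- (c * s) \<le> x * s" by linarith+
  then show ?thesis by simp linarith
qed

lemma floor_eq_close:
  fixes x y s :: real
  assumes "\<lfloor>x * s\<rfloor> = \<lfloor>y * s\<rfloor>" "s > 0"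
  shows "\<bar>x - y\<bar> \<le> 1 / s"
proof -
  have "\<bar>x * s - y * s\<bar> < 1" using assms(1) by linarith
  also have "\<bar>x * s - y * s\<bar> = \<bar>x - y\<bar> * s" using assms(2) by (simp add: abs_mult flip: left_diff_distrib)
  finally show ?thesis using assms(2) by (simp add: field_simps)
qed

context toeplitz_splitting begin

text \<open>Compactness gives a net for the chordal distance; its mesh d is chosen so that chordal
  closeness implies closeness in \<delta>.\<close>

lemma sphere_net:
  assumes "\<epsilon> > 0"
  shows "\<exists>P. finite P \<and> P \<subseteq> sphere 0 1 \<and> (\<forall>z\<in>sphere 0 1. \<exists>p\<in>P. \<delta> z p < \<epsilon>)"
proof -
  obtain d where d: "d > 0" "\<forall>z\<in>sphere 0 1. \<forall>w\<in>sphere 0 1. dist z w < d \<longrightarrow> \<delta> z w < \<epsilon>"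
    using \<delta>_small[OF assms] by blast
  have "\<exists>P. finite P \<and> P \<subseteq> sphere (0 :: complex ^ 'd) 1 \<and> sphere 0 1 \<subseteq> (\<Union>p\<in>P. ball p d)"
    by (rule seq_compact_imp_totally_bounded[OF compact_imp_seq_compact[OF compact_sphere], rule_format, OF d(1)])
  then obtain P :: "(complex ^ 'd) set" where P: "finite P" "P \<subseteq> sphere 0 1" "sphere 0 1 \<subseteq> (\<Union>p\<in>P. ball p d)"
    by (elim exE conjE)
  have "\<exists>p\<in>P. \<delta> z p < \<epsilon>" if z: "z \<in> sphere 0 1" for z
  proof -
    obtain p where p: "p \<in> P" "z \<in> ball p d" using P(3) z by blast
    then have "\<delta> z p < \<epsilon>" using d(2) z P(2) by (auto simp: dist_commute)
    then show ?thesis using p(1) by blast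
  qed
  with P show ?thesis by blast
qed

text \<open>Chosen so that 2 / N \<le> \<epsilon> / 4, where 2 / N bounds what the entries outside
  the N x N block contribute for a difference of two elements with seminorm at most 1.\<close>

definition truncation :: "real \<Rightarrow> nat" where
  "truncation \<epsilon> = Suc (nat \<lceil>8 / \<epsilon>\<rceil>)"

text \<open>Values are rounded at scale 1 / s with s = \<open>resolution \<epsilon>\<close>. The N^2
  rounding errors of the matrix block and the one of the function add up to (N^2 + 1) / s =
  \<epsilon> / 4.\<close>

definition resolution :: "real \<Rightarrow> real" where
  "resolution \<epsilon> = 4 * ((real (truncation \<epsilon>))\<^sup>2 + 1) / \<epsilon>"

text \<open>Two functions with Lipschitz constant at most 1 each move by less than \<epsilon> / 8
  between a point and the net, together \<epsilon> / 4.\<close>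

definition net :: "real \<Rightarrow> (complex ^ 'd) set" where
  "net \<epsilon> = (SOME P. finite P \<and> P \<subseteq> sphere 0 1 \<and> (\<forall>z\<in>sphere 0 1. \<exists>p\<in>P. \<delta> z p < \<epsilon> / 8))"

text \<open>A Lipschitz constant bounds a function only up to an additive constant; subtracting the
  value at this point removes the constant.\<close>

definition base_point :: "complex ^ 'd" where
  "base_point = (SOME z. z \<in> sphere 0 1)"

lemma base_point: "base_point \<in> sphere 0 1"
proof -
  obtain z :: "complex ^ 'd" where "norm z = 1" using vector_choose_size[of 1] by auto
  then have "z \<in> sphere 0 1" by simp
  then show ?thesis unfolding base_point_def by (rule someI)
qed

lemma net:
  assumes "\<epsilon> > 0"
  shows "finite (net \<epsilon>)" "net \<epsilon> \<subseteq> sphere 0 1" "z \<in> sphere 0 1 \<Longrightarrow> \<exists>p\<in>net \<epsilon>. \<delta> z p < \<epsilon> / 8"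
proof -
  have "\<exists>P. finite P \<and> P \<subseteq> sphere 0 1 \<and> (\<forall>z\<in>sphere 0 1. \<exists>p\<in>P. \<delta> z p < \<epsilon> / 8)"
    using assms by (intro sphere_net) simp
  from someI_ex[OF this] have "finite (net \<epsilon>) \<and> net \<epsilon> \<subseteq> sphere 0 1 \<and> (\<forall>z\<in>sphere 0 1. \<exists>p\<in>net \<epsilon>. \<delta> z p < \<epsilon> / 8)"
    unfolding net_def .
  then show "finite (net \<epsilon>)" "net \<epsilon> \<subseteq> sphere 0 1" "z \<in> sphere 0 1 \<Longrightarrow> \<exists>p\<in>net \<epsilon>. \<delta> z p < \<epsilon> / 8"
    by blast+
qed

text \<open>Elements of \<open>L \<le> 1\<close> with equal colours differ by a scalar up to an error \<open>\<epsilon>\<close>.\<close>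

definition colour :: "real \<Rightarrow> 'd operator \<Rightarrow> (nat \<times> nat \<Rightarrow> int) \<times> (complex ^ 'd \<Rightarrow> int)" where
  "colour \<epsilon> T =
    ((\<lambda>p. if p \<in> {..<truncation \<epsilon>} \<times> {..<truncation \<epsilon>}
          then \<lfloor>Re (entry (compact_part T) (fst p) (snd p)) * resolution \<epsilon>\<rfloor> else 0),
     (\<lambda>p. if p \<in> net \<epsilon> then \<lfloor>Re (symbol_part T p - symbol_part T base_point) * resolution \<epsilon>\<rfloor> else 0))"

lemma resolution_pos: "\<epsilon> > 0 \<Longrightarrow> resolution \<epsilon> > 0"
  by (simp add: resolution_def add_nonneg_pos)

lemma lip_L_le_oneE:
  assumes "T \<in> LT" "lip_L T \<le> 1"
  obtains K f where "K \<in> LC" "f \<in> RL" "T = K + \<sigma> f" "compact_part T = K" "symbol_part T = f" "ln_K K \<le> 1" "lc f \<le> 1"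
proof -
  obtain K f where Kf: "K \<in> LC" "f \<in> RL" "T = K + \<sigma> f" using assms(1) by (rule LT_E)
  have "ln_K K + lc f \<le> 1" using assms(2) Kf by (simp add: lip_L_eq)
  then have "ln_K K \<le> 1" "lc f \<le> 1"
    using lip_compact_entry(2)[OF Kf(1)] lc_nonneg[OF Kf(2)] by linarith+
  then show ?thesis using that Kf parts[OF Kf(1,2)] by simp
qed

text \<open>The generous bound 4 matches the one for functions in \<open>lip_le_four\<close>, so one
  range of integers serves both halves of the colour.\<close>

lemma entry_le_one:
  assumes "K \<in> LC" "ln_K K \<le> 1"
  shows "cmod (entry K i j) \<le> 1 / real (i + j + 2) ^ 3" "\<bar>Re (entry K i j)\<bar> \<le> 4"
proof -
  have "cmod (entry K i j) \<le> ln_K K / real (i + j + 2) ^ 3" by (rule lip_compact_entry(1)[OF assms(1)])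
  also have "\<dots> \<le> 1 / real (i + j + 2) ^ 3" using assms(2) by (intro divide_right_mono) auto
  finally show le: "cmod (entry K i j) \<le> 1 / real (i + j + 2) ^ 3" .
  also have "\<dots> \<le> 1" by (simp add: one_le_power)
  finally show "\<bar>Re (entry K i j)\<bar> \<le> 4" using abs_Re_le_cmod[of "entry K i j"] by linarith
qed

lemma lip_le_four:
  assumes "f \<in> RL" "lc f \<le> 1" "z \<in> sphere 0 1" "w \<in> sphere 0 1"
  shows "cmod (f z - f w) \<le> \<delta> z w" "cmod (f z - f w) \<le> 4"
proof -
  have "cmod (f z - f w) \<le> lc f * \<delta> z w" by (rule lc_bound[OF assms(1,3,4)])
  also have "\<dots> \<le> 1 * \<delta> z w" using assms(2) by (intro mult_right_mono \<delta>_nonneg assms)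
  finally show "cmod (f z - f w) \<le> \<delta> z w" by simp
  then show "cmod (f z - f w) \<le> 4" using \<delta>_le[OF assms(3,4)] by linarith
qed

lemma colour_finite:
  assumes \<epsilon>: "\<epsilon> > 0"
  shows "finite (colour \<epsilon> ` {T \<in> LT. lip_L T \<le> 1})"
proof (rule finite_subset)
  \<comment> \<open>All rounded values come from reals of modulus at most 4; the added 1 absorbs
    rounding down.\<close>
  define b where "b = \<lceil>4 * resolution \<epsilon>\<rceil> + 1"
  let ?F = "\<lambda>X. {g. \<forall>x. (x \<in> X \<longrightarrow> g x \<in> {- b..b :: int}) \<and> (x \<notin> X \<longrightarrow> g x = 0)}"
  let ?N = "{..<truncation \<epsilon>} \<times> {..<truncation \<epsilon>}"
  show "finite (?F ?N \<times> ?F (net \<epsilon>))"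
    by (intro finite_cartesian_product finite_integer_functions net(1)[OF \<epsilon>] finite_lessThan)
  show "colour \<epsilon> ` {T \<in> LT. lip_L T \<le> 1} \<subseteq> ?F ?N \<times> ?F (net \<epsilon>)"
  proof
    fix c assume "c \<in> colour \<epsilon> ` {T \<in> LT. lip_L T \<le> 1}"
    then obtain T where T: "c = colour \<epsilon> T" "T \<in> LT" "lip_L T \<le> 1" by blast
    obtain K f where Kf: "K \<in> LC" "f \<in> RL" "compact_part T = K" "symbol_part T = f" "ln_K K \<le> 1" "lc f \<le> 1"
      using lip_L_le_oneE[OF T(2,3)] by metis
    have r: "0 \<le> resolution \<epsilon>" using resolution_pos[OF \<epsilon>] by simp
    have "\<lfloor>Re (entry K i j) * resolution \<epsilon>\<rfloor> \<in> {- b..b}" for i j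
      unfolding b_def by (rule floor_bound[OF entry_le_one(2)[OF Kf(1,5)] r])
    moreover have "\<lfloor>Re (f p - f base_point) * resolution \<epsilon>\<rfloor> \<in> {- b..b}" if "p \<in> net \<epsilon>" for p
      unfolding b_def
    proof (rule floor_bound[OF _ r])
      have "p \<in> sphere 0 1" using net(2)[OF \<epsilon>] that by blast
      from lip_le_four(2)[OF Kf(2,6) this base_point] show "\<bar>Re (f p - f base_point)\<bar> \<le> 4"
        using abs_Re_le_cmod[of "f p - f base_point"] by linarith
    qed
    ultimately show "c \<in> ?F ?N \<times> ?F (net \<epsilon>)"
      unfolding T(1) colour_def Kf(3,4) by simp
  qed
qed

text \<open>Error budget: the compact parts differ by at most N^2 / s inside the block and 2 / N
  outside; the functions differ, after removal of a constant, by at most \<epsilon> / 4 + 1 / s. The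
  sum is at most 3 \<epsilon> / 4.\<close>

lemma colour_close:
  assumes \<epsilon>: "\<epsilon> > 0" and S: "S \<in> LT" and T: "T \<in> LT" and L: "lip_L S \<le> 1" "lip_L T \<le> 1"
    and col: "colour \<epsilon> S = colour \<epsilon> T"
  shows "\<exists>c. operator_le n (- \<epsilon> *\<^sub>R id_operator n) (S - T - c *\<^sub>R id_operator n) \<and>
    operator_le n (S - T - c *\<^sub>R id_operator n) (\<epsilon> *\<^sub>R id_operator n)"
proof -
  obtain K f where Kf: "K \<in> LC" "f \<in> RL" "S = K + \<sigma> f" "compact_part S = K" "symbol_part S = f" "ln_K K \<le> 1" "lc f \<le> 1"
    using lip_L_le_oneE[OF S L(1)] by metis
  obtain J g where Jg: "J \<in> LC" "g \<in> RL" "T = J + \<sigma> g" "compact_part T = J" "symbol_part T = g" "ln_K J \<le> 1" "lc g \<le> 1"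
    using lip_L_le_oneE[OF T L(2)] by metis
  define N where "N = truncation \<epsilon>"
  define s where "s = resolution \<epsilon>"
  have s: "s > 0" unfolding s_def by (rule resolution_pos[OF \<epsilon>])
  have N: "N \<ge> 1" "2 / real N \<le> \<epsilon> / 4"
  proof -
    show N1: "N \<ge> 1" by (simp add: N_def truncation_def)
    have "8 / \<epsilon> \<le> real N" unfolding N_def truncation_def by linarith
    then show "2 / real N \<le> \<epsilon> / 4" using \<epsilon> N1 by (simp add: field_simps)
  qed
  have sN: "((real N)\<^sup>2 + 1) / s = \<epsilon> / 4"
  proof -
    have "A / (4 * A / \<epsilon>) = \<epsilon> / 4" if "A > 0" for A :: real
      using that \<epsilon> by (simp add: field_simps)
    from this[of "(real N)\<^sup>2 + 1"] show ?thesis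
      by (simp add: s_def resolution_def N_def add_nonneg_pos)
  qed
  have col1: "\<bar>Re (entry K i j) - Re (entry J i j)\<bar> \<le> 1 / s" if "i < N" "j < N" for i j
  proof -
    have "fst (colour \<epsilon> S) (i, j) = fst (colour \<epsilon> T) (i, j)" using col by simp
    then show ?thesis
      using that s by (intro floor_eq_close) (simp_all add: colour_def Kf(4) Jg(4) N_def s_def)
  qed
  have col2: "\<bar>Re (f p - f base_point) - Re (g p - g base_point)\<bar> \<le> 1 / s" if "p \<in> net \<epsilon>" for p
  proof -
    have "snd (colour \<epsilon> S) p = snd (colour \<epsilon> T) p" using col by simp
    then show ?thesis
      using that s by (intro floor_eq_close) (simp_all add: colour_def Kf(5) Jg(5) s_def)
  qed
  \<comment> \<open>With this scalar u vanishes at the base point, and the colours control u on the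
    net.\<close>
  define c where "c = Re (f base_point - g base_point)"
  define u where "u = f - g - c *\<^sub>R one"
  have u: "u \<in> RL" unfolding u_def by (intro subspace_diff[OF subspace_RL] RL_scaleR RL_one Kf Jg)
  have u_bound: "cmod (u z) \<le> \<epsilon> / 4 + 1 / s" if z: "z \<in> sphere 0 1" for z
  proof -
    obtain p where p: "p \<in> net \<epsilon>" "\<delta> z p < \<epsilon> / 8" using net(3)[OF \<epsilon> z] by blast
    have ps: "p \<in> sphere 0 1" using net(2)[OF \<epsilon>] p(1) by blast
    \<comment> \<open>Colours record real parts only; they determine the moduli because all
      functions and entries involved are real.\<close>
    have re: "w = of_real (Re w)" if "w \<in> \<real>" for w :: complex using that by (simp add: of_real_Re)
    have "(f p - f base_point) - (g p - g base_point) \<in> \<real>"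
      by (intro Reals_diff RL_real[OF Kf(2)] RL_real[OF Jg(2)] ps base_point)
    from re[OF this] have "cmod ((f p - f base_point) - (g p - g base_point)) = \<bar>Re ((f p - f base_point) - (g p - g base_point))\<bar>"
      by (metis norm_of_real)
    then have mid: "cmod ((f p - f base_point) - (g p - g base_point)) \<le> 1 / s"
      using col2[OF p(1)] by simp
    have c: "of_real c = f base_point - g base_point"
      unfolding c_def by (rule re[symmetric]) (intro Reals_diff RL_real[OF Kf(2)] RL_real[OF Jg(2)] base_point)
    have "u z = (f z - f p) - (g z - g p) + ((f p - f base_point) - (g p - g base_point))"
      using z c by (simp add: u_def scaleR_fun_def scaleR_conv_of_real)
    then have "cmod (u z) \<le> cmod (f z - f p) + cmod (g z - g p) + cmod ((f p - f base_point) - (g p - g base_point))"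
      by (simp only:) (intro order_trans[OF norm_triangle_ineq] add_mono norm_triangle_ineq4 order_refl)
    then show ?thesis
      using lip_le_four(1)[OF Kf(2,7) z ps] lip_le_four(1)[OF Jg(2,7) z ps] mid p(2) by linarith
  qed
  have D: "K - J \<in> LC" by (rule subspace_diff[OF subspace_LC Kf(1) Jg(1)])
  note Db = lip_compact_bounded[OF D]
  have ent: "entry (K - J) i j = entry K i j - entry J i j" for i j
    by (rule entry_diff[OF lip_compact_bounded[OF Kf(1)] lip_compact_bounded[OF Jg(1)]])
  have form: "cmod (bergman_inner n ((K - J) h) h) \<le> ((real N)\<^sup>2 * (1 / s) + 2 / real N) * (bergman_norm n h * bergman_norm n h)"
    if h: "h \<in> bergman n" for h
  proof (rule truncated_form_bound[OF Db h h N(1)])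
    \<comment> \<open>Both compact parts have seminorm at most 1, so the decay constant of the
      difference is 2.\<close>
    show "cmod (entry (K - J) i j) \<le> 2 / real (i + j + 2) ^ 3" for i j
    proof -
      have "2 / real (i + j + 2) ^ 3 = 1 / real (i + j + 2) ^ 3 + 1 / real (i + j + 2) ^ 3"
        by (simp only: add_divide_distrib[symmetric] one_add_one)
      then show ?thesis
        unfolding ent
        using norm_triangle_ineq4[of "entry K i j" "entry J i j"] entry_le_one(1)[OF Kf(1,6), of i j] entry_le_one(1)[OF Jg(1,6), of i j]
        by linarith
    qed
    show "cmod (entry (K - J) i j) \<le> 1 / s" if "i < N" "j < N" for i j
    proof -
      have "entry (K - J) i j \<in> \<real>" by (rule LC_entry_real[OF D])
      then have "cmod (entry (K - J) i j) = \<bar>Re (entry (K - J) i j)\<bar>" by (metis of_real_Re norm_of_real)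
      then show ?thesis using col1[OF that] by (simp add: ent)
    qed
  qed (use s in auto)
  \<comment> \<open>Unitality moves the scalar into the symbol: c times the identity is the image of
    the constant c.\<close>
  have eq: "S - T - c *\<^sub>R id_operator n = (K - J) + \<sigma> u"
    unfolding u_def Kf(3) Jg(3)
    by (simp add: \<sigma>_diff \<sigma>_scaleR Kf Jg RL_one RL_scaleR subspace_diff[OF subspace_RL] unital)
  have X: "S - T - c *\<^sub>R id_operator n \<in> LT"
    unfolding eq by (rule LT_I[OF D u])
  have quad: "\<bar>quad (S - T - c *\<^sub>R id_operator n) h\<bar> \<le> \<epsilon> * (bergman_norm n h)\<^sup>2" if h: "h \<in> bergman n" for h
  proof -
    have "\<bar>quad (S - T - c *\<^sub>R id_operator n) h\<bar> \<le> \<bar>quad (K - J) h\<bar> + \<bar>quad (\<sigma> u) h\<bar>"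
      unfolding eq quad_add[OF Db \<sigma>_bounded[OF u] h] by (rule abs_triangle_ineq)
    also have "\<bar>quad (K - J) h\<bar> \<le> ((real N)\<^sup>2 * (1 / s) + 2 / real N) * (bergman_norm n h)\<^sup>2"
      using form[OF h] abs_Re_le_cmod[of "bergman_inner n ((K - J) h) h"] unfolding quad_def by (simp add: power2_eq_square)
    also have "\<bar>quad (\<sigma> u) h\<bar> \<le> (\<epsilon> / 4 + 1 / s) * (bergman_norm n h)\<^sup>2"
      by (rule quad_\<sigma>_le[OF u u_bound h])
    also have "((real N)\<^sup>2 * (1 / s) + 2 / real N) * (bergman_norm n h)\<^sup>2 + (\<epsilon> / 4 + 1 / s) * (bergman_norm n h)\<^sup>2
        = (((real N)\<^sup>2 + 1) / s + 2 / real N + \<epsilon> / 4) * (bergman_norm n h)\<^sup>2"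
      by (simp add: add_divide_distrib algebra_simps)
    also have "\<dots> \<le> \<epsilon> * (bergman_norm n h)\<^sup>2"
      unfolding sN using N(2) \<epsilon> by (intro mult_right_mono) auto
    finally show ?thesis by simp
  qed
  have F: "S - T - c *\<^sub>R id_operator n \<in> form_real" using X LT_form_real by blast
  have I: "r *\<^sub>R id_operator n \<in> form_real" for r by (rule subspace_scale[OF subspace_form_real id_form_real])
  have "operator_le n (- \<epsilon> *\<^sub>R id_operator n) (S - T - c *\<^sub>R id_operator n)"
    unfolding operator_le_iff[OF I F]
  proof
    fix h :: "'d cfun" assume h: "h \<in> bergman n"
    show "quad (- \<epsilon> *\<^sub>R id_operator n) h \<le> quad (S - T - c *\<^sub>R id_operator n) h"
      unfolding quad_scaleR quad_id[OF h] using quad[OF h] by linarith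
  qed
  moreover have "operator_le n (S - T - c *\<^sub>R id_operator n) (\<epsilon> *\<^sub>R id_operator n)"
    unfolding operator_le_iff[OF F I]
  proof
    fix h :: "'d cfun" assume h: "h \<in> bergman n"
    show "quad (S - T - c *\<^sub>R id_operator n) h \<le> quad (\<epsilon> *\<^sub>R id_operator n) h"
      unfolding quad_scaleR quad_id[OF h] using quad[OF h] by linarith
  qed
  ultimately show ?thesis by blast
qed

lemma order_unit_space_LT: "order_unit_space LT (operator_le n) (id_operator n)"
  by (rule order_unit_space_form_real[OF subspace_LT LT_form_real id_LT])

sublocale seminorm: order_unit_seminorm LT "operator_le n" "id_operator n" lip_L colour
proof
  show "order_unit_space LT (operator_le n) (id_operator n)" by (rule order_unit_space_LT)
  show "operator_le n (0 :: 'd operator) (id_operator n)"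
    unfolding operator_le_iff[OF subspace_0[OF subspace_form_real] id_form_real]
    by (simp add: quad_id) (simp add: quad_def zero_fun_def)
  show "\<exists>c. operator_le n (- \<epsilon> *\<^sub>R id_operator n) (S - T - c *\<^sub>R id_operator n) \<and>
      operator_le n (S - T - c *\<^sub>R id_operator n) (\<epsilon> *\<^sub>R id_operator n)"
    if "\<epsilon> > 0" "S \<in> LT" "T \<in> LT" "lip_L S \<le> 1" "lip_L T \<le> 1" "colour \<epsilon> S = colour \<epsilon> T" for \<epsilon> S T
    using that by (rule colour_close)
qed (rule lip_L_nonneg lip_L_add lip_L_scaleR lip_L_id colour_finite; assumption)+

lemma LT_toeplitz_algebra: "LT \<subseteq> {T \<in> toeplitz_algebra n. self_adjoint n T}"
proof
  fix T assume T: "T \<in> LT"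
  then obtain K f where Kf: "K \<in> LC" "f \<in> RL" "T = K + \<sigma> f" by (rule LT_E)
  have "K \<in> toeplitz_algebra n" using lip_compact_toeplitz_algebra Kf(1) by blast
  moreover have "\<sigma> f \<in> toeplitz_algebra n" using \<sigma>_symbol[OF Kf(2)] by (simp add: has_symbol_def)
  ultimately have "T \<in> toeplitz_algebra n" unfolding Kf(3) by (rule toeplitz_algebra_add)
  moreover have "self_adjoint n T" using T LT_form_real form_real_self_adjoint by blast
  ultimately show "T \<in> {T \<in> toeplitz_algebra n. self_adjoint n T}" by simp
qed

lemma compact_quantum_metric_space_LT: "compact_quantum_metric_space LT (operator_le n) (id_operator n) lip_L"
  unfolding compact_quantum_metric_space_def using order_unit_space_LT seminorm.lip_norm_L by blast

end

theorem theorem2p2: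
  fixes n :: nat
    and \<kappa> :: "nat \<Rightarrow> ('d::finite \<Rightarrow> nat)"
    and \<sigma> :: "(complex ^ 'd \<Rightarrow> complex) \<Rightarrow> ((complex ^ 'd \<Rightarrow> complex) \<Rightarrow> (complex ^ 'd \<Rightarrow> complex))"
    and \<delta> :: "complex ^ 'd \<Rightarrow> complex ^ 'd \<Rightarrow> real"
  assumes "CARD('d) \<le> n"
    and "bij_betw \<kappa> {1..} UNIV"
    and "positive_linear_splitting n \<sigma>"
    and unital: "\<sigma> (indicator (sphere 0 1)) = id_operator n"
    and metric: "\<delta> = dist \<or> \<delta> = geodesic_dist"
  shows "lip_toeplitz n \<kappa> \<delta> \<sigma> \<subseteq> {T \<in> toeplitz_algebra n. self_adjoint n T} \<and>
         internal_direct_sum (lip_toeplitz n \<kappa> \<delta> \<sigma>) (lip_compact n \<kappa>) (\<sigma> ` real_lipschitz \<delta>) \<and>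
         (\<exists>L. (\<forall>K\<in>lip_compact n \<kappa>. \<forall>f\<in>real_lipschitz \<delta>.
                 L (\<sigma> f + K) = lip_compact_norm n \<kappa> K + lipschitz_constant \<delta> f) \<and>
              compact_quantum_metric_space (lip_toeplitz n \<kappa> \<delta> \<sigma>) (operator_le n) (id_operator n) L)"
proof -
  interpret toeplitz_splitting n \<kappa> \<sigma> \<delta>
    by unfold_locales (use assms in auto)
  have "\<forall>K\<in>lip_compact n \<kappa>. \<forall>f\<in>real_lipschitz \<delta>.
      lip_L (\<sigma> f + K) = lip_compact_norm n \<kappa> K + lipschitz_constant \<delta> f"
    by (simp add: add.commute[of "\<sigma> _"] lip_L_eq)
  then show ?thesis
    using LT_toeplitz_algebra direct_sum compact_quantum_metric_space_LT by blast
qed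

end
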